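(* Let $0<e\le 1$ and let $f(v,t)$ be a solution of (E1) with initial datum $f_0$ a probability density with zero mean velocity, and let $g(v,t)=e^{-3Et}f(e^{-Et}v,t)$ be the rescaled solution, which solves (E2). Then for all $t\ge0$ $$I(g(\cdot,t))\le \exp\!\Big(\Big[\frac{(1-e)(2+e+15e^2)}{8e^3}-2E\Big]t\Big)\,I(g(\cdot,0)).$$ Moreover, for every admissible $\widetilde B$ the exponent $\frac{(1-e)(2+e+15e^2)}{8e^3}-2E$ is strictly positive when $0<e<1$, and it tends to $0$ as $e\to1$.
   Context: Restitution coefficient $0<e\le1$. $\widetilde B$ is a positive, integrable, even function on $[-1,1]$ with $\int_{-1}^1\widetilde B(s)\,ds=2$. $dn$ is the uniform measure on $S^2$ of total mass $4\pi$; $v'=v-\frac{1+e}{2}((v-w)\cdot n)n$. $\langle Q_e(f,f),\varphi\rangle=\frac1{4\pi}\iiint\widetilde B(n\cdot\frac{v-w}{|v-w|})f(v)f(w)[\varphi(v')-\varphi(v)]\,dn\,dv\,dw$. (E1): $\frac{d}{dt}\int f\varphi\,dv=\langle Q_e(f,f),\varphi\rangle$ for all bounded continuous $\varphi$. $E=\frac{1-e^2}{8}\int_{-1}^1 s^2\widetilde B(s)\,ds$. (E2), the rescaled equation: $\frac{d}{dt}\int g\varphi\,dv=-E\int g\,(v\cdot\nabla\varphi)\,dv+\langle Q_e(g,g),\varphi\rangle$ for all smooth bounded test functions $\varphi$. Fisher information: $I(f)=4\int|\nabla\sqrt f|^2dv$ (or $+\infty$). *)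

theory Defs
  imports "HOL-Analysis.Analysis"
begin

type_synonym vel = "real^3"

text \<open>Uniform measure dn on the unit sphere S^2 of total mass 4 pi: the pushforward of
  Lebesgue measure on the closed unit ball under radial projection, scaled by 3
  (volume of the unit ball is 4 pi / 3).\<close>
definition sphere_measure :: "vel measure" where
  "sphere_measure =
     scale_measure 3 (distr (restrict_space lborel (cball 0 1)) borel (\<lambda>x. x /\<^sub>R norm x))"

definition admissible_kernel :: "(real \<Rightarrow> real) \<Rightarrow> bool" where
  "admissible_kernel B \<longleftrightarrow>
     (\<forall>s\<in>{-1..1}. B s > 0) \<and>
     set_integrable lborel {-1..1} B \<and>
     (\<forall>s\<in>{-1..1}. B (-s) = B s) \<and>
     (LINT s:{-1..1}|lborel. B s) = 2"

definition coeffE :: "real \<Rightarrow> (real \<Rightarrow> real) \<Rightarrow> real" where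
  "coeffE e B = (1 - e\<^sup>2) / 8 * (LINT s:{-1..1}|lborel. s\<^sup>2 * B s)"

definition post_vel :: "real \<Rightarrow> vel \<Rightarrow> vel \<Rightarrow> vel \<Rightarrow> vel" where
  "post_vel e v w n = v - ((1 + e) / 2 * ((v - w) \<bullet> n)) *\<^sub>R n"

definition coll_weak :: "real \<Rightarrow> (real \<Rightarrow> real) \<Rightarrow> (vel \<Rightarrow> real) \<Rightarrow> (vel \<Rightarrow> real) \<Rightarrow> real" where
  "coll_weak e B f \<phi> = 1 / (4 * pi) *
     (\<integral>v. \<integral>w. \<integral>n. B (n \<bullet> ((v - w) /\<^sub>R norm (v - w))) * f v * f w *
                     (\<phi> (post_vel e v w n) - \<phi> v) \<partial>sphere_measure \<partial>lborel \<partial>lborel)"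

definition solves_E1 :: "real \<Rightarrow> (real \<Rightarrow> real) \<Rightarrow> (real \<Rightarrow> vel \<Rightarrow> real) \<Rightarrow> bool" where
  "solves_E1 e B f \<longleftrightarrow>
     (\<forall>t\<ge>0. f t \<in> borel_measurable lborel \<and> (\<forall>v. f t v \<ge> 0) \<and> integrable lborel (f t)) \<and>
     (\<forall>\<phi>. continuous_on UNIV \<phi> \<longrightarrow> bounded (range \<phi>) \<longrightarrow>
        (\<forall>t\<ge>0. ((\<lambda>s. \<integral>v. f s v * \<phi> v \<partial>lborel)
                   has_real_derivative coll_weak e B (f t) \<phi>) (at t within {0..})))"

definition grad :: "(vel \<Rightarrow> real) \<Rightarrow> vel \<Rightarrow> vel" where
  "grad \<phi> x = (\<chi> i. frechet_derivative \<phi> (at x) (axis i 1))"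

definition test_fun :: "(vel \<Rightarrow> real) \<Rightarrow> bool" where
  "test_fun \<phi> \<longleftrightarrow> (\<forall>x. \<phi> differentiable (at x)) \<and> continuous_on UNIV (grad \<phi>) \<and>
     bounded {x. \<phi> x \<noteq> 0}"

definition weak_grad :: "(vel \<Rightarrow> real) \<Rightarrow> (vel \<Rightarrow> vel) \<Rightarrow> bool" where
  "weak_grad u G \<longleftrightarrow>
     u \<in> borel_measurable lborel \<and> G \<in> borel_measurable lborel \<and>
     (\<forall>K. compact K \<longrightarrow> set_integrable lborel K u \<and> set_integrable lborel K G) \<and>
     (\<forall>\<phi> i. test_fun \<phi> \<longrightarrow>
        (\<integral>x. u x * grad \<phi> x $ i \<partial>lborel) = - (\<integral>x. G x $ i * \<phi> x \<partial>lborel))"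

text \<open>Fisher information I(f) = 4 \<integral> |\<nabla> sqrt f|^2, or +\<infinity> if sqrt f has no weak gradient
  (weak gradients are unique a.e., so the infimum is the value).\<close>
definition fisher :: "(vel \<Rightarrow> real) \<Rightarrow> ennreal" where
  "fisher f = Inf {ennreal 4 * (\<integral>\<^sup>+ x. ennreal ((norm (G x))\<^sup>2) \<partial>lborel) | G.
                     weak_grad (\<lambda>x. sqrt (f x)) G}"

definition fisher_rate :: "real \<Rightarrow> (real \<Rightarrow> real) \<Rightarrow> real" where
  "fisher_rate e B = (1 - e) * (2 + e + 15 * e\<^sup>2) / (8 * e ^ 3) - 2 * coeffE e B"

end

(* The bound I(f) <= C is used in its dual form
     2 int (div psi) f <= C + int |psi|^2 f   for all compactly supported C^1 vector fields psi,
   which is linear in f and stable under convex combinations and L^1 limits.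

   Write Q_e(f,f) = gain f - f. Testing gain f against psi amounts to testing the tensor product
   f(v) f(w) against averages of psi over the scattering directions. In the centre of mass c and the
   relative velocity u, the average M commutes with translations in c and with the dilations and
   rotations of u. Splitting psi(c + y/2) into its even part in y and the radial and angular components
   of its odd part, one therefore finds a field W = X + e Y on pairs whose symmetrised divergence is
   (1 + e) times the average of div psi, and whose square norm is controlled by the average of |psi|^2.
   Hence I(gain f) <= (2/(1+e))^2 I(f). The Euler scheme (1 - tau) f + tau gain f converges to the
   solution in L^1, so I(f(t)) <= exp(((2/(1+e))^2 - 1) t) I(f(0)); the dilation contributes exp(-2Et),
   and (2/(1+e))^2 - 1 <= (1-e)(2+e+15e^2)/(8e^3).

   The dual form is identified with the weak-gradient definition by mollification in one direction and
   by a Riesz representation argument in the other. *)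

theory Submission
  imports Defs
begin

text \<open>Formally -2 int psi . grad f - int |psi|^2 f is largest at psi = -grad log f, with value
  I(f), so the dual form loses nothing. The obstacle: averaging over the scattering does not commute
  with a derivative in an arbitrary direction of u. But the divergence of r y - y \<times> a
  involves only the radial derivative of r and rotational derivatives of a. Hence the coefficients r
  and a of the odd part are averaged, and the field is rebuilt at u. This enlarges norms by at most
  |u| / |y| \<le> 1 / e, since a collision shrinks the relative velocity at most by the factor e;
  the weight e of Y pays for it. X contributes 1 and Y contributes e to the divergence factor 1 + e;
  the weight 2 / (1 + e) in the rescaled dual bound brings it to 2, at the price of its square. B is
  only integrable, so the law of the outgoing velocity has no regularity in u; local orthogonal
  frames move the dependence on u into the observable. Admissibility controls B on [-1, 1] only: if
  B is not Borel on the whole line, the collision integrals degenerate and the solution stands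
  still.\<close>

section \<open>Continuously differentiable maps\<close>

text \<open>Continuity is asked for each fixed direction only; in finite dimension this amounts to
  norm continuity of the derivative. The derivative is taken \<open>at x\<close>, not within S, so
  the notion also makes sense on sets that are not open, such as products with a compact
  set.\<close>

definition c1_on :: "'a::euclidean_space set \<Rightarrow> ('a \<Rightarrow> 'b::real_normed_vector) \<Rightarrow> bool" where
  "c1_on S f \<longleftrightarrow> (\<forall>x\<in>S. f differentiable (at x)) \<and>
     (\<forall>v. continuous_on S (\<lambda>x. frechet_derivative f (at x) v))"

lemma c1_onI:
  assumes "\<And>x. x \<in> S \<Longrightarrow> (f has_derivative f' x) (at x)"
    and "\<And>v. continuous_on S (\<lambda>x. f' x v)"
  shows "c1_on S f"
proof -
  have "frechet_derivative f (at x) = f' x" if "x \<in> S" for x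
    using frechet_derivative_at[OF assms(1)[OF that]] by simp
  then show ?thesis
    unfolding c1_on_def using assms
    by (auto simp: differentiable_def intro: continuous_on_eq[OF assms(2)])
qed

lemma c1_on_has_derivative:
  "c1_on S f \<Longrightarrow> x \<in> S \<Longrightarrow> (f has_derivative frechet_derivative f (at x)) (at x)"
  by (simp add: c1_on_def frechet_derivative_works)

lemma c1_on_imp_continuous_on: "c1_on S f \<Longrightarrow> continuous_on S f"
  by (meson c1_on_has_derivative continuous_at_imp_continuous_on has_derivative_continuous)

lemma c1_on_subset: "c1_on S f \<Longrightarrow> T \<subseteq> S \<Longrightarrow> c1_on T f"
  unfolding c1_on_def using continuous_on_subset by blast

text \<open>Expanding the direction in the basis upgrades continuity for each fixed direction to
  joint continuity in base point and direction.\<close>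

lemma continuous_on_frechet_derivative:
  assumes "c1_on S f" "continuous_on T g" "g ` T \<subseteq> S" "continuous_on T h"
  shows "continuous_on T (\<lambda>t. frechet_derivative f (at (g t)) (h t))"
proof -
  have "frechet_derivative f (at (g t)) (h t)
      = (\<Sum>b\<in>Basis. (h t \<bullet> b) *\<^sub>R frechet_derivative f (at (g t)) b)" if "t \<in> T" for t
  proof -
    have "linear (frechet_derivative f (at (g t)))"
      using c1_on_has_derivative[OF assms(1)] that assms(3)
      by (meson has_derivative_linear image_subset_iff)
    then have "frechet_derivative f (at (g t)) (\<Sum>b\<in>Basis. (h t \<bullet> b) *\<^sub>R b)
      = (\<Sum>b\<in>Basis. (h t \<bullet> b) *\<^sub>R frechet_derivative f (at (g t)) b)"
      by (simp add: linear_sum linear_cmul)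
    then show ?thesis by (simp add: euclidean_representation)
  qed
  moreover have "continuous_on T (\<lambda>t. \<Sum>b\<in>Basis. (h t \<bullet> b) *\<^sub>R frechet_derivative f (at (g t)) b)"
  proof (intro continuous_on_sum continuous_on_scaleR continuous_on_inner continuous_on_const assms(4))
    fix b
    have "continuous_on S (\<lambda>x. frechet_derivative f (at x) b)" using assms(1) by (simp add: c1_on_def)
    then show "continuous_on T (\<lambda>t. frechet_derivative f (at (g t)) b)"
      using assms(2,3) by (rule continuous_on_compose2)
  qed
  ultimately show ?thesis
    by (simp cong: continuous_on_cong)
qed

lemma c1_on_compose:
  assumes "c1_on S f" "c1_on T g" "g ` T \<subseteq> S"
  shows "c1_on T (\<lambda>x. f (g x))"
proof (rule c1_onI)
  fix x assume "x \<in> T"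
  then show "((\<lambda>x. f (g x)) has_derivative
     (\<lambda>v. frechet_derivative f (at (g x)) (frechet_derivative g (at x) v))) (at x)"
    using assms by (intro has_derivative_compose[where f=g and g=f]) (auto intro: c1_on_has_derivative)
next
  fix v
  show "continuous_on T (\<lambda>x. frechet_derivative f (at (g x)) (frechet_derivative g (at x) v))"
    using assms(2,3) by (intro continuous_on_frechet_derivative[OF assms(1)])
      (auto intro: c1_on_imp_continuous_on simp: c1_on_def[of T g])
qed

lemma c1_on_bounded_linear: "bounded_linear f \<Longrightarrow> c1_on S f"
  by (rule c1_onI[where f'="\<lambda>_. f"]) (auto intro: bounded_linear_imp_has_derivative)

lemma c1_on_const [intro]: "c1_on S (\<lambda>x. c)"
  by (rule c1_onI[where f'="\<lambda>_ _. 0"]) auto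

lemma c1_on_bilinear:
  fixes pr :: "'b::real_normed_vector \<Rightarrow> 'c::real_normed_vector \<Rightarrow> 'd::real_normed_vector"
  assumes "bounded_bilinear pr" "c1_on S f" "c1_on S g"
  shows "c1_on S (\<lambda>x. pr (f x) (g x))"
proof (rule c1_onI)
  interpret bounded_bilinear pr by fact
  show "((\<lambda>x. pr (f x) (g x)) has_derivative
     (\<lambda>v. pr (f x) (frechet_derivative g (at x) v) + pr (frechet_derivative f (at x) v) (g x))) (at x)"
    if "x \<in> S" for x
    using c1_on_has_derivative[OF assms(2) that] c1_on_has_derivative[OF assms(3) that] by (rule FDERIV)
  show "continuous_on S
     (\<lambda>x. pr (f x) (frechet_derivative g (at x) v) + pr (frechet_derivative f (at x) v) (g x))" for v
    using assms(2,3) c1_on_imp_continuous_on[OF assms(2)] c1_on_imp_continuous_on[OF assms(3)]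
    by (intro continuous_on_add continuous_on) (auto simp: c1_on_def)
qed

lemma c1_on_add: "c1_on S f \<Longrightarrow> c1_on S g \<Longrightarrow> c1_on S (\<lambda>x. f x + g x)"
  by (rule c1_onI[where f'="\<lambda>x v. frechet_derivative f (at x) v + frechet_derivative g (at x) v"])
     (auto intro!: derivative_intros continuous_intros c1_on_has_derivative simp: c1_on_def)

lemma c1_on_diff: "c1_on S f \<Longrightarrow> c1_on S g \<Longrightarrow> c1_on S (\<lambda>x. f x - g x)"
  by (rule c1_onI[where f'="\<lambda>x v. frechet_derivative f (at x) v - frechet_derivative g (at x) v"])
     (auto intro!: derivative_intros continuous_intros c1_on_has_derivative simp: c1_on_def)

lemmas c1_on_scaleR = c1_on_bilinear[OF bounded_bilinear_scaleR]
  and c1_on_inner = c1_on_bilinear[OF bounded_bilinear_inner]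
  and c1_on_mult = c1_on_bilinear[OF bounded_bilinear_mult]
  and c1_on_linear_compose = c1_on_compose[OF c1_on_bounded_linear[of _ UNIV], OF _ _ subset_UNIV]

lemma c1_on_id: "c1_on S (\<lambda>x. x)"
  by (rule c1_on_bounded_linear) (rule bounded_linear_ident)

lemma c1_on_fst: "c1_on S fst" and c1_on_snd: "c1_on S snd"
  by (auto intro: c1_on_bounded_linear bounded_linear_fst bounded_linear_snd)

lemma c1_on_Pair: "c1_on S f \<Longrightarrow> c1_on S g \<Longrightarrow> c1_on S (\<lambda>x. (f x, g x))"
  by (rule c1_onI[where f'="\<lambda>x v. (frechet_derivative f (at x) v, frechet_derivative g (at x) v)"])
     (auto intro!: derivative_intros continuous_intros c1_on_has_derivative simp: c1_on_def)

lemma c1_on_cong: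
  assumes "c1_on S f" "open S" "\<And>x. x \<in> S \<Longrightarrow> f x = g x"
  shows "c1_on S g"
proof (rule c1_onI)
  show "(g has_derivative frechet_derivative f (at x)) (at x)" if "x \<in> S" for x
    using has_derivative_transform_within_open[OF c1_on_has_derivative[OF assms(1) that] assms(2) that assms(3)]
    by simp
  show "continuous_on S (\<lambda>x. frechet_derivative f (at x) v)" for v
    using assms by (simp add: c1_on_def)
qed

lemma c1_on_local:
  assumes "\<And>x. x \<in> S \<Longrightarrow> \<exists>T. open T \<and> x \<in> T \<and> c1_on T f"
  shows "c1_on S f"
  unfolding c1_on_def
proof (intro conjI allI ballI)
  fix x assume "x \<in> S"
  then show "f differentiable at x" using assms unfolding c1_on_def by blast
next
  fix v show "continuous_on S (\<lambda>x. frechet_derivative f (at x) v)"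
  proof (rule continuous_at_imp_continuous_on, rule ballI)
    fix x assume "x \<in> S"
    then obtain T where "open T" "x \<in> T" "c1_on T f" using assms by blast
    then show "isCont (\<lambda>x. frechet_derivative f (at x) v) x"
      unfolding c1_on_def using continuous_on_interior interior_open by blast
  qed
qed

lemma c1_on_real_deriv:
  fixes f :: "real \<Rightarrow> real"
  assumes "\<And>x. x \<in> S \<Longrightarrow> (f has_field_derivative f' x) (at x)" "continuous_on S f'"
  shows "c1_on S f"
  using assms by (intro c1_onI[where f'="\<lambda>x. (*) (f' x)"])
    (auto intro!: continuous_intros simp: has_field_derivative_def)

lemma c1_on_inverse: "c1_on S f \<Longrightarrow> (\<And>x. x \<in> S \<Longrightarrow> f x \<noteq> 0) \<Longrightarrow> c1_on S (\<lambda>x. inverse (f x :: real))"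
  by (rule c1_on_compose[where S="- {0}" and f=inverse])
     (auto intro!: c1_on_real_deriv[where f'="\<lambda>x. - (inverse x)\<^sup>2"] continuous_intros derivative_eq_intros
       simp: power2_eq_square)

lemma c1_on_divide: "c1_on S f \<Longrightarrow> c1_on S g \<Longrightarrow> (\<And>x. x \<in> S \<Longrightarrow> g x \<noteq> 0) \<Longrightarrow> c1_on S (\<lambda>x. f x / g x :: real)"
  unfolding divide_inverse by (intro c1_on_mult c1_on_inverse)

lemma c1_on_sqrt: "c1_on S f \<Longrightarrow> (\<And>x. x \<in> S \<Longrightarrow> f x > 0) \<Longrightarrow> c1_on S (\<lambda>x. sqrt (f x))"
  by (rule c1_on_compose[where S="{0<..}" and f=sqrt])
     (auto intro!: c1_on_real_deriv[where f'="\<lambda>x. inverse (sqrt x) / 2"] continuous_intros DERIV_real_sqrt)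

lemma c1_on_norm: "c1_on S f \<Longrightarrow> (\<And>x. x \<in> S \<Longrightarrow> f x \<noteq> 0) \<Longrightarrow> c1_on S (\<lambda>x. norm (f x :: 'b::euclidean_space))"
  unfolding norm_eq_sqrt_inner by (intro c1_on_sqrt c1_on_inner) auto

section \<open>Integrals over a compact set depending on a parameter\<close>

lemma continuous_on_PairI: "continuous_on A (Pair q)"
  by (intro continuous_intros)

lemma set_integrable_compact:
  fixes h :: "'m::euclidean_space \<Rightarrow> 'b::euclidean_space"
  assumes "finite_measure N" "sets N = sets borel" "compact A" "continuous_on A h"
  shows "set_integrable N A h"
proof -
  interpret finite_measure N by fact
  have "(\<lambda>x. indicator A x *\<^sub>R h x) \<in> borel_measurable borel"
    using assms(3,4) by (intro borel_measurable_continuous_on_indicator borel_compact)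
  then have m: "(\<lambda>x. indicator A x *\<^sub>R h x) \<in> borel_measurable N"
    using measurable_cong_sets[OF assms(2) refl] by blast
  obtain K where K: "\<And>x. x \<in> A \<Longrightarrow> norm (h x) \<le> K"
    using compact_imp_bounded[OF compact_continuous_image[OF assms(4,3)]] unfolding bounded_iff by auto
  show ?thesis unfolding set_integrable_def
    by (rule integrable_const_bound[OF _ m, of "max K 0"])
       (auto intro!: AE_I2 K simp: indicator_def le_max_iff_disj split: if_splits)
qed

text \<open>On a compact neighbourhood of p times \<open>A\<close> the partial derivatives are
  uniformly continuous. By the mean value inequality the linearisation error of \<open>g q m\<close>
  is then small relative to |q - p| uniformly in m, and can be integrated against a finite
  measure.\<close>

lemma has_derivative_integral_compact:
  fixes g :: "'p::euclidean_space \<Rightarrow> 'm::euclidean_space \<Rightarrow> 'b::euclidean_space"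
  assumes N: "finite_measure N" "sets N = sets borel" and A: "compact A"
    and S: "open S" "p \<in> S"
    and der: "\<And>p m. p \<in> S \<Longrightarrow> m \<in> A \<Longrightarrow> ((\<lambda>p. g p m) has_derivative g' p m) (at p)"
    and cont: "\<And>v. continuous_on (S \<times> A) (\<lambda>(p,m). g' p m v)"
    and contg: "\<And>p. p \<in> S \<Longrightarrow> continuous_on A (g p)"
  shows "((\<lambda>p. LINT m:A|N. g p m) has_derivative (\<lambda>v. LINT m:A|N. g' p m v)) (at p)"
proof -
  interpret finite_measure N by fact
  have contg': "continuous_on A (\<lambda>m. g' q m v)" if "q \<in> S" for q v
    using continuous_on_compose2[OF cont[of v], of A "\<lambda>m. (q,m)"] that
    by (auto intro: continuous_on_PairI)
  note int = set_integrable_compact[OF N A]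
  obtain \<delta> where \<delta>: "\<delta> > 0" "cball p \<delta> \<subseteq> S" using S open_contains_cball by blast
  have lin: "bounded_linear (\<lambda>v. LINT m:A|N. g' p m v)"
  proof -
    have l: "linear (g' p m)" if "m \<in> A" for m using der[OF S(2) that] has_derivative_linear by blast
    have *: "(LINT m:A|N. g' p m (a + b)) = (LINT m:A|N. g' p m a) + (LINT m:A|N. g' p m b)" for a b
      unfolding set_integral_add(2)[OF int[OF contg'[OF S(2), of a]] int[OF contg'[OF S(2), of b]], symmetric]
      unfolding set_lebesgue_integral_def
      by (intro Bochner_Integration.integral_cong) (use l in \<open>auto simp: linear_add indicator_def\<close>)
    have "(LINT m:A|N. g' p m (c *\<^sub>R a)) = c *\<^sub>R (LINT m:A|N. g' p m a)" for a c
    proof -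
      have "(LINT m:A|N. g' p m (c *\<^sub>R a)) = (LINT m:A|N. c *\<^sub>R g' p m a)"
      unfolding set_lebesgue_integral_def
      by (intro Bochner_Integration.integral_cong) (use l in \<open>auto simp: linear_cmul indicator_def\<close>)
      then show ?thesis by simp
    qed
    with * show ?thesis by (intro linear_conv_bounded_linear[THEN iffD1] linearI)
  qed
  show ?thesis unfolding has_derivative_at_alt
  proof (intro conjI lin allI impI)
    fix \<epsilon> :: real assume "\<epsilon> > 0"
    \<comment> \<open>Dividing by the dimension absorbs the sum over the basis that bounds the
      operator norm, dividing by the mass absorbs the integral; the + 1 covers a measure of mass
      0.\<close>
    define \<eta> where "\<eta> = \<epsilon> / (measure N (space N) + 1) / DIM('p)"
    have \<eta>: "\<eta> > 0" unfolding \<eta>_def using \<open>\<epsilon> > 0\<close> by (intro divide_pos_pos) (auto intro: add_nonneg_pos)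
    have "\<exists>d>0. \<forall>q m. q \<in> cball p \<delta> \<longrightarrow> m \<in> A \<longrightarrow> dist q p < d \<longrightarrow> norm (g' q m b - g' p m b) \<le> \<eta>" for b
    proof -
      have "uniformly_continuous_on (cball p \<delta> \<times> A) (\<lambda>(p,m). g' p m b)"
        by (intro compact_uniformly_continuous compact_Times A continuous_on_subset[OF cont]) (use \<delta> in auto)
      from this[unfolded uniformly_continuous_on_def, rule_format, OF \<eta>]
      obtain d where d: "d > 0" "\<And>x x'. x \<in> cball p \<delta> \<times> A \<Longrightarrow> x' \<in> cball p \<delta> \<times> A \<Longrightarrow> dist x' x < d
          \<Longrightarrow> dist ((\<lambda>(p,m). g' p m b) x') ((\<lambda>(p,m). g' p m b) x) < \<eta>"
        by blast
      have "norm (g' q m b - g' p m b) \<le> \<eta>" if "q \<in> cball p \<delta>" "m \<in> A" "dist q p < d" for q m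
        using d(2)[of "(p,m)" "(q,m)"] that \<delta> by (auto simp: dist_Pair_Pair dist_norm)
      with d(1) show ?thesis by blast
    qed
    then obtain d where d: "\<And>b. d b > 0" "\<And>b q m. q \<in> cball p \<delta> \<Longrightarrow> m \<in> A \<Longrightarrow> dist q p < d b \<Longrightarrow> norm (g' q m b - g' p m b) \<le> \<eta>"
      using choice[of "\<lambda>b d. d > 0 \<and> (\<forall>q m. q \<in> cball p \<delta> \<longrightarrow> m \<in> A \<longrightarrow> dist q p < d \<longrightarrow> norm (g' q m b - g' p m b) \<le> \<eta>)"]
      by blast
    define d0 where "d0 = min \<delta> (Min (d ` Basis))"
    have d0: "d0 > 0" "d0 \<le> \<delta>" "\<And>b. b \<in> Basis \<Longrightarrow> d0 \<le> d b" unfolding d0_def using \<delta> d(1)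
      by (auto simp: min.coboundedI2)
    have key: "norm (g q m - g p m - g' p m (q - p)) \<le> \<epsilon> / (measure N (space N) + 1) * norm (q - p)"
      if q: "norm (q - p) < d0" and m: "m \<in> A" for q m
    proof -
      have "norm (g q m - g p m - g' p m (q - p)) \<le> norm (q - p) * (\<epsilon> / (measure N (space N) + 1))"
      proof (rule differentiable_bound_linearization[where S="ball p d0" and f="\<lambda>p. g p m" and f'="\<lambda>p. g' p m"])
        fix t :: real assume "t \<in> {0..1}"
        then have "norm (t *\<^sub>R (q - p)) \<le> norm (q - p)" by (simp add: mult_left_le_one_le)
        with q show "p + t *\<^sub>R (q - p) \<in> ball p d0" by (simp add: dist_norm)
      next
        fix x assume x: "x \<in> ball p d0"
        then have "x \<in> S" using d0 \<delta> by (auto simp: subset_iff)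
        then show "((\<lambda>p. g p m) has_derivative g' x m) (at x within ball p d0)"
          using der m has_derivative_at_withinI by blast
        have l: "linear (\<lambda>i. g' x m i - g' p m i)" using der[OF S(2) m] der[OF \<open>x \<in> S\<close> m]
          by (intro linear_compose_sub) (auto dest: has_derivative_linear)
        have "onorm (\<lambda>i. g' x m i - g' p m i) \<le> (\<Sum>b\<in>Basis. norm (g' x m b - g' p m b))"
        proof (rule onorm_le)
          fix v
          have "(\<lambda>i. g' x m i - g' p m i) (\<Sum>b\<in>Basis. (v \<bullet> b) *\<^sub>R b) = (\<Sum>b\<in>Basis. (v \<bullet> b) *\<^sub>R (g' x m b - g' p m b))"
            by (subst linear_sum[OF l]) (simp add: linear_cmul[OF l])
          then have "norm (g' x m v - g' p m v) = norm (\<Sum>b\<in>Basis. (v \<bullet> b) *\<^sub>R (g' x m b - g' p m b))"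
            by (simp add: euclidean_representation)
          also have "\<dots> \<le> (\<Sum>b\<in>Basis. norm v * norm (g' x m b - g' p m b))"
            by (intro sum_norm_le) (auto intro!: mult_right_mono Basis_le_norm)
          finally show "norm (g' x m v - g' p m v) \<le> (\<Sum>b\<in>Basis. norm (g' x m b - g' p m b)) * norm v"
            by (simp add: sum_distrib_left mult.commute)
        qed
        also have "\<dots> \<le> (\<Sum>b\<in>(Basis::'p set). \<eta>)"
        proof (intro sum_mono d(2))
          show "dist x p < d b" if "b \<in> Basis" for b using x d0(3)[OF that] by (simp add: dist_commute)
        qed (use x d0(2) m in \<open>auto simp: dist_commute\<close>)
        also have "\<dots> = \<epsilon> / (measure N (space N) + 1)" by (simp add: \<eta>_def)
        finally show "onorm (g' x m - g' p m) \<le> \<epsilon> / (measure N (space N) + 1)"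
          by (simp add: fun_diff_def)
      qed (use d0 in auto)
      then show ?thesis by (simp add: mult.commute)
    qed
    have "norm ((LINT m:A|N. g q m) - (LINT m:A|N. g p m) - (LINT m:A|N. g' p m (q - p))) \<le> \<epsilon> * norm (q - p)"
      if q: "norm (q - p) < d0" for q
    proof -
      have "q \<in> S" using q d0 \<delta> by (auto simp: subset_iff dist_norm norm_minus_commute)
      note i = int[OF contg[OF \<open>q \<in> S\<close>]] int[OF contg[OF S(2)]] int[OF contg'[OF S(2), of "q - p"]]
      have "(LINT m:A|N. g q m) - (LINT m:A|N. g p m) - (LINT m:A|N. g' p m (q - p))
        = (LINT m:A|N. g q m - g p m - g' p m (q - p))"
        using i by (simp add: set_integral_diff)
      also have "norm \<dots> \<le> (LINT m|N. \<epsilon> / (measure N (space N) + 1) * norm (q - p))"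
        unfolding set_lebesgue_integral_def
        using set_integral_diff(1)[OF set_integral_diff(1)[OF i(1,2)] i(3)] \<open>\<epsilon> > 0\<close> key[OF q]
        by (intro Bochner_Integration.integral_norm_bound_integral)
           (auto simp: set_integrable_def indicator_def intro!: divide_nonneg_nonneg mult_nonneg_nonneg)
      also have "\<dots> = \<epsilon> * norm (q - p) * (measure N (space N) / (measure N (space N) + 1))" by simp
      also have "\<dots> \<le> \<epsilon> * norm (q - p) * 1" using \<open>\<epsilon> > 0\<close>
        by (intro mult_left_mono) (auto simp: divide_le_eq add_nonneg_pos)
      finally show ?thesis by simp
    qed
    with d0 show "\<exists>d>0. \<forall>y. norm (y - p) < d \<longrightarrow> norm ((LINT m:A|N. g y m) - (LINT m:A|N. g p m) - (LINT m:A|N. g' p m (y - p))) \<le> \<epsilon> * norm (y - p)"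
      by blast
  qed
qed

lemma continuous_on_integral_compact:
  fixes g :: "'p::euclidean_space \<times> 'm::euclidean_space \<Rightarrow> 'b::euclidean_space"
  assumes N: "finite_measure N" "sets N = sets borel" and A: "compact A"
    and S: "open S" and cont: "continuous_on (S \<times> A) g"
  shows "continuous_on S (\<lambda>p. LINT m:A|N. g (p, m))"
proof (rule continuous_at_imp_continuous_on, rule ballI)
  interpret finite_measure N by fact
  have contg: "continuous_on A (\<lambda>m. g (q, m))" if "q \<in> S" for q
    using continuous_on_compose2[OF cont, of A "\<lambda>m. (q,m)"] that
    by (auto intro: continuous_on_PairI)
  note int = set_integrable_compact[OF N A]
  fix p assume p: "p \<in> S"
  obtain \<delta> where \<delta>: "\<delta> > 0" "cball p \<delta> \<subseteq> S" using S p open_contains_cball by blast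
  show "isCont (\<lambda>p. LINT m:A|N. g (p, m)) p" unfolding continuous_at_eps_delta dist_norm
  proof (intro allI impI)
    fix \<epsilon> :: real assume "\<epsilon> > 0"
    define \<eta> where "\<eta> = \<epsilon> / (measure N (space N) + 1)"
    have \<eta>: "\<eta> > 0" unfolding \<eta>_def using \<open>\<epsilon> > 0\<close> by (intro divide_pos_pos) (auto intro: add_nonneg_pos)
    have "uniformly_continuous_on (cball p \<delta> \<times> A) g"
      by (intro compact_uniformly_continuous compact_Times A continuous_on_subset[OF cont]) (use \<delta> in auto)
    from this[unfolded uniformly_continuous_on_def, rule_format, OF \<eta>]
      obtain d where d: "d > 0" "\<And>x x'. x \<in> cball p \<delta> \<times> A \<Longrightarrow> x' \<in> cball p \<delta> \<times> A \<Longrightarrow> dist x' x < d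
        \<Longrightarrow> dist (g x') (g x) < \<eta>"
        by blast
    have "norm ((LINT m:A|N. g (q, m)) - (LINT m:A|N. g (p, m))) < \<epsilon>" if q: "norm (q - p) < min d \<delta>" for q
    proof -
      have q': "q \<in> cball p \<delta>" "dist q p < d" using q by (auto simp: dist_norm norm_minus_commute)
      then have "q \<in> S" using \<delta> by auto
      note i = int[OF contg[OF \<open>q \<in> S\<close>]] int[OF contg[OF p]]
      have k: "norm (g (q, m) - g (p, m)) \<le> \<eta>" if "m \<in> A" for m
        using d(2)[of "(p,m)" "(q,m)"] that q' \<delta>(1) by (auto simp: dist_Pair_Pair dist_norm)
      have "(LINT m:A|N. g (q, m)) - (LINT m:A|N. g (p, m)) = (LINT m:A|N. g (q, m) - g (p, m))"
        using i by (simp add: set_integral_diff)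
      also have "norm \<dots> \<le> (LINT m|N. \<eta>)"
        unfolding set_lebesgue_integral_def
        using set_integral_diff(1)[OF i] k \<eta>
        by (intro Bochner_Integration.integral_norm_bound_integral) (auto simp: set_integrable_def indicator_def)
      also have "\<dots> = \<epsilon> * (measure N (space N) / (measure N (space N) + 1))" by (simp add: \<eta>_def)
      also have "\<dots> < \<epsilon> * 1" using \<open>\<epsilon> > 0\<close> measure_nonneg[of N "space N"]
        by (intro mult_strict_left_mono) (auto simp: divide_simps add_nonneg_pos simp del: measure_nonneg)
      finally show ?thesis by simp
    qed
    with d(1) \<delta>(1) show "\<exists>d>0. \<forall>x'. norm (x' - p) < d \<longrightarrow> norm ((LINT m:A|N. g (x', m)) - (LINT m:A|N. g (p, m))) < \<epsilon>"
      by (intro exI[of _ "min d \<delta>"]) auto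
  qed
qed

text \<open>Joint regularity on a set containing \<open>S \<times> A\<close> supplies the continuity
  and the differentiability that the two preceding lemmas need; only the parameter slot
  \<open>(v, 0)\<close> is differentiated.\<close>

lemma c1_on_integral_compact:
  fixes g :: "'p::euclidean_space \<times> 'm::euclidean_space \<Rightarrow> 'b::euclidean_space"
  assumes N: "finite_measure N" "sets N = sets borel" and A: "compact A"
    and S: "open S" and g: "c1_on U g" "S \<times> A \<subseteq> U"
  shows "c1_on S (\<lambda>p. LINT m:A|N. g (p, m))"
    and "p \<in> S \<Longrightarrow> ((\<lambda>p. LINT m:A|N. g (p, m)) has_derivative
           (\<lambda>v. LINT m:A|N. frechet_derivative g (at (p, m)) (v, 0))) (at p)"
proof -
  have cont: "continuous_on (S \<times> A) (\<lambda>(p,m). frechet_derivative g (at (p, m)) (v, 0))" for v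
    using continuous_on_frechet_derivative[OF g(1), of "S \<times> A" "\<lambda>x. x" "\<lambda>_. (v, 0)"] g(2)
    by (simp add: case_prod_unfold)
  have *: "((\<lambda>p. LINT m:A|N. g (p, m)) has_derivative
           (\<lambda>v. LINT m:A|N. frechet_derivative g (at (p, m)) (v, 0))) (at p)" if "p \<in> S" for p
  proof (rule has_derivative_integral_compact[OF N A S that _ cont])
    fix p m assume "p \<in> S" "m \<in> A"
    then have D: "(g has_derivative frechet_derivative g (at (p, m))) (at (p, m))"
      using g by (intro c1_on_has_derivative) auto
    have P: "((\<lambda>p. (p, m)) has_derivative (\<lambda>v. (v, 0))) (at p within UNIV)"
      by (rule has_derivative_Pair[OF has_derivative_ident has_derivative_const])
    from has_derivative_compose[where f="\<lambda>p. (p, m)" and f'="\<lambda>v. (v, 0)" and s=UNIV, OF P D]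
    show "((\<lambda>p. g (p, m)) has_derivative (\<lambda>v. frechet_derivative g (at (p, m)) (v, 0))) (at p)"
      by simp
  next
    fix p assume "p \<in> S"
    then show "continuous_on A (\<lambda>m. g (p, m))"
      using g by (intro continuous_on_compose2[OF c1_on_imp_continuous_on[OF g(1)]] continuous_intros) auto
  qed
  then show "p \<in> S \<Longrightarrow> ((\<lambda>p. LINT m:A|N. g (p, m)) has_derivative
           (\<lambda>v. LINT m:A|N. frechet_derivative g (at (p, m)) (v, 0))) (at p)" .
  show "c1_on S (\<lambda>p. LINT m:A|N. g (p, m))"
  proof (rule c1_onI[OF *])
    fix v
    show "continuous_on S (\<lambda>p. LINT m:A|N. frechet_derivative g (at (p, m)) (v, 0))"
      using continuous_on_integral_compact[OF N A S cont[of v]] by simp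
  qed auto
qed

section \<open>Test fields and the dual Fisher bound\<close>

definition dvg :: "('a::euclidean_space \<Rightarrow> 'a) \<Rightarrow> 'a \<Rightarrow> real" where
  "dvg \<psi> x = (\<Sum>b\<in>Basis. frechet_derivative \<psi> (at x) b \<bullet> b)"

text \<open>Domain and codomain are left general so that the same facts serve vector fields, scalar
  test functions and fields on pairs of velocities.\<close>

definition tfield :: "('a::euclidean_space \<Rightarrow> 'b::real_normed_vector) \<Rightarrow> bool" where
  "tfield \<psi> \<longleftrightarrow> c1_on UNIV \<psi> \<and> bounded {x. \<psi> x \<noteq> 0}"

text \<open>An inequality for every test field in place of a supremum: C may be any upper bound, and
  neither finiteness nor attainment has to be discussed.\<close>

definition fisher_le :: "real \<Rightarrow> (vel \<Rightarrow> real) \<Rightarrow> bool" where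
  "fisher_le C f \<longleftrightarrow> (\<forall>\<psi>. tfield \<psi> \<longrightarrow>
     2 * (\<integral>x. dvg \<psi> x * f x \<partial>lborel) \<le> C + (\<integral>x. (norm (\<psi> x))\<^sup>2 * f x \<partial>lborel))"

text \<open>The complement of a closed ball is open, so the derivative vanishes there together with
  the field.\<close>

lemma tfield_vanish:
  assumes "tfield \<psi>"
  obtains R where "R > 0" "\<And>x. norm x > R \<Longrightarrow> \<psi> x = 0"
    "\<And>x. norm x > R \<Longrightarrow> frechet_derivative \<psi> (at x) = (\<lambda>_. 0)"
proof -
  obtain R where R: "R > 0" "\<And>x. \<psi> x \<noteq> 0 \<Longrightarrow> norm x \<le> R"
    using assms unfolding tfield_def bounded_pos by auto
  have "frechet_derivative \<psi> (at x) = (\<lambda>_. 0)" if "norm x > R" for x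
  proof -
    have "(\<psi> has_derivative (\<lambda>_. 0)) (at x)"
    proof (rule has_derivative_transform_within_open)
      show "((\<lambda>_. 0) has_derivative (\<lambda>_. 0)) (at x)" by (rule has_derivative_const)
      show "x \<in> - cball 0 R" using that by simp
      show "0 = \<psi> y" if "y \<in> - cball 0 R" for y using that R(2)[of y] by force
    qed auto
    then show ?thesis using frechet_derivative_at by metis
  qed
  with R that show thesis by (metis linorder_not_le)
qed

lemma bounded_if_vanish:
  fixes g :: "'a::euclidean_space \<Rightarrow> 'b::real_normed_vector"
  assumes "continuous_on UNIV g" "\<And>x. norm x > R \<Longrightarrow> g x = 0"
  obtains K where "K > 0" "\<And>x. norm (g x) \<le> K"
proof -
  have "bounded (g ` cball 0 R)"
    by (intro compact_imp_bounded compact_continuous_image continuous_on_subset[OF assms(1)]) auto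
  then obtain K where K: "K > 0" "\<And>x. x \<in> cball 0 R \<Longrightarrow> norm (g x) \<le> K"
    unfolding bounded_pos by auto
  have "norm (g x) \<le> K" for x
    using K assms(2)[of x] by (cases "norm x \<le> R") auto
  with K(1) that show thesis by blast
qed

lemma tfield_continuous: "tfield \<psi> \<Longrightarrow> continuous_on UNIV \<psi>"
  by (simp add: tfield_def c1_on_imp_continuous_on)

lemma tfield_bounded:
  fixes \<psi> :: "'a::euclidean_space \<Rightarrow> 'b::real_normed_vector"
  assumes "tfield \<psi>" obtains K where "K > 0" "\<And>x. norm (\<psi> x) \<le> K"
  using tfield_vanish[OF assms] bounded_if_vanish[OF tfield_continuous[OF assms]] by metis

lemma continuous_on_dvg: "c1_on S \<psi> \<Longrightarrow> continuous_on S (dvg \<psi>)"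
  unfolding dvg_def c1_on_def by (intro continuous_intros) auto

lemma tfield_dvg_bounded:
  assumes "tfield \<psi>" obtains K where "K > 0" "\<And>x. \<bar>dvg \<psi> x\<bar> \<le> K"
proof -
  obtain R where "\<And>x. norm x > R \<Longrightarrow> frechet_derivative \<psi> (at x) = (\<lambda>_. 0)"
    using tfield_vanish[OF assms] by metis
  then have "\<And>x. norm x > R \<Longrightarrow> dvg \<psi> x = 0" by (simp add: dvg_def)
  with bounded_if_vanish[of "dvg \<psi>" R] that continuous_on_dvg[of UNIV \<psi>] assms
  show thesis unfolding tfield_def by auto
qed

lemma tfield_frechet_bounded:
  fixes \<psi> :: "'a::euclidean_space \<Rightarrow> 'b::real_normed_vector"
  assumes "tfield \<psi>" obtains K where "K > 0" "\<And>x v. norm (frechet_derivative \<psi> (at x) v) \<le> K * norm v"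
proof -
  obtain R where R: "\<And>x. norm x > R \<Longrightarrow> frechet_derivative \<psi> (at x) = (\<lambda>_. 0)"
    using tfield_vanish[OF assms] by metis
  have "\<exists>K. \<forall>x. norm (frechet_derivative \<psi> (at x) b) \<le> K" for b
    using bounded_if_vanish[of "\<lambda>x. frechet_derivative \<psi> (at x) b" R] R assms
    unfolding tfield_def c1_on_def by metis
  then obtain K where K: "\<And>b x. norm (frechet_derivative \<psi> (at x) b) \<le> K b" by metis
  define L where "L = (\<Sum>b\<in>Basis. K b) + 1"
  have K0: "K b \<ge> 0" for b using K[of 0 b] norm_ge_zero order_trans by blast
  have "norm (frechet_derivative \<psi> (at x) v) \<le> L * norm v" for x v
  proof -
    have l: "linear (frechet_derivative \<psi> (at x))"
      using assms c1_on_has_derivative has_derivative_linear unfolding tfield_def by blast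
    have "frechet_derivative \<psi> (at x) (\<Sum>b\<in>Basis. (v \<bullet> b) *\<^sub>R b) = (\<Sum>b\<in>Basis. (v \<bullet> b) *\<^sub>R frechet_derivative \<psi> (at x) b)"
      by (simp add: linear_sum[OF l] linear_cmul[OF l])
    then have "norm (frechet_derivative \<psi> (at x) v) \<le> (\<Sum>b\<in>Basis. norm v * K b)"
      by (simp add: euclidean_representation)
         (intro sum_norm_le, auto intro!: mult_mono K Basis_le_norm)
    also have "\<dots> \<le> L * norm v"
      unfolding L_def sum_distrib_left[symmetric] by (simp add: algebra_simps)
    finally show ?thesis .
  qed
  moreover have "L > 0" unfolding L_def using K0 by (simp add: add_nonneg_pos sum_nonneg)
  ultimately show thesis using that by blast
qed

lemma tfield_lipschitz:
  fixes \<psi> :: "'a::euclidean_space \<Rightarrow> 'b::real_normed_vector"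
  assumes "tfield \<psi>" obtains L where "L > 0" "\<And>x y. norm (\<psi> x - \<psi> y) \<le> L * norm (x - y)"
proof -
  obtain K where K: "K > 0" "\<And>x v. norm (frechet_derivative \<psi> (at x) v) \<le> K * norm v"
    using tfield_frechet_bounded[OF assms] by blast
  have "norm (\<psi> x - \<psi> y) \<le> K * norm (x - y)" for x y
  proof (rule differentiable_bound[of UNIV \<psi> "\<lambda>x. frechet_derivative \<psi> (at x)"])
    show "(\<psi> has_derivative frechet_derivative \<psi> (at x)) (at x within UNIV)" for x
      using assms c1_on_has_derivative unfolding tfield_def by blast
    show "onorm (frechet_derivative \<psi> (at x)) \<le> K" for x
      using K by (intro onorm_le) auto
  qed auto
  with K(1) that show thesis by blast
qed

lemma tfield_scaleR: "tfield \<psi> \<Longrightarrow> tfield (\<lambda>x. c *\<^sub>R \<psi> x)"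
  unfolding tfield_def by (auto intro!: c1_on_scaleR elim: bounded_subset)

lemma dvg_scaleR:
  assumes "\<psi> differentiable (at x)"
  shows "dvg (\<lambda>x. c *\<^sub>R \<psi> x) x = c * dvg \<psi> x"
proof -
  have "((\<lambda>x. c *\<^sub>R \<psi> x) has_derivative (\<lambda>v. c *\<^sub>R frechet_derivative \<psi> (at x) v)) (at x)"
    using assms by (intro has_derivative_scaleR_right) (simp add: frechet_derivative_works)
  then have "frechet_derivative (\<lambda>x. c *\<^sub>R \<psi> x) (at x) = (\<lambda>v. c *\<^sub>R frechet_derivative \<psi> (at x) v)"
    using frechet_derivative_at by metis
  then show ?thesis by (simp add: dvg_def sum_distrib_left)
qed

text \<open>Replacing psi by psi / l makes the balance between divergence and square norm a free
  parameter. It is spent on l = 2 / (1 + e) for the collision operator, on l = 1/2 for the square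
  root, and on the factor of a dilation.\<close>

lemma fisher_leD:
  assumes "fisher_le C f" "tfield \<psi>" "l > 0"
  shows "2 * (\<integral>x. dvg \<psi> x * f x \<partial>lborel) \<le> l * C + (\<integral>x. (norm (\<psi> x))\<^sup>2 * f x \<partial>lborel) / l"
proof -
  have d: "dvg (\<lambda>x. inverse l *\<^sub>R \<psi> x) = (\<lambda>x. inverse l * dvg \<psi> x)"
    using assms(2) by (intro ext dvg_scaleR) (simp add: tfield_def c1_on_def)
  have "2 * (\<integral>x. inverse l * dvg \<psi> x * f x \<partial>lborel)
     \<le> C + (\<integral>x. (inverse l)\<^sup>2 * ((norm (\<psi> x))\<^sup>2 * f x) \<partial>lborel)"
    using assms(1)[unfolded fisher_le_def, rule_format, OF tfield_scaleR[OF assms(2), of "inverse l"]] assms(3)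
    unfolding d by (simp add: power_mult_distrib mult_ac)
  also have "(\<integral>x. (inverse l)\<^sup>2 * ((norm (\<psi> x))\<^sup>2 * f x) \<partial>lborel) = (inverse l)\<^sup>2 * (\<integral>x. (norm (\<psi> x))\<^sup>2 * f x \<partial>lborel)"
    by simp
  also have "(\<integral>x. inverse l * dvg \<psi> x * f x \<partial>lborel) = inverse l * (\<integral>x. dvg \<psi> x * f x \<partial>lborel)"
    by (simp add: mult.assoc)
  finally show ?thesis
    using assms(3) mult_left_mono[of _ _ l] by (simp add: field_simps power2_eq_square)
qed

section \<open>A C^1 cutoff function\<close>

definition sqpos :: "real \<Rightarrow> real" where "sqpos t = (max 0 t)\<^sup>2"
text \<open>Test fields need only be C^1, so two nested squared positive parts do the work of a
  smooth bump. The values are explicit, 1 up to t = 1 and 0 from t = 2 on, and the slope is at most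
  4.\<close>

definition cutoff :: "real \<Rightarrow> real" where "cutoff t = sqpos (1 - sqpos (t - 1))"
definition dcutoff :: "real \<Rightarrow> real" where
  "dcutoff t = - (2 * max 0 (1 - sqpos (t - 1)) * (2 * max 0 (t - 1)))"

lemma DERIV_sqpos: "(sqpos has_field_derivative 2 * max 0 t) (at t)"
proof -
  consider "t > 0" | "t < 0" | "t = 0" by linarith
  then show ?thesis
  proof cases
    case 1
    have "((\<lambda>t. t\<^sup>2) has_field_derivative 2 * max 0 t) (at t)"
      using 1 by (auto intro!: derivative_eq_intros)
    then show ?thesis
      by (rule has_field_derivative_transform_within_open[of _ _ _ "{0<..}"]) (use 1 in \<open>auto simp: sqpos_def\<close>)
  next
    case 2
    have "((\<lambda>t. 0) has_field_derivative 2 * max 0 t) (at t)"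
      using 2 by (auto intro!: derivative_eq_intros)
    then show ?thesis
      by (rule has_field_derivative_transform_within_open[of _ _ _ "{..<0}"]) (use 2 in \<open>auto simp: sqpos_def\<close>)
  next
    case 3
    have "(\<lambda>h. (sqpos (0 + h) - sqpos 0) / h) \<midarrow>0\<rightarrow> 0"
    proof (rule Lim_null_comparison[where g="\<lambda>h. \<bar>h\<bar>"])
      show "\<forall>\<^sub>F h in at 0. norm ((sqpos (0 + h) - sqpos 0) / h) \<le> \<bar>h\<bar>"
        by (rule always_eventually) (auto simp: sqpos_def max_def power2_eq_square)
    qed (auto intro: tendsto_eq_intros)
    then show ?thesis using 3 by (simp add: DERIV_def)
  qed
qed

lemma DERIV_cutoff: "(cutoff has_field_derivative dcutoff t) (at t)"
proof -
  have "((\<lambda>t. t - 1) has_field_derivative 1) (at t)" by (auto intro!: derivative_eq_intros)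
  from DERIV_chain2[OF DERIV_sqpos this]
  have "((\<lambda>t. 1 - sqpos (t - 1)) has_field_derivative - (2 * max 0 (t - 1))) (at t)"
    by (auto intro!: derivative_eq_intros)
  from DERIV_chain2[OF DERIV_sqpos this] show ?thesis
    by (simp add: cutoff_def[abs_def] dcutoff_def mult_ac)
qed

lemma c1_on_sqpos: "c1_on S sqpos"
  by (rule c1_on_real_deriv[OF DERIV_sqpos]) (intro continuous_intros)

lemma continuous_on_sqpos: "continuous_on S sqpos"
  using c1_on_sqpos by (rule c1_on_imp_continuous_on)

lemma c1_on_cutoff: "c1_on S cutoff"
  unfolding dcutoff_def[abs_def]
  by (rule c1_on_real_deriv[OF DERIV_cutoff])
     (unfold dcutoff_def, intro continuous_intros continuous_on_compose2[OF continuous_on_sqpos[of UNIV]], auto)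

lemma cutoff_simps [simp]: "t \<le> 1 \<Longrightarrow> cutoff t = 1" "2 \<le> t \<Longrightarrow> cutoff t = 0"
proof -
  show "cutoff t = 1" if "t \<le> 1" using that by (simp add: cutoff_def sqpos_def)
  show "cutoff t = 0" if "2 \<le> t"
  proof -
    have "1 \<le> (t - 1)\<^sup>2" using that power_mono[of 1 "t - 1" 2] by simp
    then show ?thesis using that by (simp add: cutoff_def sqpos_def)
  qed
qed

lemma cutoff_bounds: "0 \<le> cutoff t" "cutoff t \<le> 1"
proof -
  show "0 \<le> cutoff t" by (simp add: cutoff_def sqpos_def)
  have "max 0 (1 - sqpos (t - 1)) \<le> 1" by (simp add: sqpos_def)
  then show "cutoff t \<le> 1" unfolding cutoff_def sqpos_def[of "1 - _"] by (simp add: power_le_one)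
qed

lemma dcutoff_zero: "t \<le> 1 \<or> 2 \<le> t \<Longrightarrow> dcutoff t = 0"
proof -
  assume "t \<le> 1 \<or> 2 \<le> t"
  moreover have "1 \<le> (t - 1)\<^sup>2" if "2 \<le> t" using that power_mono[of 1 "t - 1" 2] by simp
  ultimately show ?thesis by (auto simp: dcutoff_def sqpos_def)
qed

lemma dcutoff_le: "\<bar>dcutoff t\<bar> \<le> 4"
proof (cases "t \<le> 1 \<or> 2 \<le> t")
  case False
  have "max 0 (1 - sqpos (t - 1)) * max 0 (t - 1) \<le> 1 * 1"
    using False by (intro mult_mono) (auto simp: sqpos_def)
  moreover have "0 \<le> max 0 (1 - sqpos (t - 1)) * max 0 (t - 1)" by simp
  ultimately show ?thesis unfolding dcutoff_def by (simp add: abs_mult)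
qed (simp add: dcutoff_zero)

section \<open>Averages over scattered relative velocities\<close>

lemma frechet_eqI: "(f has_derivative f') (at x) \<Longrightarrow> frechet_derivative f (at x) = f'"
  using frechet_derivative_at by metis

text \<open>Householder reflection in the hyperplane orthogonal to p. For p = x - y it exchanges two
  vectors of equal norm (\<open>refl_at_swap\<close>), and it depends smoothly on p away from 0,
  which makes it a convenient moving frame.\<close>

definition refl_at :: "'a::real_inner \<Rightarrow> 'a \<Rightarrow> 'a" where
  "refl_at p x = x - (2 * (p \<bullet> x) / (p \<bullet> p)) *\<^sub>R p"

lemma orthogonal_refl_at: "p \<noteq> 0 \<Longrightarrow> orthogonal_transformation (refl_at p)"
  unfolding orthogonal_transformation_def
  by (auto intro!: linearI simp: refl_at_def algebra_simps inner_diff_left inner_diff_right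
    inner_add_right add_divide_distrib inner_commute)

lemma refl_at_swap:
  assumes "norm x = norm y" "x \<noteq> y"
  shows "refl_at (x - y) x = y"
proof -
  have xx: "x \<bullet> x = y \<bullet> y" using assms(1) by (simp add: norm_eq)
  have "(x - y) \<bullet> (x - y) = 2 * ((x - y) \<bullet> x)"
    by (simp add: inner_diff_left inner_diff_right inner_commute xx)
  moreover have "(x - y) \<bullet> (x - y) \<noteq> 0" using assms(2) by simp
  ultimately have "2 * ((x - y) \<bullet> x) / ((x - y) \<bullet> (x - y)) = 1"
    by (metis divide_self)
  then show ?thesis unfolding refl_at_def by (simp only: scaleR_one) simp
qed

text \<open>Rodrigues' formula for the rotation by the angle s about a unit vector w; its velocity
  at s = 0 is the infinitesimal rotation \<open>cross3 w x\<close>.\<close>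

definition rot_axis :: "vel \<Rightarrow> real \<Rightarrow> vel \<Rightarrow> vel" where
  "rot_axis w s x = cos s *\<^sub>R x + sin s *\<^sub>R cross3 w x + ((1 - cos s) * (w \<bullet> x)) *\<^sub>R w"

lemma orthogonal_rot_axis:
  assumes "norm w = 1" shows "orthogonal_transformation (rot_axis w s)"
  unfolding orthogonal_transformation
proof (intro conjI allI)
  show "linear (rot_axis w s)"
    by (intro linearI) (auto simp: rot_axis_def cross_add_right cross_mult_right algebra_simps inner_add_right)
  fix x
  have ww: "w \<bullet> w = 1" using assms by (simp add: norm_eq_1)
  have cc: "cross3 w x \<bullet> cross3 w x = x \<bullet> x - (w \<bullet> x)\<^sup>2"
    using norm_cross_dot[of w x] assms by (simp add: power2_norm_eq_inner[symmetric])
  have sc: "(sin s)\<^sup>2 = 1 - (cos s)\<^sup>2" by (simp add: sin_squared_eq)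
  have "rot_axis w s x \<bullet> rot_axis w s x
      = (cos s)\<^sup>2 * (x \<bullet> x) + (sin s)\<^sup>2 * (cross3 w x \<bullet> cross3 w x)
        + (1 - cos s)\<^sup>2 * (w \<bullet> x)\<^sup>2 * (w \<bullet> w) + 2 * cos s * (1 - cos s) * (w \<bullet> x)\<^sup>2"
    by (simp add: rot_axis_def inner_add_left inner_add_right dot_cross_self inner_commute algebra_simps power2_eq_square)
  also have "\<dots> = x \<bullet> x" unfolding cc ww sc by (simp add: algebra_simps power2_eq_square)
  finally show "norm (rot_axis w s x) = norm x" by (simp add: norm_eq)
qed

lemma cross3_bounded_bilinear: "bounded_bilinear cross3"
  using bilinear_cross by (simp add: bilinear_conv_bounded_bilinear)

lemmas c1_on_cross3 = c1_on_bilinear[OF cross3_bounded_bilinear]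

lemma cross3_cross3: "cross3 x (cross3 y z) = (x \<bullet> z) *\<^sub>R y - (x \<bullet> y) *\<^sub>R z"
  by (simp add: cross3_simps forall_3)

text \<open>A collision multiplies the relative speed by a factor between e and 1. After division by
  |u| the outgoing relative velocity therefore lies here, away from 0, where the radial and angular
  coefficients are singular.\<close>

definition annulus :: "real \<Rightarrow> vel set" where "annulus e = {m. e \<le> norm m \<and> norm m \<le> 1}"

lemma compact_annulus: "compact (annulus e)"
proof -
  have "annulus e = cball 0 1 \<inter> norm -` {e..}" by (auto simp: annulus_def)
  moreover have "closed (norm -` {e..} :: vel set)" by (intro closed_vimage continuous_intros)
  ultimately show ?thesis by (simp add: compact_Int_closed)
qed

text \<open>The law of \<open>y/|u|\<close>, where \<open>y\<close> is the relative velocity after the collision, depends on the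
  relative velocity \<open>u\<close> before the collision only through its direction \<open>k\<close>.\<close>

locale scattering =
  fixes e :: real and \<nu> :: "vel \<Rightarrow> vel measure"
  assumes e: "0 < e" "e \<le> 1"
    and nu_finite: "norm k = 1 \<Longrightarrow> finite_measure (\<nu> k)"
    and nu_space: "norm k = 1 \<Longrightarrow> measure (\<nu> k) (space (\<nu> k)) = 1"
    and sets_nu: "norm k = 1 \<Longrightarrow> sets (\<nu> k) = sets borel"
    and supp: "norm k = 1 \<Longrightarrow> AE m in \<nu> k. m \<in> annulus e"
    and rot: "norm k = 1 \<Longrightarrow> orthogonal_transformation R \<Longrightarrow> \<nu> (R k) = distr (\<nu> k) borel R"
begin

text \<open>Restricting the integral to the annulus changes nothing, by \<open>supp\<close>, and
  leaves a compact domain on which y = |u| m avoids 0; so h needs regularity only off y = 0.\<close>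

definition avg :: "(vel \<times> vel \<Rightarrow> 'b::euclidean_space) \<Rightarrow> vel \<times> vel \<Rightarrow> 'b" where
  "avg h = (\<lambda>(c, u). LINT m:annulus e|\<nu> (u /\<^sub>R norm u). h (c, norm u *\<^sub>R m))"

lemma avg_cong:
  assumes "\<And>y. y \<noteq> 0 \<Longrightarrow> h (c, y) = h' (c, y)" "u \<noteq> 0"
  shows "avg h (c, u) = avg h' (c, u)"
proof -
  have "h (c, norm u *\<^sub>R m) = h' (c, norm u *\<^sub>R m)" if "m \<in> annulus e" for m
    using that e assms(2) by (intro assms(1)) (auto simp: annulus_def)
  then have "indicat_real (annulus e) m *\<^sub>R h (c, norm u *\<^sub>R m)
      = indicat_real (annulus e) m *\<^sub>R h' (c, norm u *\<^sub>R m)" for m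
    by (cases "m \<in> annulus e") auto
  then show ?thesis unfolding avg_def set_lebesgue_integral_def prod.case by (simp only:)
qed

lemma nu_rot:
  fixes h :: "vel \<Rightarrow> 'b::euclidean_space"
  assumes "norm k = 1" "orthogonal_transformation R" "continuous_on (annulus e) h"
  shows "(LINT m:annulus e|\<nu> (R k). h m) = (LINT m:annulus e|\<nu> k. h (R m))"
proof -
  have R: "R \<in> borel_measurable borel"
    using assms(2) by (intro borel_measurable_continuous_onI linear_continuous_on)
      (simp add: orthogonal_transformation_linear linear_linear)
  have h: "(\<lambda>x. indicat_real (annulus e) x *\<^sub>R h x) \<in> borel_measurable borel"
    using assms(3) by (intro borel_measurable_continuous_on_indicator borel_compact compact_annulus)
  have i: "indicat_real (annulus e) (R x) = indicat_real (annulus e) x" for x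
    using assms(2) by (simp add: indicator_def annulus_def orthogonal_transformation_norm)
  show ?thesis
    unfolding rot[OF assms(1,2)] set_lebesgue_integral_def
    by (subst integral_distr) (use R h measurable_cong_sets[OF sets_nu[OF assms(1)] refl] in \<open>auto simp: i\<close>)
qed

lemma avg_rot:
  fixes h :: "vel \<times> vel \<Rightarrow> 'b::euclidean_space"
  assumes "norm k = 1" "orthogonal_transformation R" "r > 0" "continuous_on {p. snd p \<noteq> 0} h"
  shows "avg h (c, r *\<^sub>R R k) = (LINT m:annulus e|\<nu> k. h (c, r *\<^sub>R R m))"
proof -
  have n: "norm (R k) = 1" using assms by (simp add: orthogonal_transformation_norm)
  have "continuous_on (annulus e) (\<lambda>m. h (c, r *\<^sub>R m))"
    using e assms(3) by (intro continuous_on_compose2[OF assms(4)] continuous_intros) (auto simp: annulus_def)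
  from nu_rot[OF assms(1,2) this] n assms(3) show ?thesis
    by (simp add: avg_def)
qed

lemma open_snd: "open {p :: vel \<times> vel. snd p \<noteq> 0}"
  by (intro open_Collect_neq continuous_intros)

text \<open>The measure in \<open>avg\<close> moves with u. Reflecting |u| a to u converts the
  average into an integral against the fixed measure \<open>\<nu> a\<close>, with all dependence on
  u in a smooth map acting on the integrand. The reflection degenerates only when u has the
  direction of a.\<close>

lemma frame:
  assumes "norm a = 1" "norm u *\<^sub>R a \<noteq> u" "u \<noteq> 0" "continuous_on {p. snd p \<noteq> 0} h"
  shows "avg h (c, u) = (LINT m:annulus e|\<nu> a. h (c, norm u *\<^sub>R refl_at (norm u *\<^sub>R a - u) m))"
proof -
  let ?p = "norm u *\<^sub>R a - u"
  have "linear (refl_at ?p)" using orthogonal_refl_at[of ?p] assms by (simp add: orthogonal_transformation_linear)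
  then have "norm u *\<^sub>R refl_at ?p a = refl_at ?p (norm u *\<^sub>R a)" by (simp add: linear_cmul)
  also have "\<dots> = u" using assms by (intro refl_at_swap) auto
  finally show ?thesis
    using avg_rot[OF assms(1) orthogonal_refl_at[of ?p], of "norm u" h c] assms by simp
qed

text \<open>No regularity of k |-> \<open>\<nu> k\<close> is assumed. Around every point a frame a
  is chosen in which parametric integration applies; the excluded direction varies with a, so the
  charts \<open>V a\<close> cover all u \<noteq> 0.\<close>

lemma frame_regular:
  fixes h :: "vel \<times> vel \<Rightarrow> 'b::euclidean_space"
  shows "continuous_on {p. snd p \<noteq> 0} h \<Longrightarrow> continuous_on {p. snd p \<noteq> 0} (avg h)"
    and "c1_on {p. snd p \<noteq> 0} h \<Longrightarrow> c1_on {p. snd p \<noteq> 0} (avg h)"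
proof -
  define V where "V a = {p :: vel \<times> vel. snd p \<noteq> 0 \<and> norm (snd p) *\<^sub>R a - snd p \<noteq> 0}" for a
  define G where "G a = (\<lambda>x :: (vel \<times> vel) \<times> vel. (fst (fst x),
      norm (snd (fst x)) *\<^sub>R refl_at (norm (snd (fst x)) *\<^sub>R a - snd (fst x)) (snd x)))" for a
  have V: "open (V a)" for a unfolding V_def
    by (intro open_Collect_conj open_Collect_neq continuous_intros)
  have G: "c1_on (V a \<times> UNIV) (G a)" for a
    unfolding G_def refl_at_def V_def
    by (intro c1_on_Pair c1_on_scaleR c1_on_diff c1_on_divide c1_on_mult c1_on_inner c1_on_norm c1_on_const c1_on_id
       c1_on_linear_compose[OF bounded_linear_fst] c1_on_linear_compose[OF bounded_linear_snd]) auto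
  have sub: "G a ` (V a \<times> annulus e) \<subseteq> {p. snd p \<noteq> 0}" for a
  proof clarsimp
    fix c u m assume p: "(c, u) \<in> V a" "m \<in> annulus e" and z: "snd (G a ((c, u), m)) = 0"
    then have "norm (refl_at (norm u *\<^sub>R a - u) m) = norm m"
      by (intro orthogonal_transformation_norm orthogonal_refl_at) (auto simp: V_def)
    with p z e show False by (auto simp: G_def V_def annulus_def)
  qed
  have eq: "avg h p = (LINT m:annulus e|\<nu> a. h (G a (p, m)))"
    if "norm a = 1" "p \<in> V a" "continuous_on {p. snd p \<noteq> 0} h" for p a and h :: "vel \<times> vel \<Rightarrow> 'b"
    using frame[OF that(1) _ _ that(3), of "snd p" "fst p"] that(2) by (simp add: V_def G_def)
  have ex: "\<exists>a. norm a = 1 \<and> p \<in> V a" if "snd p \<noteq> 0" for p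
  proof -
    \<comment> \<open>a = -u / |u| is as far from the excluded direction as possible: the reflecting
      vector is then -2 u.\<close>
    have "norm (snd p) *\<^sub>R (- (snd p /\<^sub>R norm (snd p))) - snd p = - (2 *\<^sub>R snd p)"
      using that by (simp add: scaleR_2)
    then show ?thesis
      using that by (intro exI[of _ "- (snd p /\<^sub>R norm (snd p))"]) (simp add: V_def)
  qed
  {
    assume h: "continuous_on {p. snd p \<noteq> 0} h"
    show "continuous_on {p. snd p \<noteq> 0} (avg h)"
    proof (rule continuous_at_imp_continuous_on, rule ballI)
      fix p :: "vel \<times> vel" assume "p \<in> {p. snd p \<noteq> 0}"
      then obtain a where a: "norm a = 1" "p \<in> V a" using ex by blast
      have "continuous_on (V a \<times> annulus e) (\<lambda>x. h (G a x))"
        by (intro continuous_on_compose2[OF h _ sub] c1_on_imp_continuous_on c1_on_subset[OF G]) auto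
      from continuous_on_integral_compact[OF nu_finite[OF a(1)] sets_nu[OF a(1)] compact_annulus V this]
      have "continuous_on (V a) (avg h)" by (simp add: eq[OF a(1) _ h] cong: continuous_on_cong)
      then show "isCont (avg h) p" using V a by (simp add: continuous_on_eq_continuous_at)
    qed
  }
  {
    assume h: "c1_on {p. snd p \<noteq> 0} h"
    note hc = c1_on_imp_continuous_on[OF h]
    show "c1_on {p. snd p \<noteq> 0} (avg h)"
    proof (rule c1_on_local)
      fix p :: "vel \<times> vel" assume "p \<in> {p. snd p \<noteq> 0}"
      then obtain a where a: "norm a = 1" "p \<in> V a" using ex by blast
      have "c1_on (V a \<times> annulus e) (\<lambda>x. h (G a x))"
        by (intro c1_on_compose[OF h _ sub] c1_on_subset[OF G]) auto
      from c1_on_integral_compact(1)[OF nu_finite[OF a(1)] sets_nu[OF a(1)] compact_annulus V this]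
      have "c1_on (V a) (\<lambda>p. LINT m:annulus e|\<nu> a. h (G a (p, m)))" by simp
      then have "c1_on (V a) (avg h)" by (rule c1_on_cong[OF _ V]) (simp add: eq[OF a(1) _ hc])
      with V a show "\<exists>T. open T \<and> p \<in> T \<and> c1_on T (avg h)" by blast
    qed
  }
qed

text \<open>Along a curve on which the average is an integral against one fixed measure, the
  derivative passes to the integrand. The curves to be inserted are orbits of translations,
  dilations and rotations.\<close>

lemma avg_deriv_curve:
  fixes h :: "vel \<times> vel \<Rightarrow> 'b::euclidean_space"
  assumes h: "c1_on {p. snd p \<noteq> 0} h" and k: "norm k = 1"
    and \<gamma>: "(\<gamma> has_derivative \<gamma>') (at (0::real))" "snd (\<gamma> 0) \<noteq> 0"
    and S: "open S" "0 \<in> S" and G: "c1_on (S \<times> UNIV) G" "\<And>s m. s \<in> S \<Longrightarrow> m \<in> annulus e \<Longrightarrow> snd (G (s, m)) \<noteq> 0"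
    and dG: "\<And>m. m \<in> annulus e \<Longrightarrow> ((\<lambda>s. G (s, m)) has_derivative (\<lambda>s. s *\<^sub>R G' m)) (at 0)"
    and eq: "\<And>s. s \<in> S \<Longrightarrow> avg h (\<gamma> s) = (LINT m:annulus e|\<nu> k. h (G (s, m)))"
  shows "frechet_derivative (avg h) (at (\<gamma> 0)) (\<gamma>' 1)
     = (LINT m:annulus e|\<nu> k. frechet_derivative h (at (G (0, m))) (G' m))"
proof -
  have sub: "G ` (S \<times> annulus e) \<subseteq> {p. snd p \<noteq> 0}" using G(2) by auto
  have hG: "c1_on (S \<times> annulus e) (\<lambda>x. h (G x))"
    by (intro c1_on_compose[OF h _ sub] c1_on_subset[OF G(1)]) auto
  from c1_on_integral_compact(2)[OF nu_finite[OF k] sets_nu[OF k] compact_annulus S(1) this order_refl S(2)]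
  have 1: "((\<lambda>s. LINT m:annulus e|\<nu> k. h (G (s, m))) has_derivative
     (\<lambda>v. LINT m:annulus e|\<nu> k. frechet_derivative (\<lambda>x. h (G x)) (at (0, m)) (v, 0))) (at 0)" .
  have "((\<lambda>s. avg h (\<gamma> s)) has_derivative
     (\<lambda>v. LINT m:annulus e|\<nu> k. frechet_derivative (\<lambda>x. h (G x)) (at (0, m)) (v, 0))) (at 0)"
    by (rule has_derivative_transform_within_open[OF 1 S]) (simp add: eq)
  moreover have "((\<lambda>s. avg h (\<gamma> s)) has_derivative (\<lambda>v. frechet_derivative (avg h) (at (\<gamma> 0)) (\<gamma>' v))) (at 0)"
    using \<gamma> by (intro has_derivative_compose[OF \<gamma>(1)] c1_on_has_derivative[OF frame_regular(2)[OF h]]) auto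
  ultimately have "frechet_derivative (avg h) (at (\<gamma> 0)) (\<gamma>' 1)
    = (LINT m:annulus e|\<nu> k. frechet_derivative (\<lambda>x. h (G x)) (at (0, m)) (1, 0))"
    using fun_cong[OF has_derivative_unique] by blast
  also have "\<dots> = (LINT m:annulus e|\<nu> k. frechet_derivative h (at (G (0, m))) (G' m))"
  proof (rule set_lebesgue_integral_cong)
    show "annulus e \<in> sets (\<nu> k)" using sets_nu[OF k] compact_annulus by (simp add: borel_compact)
    show "\<forall>m. m \<in> annulus e \<longrightarrow> frechet_derivative (\<lambda>x. h (G x)) (at (0, m)) (1, 0)
        = frechet_derivative h (at (G (0, m))) (G' m)"
    proof (intro allI impI)
      fix m assume m: "m \<in> annulus e"
      have P: "((\<lambda>s. (s, m)) has_derivative (\<lambda>s. (s, 0))) (at (0::real))"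
        by (rule has_derivative_Pair[OF has_derivative_ident has_derivative_const])
      have "((\<lambda>x. h (G x)) has_derivative frechet_derivative (\<lambda>x. h (G x)) (at (0, m))) (at (0, m))"
        using hG m S by (intro c1_on_has_derivative) auto
      from has_derivative_compose[where f="\<lambda>s. (s, m)" and s=UNIV, OF P this]
      have a: "((\<lambda>s. h (G (s, m))) has_derivative (\<lambda>s. frechet_derivative (\<lambda>x. h (G x)) (at (0, m)) (s, 0))) (at 0)" .
      have "((\<lambda>s. h (G (s, m))) has_derivative (\<lambda>s. frechet_derivative h (at (G (0, m))) (s *\<^sub>R G' m))) (at 0)"
        using G(2)[OF S(2) m] by (intro has_derivative_compose[OF dG[OF m]] c1_on_has_derivative[OF h]) auto
      from fun_cong[OF has_derivative_unique[OF a this], of 1]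
      show "frechet_derivative (\<lambda>x. h (G x)) (at (0, m)) (1, 0) = frechet_derivative h (at (G (0, m))) (G' m)"
        by simp
    qed
  qed
  finally show ?thesis .
qed

text \<open>Each of the three directions is tangent to the orbit of a symmetry: translation of c,
  dilation of u, rotation of u. The derivative of the average is the average of the derivative of h
  along the same symmetry, now evaluated at y.\<close>

lemma avg_deriv:
  fixes h :: "vel \<times> vel \<Rightarrow> 'b::euclidean_space"
  assumes h: "c1_on {p. snd p \<noteq> 0} h" and u: "u \<noteq> 0"
  shows "frechet_derivative (avg h) (at (c, u)) (x, 0) = avg (\<lambda>p. frechet_derivative h (at p) (x, 0)) (c, u)"
    and "frechet_derivative (avg h) (at (c, u)) (0, u) = avg (\<lambda>p. frechet_derivative h (at p) (0, snd p)) (c, u)"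
    and "norm w = 1 \<Longrightarrow> frechet_derivative (avg h) (at (c, u)) (0, cross3 w u)
       = avg (\<lambda>p. frechet_derivative h (at p) (0, cross3 w (snd p))) (c, u)"
proof -
  define k where "k = u /\<^sub>R norm u"
  have k: "norm k = 1" using u by (simp add: k_def)
  have uk: "norm u *\<^sub>R k = u" using u by (simp add: k_def)
  have e0: "m \<noteq> 0" if "m \<in> annulus e" for m using that e by (auto simp: annulus_def)
  note hc = c1_on_imp_continuous_on[OF h]
  note c1 = c1_on_Pair c1_on_scaleR c1_on_add c1_on_mult c1_on_const c1_on_id
       c1_on_linear_compose[OF bounded_linear_fst] c1_on_linear_compose[OF bounded_linear_snd]
  have "frechet_derivative (avg h) (at ((\<lambda>s::real. (c + s *\<^sub>R x, u)) 0)) ((\<lambda>s. (s *\<^sub>R x, 0)) (1::real))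
     = (LINT m:annulus e|\<nu> k. frechet_derivative h (at ((\<lambda>z. (c + fst z *\<^sub>R x, norm u *\<^sub>R snd z)) (0::real, m))) (x, 0))"
  proof (rule avg_deriv_curve[OF h k _ _ open_UNIV])
    show "c1_on (UNIV \<times> UNIV) (\<lambda>z :: real \<times> vel. (c + fst z *\<^sub>R x, norm u *\<^sub>R snd z))" by (intro c1)
  qed (use u e0 in \<open>auto intro!: derivative_eq_intros simp: avg_def k_def\<close>)
  then show "frechet_derivative (avg h) (at (c, u)) (x, 0) = avg (\<lambda>p. frechet_derivative h (at p) (x, 0)) (c, u)"
    by (simp add: avg_def k_def)
  have "frechet_derivative (avg h) (at ((\<lambda>s::real. (c, (1 + s) *\<^sub>R u)) 0)) ((\<lambda>s. (0, s *\<^sub>R u)) (1::real))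
     = (LINT m:annulus e|\<nu> k. frechet_derivative h (at ((\<lambda>z. (c, ((1 + fst z) * norm u) *\<^sub>R snd z)) (0::real, m))) (0, norm u *\<^sub>R m))"
  proof (rule avg_deriv_curve[OF h k _ _ open_greaterThan[of "-1"]])
    show "c1_on ({-1<..} \<times> UNIV) (\<lambda>z :: real \<times> vel. (c, ((1 + fst z) * norm u) *\<^sub>R snd z))" by (intro c1)
    \<comment> \<open>s > -1 keeps the direction of (1 + s) u equal to k, so the measure does not
      move along the curve.\<close>
    fix s :: real assume s: "s \<in> {-1<..}"
    then have "norm ((1 + s) *\<^sub>R u) = (1 + s) * norm u" by simp
    moreover have "((1 + s) *\<^sub>R u) /\<^sub>R ((1 + s) * norm u) = k" using s by (simp add: k_def)
    ultimately show "avg h (c, (1 + s) *\<^sub>R u) = (LINT m:annulus e|\<nu> k. h (c, ((1 + fst (s, m)) * norm u) *\<^sub>R snd (s, m)))"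
      unfolding avg_def prod.case fst_conv snd_conv by (simp only:)
  qed (use u e0 in \<open>auto intro!: derivative_eq_intros\<close>)
  then show "frechet_derivative (avg h) (at (c, u)) (0, u) = avg (\<lambda>p. frechet_derivative h (at p) (0, snd p)) (c, u)"
    by (simp add: avg_def k_def)
  show "frechet_derivative (avg h) (at (c, u)) (0, cross3 w u)
       = avg (\<lambda>p. frechet_derivative h (at p) (0, cross3 w (snd p))) (c, u)" if w: "norm w = 1"
  proof -
    have r0: "rot_axis w 0 x = x" for x by (simp add: rot_axis_def)
    have dr: "((\<lambda>s. rot_axis w s x) has_derivative (\<lambda>s. s *\<^sub>R cross3 w x)) (at 0)" for x
      unfolding rot_axis_def by (auto intro!: derivative_eq_intros simp: scaleR_left.zero)
    have "frechet_derivative (avg h) (at ((\<lambda>s::real. (c, rot_axis w s u)) 0)) ((\<lambda>s. (0, s *\<^sub>R cross3 w u)) (1::real))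
     = (LINT m:annulus e|\<nu> k. frechet_derivative h (at ((\<lambda>z. (c, norm u *\<^sub>R rot_axis w (fst z) (snd z))) (0::real, m))) (0, norm u *\<^sub>R cross3 w m))"
    proof (rule avg_deriv_curve[OF h k _ _ open_UNIV])
      show "((\<lambda>s. (c, rot_axis w s u)) has_derivative (\<lambda>s. (0, s *\<^sub>R cross3 w u))) (at 0)"
        by (intro has_derivative_Pair has_derivative_const dr)
      show "((\<lambda>s. (c, norm u *\<^sub>R rot_axis w (fst (s, m)) (snd (s, m)))) has_derivative (\<lambda>s. s *\<^sub>R (0, norm u *\<^sub>R cross3 w m))) (at 0)" for m
        using has_derivative_Pair[OF has_derivative_const[of c] has_derivative_scaleR_right[OF dr, of "norm u" m]]
        by (simp add: mult.commute)
      show "avg h (c, rot_axis w s u) = (LINT m:annulus e|\<nu> k. h (c, norm u *\<^sub>R rot_axis w (fst (s, m)) (snd (s, m))))" for s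
      proof -
        have "rot_axis w s u = norm u *\<^sub>R rot_axis w s k"
          using linear_cmul[OF orthogonal_transformation_linear[OF orthogonal_rot_axis[OF w]], of s "norm u" k] uk by simp
        then show ?thesis using avg_rot[OF k orthogonal_rot_axis[OF w], of "norm u" h c s] u hc by simp
      qed
      show "c1_on (UNIV \<times> UNIV) (\<lambda>z :: real \<times> vel. (c, norm u *\<^sub>R rot_axis w (fst z) (snd z)))"
      proof -
        have "c1_on UNIV (cos :: real \<Rightarrow> real)"
          by (rule c1_on_real_deriv[OF DERIV_cos]) (intro continuous_intros)
        note co = c1_on_compose[OF this c1_on_fst subset_UNIV]
        have "c1_on UNIV (sin :: real \<Rightarrow> real)"
          by (rule c1_on_real_deriv[OF DERIV_sin]) (intro continuous_intros)
        note si = c1_on_compose[OF this c1_on_fst subset_UNIV]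
        show ?thesis unfolding rot_axis_def
          by (intro c1_on_Pair c1_on_scaleR c1_on_add c1_on_mult c1_on_const c1_on_diff c1_on_inner c1_on_cross3
              co si c1_on_snd)
      qed
      show "snd (c, norm u *\<^sub>R rot_axis w (fst (s, m)) (snd (s, m))) \<noteq> 0" if "m \<in> annulus e" for s m
        using u e0[OF that] orthogonal_transformation_norm[OF orthogonal_rot_axis[OF w], of s m] by auto
    qed (use u in \<open>auto simp: r0\<close>)
    then show ?thesis by (simp add: avg_def k_def r0 cross_mult_right)
  qed
qed

end

section \<open>Divergence in terms of radial and rotational derivatives\<close>

lemma sum_Basis3: "(\<Sum>b\<in>Basis. F b) = F (axis 1 1) + F (axis 2 1) + F (axis 3 1 :: vel)"
proof -
  have B: "(Basis :: vel set) = {axis 1 1, axis 2 1, axis 3 1}"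
    by (auto simp: Basis_vec_def axis_inverse UNIV_3)
  show ?thesis unfolding B by (simp add: axis_eq_axis add.assoc)
qed

lemma cross3_axis:
  "cross3 (axis 1 1) x = x $ 2 *\<^sub>R axis 3 1 - x $ 3 *\<^sub>R axis 2 1"
  "cross3 (axis 2 1) x = x $ 3 *\<^sub>R axis 1 1 - x $ 1 *\<^sub>R axis 3 1"
  "cross3 (axis 3 1) x = x $ 1 *\<^sub>R axis 2 1 - x $ 2 *\<^sub>R axis 1 1"
  by (simp_all add: cross3_simps forall_3 axis_def)

text \<open>div(S x) = 3 S + x . grad S, and -div(x \<times> g) = x . curl g, which differentiates g
  only along the rotations b \<times> x. So the divergence uses exactly those derivatives of S and g
  that commute with \<open>avg\<close>.\<close>

lemma divergence_split:
  fixes S :: "vel \<Rightarrow> real" and g :: "vel \<Rightarrow> vel"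
  assumes S: "(S has_derivative S') (at x)" and g: "(g has_derivative g') (at x)"
    and F: "((\<lambda>x. S x *\<^sub>R x - cross3 x (g x)) has_derivative F') (at x)"
  shows "(\<Sum>b\<in>Basis. F' b \<bullet> b) = 3 * S x + S' x + (\<Sum>b\<in>Basis. g' (cross3 b x) \<bullet> b)"
proof -
  have "((\<lambda>x. S x *\<^sub>R x - cross3 x (g x)) has_derivative
     (\<lambda>b. (S x *\<^sub>R b + S' b *\<^sub>R x) - (cross3 x (g' b) + cross3 b (g x)))) (at x)"
    by (intro has_derivative_diff has_derivative_scaleR S has_derivative_ident
       bounded_bilinear.FDERIV[OF cross3_bounded_bilinear] g)
  from has_derivative_unique[OF F this]
  have F': "F' = (\<lambda>b. (S x *\<^sub>R b + S' b *\<^sub>R x) - (cross3 x (g' b) + cross3 b (g x)))" .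
  have lS: "linear S'" and lg: "linear g'" using S g has_derivative_linear by auto
  have "x = x $ 1 *\<^sub>R axis 1 1 + x $ 2 *\<^sub>R axis 2 1 + x $ 3 *\<^sub>R axis 3 1"
    by (simp add: vec_eq_iff forall_3 axis_def)
  then have "S' x = S' (x $ 1 *\<^sub>R axis 1 1 + x $ 2 *\<^sub>R axis 2 1 + x $ 3 *\<^sub>R axis 3 1)" by simp
  also have "\<dots> = x $ 1 * S' (axis 1 1) + x $ 2 * S' (axis 2 1) + x $ 3 * S' (axis 3 1)"
    by (simp add: linear_add[OF lS] linear_cmul[OF lS])
  finally have S'x: "S' x = x $ 1 * S' (axis 1 1) + x $ 2 * S' (axis 2 1) + x $ 3 * S' (axis 3 1)" .
  show ?thesis
    unfolding F' sum_Basis3 cross3_axis S'x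
    by (simp add: linear_diff[OF lg] linear_cmul[OF lg] inner_diff_left inner_add_left inner_axis
      cross3_axis cross3_simps axis_def)
qed

lemma has_derivative_snd_slice:
  assumes "(F has_derivative F') (at (c, u))"
  shows "((\<lambda>u. F (c, u)) has_derivative (\<lambda>x. F' (0, x))) (at u)"
proof -
  have "((\<lambda>u. (c, u)) has_derivative (\<lambda>x. (0, x))) (at u within UNIV)"
    by (rule has_derivative_Pair[OF has_derivative_const has_derivative_ident])
  from has_derivative_compose[OF this, of F F'] assms show ?thesis by simp
qed

lemma has_derivative_fst_slice:
  assumes "(F has_derivative F') (at (c, u))"
  shows "((\<lambda>c. F (c, u)) has_derivative (\<lambda>x. F' (x, 0))) (at c)"
proof -
  have "((\<lambda>c. (c, u)) has_derivative (\<lambda>x. (x, 0))) (at c within UNIV)"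
    by (rule has_derivative_Pair[OF has_derivative_ident has_derivative_const])
  from has_derivative_compose[OF this, of F F'] assms show ?thesis by simp
qed

text \<open>x is split relative to y into a radial coefficient and an angular vector, and a vector
  is rebuilt from them relative to u; for u = y this returns x. The two pieces are orthogonal,
  crossing with u only discards the component of the angular vector along u, and Lagrange's identity
  recovers |x|^2.\<close>

lemma norm_lift_le:
  fixes x y u :: vel assumes "y \<noteq> 0"
  shows "norm (((y \<bullet> x) / (y \<bullet> y)) *\<^sub>R u - cross3 u ((1 / (y \<bullet> y)) *\<^sub>R cross3 y x)) \<le> norm u * norm x / norm y"
    (is "norm (?a *\<^sub>R u - cross3 u ?g) \<le> _")
proof -
  have yy: "y \<bullet> y > 0" using assms by simp
  have "(norm (?a *\<^sub>R u - cross3 u ?g))\<^sup>2 = ?a\<^sup>2 * (norm u)\<^sup>2 + (norm (cross3 u ?g))\<^sup>2"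
    unfolding power2_norm_eq_inner
    by (simp add: inner_diff_left inner_diff_right dot_cross_self inner_commute power2_eq_square)
  also have "\<dots> \<le> ?a\<^sup>2 * (norm u)\<^sup>2 + (norm u)\<^sup>2 * (norm ?g)\<^sup>2"
    using norm_cross_dot[of u ?g] zero_le_power2[of "u \<bullet> ?g"] unfolding power_mult_distrib by linarith
  also have "\<dots> = (norm u)\<^sup>2 * ((y \<bullet> x)\<^sup>2 + (norm (cross3 y x))\<^sup>2) / (y \<bullet> y)\<^sup>2"
    by (simp add: power_mult_distrib power_divide add_divide_distrib algebra_simps)
  also have "(y \<bullet> x)\<^sup>2 + (norm (cross3 y x))\<^sup>2 = (y \<bullet> y) * (norm x)\<^sup>2"
    using norm_cross_dot[of y x] by (simp add: power_mult_distrib power2_norm_eq_inner)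
  also have "(norm u)\<^sup>2 * ((y \<bullet> y) * (norm x)\<^sup>2) / (y \<bullet> y)\<^sup>2 = (norm u * norm x / norm y)\<^sup>2"
    using assms by (simp add: dot_square_norm power2_eq_square)
  finally show ?thesis by (rule power2_le_imp_le) simp
qed

context scattering begin

lemma annulus_nonzero: "m \<in> annulus e \<Longrightarrow> m \<noteq> 0"
  using e by (auto simp: annulus_def)

lemma annulus_sets: "norm k = 1 \<Longrightarrow> annulus e \<in> sets (\<nu> k)"
  using sets_nu compact_annulus by (simp add: borel_compact)

lemma avg_integrable:
  fixes h :: "vel \<times> vel \<Rightarrow> 'b::euclidean_space"
  assumes "continuous_on {p. snd p \<noteq> 0} h" "u \<noteq> 0"
  shows "set_integrable (\<nu> (u /\<^sub>R norm u)) (annulus e) (\<lambda>m. h (c, norm u *\<^sub>R m))"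
  using assms(2) annulus_nonzero
  by (intro set_integrable_compact nu_finite sets_nu compact_annulus
      continuous_on_compose2[OF assms(1)] continuous_intros) auto

lemma avg_bounded_linear:
  fixes h :: "vel \<times> vel \<Rightarrow> 'b::euclidean_space" and T :: "'b \<Rightarrow> 'c::euclidean_space"
  assumes "bounded_linear T" "continuous_on {p. snd p \<noteq> 0} h" "u \<noteq> 0"
  shows "avg (\<lambda>p. T (h p)) (c, u) = T (avg h (c, u))"
proof -
  interpret T: bounded_linear T by fact
  have "(LINT m:annulus e|\<nu> (u /\<^sub>R norm u). T (h (c, norm u *\<^sub>R m))) =
    T (LINT m:annulus e|\<nu> (u /\<^sub>R norm u). h (c, norm u *\<^sub>R m))"
    unfolding set_lebesgue_integral_def T.scaleR[symmetric]
    using avg_integrable[OF assms(2,3), of c] unfolding set_integrable_def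
    by (rule integral_bounded_linear[OF assms(1)])
  then show ?thesis by (simp add: avg_def)
qed

lemma avg_add:
  fixes h g :: "vel \<times> vel \<Rightarrow> 'b::euclidean_space"
  assumes "continuous_on {p. snd p \<noteq> 0} h" "continuous_on {p. snd p \<noteq> 0} g" "u \<noteq> 0"
  shows "avg (\<lambda>p. h p + g p) (c, u) = avg h (c, u) + avg g (c, u)"
  using avg_integrable[OF assms(1,3), of c] avg_integrable[OF assms(2,3), of c] by (simp add: avg_def)

lemma avg_diff:
  fixes h g :: "vel \<times> vel \<Rightarrow> 'b::euclidean_space"
  assumes "continuous_on {p. snd p \<noteq> 0} h" "continuous_on {p. snd p \<noteq> 0} g" "u \<noteq> 0"
  shows "avg (\<lambda>p. h p - g p) (c, u) = avg h (c, u) - avg g (c, u)"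
  using avg_integrable[OF assms(1,3), of c] avg_integrable[OF assms(2,3), of c] by (simp add: avg_def)

lemma avg_sum:
  fixes h :: "'i \<Rightarrow> vel \<times> vel \<Rightarrow> 'b::euclidean_space"
  assumes "finite I" "\<And>i. i \<in> I \<Longrightarrow> continuous_on {p. snd p \<noteq> 0} (h i)" "u \<noteq> 0"
  shows "avg (\<lambda>p. \<Sum>i\<in>I. h i p) (c, u) = (\<Sum>i\<in>I. avg (h i) (c, u))"
  using assms(1,2)
proof (induction rule: finite_induct)
  case empty
  then show ?case by (simp add: avg_def)
next
  case (insert i I)
  then show ?case using assms(3) by (simp add: avg_add continuous_on_sum)
qed

lemma avg_const: "u \<noteq> 0 \<Longrightarrow> avg (\<lambda>_. x) (c, u) = x"
proof -
  assume "u \<noteq> 0"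
  then have k: "norm (u /\<^sub>R norm u) = 1" by simp
  interpret finite_measure "\<nu> (u /\<^sub>R norm u)" by (rule nu_finite[OF k])
  have "measure (\<nu> (u /\<^sub>R norm u)) (annulus e) = measure (\<nu> (u /\<^sub>R norm u)) (space (\<nu> (u /\<^sub>R norm u)))"
    using supp[OF k] annulus_sets[OF k] sets.sets_into_space[OF annulus_sets[OF k]]
    by (intro measure_eq_AE) auto
  then show ?thesis
    using annulus_sets[OF k] emeasure_finite by (simp add: avg_def set_integral_const nu_space[OF k])
qed

text \<open>The average sees only speeds between e |u| and |u|, so the comparison is required only
  there. This is how the restitution coefficient enters the estimates.\<close>

lemma avg_mono:
  fixes h g :: "vel \<times> vel \<Rightarrow> real"
  assumes "continuous_on {p. snd p \<noteq> 0} h" "continuous_on {p. snd p \<noteq> 0} g" "u \<noteq> 0"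
    and "\<And>y. e * norm u \<le> norm y \<Longrightarrow> norm y \<le> norm u \<Longrightarrow> h (c, y) \<le> g (c, y)"
  shows "avg h (c, u) \<le> avg g (c, u)"
proof -
  have "h (c, norm u *\<^sub>R m) \<le> g (c, norm u *\<^sub>R m)" if "m \<in> annulus e" for m
    using that assms(3) by (intro assms(4)) (auto simp: annulus_def mult.commute mult_left_le)
  then show ?thesis unfolding avg_def prod.case
    by (intro set_integral_mono avg_integrable assms(1-3))
qed

text \<open>Jensen's inequality, from expanding the average of |h - a|^2 \<ge> 0 with a the average
  of h.\<close>

lemma avg_norm_sq_le:
  fixes h :: "vel \<times> vel \<Rightarrow> 'b::euclidean_space"
  assumes h: "continuous_on {p. snd p \<noteq> 0} h" and u: "u \<noteq> 0"
  shows "(norm (avg h (c, u)))\<^sup>2 \<le> avg (\<lambda>p. (norm (h p))\<^sup>2) (c, u)"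
proof -
  define a where "a = avg h (c, u)"
  have c1: "continuous_on {p. snd p \<noteq> 0} (\<lambda>p. (norm (h p))\<^sup>2)" "continuous_on {p. snd p \<noteq> 0} (\<lambda>p. 2 * (a \<bullet> h p))"
    by (intro continuous_intros h)+
  have "0 = avg (\<lambda>_. 0 :: real) (c, u)" using avg_const[OF u, of "0::real"] by simp
  also have "\<dots> \<le> avg (\<lambda>p. (norm (h p))\<^sup>2 - 2 * (a \<bullet> h p) + (norm a)\<^sup>2) (c, u)"
  proof (rule avg_mono[OF _ _ u])
    fix y
    have "(norm (h (c, y) - a))\<^sup>2 = (norm (h (c, y)))\<^sup>2 - 2 * (a \<bullet> h (c, y)) + (norm a)\<^sup>2"
      by (simp add: power2_norm_eq_inner inner_diff_left inner_diff_right inner_commute)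
    then show "0 \<le> (norm (h (c, y)))\<^sup>2 - 2 * (a \<bullet> h (c, y)) + (norm a)\<^sup>2" by (metis zero_le_power2)
  qed (intro continuous_intros h)+
  also have "\<dots> = avg (\<lambda>p. (norm (h p))\<^sup>2) (c, u) - avg (\<lambda>p. 2 * (a \<bullet> h p)) (c, u) + (norm a)\<^sup>2"
    using c1 by (subst avg_add avg_diff, (intro continuous_intros h u)+)+ (simp add: avg_const[OF u])
  also have "avg (\<lambda>p. 2 * (a \<bullet> h p)) (c, u) = 2 * (a \<bullet> a)"
    unfolding a_def
    by (rule avg_bounded_linear[OF _ h u]) (intro bounded_linear_const_mult bounded_linear_inner_right)
  finally show ?thesis by (simp add: a_def power2_norm_eq_inner)
qed

lemma avg_norm_le:
  fixes h :: "vel \<times> vel \<Rightarrow> 'b::euclidean_space"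
  assumes h: "continuous_on {p. snd p \<noteq> 0} h" and u: "u \<noteq> 0" and K: "K \<ge> 0"
    "\<And>y. e * norm u \<le> norm y \<Longrightarrow> norm y \<le> norm u \<Longrightarrow> norm (h (c, y)) \<le> K"
  shows "norm (avg h (c, u)) \<le> K"
proof -
  have "(norm (avg h (c, u)))\<^sup>2 \<le> avg (\<lambda>p. (norm (h p))\<^sup>2) (c, u)" by (rule avg_norm_sq_le[OF h u])
  also have "\<dots> \<le> avg (\<lambda>_. K\<^sup>2) (c, u)"
    using K(2) by (intro avg_mono u continuous_intros h power_mono) auto
  also have "\<dots> = K\<^sup>2" by (rule avg_const[OF u])
  finally show ?thesis using K(1) by (rule power2_le_imp_le)
qed

lemma avg_minus:
  fixes h :: "vel \<times> vel \<Rightarrow> 'b::euclidean_space"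
  assumes h: "continuous_on {p. snd p \<noteq> 0} h" and u: "u \<noteq> 0"
  shows "avg h (c, - u) = avg (\<lambda>p. h (fst p, - snd p)) (c, u)"
proof -
  have "orthogonal_transformation (uminus :: vel \<Rightarrow> vel)"
    by (simp add: orthogonal_transformation_def linear_uminus)
  from avg_rot[OF _ this _ h, of "u /\<^sub>R norm u" "norm u" c] u
  show ?thesis by (simp add: avg_def)
qed

end

section \<open>Lifting a test field from single velocities to pairs\<close>

locale lifted_field = scattering +
  fixes \<psi> :: "vel \<Rightarrow> vel"
  assumes psi: "tfield \<psi>"
begin

text \<open>The velocities after the collision are c + y / 2 and c - y / 2; exchanging the two
  particles is y |-> -y.\<close>

definition even_part where
  "even_part p = (1/2) *\<^sub>R (\<psi> (fst p + (1/2) *\<^sub>R snd p) + \<psi> (fst p - (1/2) *\<^sub>R snd p))"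

definition odd_part where
  "odd_part p = (1/2) *\<^sub>R (\<psi> (fst p + (1/2) *\<^sub>R snd p) - \<psi> (fst p - (1/2) *\<^sub>R snd p))"

definition even_dvg where
  "even_dvg p = (1/2) * (dvg \<psi> (fst p + (1/2) *\<^sub>R snd p) + dvg \<psi> (fst p - (1/2) *\<^sub>R snd p))"

text \<open>Together with \<open>angular\<close> these are the coefficients in odd part = r y - y
  \<times> a. They are averaged in place of the odd part itself, because the divergence in u of its
  average would involve derivatives that do not commute with \<open>avg\<close>.\<close>

definition radial where "radial p = (snd p \<bullet> odd_part p) / (snd p \<bullet> snd p)"
definition angular where "angular p = (1 / (snd p \<bullet> snd p)) *\<^sub>R cross3 (snd p) (odd_part p)"

definition Xf where "Xf = avg even_part"
definition Yf where "Yf = (\<lambda>p. avg radial p *\<^sub>R snd p - cross3 (snd p) (avg angular p))"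

lemma psi_c1: "c1_on UNIV \<psi>" and psi_cont: "continuous_on UNIV \<psi>"
  using psi by (auto simp: tfield_def c1_on_imp_continuous_on)

lemma psi_plus_minus_c1:
  "c1_on S (\<lambda>p. \<psi> (fst p + (1/2) *\<^sub>R snd p))" "c1_on S (\<lambda>p. \<psi> (fst p - (1/2) *\<^sub>R snd p))"
  by (rule c1_on_compose[OF psi_c1], intro c1_on_add c1_on_diff c1_on_scaleR c1_on_const c1_on_fst c1_on_snd, simp)+

lemma parts_c1: "c1_on S even_part" "c1_on S odd_part"
  unfolding even_part_def[abs_def] odd_part_def[abs_def]
  by (intro c1_on_scaleR c1_on_const c1_on_add c1_on_diff psi_plus_minus_c1)+

lemma radial_angular_c1: "c1_on {p. snd p \<noteq> 0} radial" "c1_on {p. snd p \<noteq> 0} angular"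
  unfolding radial_def[abs_def] angular_def[abs_def]
  by (intro c1_on_scaleR c1_on_divide c1_on_inner c1_on_cross3 c1_on_const c1_on_snd parts_c1; simp)+

lemma XY_c1: "c1_on {p. snd p \<noteq> 0} Xf" "c1_on {p. snd p \<noteq> 0} Yf"
  unfolding Xf_def Yf_def
  by (intro frame_regular parts_c1 radial_angular_c1 c1_on_diff c1_on_scaleR c1_on_cross3 c1_on_snd)+

text \<open>Differentiating the odd part in y instead of c yields a second factor 1/2; it is the 1/2
  in \<open>div_Yf\<close>.\<close>

lemma parts_deriv:
  "frechet_derivative even_part (at (c, y)) (x, 0) = (1/2) *\<^sub>R
     (frechet_derivative \<psi> (at (c + (1/2) *\<^sub>R y)) x + frechet_derivative \<psi> (at (c - (1/2) *\<^sub>R y)) x)"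
  "frechet_derivative odd_part (at (c, y)) (0, x) = (1/2) *\<^sub>R ((1/2) *\<^sub>R
     (frechet_derivative \<psi> (at (c + (1/2) *\<^sub>R y)) x + frechet_derivative \<psi> (at (c - (1/2) *\<^sub>R y)) x))"
proof -
  let ?D = "\<lambda>z. frechet_derivative \<psi> (at z)"
  have D: "(\<psi> has_derivative ?D z) (at z)" for z using c1_on_has_derivative[OF psi_c1] by simp
  have lin: "linear (?D z)" for z using D has_derivative_linear by blast
  have p: "((\<lambda>p. fst p + (1/2) *\<^sub>R snd p) has_derivative (\<lambda>p. fst p + (1/2) *\<^sub>R snd p)) (at z)"
    and m: "((\<lambda>p. fst p - (1/2) *\<^sub>R snd p) has_derivative (\<lambda>p. fst p - (1/2) *\<^sub>R snd p)) (at z)" for z :: "vel \<times> vel"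
    by (auto intro!: derivative_eq_intros)
  have "(even_part has_derivative (\<lambda>z. (1/2) *\<^sub>R (?D (c + (1/2) *\<^sub>R y) (fst z + (1/2) *\<^sub>R snd z)
      + ?D (c - (1/2) *\<^sub>R y) (fst z - (1/2) *\<^sub>R snd z)))) (at (c, y))"
    unfolding even_part_def[abs_def]
    by (intro has_derivative_scaleR_right has_derivative_add has_derivative_compose[OF p] has_derivative_compose[OF m])
       (auto simp: D)
  from frechet_eqI[OF this] show "frechet_derivative even_part (at (c, y)) (x, 0) = (1/2) *\<^sub>R
     (?D (c + (1/2) *\<^sub>R y) x + ?D (c - (1/2) *\<^sub>R y) x)" by simp
  have "(odd_part has_derivative (\<lambda>z. (1/2) *\<^sub>R (?D (c + (1/2) *\<^sub>R y) (fst z + (1/2) *\<^sub>R snd z)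
      - ?D (c - (1/2) *\<^sub>R y) (fst z - (1/2) *\<^sub>R snd z)))) (at (c, y))"
    unfolding odd_part_def[abs_def]
    by (intro has_derivative_scaleR_right has_derivative_diff has_derivative_compose[OF p] has_derivative_compose[OF m])
       (auto simp: D)
  from frechet_eqI[OF this] show "frechet_derivative odd_part (at (c, y)) (0, x) = (1/2) *\<^sub>R ((1/2) *\<^sub>R
     (?D (c + (1/2) *\<^sub>R y) x + ?D (c - (1/2) *\<^sub>R y) x))"
    by (simp add: linear_cmul[OF lin] linear_neg[OF lin] scaleR_add_right)
qed

lemma even_dvg_cont: "continuous_on S even_dvg"
  unfolding even_dvg_def[abs_def]
  by (intro continuous_intros continuous_on_compose2[OF continuous_on_dvg[OF psi_c1]]) auto

lemma split_odd_part: "snd p \<noteq> 0 \<Longrightarrow> odd_part p = radial p *\<^sub>R snd p - cross3 (snd p) (angular p)"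
  by (simp add: radial_def angular_def cross_mult_right cross3_cross3 scaleR_diff_right)

text \<open>Translations of c commute with the average, so the divergence acts under it.\<close>

lemma div_Xf: "u \<noteq> 0 \<Longrightarrow> (\<Sum>b\<in>Basis. frechet_derivative Xf (at (c, u)) (b, 0) \<bullet> b) = avg even_dvg (c, u)"
proof -
  assume u: "u \<noteq> 0"
  have cont: "continuous_on S (\<lambda>p. frechet_derivative even_part (at p) (x, 0))" for x S
    using parts_c1(1)[of S] by (simp add: c1_on_def)
  have "(\<Sum>b\<in>Basis. frechet_derivative Xf (at (c, u)) (b, 0) \<bullet> b)
     = (\<Sum>b\<in>Basis. avg (\<lambda>p. frechet_derivative even_part (at p) (b, 0)) (c, u) \<bullet> b)"
    unfolding Xf_def by (simp add: avg_deriv(1)[OF parts_c1(1) u])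
  also have "\<dots> = (\<Sum>b\<in>Basis. avg (\<lambda>p. frechet_derivative even_part (at p) (b, 0) \<bullet> b) (c, u))"
    by (intro sum.cong refl avg_bounded_linear[symmetric] bounded_linear_inner_left cont u)
  also have "\<dots> = avg (\<lambda>p. \<Sum>b\<in>Basis. frechet_derivative even_part (at p) (b, 0) \<bullet> b) (c, u)"
    by (intro avg_sum[symmetric] u continuous_on_inner cont continuous_on_const) simp
  also have "\<dots> = avg even_dvg (c, u)"
    by (rule avg_cong[OF _ u])
       (simp add: parts_deriv even_dvg_def dvg_def inner_add_left sum.distrib sum_divide_distrib add_divide_distrib)
  finally show ?thesis .
qed

text \<open>\<open>divergence_split\<close> is used twice, in opposite directions: at u, to reduce
  the divergence of \<open>Yf\<close> to derivatives along symmetries, and at y under the average,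
  to reassemble these into the divergence of the odd part.\<close>

lemma div_Yf: "u \<noteq> 0 \<Longrightarrow> (\<Sum>b\<in>Basis. frechet_derivative Yf (at (c, u)) (0, b) \<bullet> b) = avg even_dvg (c, u) / 2"
proof -
  assume u: "u \<noteq> 0"
  let ?dr = "\<lambda>p. frechet_derivative radial (at p)" and ?da = "\<lambda>p. frechet_derivative angular (at p)"
  have snd0: "continuous_on {p :: vel \<times> vel. snd p \<noteq> 0} snd" by (intro continuous_intros)
  have cr: "continuous_on {p. snd p \<noteq> 0} (\<lambda>p. ?dr p (0, snd p))"
    by (intro continuous_on_frechet_derivative[OF radial_angular_c1(1)] continuous_intros) auto
  have ca: "continuous_on {p. snd p \<noteq> 0} (\<lambda>p. ?da p (0, cross3 b (snd p)))" for b
    by (intro continuous_on_frechet_derivative[OF radial_angular_c1(2)] continuous_intros continuous_on_cross) auto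
  have "((\<lambda>u. avg radial (c, u) *\<^sub>R u - cross3 u (avg angular (c, u))) has_derivative
      (\<lambda>x. frechet_derivative Yf (at (c, u)) (0, x))) (at u)"
    using has_derivative_snd_slice[OF c1_on_has_derivative[OF XY_c1(2), of "(c, u)"]] u by (simp add: Yf_def)
  from divergence_split[OF has_derivative_snd_slice[OF c1_on_has_derivative[OF frame_regular(2)[OF radial_angular_c1(1)], of "(c, u)"]]
     has_derivative_snd_slice[OF c1_on_has_derivative[OF frame_regular(2)[OF radial_angular_c1(2)], of "(c, u)"]] this] u
  have "(\<Sum>b\<in>Basis. frechet_derivative Yf (at (c, u)) (0, b) \<bullet> b) = 3 * avg radial (c, u)
    + frechet_derivative (avg radial) (at (c, u)) (0, u)
    + (\<Sum>b\<in>Basis. frechet_derivative (avg angular) (at (c, u)) (0, cross3 b u) \<bullet> b)" by simp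
  also have "\<dots> = 3 * avg radial (c, u) + avg (\<lambda>p. ?dr p (0, snd p)) (c, u)
    + (\<Sum>b\<in>Basis. avg (\<lambda>p. ?da p (0, cross3 b (snd p))) (c, u) \<bullet> b)"
    using u by (simp add: avg_deriv(2)[OF radial_angular_c1(1)] avg_deriv(3)[OF radial_angular_c1(2)])
  also have "3 * avg radial (c, u) = avg (\<lambda>p. 3 * radial p) (c, u)"
    by (rule avg_bounded_linear[symmetric, OF _ c1_on_imp_continuous_on[OF radial_angular_c1(1)] u])
       (intro bounded_linear_mult_right)
  also have "(\<Sum>b\<in>Basis. avg (\<lambda>p. ?da p (0, cross3 b (snd p))) (c, u) \<bullet> b)
      = avg (\<lambda>p. \<Sum>b\<in>Basis. ?da p (0, cross3 b (snd p)) \<bullet> b) (c, u)"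
    using u ca
    by (simp add: avg_sum continuous_on_inner continuous_on_const avg_bounded_linear[OF bounded_linear_inner_left])
  also have "avg (\<lambda>p. 3 * radial p) (c, u) + avg (\<lambda>p. ?dr p (0, snd p)) (c, u)
      + avg (\<lambda>p. \<Sum>b\<in>Basis. ?da p (0, cross3 b (snd p)) \<bullet> b) (c, u)
    = avg (\<lambda>p. 3 * radial p + ?dr p (0, snd p) + (\<Sum>b\<in>Basis. ?da p (0, cross3 b (snd p)) \<bullet> b)) (c, u)"
    using u cr ca c1_on_imp_continuous_on[OF radial_angular_c1(1)]
    by (simp add: avg_add continuous_on_add continuous_on_sum continuous_on_inner continuous_on_const continuous_on_mult_left)
  also have "\<dots> = avg (\<lambda>p. (1/2) * even_dvg p) (c, u)"
  proof (rule avg_cong[OF _ u])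
    fix y :: vel assume y: "y \<noteq> 0"
    have "((\<lambda>y. odd_part (c, y)) has_derivative (\<lambda>x. frechet_derivative odd_part (at (c, y)) (0, x))) (at y)"
      using has_derivative_snd_slice[OF c1_on_has_derivative[OF parts_c1(2)[of UNIV], of "(c, y)"]] by simp
    then have "((\<lambda>y. radial (c, y) *\<^sub>R y - cross3 y (angular (c, y))) has_derivative
       (\<lambda>x. frechet_derivative odd_part (at (c, y)) (0, x))) (at y)"
    proof (rule has_derivative_transform_within_open)
      show "open (- {0 :: vel})" by (intro open_Compl closed_singleton)
      show "odd_part (c, z) = radial (c, z) *\<^sub>R z - cross3 z (angular (c, z))" if "z \<in> - {0}" for z
        using split_odd_part[of "(c, z)"] that by simp
    qed (use y in simp)
    from divergence_split[OF has_derivative_snd_slice[OF c1_on_has_derivative[OF radial_angular_c1(1), of "(c, y)"]]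
       has_derivative_snd_slice[OF c1_on_has_derivative[OF radial_angular_c1(2), of "(c, y)"]] this] y
    have "3 * radial (c, y) + ?dr (c, y) (0, y) + (\<Sum>b\<in>Basis. ?da (c, y) (0, cross3 b y) \<bullet> b)
      = (\<Sum>b\<in>Basis. frechet_derivative odd_part (at (c, y)) (0, b) \<bullet> b)" by simp
    also have "\<dots> = (1/2) * even_dvg (c, y)"
      by (simp add: parts_deriv even_dvg_def dvg_def inner_add_left sum.distrib sum_divide_distrib add_divide_distrib)
    finally show "3 * radial (c, y) + ?dr (c, y) (0, snd (c, y)) + (\<Sum>b\<in>Basis. ?da (c, y) (0, cross3 b (snd (c, y))) \<bullet> b)
      = (1/2) * even_dvg (c, y)" by simp
  qed
  also have "\<dots> = (1/2) * avg even_dvg (c, u)"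
    by (rule avg_bounded_linear[OF bounded_linear_mult_right even_dvg_cont u])
  finally show ?thesis by simp
qed

lemma XY_parity:
  assumes "u \<noteq> 0"
  shows "Xf (c, - u) = Xf (c, u)" "Yf (c, - u) = - Yf (c, u)"
proof -
  have e: "even_part (fst p, - snd p) = even_part p" and o: "odd_part (fst p, - snd p) = - odd_part p" for p
    by (simp_all add: even_part_def odd_part_def scaleR_diff_right add.commute)
  show "Xf (c, - u) = Xf (c, u)"
    unfolding Xf_def avg_minus[OF c1_on_imp_continuous_on[OF parts_c1(1)] assms] by (simp add: e)
  have r: "radial (fst p, - snd p) = radial p" for p
    by (simp add: radial_def o)
  have "avg radial (c, - u) = avg radial (c, u)"
    unfolding avg_minus[OF c1_on_imp_continuous_on[OF radial_angular_c1(1)] assms] by (simp add: r)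
  moreover have a: "angular (fst p, - snd p) = angular p" for p
    by (simp add: angular_def o)
  have "avg angular (c, - u) = avg angular (c, u)"
    unfolding avg_minus[OF c1_on_imp_continuous_on[OF radial_angular_c1(2)] assms] by (simp add: a)
  ultimately show "Yf (c, - u) = - Yf (c, u)" by (simp add: Yf_def)
qed

text \<open>The chain rule for (c, u) |-> (c, -u): the u-slot of the direction changes sign and the
  factor s comes out. It is used with s = 1 for \<open>Xf\<close> and s = -1 for
  \<open>Yf\<close>.\<close>

lemma deriv_parity:
  fixes F :: "vel \<times> vel \<Rightarrow> vel"
  assumes F: "c1_on {p. snd p \<noteq> 0} F" and s: "\<And>c u. u \<noteq> 0 \<Longrightarrow> F (c, - u) = s *\<^sub>R F (c, u)" and u: "u \<noteq> 0"
  shows "frechet_derivative F (at (c, - u)) (x, y) = s *\<^sub>R frechet_derivative F (at (c, u)) (x, - y)"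
proof -
  have J: "((\<lambda>p. (fst p, - snd p)) has_derivative (\<lambda>p. (fst p, - snd p))) (at p)" for p :: "vel \<times> vel"
    by (auto intro!: derivative_eq_intros)
  have "((\<lambda>p. s *\<^sub>R F (fst p, - snd p)) has_derivative (\<lambda>p. s *\<^sub>R frechet_derivative F (at (c, u)) (fst p, - snd p))) (at (c, - u))"
    using u by (intro has_derivative_scaleR_right has_derivative_compose[OF J]) (auto intro: c1_on_has_derivative[OF F])
  then have "(F has_derivative (\<lambda>p. s *\<^sub>R frechet_derivative F (at (c, u)) (fst p, - snd p))) (at (c, - u))"
  proof (rule has_derivative_transform_within_open[OF _ open_snd])
    show "s *\<^sub>R F (fst p, - snd p) = F p" if "p \<in> {p. snd p \<noteq> 0}" for p
      using s[of "- snd p" "fst p"] that by simp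
  qed (use u in simp)
  from frechet_eqI[OF this] show ?thesis by simp
qed

end

section \<open>The dual estimate for the collision operator\<close>

lemma pair_density_integrable:
  fixes f :: "'a::euclidean_space \<Rightarrow> real"
  assumes [measurable]: "f \<in> borel_measurable lborel" and f: "integrable lborel f"
  shows "integrable lborel (\<lambda>p. f (fst p) * f (snd p))"
    and "(\<integral>p. f (fst p) * f (snd p) \<partial>lborel) = (\<integral>x. f x \<partial>lborel)\<^sup>2"
proof -
  have [measurable]: "f \<in> borel_measurable borel" using assms(1) by simp
  have i: "integrable (lborel \<Otimes>\<^sub>M lborel) (\<lambda>(x,y). f x * f y)"
    by (rule lborel_pair.Fubini_integrable) (use f in \<open>auto simp: abs_mult intro!: integrable_abs integrable_mult_left\<close>)
  then show "integrable lborel (\<lambda>p. f (fst p) * f (snd p))" by (simp add: lborel_prod case_prod_unfold)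
  have "(\<integral>p. f (fst p) * f (snd p) \<partial>lborel) = (\<integral>x. (\<integral>y. f x * f y \<partial>lborel) \<partial>lborel)"
    using lborel_pair.integral_fst[OF i] by (simp add: lborel_prod case_prod_unfold)
  then show "(\<integral>p. f (fst p) * f (snd p) \<partial>lborel) = (\<integral>x. f x \<partial>lborel)\<^sup>2" by (simp add: power2_eq_square)
qed

lemma borel_measurable_fst_snd [measurable]:
  "fst \<in> borel_measurable (borel :: ('a::euclidean_space \<times> 'b::euclidean_space) measure)"
  "snd \<in> borel_measurable (borel :: ('a::euclidean_space \<times> 'b::euclidean_space) measure)"
  by (intro borel_measurable_continuous_onI continuous_intros)+

lemma pair_swap_integral:
  fixes f :: "'a::euclidean_space \<Rightarrow> real" and h :: "'a \<times> 'a \<Rightarrow> real"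
  assumes [measurable]: "f \<in> borel_measurable borel" "h \<in> borel_measurable borel"
  shows "(\<integral>p. h (snd p, fst p) * (f (fst p) * f (snd p)) \<partial>lborel) = (\<integral>p. h p * (f (fst p) * f (snd p)) \<partial>lborel)"
proof -
  have "(\<lambda>p. h p * (f (fst p) * f (snd p))) \<in> borel_measurable (lborel \<Otimes>\<^sub>M lborel)"
    unfolding lborel_prod by measurable
  from lborel_pair.integral_product_swap[OF this] show ?thesis
    by (simp add: lborel_prod case_prod_unfold mult.commute[of "f (fst _)"])
qed

text \<open>The direction of v - w has no meaning for v = w, so pointwise facts about pairs are
  stated off the diagonal. The diagonal is negligible because it lies in the hyperplane orthogonal
  to \<open>(b, - b)\<close>.\<close>

lemma AE_lborel_off_diagonal: "AE p in lborel. fst p \<noteq> (snd p :: 'a::euclidean_space)"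
proof -
  obtain b :: 'a where b: "b \<in> Basis" using nonempty_Basis by blast
  have "negligible {p :: 'a \<times> 'a. (b, - b) \<bullet> p = 0}"
    using b by (intro negligible_hyperplane) (auto simp: zero_prod_def nonzero_Basis)
  then have "negligible {p :: 'a \<times> 'a. fst p = snd p}"
    by (rule negligible_subset) (auto simp: inner_prod_def)
  moreover have "closed {p :: 'a \<times> 'a. fst p = snd p}" by (intro closed_Collect_eq continuous_intros)
  ultimately have "{p :: 'a \<times> 'a. fst p = snd p} \<in> null_sets lborel"
    by (simp add: negligible_iff_null_sets null_sets_completion_iff borel_closed)
  from AE_not_in[OF this] show ?thesis by simp
qed

context lifted_field begin

lemma psi_bounds:
  obtains K L where "K > 0" "L > 0" "\<And>x. norm (\<psi> x) \<le> K" "\<And>x y. norm (\<psi> x - \<psi> y) \<le> L * norm (x - y)"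
  using tfield_bounded[OF psi] tfield_lipschitz[OF psi] by metis

text \<open>With u frozen, rebuilding is linear in the coefficients, so \<open>Yf\<close> becomes
  the average of a single field and Jensen's inequality applies to it.\<close>

definition lift where "lift u p = radial p *\<^sub>R u - cross3 u (angular p)"

lemma lift_cont: "continuous_on {p. snd p \<noteq> 0} (lift u)"
  unfolding lift_def[abs_def]
  by (intro continuous_intros continuous_on_cross c1_on_imp_continuous_on radial_angular_c1)

lemma Yf_lift: "u \<noteq> 0 \<Longrightarrow> Yf (c, u) = avg (lift u) (c, u)"
proof -
  assume u: "u \<noteq> 0"
  note r = c1_on_imp_continuous_on[OF radial_angular_c1(1)] and a = c1_on_imp_continuous_on[OF radial_angular_c1(2)]
  have "bounded_linear (cross3 u)" using bounded_bilinear.bounded_linear_right[OF cross3_bounded_bilinear] .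
  from avg_bounded_linear[OF this a u]
  have "cross3 u (avg angular (c, u)) = avg (\<lambda>p. cross3 u (angular p)) (c, u)" by simp
  moreover have "avg radial (c, u) *\<^sub>R u = avg (\<lambda>p. radial p *\<^sub>R u) (c, u)"
    by (rule avg_bounded_linear[OF bounded_linear_scaleR_left r u, symmetric])
  ultimately show ?thesis
    unfolding Yf_def lift_def[abs_def]
    by (subst avg_diff) (auto intro!: u continuous_intros continuous_on_cross r a)
qed

lemma lift_le: "y \<noteq> 0 \<Longrightarrow> norm (lift u (c, y)) \<le> norm u * norm (odd_part (c, y)) / norm y"
  using norm_lift_le[of y "odd_part (c, y)" u] by (simp add: lift_def radial_def angular_def)

text \<open>The support bound |y| \<ge> e |u| turns the factor |u| / |y| into 1 / e.\<close>

lemma lift_le': "u \<noteq> 0 \<Longrightarrow> e * norm u \<le> norm y \<Longrightarrow> norm (lift u (c, y)) \<le> norm (odd_part (c, y)) / e"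
proof -
  assume u: "u \<noteq> 0" and y: "e * norm u \<le> norm y"
  have "e * norm u > 0" using u e by simp
  with y have y0: "norm y > 0" by linarith
  have "norm (lift u (c, y)) \<le> norm u * norm (odd_part (c, y)) / norm y" using y0 by (intro lift_le) auto
  also have "\<dots> = (norm u / norm y) * norm (odd_part (c, y))" by simp
  also have "\<dots> \<le> (1 / e) * norm (odd_part (c, y))"
    using y y0 e by (intro mult_right_mono) (auto simp: field_simps)
  finally show ?thesis by simp
qed

lemma parts_le:
  assumes "\<And>x. norm (\<psi> x) \<le> K"
  shows "norm (even_part p) \<le> K" "norm (odd_part p) \<le> K"
proof -
  show "norm (even_part p) \<le> K"
    using norm_triangle_ineq[of "\<psi> (fst p + (1/2) *\<^sub>R snd p)" "\<psi> (fst p - (1/2) *\<^sub>R snd p)"]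
      assms[of "fst p + (1/2) *\<^sub>R snd p"] assms[of "fst p - (1/2) *\<^sub>R snd p"]
    by (simp add: even_part_def)
  show "norm (odd_part p) \<le> K"
    using norm_triangle_ineq4[of "\<psi> (fst p + (1/2) *\<^sub>R snd p)" "\<psi> (fst p - (1/2) *\<^sub>R snd p)"]
      assms[of "fst p + (1/2) *\<^sub>R snd p"] assms[of "fst p - (1/2) *\<^sub>R snd p"]
    by (simp add: odd_part_def)
qed

lemma Xf_le: "(\<And>x. norm (\<psi> x) \<le> K) \<Longrightarrow> u \<noteq> 0 \<Longrightarrow> norm (Xf (c, u)) \<le> K"
  unfolding Xf_def using parts_le norm_ge_zero order_trans
  by (intro avg_norm_le c1_on_imp_continuous_on[OF parts_c1(1)]) blast+

lemma Yf_le: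
  assumes "\<And>x. norm (\<psi> x) \<le> K" "u \<noteq> 0"
  shows "norm (Yf (c, u)) \<le> K / e"
  unfolding Yf_lift[OF assms(2)]
proof (rule avg_norm_le[OF lift_cont assms(2)])
  show "0 \<le> K / e" using e order_trans[OF norm_ge_zero assms(1)] by simp
  fix y :: vel assume "e * norm u \<le> norm y"
  from lift_le'[OF assms(2) this, of c] have "norm (lift u (c, y)) \<le> norm (odd_part (c, y)) / e" .
  also have "\<dots> \<le> K / e" using parts_le(2)[OF assms(1)] e by (intro divide_right_mono) auto
  finally show "norm (lift u (c, y)) \<le> K / e" .
qed

text \<open>For a Lipschitz field the odd part is O(|y|), which cancels the |y| in the denominator.
  This linear vanishing at u = 0 absorbs the large gradient of the cutoff near the diagonal.\<close>

lemma Yf_le_linear: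
  assumes "\<And>x y. norm (\<psi> x - \<psi> y) \<le> L * norm (x - y)" "L > 0" "u \<noteq> 0"
  shows "norm (Yf (c, u)) \<le> L * norm u"
  unfolding Yf_lift[OF assms(3)]
proof (rule avg_norm_le[OF lift_cont assms(3)])
  show "0 \<le> L * norm u" using assms by simp
  fix y :: vel assume y: "e * norm u \<le> norm y"
  have "e * norm u > 0" using assms e by simp
  with y have y0: "norm y > 0" by linarith
  have "norm (odd_part (c, y)) = (1/2) * norm (\<psi> (c + (1/2) *\<^sub>R y) - \<psi> (c - (1/2) *\<^sub>R y))"
    by (simp add: odd_part_def)
  also have "\<dots> \<le> (1/2) * (L * norm ((c + (1/2) *\<^sub>R y) - (c - (1/2) *\<^sub>R y)))"
    by (intro mult_left_mono assms(1)) simp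
  also have "(c + (1/2) *\<^sub>R y) - (c - (1/2) *\<^sub>R y) = y" by (simp flip: scaleR_add_left)
  finally have o: "norm (odd_part (c, y)) \<le> L * norm y" using mult_pos_pos[OF assms(2) y0] by simp
  have "norm (lift u (c, y)) \<le> norm u * norm (odd_part (c, y)) / norm y" using y0 by (intro lift_le) auto
  also have "\<dots> \<le> norm u * (L * norm y) / norm y" using o by (intro divide_right_mono mult_left_mono) auto
  also have "\<dots> = L * norm u" using y0 by simp
  finally show "norm (lift u (c, y)) \<le> L * norm u" .
qed

text \<open>Jensen's inequality for each part; the weight e^2 compensates the loss 1 / e^2 of the
  lift, and the even and odd parts recombine by the parallelogram identity.\<close>

lemma XY_norm_sq_le:
  assumes u: "u \<noteq> 0"
  shows "(norm (Xf (c, u)))\<^sup>2 + e\<^sup>2 * (norm (Yf (c, u)))\<^sup>2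
    \<le> avg (\<lambda>p. (1/2) * ((norm (\<psi> (fst p + (1/2) *\<^sub>R snd p)))\<^sup>2 + (norm (\<psi> (fst p - (1/2) *\<^sub>R snd p)))\<^sup>2)) (c, u)"
proof -
  have pc: "continuous_on S even_part" "continuous_on S odd_part" for S
    using c1_on_imp_continuous_on parts_c1 by blast+
  have "(norm (Xf (c, u)))\<^sup>2 \<le> avg (\<lambda>p. (norm (even_part p))\<^sup>2) (c, u)"
    unfolding Xf_def by (intro avg_norm_sq_le pc u)
  moreover have "e\<^sup>2 * (norm (Yf (c, u)))\<^sup>2 \<le> avg (\<lambda>p. (norm (odd_part p))\<^sup>2) (c, u)"
  proof -
    have "(norm (Yf (c, u)))\<^sup>2 \<le> avg (\<lambda>p. (norm (lift u p))\<^sup>2) (c, u)"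
      unfolding Yf_lift[OF u] by (intro avg_norm_sq_le lift_cont u)
    also have "\<dots> \<le> avg (\<lambda>p. (1 / e\<^sup>2) * (norm (odd_part p))\<^sup>2) (c, u)"
    proof (intro avg_mono u continuous_intros lift_cont pc)
      fix y :: vel assume "e * norm u \<le> norm y"
      from power_mono[OF lift_le'[OF u this, of c], of 2]
      show "(norm (lift u (c, y)))\<^sup>2 \<le> (1 / e\<^sup>2) * (norm (odd_part (c, y)))\<^sup>2" by (simp add: power_divide)
    qed
    also have "\<dots> = (1 / e\<^sup>2) * avg (\<lambda>p. (norm (odd_part p))\<^sup>2) (c, u)"
      by (intro avg_bounded_linear bounded_linear_mult_right continuous_intros pc u)
    finally show ?thesis using e by (simp add: field_simps)
  qed
  moreover have "avg (\<lambda>p. (norm (even_part p))\<^sup>2) (c, u) + avg (\<lambda>p. (norm (odd_part p))\<^sup>2) (c, u)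
    = avg (\<lambda>p. (norm (even_part p))\<^sup>2 + (norm (odd_part p))\<^sup>2) (c, u)"
    by (intro avg_add[symmetric] continuous_intros pc u)
  moreover have "(norm (even_part p))\<^sup>2 + (norm (odd_part p))\<^sup>2
     = (1/2) * ((norm (\<psi> (fst p + (1/2) *\<^sub>R snd p)))\<^sup>2 + (norm (\<psi> (fst p - (1/2) *\<^sub>R snd p)))\<^sup>2)" for p
    unfolding power2_norm_eq_inner even_part_def odd_part_def
    by (simp add: inner_add_left inner_add_right inner_diff_left inner_diff_right inner_commute)
       (simp add: field_simps)
  ultimately show ?thesis by simp
qed

section \<open>The truncated field on pairs and its symmetrised divergence\<close>

definition cmrel where "cmrel p = ((1/2) *\<^sub>R (fst p + snd p), fst p - snd p :: vel)"
definition Wf where "Wf p = Xf (cmrel p) + e *\<^sub>R Yf (cmrel p)"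

text \<open>W is C^1 only off the diagonal and need not have compact support. The cutoff keeps |v|
  and |w| below the order of R and |v - w| above the order of 1 / R; squared lengths keep it C^1
  everywhere.\<close>

definition Th :: "real \<Rightarrow> vel \<times> vel \<Rightarrow> real" where
  "Th R p = cutoff ((fst p \<bullet> fst p) / R\<^sup>2) * cutoff ((snd p \<bullet> snd p) / R\<^sup>2)
     * (1 - cutoff (R\<^sup>2 * ((fst p - snd p) \<bullet> (fst p - snd p))))"

text \<open>Gradient of \<open>Th\<close> in v for fixed w. The last term, with its factor R^2 |v -
  w|, is not small by itself; it is tamed only after symmetrisation, in
  \<open>dvg_Qf_sym\<close>.\<close>

definition gTh :: "real \<Rightarrow> vel \<times> vel \<Rightarrow> vel" where
  "gTh R p = (cutoff ((snd p \<bullet> snd p) / R\<^sup>2) * (1 - cutoff (R\<^sup>2 * ((fst p - snd p) \<bullet> (fst p - snd p))))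
       * (2 / R\<^sup>2 * dcutoff ((fst p \<bullet> fst p) / R\<^sup>2))) *\<^sub>R fst p
     - (cutoff ((fst p \<bullet> fst p) / R\<^sup>2) * cutoff ((snd p \<bullet> snd p) / R\<^sup>2)
       * (2 * R\<^sup>2 * dcutoff (R\<^sup>2 * ((fst p - snd p) \<bullet> (fst p - snd p))))) *\<^sub>R (fst p - snd p)"

definition Qf where "Qf R p = Th R p *\<^sub>R Wf p"

lemma cmrel_simps: "cmrel (v, w) = ((1/2) *\<^sub>R (v + w), v - w)" "fst (cmrel p) = (1/2) *\<^sub>R (fst p + snd p)"
  "snd (cmrel p) = fst p - snd p"
  by (simp_all add: cmrel_def)

lemma Wf_c1: "c1_on {p. fst p \<noteq> snd p} Wf"
proof -
  have cm: "c1_on S cmrel" for S unfolding cmrel_def[abs_def]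
    by (intro c1_on_Pair c1_on_scaleR c1_on_const c1_on_add c1_on_diff c1_on_fst c1_on_snd)
  show ?thesis unfolding Wf_def[abs_def]
    by (intro c1_on_add c1_on_scaleR c1_on_const c1_on_compose[OF XY_c1(1) cm] c1_on_compose[OF XY_c1(2) cm])
       (auto simp: cmrel_simps)
qed

lemma Th_c1: "c1_on UNIV (Th R)"
  unfolding Th_def[abs_def] divide_inverse
  by (intro c1_on_mult c1_on_diff c1_on_const c1_on_compose[OF c1_on_cutoff[of UNIV]] c1_on_inner c1_on_fst c1_on_snd)
     auto

lemma Th_bounds: "0 \<le> Th R p" "Th R p \<le> 1"
  using cutoff_bounds by (auto simp: Th_def intro!: mult_le_one)

lemma Th_swap: "Th R (snd p, fst p) = Th R p"
  unfolding Th_def by (simp add: inner_diff_left inner_diff_right inner_commute algebra_simps)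

lemma Qf_tfield:
  assumes R: "R > 0" shows "tfield (Qf R)"
  unfolding tfield_def
proof
  let ?S = "{p :: vel \<times> vel. fst p \<noteq> snd p}" and ?T = "{p :: vel \<times> vel. R\<^sup>2 * ((fst p - snd p) \<bullet> (fst p - snd p)) < 1}"
  have S: "open ?S" by (intro open_Collect_neq continuous_intros)
  have T: "open ?T" by (intro open_Collect_less continuous_intros)
  have "c1_on ?S (Qf R)" unfolding Qf_def[abs_def]
    by (intro c1_on_scaleR Wf_c1 c1_on_subset[OF Th_c1]) simp
  \<comment> \<open>Near the diagonal the cutoff makes the field identically 0, whatever value W
    takes there.\<close>
  moreover have "c1_on ?T (Qf R)"
    by (rule c1_on_cong[OF c1_on_const[of _ 0] T]) (simp add: Qf_def Th_def)
  moreover have "UNIV = ?S \<union> ?T" by auto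
  ultimately show "c1_on UNIV (Qf R)" using S T by (intro c1_on_local) blast
  have "norm p \<le> 2 * R + 2 * R" if "Qf R p \<noteq> 0" for p
  proof -
    have b: "norm x \<le> 2 * R" if "cutoff ((x \<bullet> x) / R\<^sup>2) \<noteq> 0" for x :: vel
    proof -
      have "\<not> 2 \<le> (x \<bullet> x) / R\<^sup>2" using that by auto
      then have "(norm x)\<^sup>2 \<le> 2 * R\<^sup>2" using R by (simp add: dot_square_norm field_simps)
      also have "\<dots> \<le> (2 * R)\<^sup>2" by (simp add: power_mult_distrib)
      finally show ?thesis by (rule power2_le_imp_le) (use R in simp)
    qed
    have "norm (fst p) \<le> 2 * R" "norm (snd p) \<le> 2 * R" using that b by (auto simp: Qf_def Th_def)
    then show ?thesis using norm_Pair_le[of "fst p" "snd p"] by simp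
  qed
  then show "bounded {x. Qf R x \<noteq> 0}" unfolding bounded_iff by blast
qed

lemma tfield_slice:
  fixes Q :: "vel \<times> vel \<Rightarrow> vel"
  assumes "tfield Q"
  shows "tfield (\<lambda>v. Q (v, w))" "dvg (\<lambda>v. Q (v, w)) v = (\<Sum>b\<in>Basis. frechet_derivative Q (at (v, w)) (b, 0) \<bullet> b)"
proof -
  have Q: "c1_on UNIV Q" using assms by (simp add: tfield_def)
  have "c1_on UNIV (\<lambda>v. Q (v, w))"
    by (intro c1_on_compose[OF Q] c1_on_Pair c1_on_id c1_on_const) simp
  moreover obtain K where "\<And>p. Q p \<noteq> 0 \<Longrightarrow> norm p \<le> K"
    using assms by (auto simp: tfield_def bounded_iff)
  then have "norm v \<le> K" if "Q (v, w) \<noteq> 0" for v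
    using order_trans[OF norm_fst_le[of v w]] that by blast
  then have "bounded {v. Q (v, w) \<noteq> 0}" unfolding bounded_iff by blast
  ultimately show "tfield (\<lambda>v. Q (v, w))" by (simp add: tfield_def)
  show "dvg (\<lambda>v. Q (v, w)) v = (\<Sum>b\<in>Basis. frechet_derivative Q (at (v, w)) (b, 0) \<bullet> b)"
    using frechet_eqI[OF has_derivative_fst_slice[OF c1_on_has_derivative[OF Q, of "(v, w)"]]]
    by (simp add: dvg_def)
qed

lemma Th_deriv: "((\<lambda>v. Th R (v, w)) has_derivative (\<lambda>b. gTh R (v, w) \<bullet> b)) (at v)"
proof -
  have c: "((\<lambda>v. cutoff (g v)) has_derivative (\<lambda>b. dcutoff (g v) * g' b)) (at v)"
    if "(g has_derivative g') (at v)" for g g' and v :: vel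
    using has_derivative_compose[OF that DERIV_cutoff[THEN has_field_derivative_imp_has_derivative]] .
  have d1: "((\<lambda>v. (v \<bullet> v) / R\<^sup>2) has_derivative (\<lambda>b. 2 / R\<^sup>2 * (v \<bullet> b))) (at v)"
    unfolding divide_inverse by (auto intro!: derivative_eq_intros simp: inner_commute)
  have d2: "((\<lambda>v. R\<^sup>2 * ((v - w) \<bullet> (v - w))) has_derivative (\<lambda>b. 2 * R\<^sup>2 * ((v - w) \<bullet> b))) (at v)"
    by (auto intro!: derivative_eq_intros simp: inner_commute)
  show ?thesis unfolding Th_def fst_conv snd_conv
    by (rule has_derivative_eq_rhs, (rule has_derivative_mult has_derivative_diff has_derivative_const c[OF d1] c[OF d2])+)
       (simp add: gTh_def inner_diff_left algebra_simps)
qed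

text \<open>Divergence of W in v: for fixed w, moving v by b moves c by b / 2 and u by b.\<close>

definition DW where
  "DW p = (\<Sum>b\<in>Basis. (frechet_derivative Xf (at (cmrel p)) ((1/2) *\<^sub>R b, b)
     + e *\<^sub>R frechet_derivative Yf (at (cmrel p)) ((1/2) *\<^sub>R b, b)) \<bullet> b)"

lemma dvg_Qf:
  assumes vw: "v \<noteq> w" and R: "R > 0"
  shows "dvg (\<lambda>v. Qf R (v, w)) v = Th R (v, w) * DW (v, w) + gTh R (v, w) \<bullet> Wf (v, w)"
proof -
  let ?c = "cmrel (v, w)"
  have cm: "((\<lambda>v. cmrel (v, w)) has_derivative (\<lambda>b. ((1/2) *\<^sub>R b, b))) (at v)"
    unfolding cmrel_simps by (auto intro!: derivative_eq_intros)
  have "snd ?c \<noteq> 0" using vw by (simp add: cmrel_simps)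
  then have X: "(Xf has_derivative frechet_derivative Xf (at ?c)) (at ?c)"
    and Y: "(Yf has_derivative frechet_derivative Yf (at ?c)) (at ?c)"
    using c1_on_has_derivative XY_c1 by blast+
  have W: "((\<lambda>v. Wf (v, w)) has_derivative (\<lambda>b. frechet_derivative Xf (at ?c) ((1/2) *\<^sub>R b, b)
     + e *\<^sub>R frechet_derivative Yf (at ?c) ((1/2) *\<^sub>R b, b))) (at v)"
    unfolding Wf_def
    by (intro has_derivative_add has_derivative_scaleR_right has_derivative_compose[OF cm X] has_derivative_compose[OF cm Y])
  have "((\<lambda>v. Qf R (v, w)) has_derivative (\<lambda>b. Th R (v, w) *\<^sub>R (frechet_derivative Xf (at ?c) ((1/2) *\<^sub>R b, b)
     + e *\<^sub>R frechet_derivative Yf (at ?c) ((1/2) *\<^sub>R b, b)) + (gTh R (v, w) \<bullet> b) *\<^sub>R Wf (v, w))) (at v)"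
    unfolding Qf_def by (rule has_derivative_scaleR[OF Th_deriv W])
  from frechet_eqI[OF this]
  have "dvg (\<lambda>v. Qf R (v, w)) v = Th R (v, w) * DW (v, w) + (\<Sum>b\<in>Basis. (gTh R (v, w) \<bullet> b) * (Wf (v, w) \<bullet> b))"
    unfolding dvg_def DW_def sum_distrib_left sum.distrib[symmetric]
    by (intro sum.cong refl) (simp add: inner_add_left)
  then show ?thesis by (simp only: euclidean_inner[of "gTh R (v, w)" "Wf (v, w)"])
qed

text \<open>Exchanging v and w flips u, so the u-derivatives of X and the c-derivatives of Y cancel
  in the sum. What remains is div_c X + 2 e div_u Y, and the two divergence formulas give 1 and
  e.\<close>

lemma DW_sym:
  assumes vw: "v \<noteq> w"
  shows "DW (v, w) + DW (w, v) = (1 + e) * avg even_dvg (cmrel (v, w))"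
proof -
  define c u where "c = (1/2) *\<^sub>R (v + w)" and "u = v - w"
  have u: "u \<noteq> 0" using vw by (simp add: u_def)
  have cm: "cmrel (v, w) = (c, u)" "cmrel (w, v) = (c, - u)" by (simp_all add: cmrel_simps c_def u_def add.commute)
  let ?X = "frechet_derivative Xf (at (c, u))" and ?Y = "frechet_derivative Yf (at (c, u))"
  have lX: "linear ?X" and lY: "linear ?Y"
    using c1_on_has_derivative[OF XY_c1(1), of "(c, u)"] c1_on_has_derivative[OF XY_c1(2), of "(c, u)"] u
    by (auto dest: has_derivative_linear)
  have X: "frechet_derivative Xf (at (c, - u)) (x, y) = ?X (x, - y)" for x y
    using deriv_parity[OF XY_c1(1) _ u, of 1] XY_parity by simp
  have Y: "frechet_derivative Yf (at (c, - u)) (x, y) = - ?Y (x, - y)" for x y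
    using deriv_parity[OF XY_c1(2) _ u, of "-1"] XY_parity by simp
  have *: "?X ((1/2) *\<^sub>R b, b) + ?X ((1/2) *\<^sub>R b, - b) = ?X (b, 0)"
    "?Y ((1/2) *\<^sub>R b, b) - ?Y ((1/2) *\<^sub>R b, - b) = 2 *\<^sub>R ?Y (0, b)" for b
    by (simp_all flip: linear_add[OF lX] linear_diff[OF lY] linear_cmul[OF lY] scaleR_add_left add: scaleR_2)
  have "DW (v, w) + DW (w, v) = (\<Sum>b\<in>Basis. (?X ((1/2) *\<^sub>R b, b) + ?X ((1/2) *\<^sub>R b, - b)
     + e *\<^sub>R (?Y ((1/2) *\<^sub>R b, b) - ?Y ((1/2) *\<^sub>R b, - b))) \<bullet> b)"
    unfolding DW_def cm X Y sum.distrib[symmetric]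
    by (intro sum.cong refl) (simp add: inner_add_left inner_diff_left algebra_simps)
  also have "\<dots> = (\<Sum>b\<in>Basis. ?X (b, 0) \<bullet> b) + 2 * e * (\<Sum>b\<in>Basis. ?Y (0, b) \<bullet> b)"
    unfolding * by (simp add: inner_add_left sum.distrib sum_distrib_left mult_ac)
  also have "\<dots> = (1 + e) * avg even_dvg (c, u)"
    unfolding div_Xf[OF u] div_Yf[OF u] by (simp add: algebra_simps)
  finally show ?thesis by (simp add: cm)
qed

text \<open>The error is the cutoff gradient paired with W. The cutoffs in |v| and |w| cost O(1 /
  R). The diagonal cutoff has gradient of size R^2 |u|, too large against X; but X drops out of the
  symmetrised sum and leaves u . Y = O(|u|^2), bounded where R^2 |u|^2 < 2, a region that shrinks to
  the diagonal.\<close>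

lemma dvg_Qf_sym:
  assumes vw: "v \<noteq> w" and R: "R > 0" and K: "\<And>x. norm (\<psi> x) \<le> K"
    and L: "L > 0" "\<And>x y. norm (\<psi> x - \<psi> y) \<le> L * norm (x - y)"
  shows "\<bar>dvg (\<lambda>v. Qf R (v, w)) v + dvg (\<lambda>x. Qf R (x, v)) w - Th R (v, w) * ((1 + e) * avg even_dvg (cmrel (v, w)))\<bar>
    \<le> 64 * K / R + (if R\<^sup>2 * ((v - w) \<bullet> (v - w)) < 2 then 32 * L else 0)"
proof -
  define c u where "c = (1/2) *\<^sub>R (v + w)" and "u = v - w"
  have u: "u \<noteq> 0" using vw by (simp add: u_def)
  have cm: "cmrel (v, w) = (c, u)" "cmrel (w, v) = (c, - u)" by (simp_all add: cmrel_simps c_def u_def add.commute)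
  define \<theta> where "\<theta> x = cutoff ((x \<bullet> x) / R\<^sup>2)" for x :: vel
  define ch where "ch = 1 - cutoff (R\<^sup>2 * (u \<bullet> u))"
  define g where "g x = (2 / R\<^sup>2 * dcutoff ((x \<bullet> x) / R\<^sup>2)) *\<^sub>R x" for x :: vel
  define d where "d = 2 * R\<^sup>2 * dcutoff (R\<^sup>2 * (u \<bullet> u))"
  have \<theta>: "0 \<le> \<theta> x" "\<theta> x \<le> 1" for x by (auto simp: \<theta>_def cutoff_bounds)
  have ch: "0 \<le> ch" "ch \<le> 1" by (auto simp: ch_def cutoff_bounds)
  have uu: "(w - v) \<bullet> (w - v) = u \<bullet> u" by (simp add: u_def inner_diff_left inner_diff_right inner_commute)
  have g1: "gTh R (v, w) = (\<theta> w * ch) *\<^sub>R g v - (\<theta> v * \<theta> w * d) *\<^sub>R u"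
    by (simp add: gTh_def \<theta>_def ch_def g_def d_def u_def)
  have g2: "gTh R (w, v) = (\<theta> v * ch) *\<^sub>R g w + (\<theta> v * \<theta> w * d) *\<^sub>R u"
    by (simp add: gTh_def \<theta>_def ch_def g_def d_def uu) (simp add: u_def algebra_simps)
  have W1: "Wf (v, w) = Xf (c, u) + e *\<^sub>R Yf (c, u)" by (simp add: Wf_def cm)
  have W2: "Wf (w, v) = Xf (c, u) - e *\<^sub>R Yf (c, u)" by (simp add: Wf_def cm XY_parity[OF u])
  have K0: "K \<ge> 0" using order_trans[OF norm_ge_zero K] .
  have nX: "norm (Xf (c, u)) \<le> K" by (rule Xf_le[OF K u])
  have nY: "norm (e *\<^sub>R Yf (c, u)) \<le> K" using Yf_le[OF K u, of c] e by (simp add: field_simps)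
  have nW: "norm (Wf (v, w)) \<le> 2 * K" "norm (Wf (w, v)) \<le> 2 * K"
    unfolding W1 W2 using norm_triangle_ineq[of "Xf (c, u)" "e *\<^sub>R Yf (c, u)"]
      norm_triangle_ineq4[of "Xf (c, u)" "e *\<^sub>R Yf (c, u)"] nX nY by linarith+
  have ng: "norm (g x) \<le> 16 / R" for x
  proof (cases "2 \<le> (x \<bullet> x) / R\<^sup>2")
    case True
    then show ?thesis using R by (simp add: g_def dcutoff_zero)
  next
    case False
    then have "(norm x)\<^sup>2 \<le> 2 * R\<^sup>2" using R by (simp add: dot_square_norm field_simps)
    also have "\<dots> \<le> (2 * R)\<^sup>2" by (simp add: power_mult_distrib)
    finally have "norm x \<le> 2 * R" by (rule power2_le_imp_le) (use R in simp)
    then have "2 / R\<^sup>2 * \<bar>dcutoff ((x \<bullet> x) / R\<^sup>2)\<bar> * norm x \<le> 2 / R\<^sup>2 * 4 * (2 * R)"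
      by (intro mult_mono dcutoff_le) auto
    then show ?thesis using R by (simp add: g_def abs_mult power2_eq_square)
  qed
  \<comment> \<open>(16 / R) (2 K), with one such term for each particle: together the 64 K / R of
    the claim.\<close>
  have t1: "\<bar>(a * ch) * (g x \<bullet> y)\<bar> \<le> 32 * K / R" if "0 \<le> a" "a \<le> 1" "norm y \<le> 2 * K" for a x y
  proof -
    have "\<bar>g x \<bullet> y\<bar> \<le> norm (g x) * norm y" by (rule Cauchy_Schwarz_ineq2)
    also have "\<dots> \<le> 16 / R * (2 * K)" using R ng that K0 by (intro mult_mono) auto
    finally have "\<bar>g x \<bullet> y\<bar> \<le> 32 * K / R" by simp
    moreover have "a * ch \<le> 1" "0 \<le> a * ch" using that ch by (auto intro: mult_le_one)
    ultimately have "(a * ch) * \<bar>g x \<bullet> y\<bar> \<le> 1 * (32 * K / R)" by (intro mult_mono) auto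
    then show ?thesis using that(1) ch(1) by (simp add: abs_mult)
  qed
  \<comment> \<open>The coefficient d is at most 8 R^2, \<open>Yf_le_linear\<close> gives L |u|^2
    and R^2 |u|^2 < 2; the factor 2 e comes from the difference of the two fields. In all at most 32
    L.\<close>
  have t2: "\<bar>(\<theta> v * \<theta> w * d) * (2 * e * (u \<bullet> Yf (c, u)))\<bar> \<le> (if R\<^sup>2 * (u \<bullet> u) < 2 then 32 * L else 0)"
  proof (cases "R\<^sup>2 * (u \<bullet> u) < 2")
    case True
    have "\<bar>u \<bullet> Yf (c, u)\<bar> \<le> norm u * norm (Yf (c, u))" by (rule Cauchy_Schwarz_ineq2)
    also have "\<dots> \<le> norm u * (L * norm u)" by (intro mult_left_mono Yf_le_linear[OF L(2,1) u]) auto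
    also have "\<dots> = L * (u \<bullet> u)" by (simp add: dot_square_norm power2_eq_square)
    finally have uY: "\<bar>u \<bullet> Yf (c, u)\<bar> \<le> L * (u \<bullet> u)" .
    have "\<bar>d\<bar> * \<bar>u \<bullet> Yf (c, u)\<bar> \<le> (2 * R\<^sup>2 * 4) * (L * (u \<bullet> u))"
      unfolding d_def abs_mult by (intro mult_mono uY dcutoff_le) auto
    also have "\<dots> = 8 * L * (R\<^sup>2 * (u \<bullet> u))" by simp
    also have "\<dots> \<le> 8 * L * 2" using True L(1) by (intro mult_left_mono) auto
    finally have *: "\<bar>d\<bar> * \<bar>u \<bullet> Yf (c, u)\<bar> \<le> 16 * L" by simp
    have te: "\<theta> v * \<theta> w * e \<le> 1" "0 \<le> \<theta> v * \<theta> w * e" using \<theta> e by (auto intro!: mult_le_one)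
    have "(\<theta> v * \<theta> w * e) * (\<bar>d\<bar> * \<bar>u \<bullet> Yf (c, u)\<bar>) \<le> 1 * (16 * L)" by (rule mult_mono[OF te(1) *]) auto
    then show ?thesis using True \<theta>[of v] \<theta>[of w] e by (simp add: abs_mult mult_ac)
  qed (simp add: d_def dcutoff_zero)
  have "dvg (\<lambda>v. Qf R (v, w)) v + dvg (\<lambda>x. Qf R (x, v)) w - Th R (v, w) * ((1 + e) * avg even_dvg (cmrel (v, w)))
    = gTh R (v, w) \<bullet> Wf (v, w) + gTh R (w, v) \<bullet> Wf (w, v)"
    using dvg_Qf[OF vw R] dvg_Qf[OF vw[symmetric] R] Th_swap[of R "(v, w)"]
    unfolding DW_sym[OF vw, symmetric] by (simp add: algebra_simps)
  also have "\<dots> = (\<theta> w * ch) * (g v \<bullet> Wf (v, w)) + (\<theta> v * ch) * (g w \<bullet> Wf (w, v))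
      - (\<theta> v * \<theta> w * d) * (u \<bullet> Wf (v, w) - u \<bullet> Wf (w, v))"
    unfolding g1 g2 by (simp add: inner_diff_left inner_add_left algebra_simps)
  also have "u \<bullet> Wf (v, w) - u \<bullet> Wf (w, v) = 2 * e * (u \<bullet> Yf (c, u))"
    unfolding W1 W2 by (simp add: inner_add_right inner_diff_right)
  finally show ?thesis
    using t1[of "\<theta> w" "Wf (v, w)" v] t1[of "\<theta> v" "Wf (w, v)" w] t2 \<theta> nW
    unfolding u_def by (auto simp: abs_le_iff split: if_splits)
qed

section \<open>The averaged dual estimate for the tensor product\<close>

definition Kop :: "(vel \<Rightarrow> real) \<Rightarrow> vel \<times> vel \<Rightarrow> real" where
  "Kop \<phi> p = (if fst p = snd p then 0 else avg (\<lambda>q. \<phi> (fst q + (1/2) *\<^sub>R snd q)) (cmrel p))"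

lemma Kop_measurable:
  assumes "continuous_on UNIV \<phi>" shows "Kop \<phi> \<in> borel_measurable borel"
proof -
  have cm: "continuous_on S cmrel" for S unfolding cmrel_def[abs_def] by (intro continuous_intros)
  have c: "continuous_on {p. snd p \<noteq> 0} (\<lambda>q :: vel \<times> vel. \<phi> (fst q + (1/2) *\<^sub>R snd q))"
    by (intro continuous_on_compose2[OF assms] continuous_intros) auto
  have "cmrel ` {p. fst p \<noteq> snd p} \<subseteq> {p. snd p \<noteq> 0}" by (auto simp: cmrel_simps)
  from continuous_on_compose2[OF frame_regular(1)[OF c] cm this]
  have "continuous_on {p. fst p \<noteq> snd p} (\<lambda>p. avg (\<lambda>q. \<phi> (fst q + (1/2) *\<^sub>R snd q)) (cmrel p))" .
  moreover have "open {p :: vel \<times> vel. fst p \<noteq> snd p}" by (intro open_Collect_neq continuous_intros)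
  ultimately have "(\<lambda>p. indicator {p. fst p \<noteq> snd p} p *\<^sub>R avg (\<lambda>q. \<phi> (fst q + (1/2) *\<^sub>R snd q)) (cmrel p)) \<in> borel_measurable borel"
    by (intro borel_measurable_continuous_on_indicator borel_open)
  moreover have "Kop \<phi> = (\<lambda>p. indicator {p. fst p \<noteq> snd p} p *\<^sub>R avg (\<lambda>q. \<phi> (fst q + (1/2) *\<^sub>R snd q)) (cmrel p))"
    by (auto simp: Kop_def indicator_def)
  ultimately show ?thesis by simp
qed

lemma Kop_bounded:
  assumes "continuous_on UNIV \<phi>" "\<And>x. \<bar>\<phi> x\<bar> \<le> K"
  shows "\<bar>Kop \<phi> p\<bar> \<le> K"
proof (cases "fst p = snd p")
  case True
  then show ?thesis using order_trans[OF abs_ge_zero assms(2)] by (simp add: Kop_def)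
next
  case False
  have "norm (avg (\<lambda>q. \<phi> (fst q + (1/2) *\<^sub>R snd q)) (fst (cmrel p), snd (cmrel p))) \<le> K"
  proof (rule avg_norm_le)
    show "continuous_on {p. snd p \<noteq> 0} (\<lambda>q :: vel \<times> vel. \<phi> (fst q + (1/2) *\<^sub>R snd q))"
      by (intro continuous_on_compose2[OF assms(1)] continuous_intros) auto
    show "0 \<le> K" using order_trans[OF abs_ge_zero assms(2)] .
  qed (use False assms(2) in \<open>auto simp: cmrel_simps\<close>)
  then show ?thesis using False by (simp add: Kop_def)
qed

text \<open>Exchanging v and w is u |-> -u, which under the average becomes y |-> -y; so the part of
  phi that is even in y averages to the mean of the two kernel values.\<close>

lemma Kop_swap_sum:
  assumes "continuous_on UNIV \<phi>" "v \<noteq> w"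
  shows "avg (\<lambda>p. (1/2) * (\<phi> (fst p + (1/2) *\<^sub>R snd p) + \<phi> (fst p - (1/2) *\<^sub>R snd p))) (cmrel (v, w))
    = (1/2) * (Kop \<phi> (v, w) + Kop \<phi> (w, v))"
proof -
  define c u where "c = (1/2) *\<^sub>R (v + w)" and "u = v - w"
  have u: "u \<noteq> 0" using assms(2) by (simp add: u_def)
  have cm: "cmrel (v, w) = (c, u)" "cmrel (w, v) = (c, - u)" by (simp_all add: cmrel_simps c_def u_def add.commute)
  have c1: "continuous_on S (\<lambda>q :: vel \<times> vel. \<phi> (fst q + (1/2) *\<^sub>R snd q))"
    and c2: "continuous_on S (\<lambda>q :: vel \<times> vel. \<phi> (fst q - (1/2) *\<^sub>R snd q))" for S
    by (intro continuous_on_compose2[OF assms(1)] continuous_intros; simp)+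
  have "avg (\<lambda>p. (1/2) * (\<phi> (fst p + (1/2) *\<^sub>R snd p) + \<phi> (fst p - (1/2) *\<^sub>R snd p))) (c, u)
     = (1/2) * avg (\<lambda>p. \<phi> (fst p + (1/2) *\<^sub>R snd p) + \<phi> (fst p - (1/2) *\<^sub>R snd p)) (c, u)"
    by (intro avg_bounded_linear bounded_linear_mult_right continuous_on_add c1 c2 u)
  also have "\<dots> = (1/2) * (avg (\<lambda>p. \<phi> (fst p + (1/2) *\<^sub>R snd p)) (c, u) + avg (\<lambda>p. \<phi> (fst p - (1/2) *\<^sub>R snd p)) (c, u))"
    by (simp add: avg_add[OF c1 c2 u])
  also have "avg (\<lambda>p. \<phi> (fst p - (1/2) *\<^sub>R snd p)) (c, u) = avg (\<lambda>p. \<phi> (fst p + (1/2) *\<^sub>R snd p)) (c, - u)"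
    by (simp add: avg_minus[OF c1 u])
  finally show ?thesis using assms(2) by (simp add: Kop_def cm)
qed

text \<open>|X + e Y|^2 + |X - e Y|^2 has no cross term, and \<open>XY_norm_sq_le\<close> bounds
  what remains.\<close>

lemma Qf_norm_sq_sum: 
  "(norm (Qf R p))\<^sup>2 + (norm (Qf R (snd p, fst p)))\<^sup>2
    \<le> Kop (\<lambda>x. (norm (\<psi> x))\<^sup>2) p + Kop (\<lambda>x. (norm (\<psi> x))\<^sup>2) (snd p, fst p)"
proof (cases "fst p = snd p")
  case True
  then show ?thesis by (simp add: Qf_def Th_def Kop_def)
next
  case False
  define v w c u where "v = fst p" and "w = snd p" and "c = (1/2) *\<^sub>R (v + w)" and "u = v - w"
  have vw: "v \<noteq> w" "p = (v, w)" and u: "u \<noteq> 0" using False by (simp_all add: v_def w_def u_def)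
  have cm: "cmrel (v, w) = (c, u)" "cmrel (w, v) = (c, - u)" by (simp_all add: cmrel_simps c_def u_def add.commute)
  have W1: "Wf (v, w) = Xf (c, u) + e *\<^sub>R Yf (c, u)" by (simp add: Wf_def cm)
  have W2: "Wf (w, v) = Xf (c, u) - e *\<^sub>R Yf (c, u)" by (simp add: Wf_def cm XY_parity[OF u])
  have Q: "(norm (Qf R q))\<^sup>2 \<le> (norm (Wf q))\<^sup>2" for q
    using Th_bounds[of R q] by (intro power_mono) (auto simp: Qf_def mult_left_le_one_le)
  have "(norm (Qf R (v, w)))\<^sup>2 + (norm (Qf R (w, v)))\<^sup>2 \<le> (norm (Wf (v, w)))\<^sup>2 + (norm (Wf (w, v)))\<^sup>2"
    by (intro add_mono Q)
  also have "\<dots> = 2 * ((norm (Xf (c, u)))\<^sup>2 + e\<^sup>2 * (norm (Yf (c, u)))\<^sup>2)"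
    unfolding W1 W2 power2_norm_eq_inner
    by (simp add: inner_add_left inner_add_right inner_diff_left inner_diff_right power2_eq_square algebra_simps)
  also have "\<dots> \<le> 2 * ((1/2) * (Kop (\<lambda>x. (norm (\<psi> x))\<^sup>2) (v, w) + Kop (\<lambda>x. (norm (\<psi> x))\<^sup>2) (w, v)))"
    using XY_norm_sq_le[OF u, of c] Kop_swap_sum[OF _ vw(1), of "\<lambda>x. (norm (\<psi> x))\<^sup>2"] psi_cont
    by (simp add: cm continuous_on_power continuous_on_norm)
  finally show ?thesis by (simp add: vw)
qed

text \<open>For each w the dual bound of f is applied to the slice of \<open>Qf R\<close> in v and
  integrated against f(w); then the cutoff is removed. The symmetry of f(v) f(w) under exchange
  makes control of symmetrised divergences and norms sufficient.\<close>

theorem Kop_fisher_estimate: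
  assumes fm [measurable]: "f \<in> borel_measurable borel" and f0: "\<And>x. f x \<ge> 0"
    and fi: "integrable lborel f" "(\<integral>x. f x \<partial>lborel) = 1" and C: "fisher_le C f"
  shows "2 * (\<integral>p. Kop (dvg \<psi>) p * (f (fst p) * f (snd p)) \<partial>lborel)
    \<le> (2 / (1 + e))\<^sup>2 * C + (\<integral>p. Kop (\<lambda>x. (norm (\<psi> x))\<^sup>2) p * (f (fst p) * f (snd p)) \<partial>lborel)"
proof -
  define F where "F p = f (fst p) * f (snd p)" for p
  have Fm [measurable]: "F \<in> borel_measurable borel" unfolding F_def by measurable
  have F0: "F p \<ge> 0" for p using f0 by (simp add: F_def)
  have Fi: "integrable lborel F" unfolding F_def using pair_density_integrable(1)[OF _ fi(1)] fm by simp
  have bi: "integrable lborel (\<lambda>p. h p * F p)" if [measurable]: "h \<in> borel_measurable borel" and "\<And>p. \<bar>h p\<bar> \<le> B" for h B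
  proof (rule Bochner_Integration.integrable_bound[where f="\<lambda>p. B * F p"])
    show "integrable lborel (\<lambda>p. B * F p)" using Fi by simp
    show "AE p in lborel. norm (h p * F p) \<le> norm (B * F p)"
      using that(2) F0 order_trans[OF abs_ge_self that(2)]
      by (intro AE_I2) (auto simp: abs_mult intro!: mult_right_mono order_trans[OF that(2) abs_ge_self])
  qed measurable
  have swap: "(\<integral>p. h (snd p, fst p) * F p \<partial>lborel) = (\<integral>p. h p * F p \<partial>lborel)" if "h \<in> borel_measurable borel" for h
    unfolding F_def by (rule pair_swap_integral[OF fm that])
  obtain K L where KL: "K > 0" "L > 0" "\<And>x. norm (\<psi> x) \<le> K" "\<And>x y. norm (\<psi> x - \<psi> y) \<le> L * norm (x - y)"
    using psi_bounds by metis
  obtain D where D: "D > 0" "\<And>x. \<bar>dvg \<psi> x\<bar> \<le> D" using tfield_dvg_bounded[OF psi] by blast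
  define N where "N x = (norm (\<psi> x))\<^sup>2" for x
  have Nc: "continuous_on UNIV N" unfolding N_def[abs_def] by (intro continuous_intros psi_cont)
  have NK: "\<bar>N x\<bar> \<le> K\<^sup>2" for x unfolding N_def using KL(3) by (simp add: power_mono)
  have dc: "continuous_on UNIV (dvg \<psi>)" by (rule continuous_on_dvg[OF psi_c1])
  note Km [measurable] = Kop_measurable[OF dc] Kop_measurable[OF Nc]
  \<comment> \<open>Chosen so that l (1 + e) is the 2 of the dual bound; its square is the constant
    of the theorem.\<close>
  define l where "l = 2 / (1 + e)"
  have l: "l > 0" "l * (1 + e) = 2" using e by (auto simp: l_def divide_simps)
  define q where "q R p = dvg (\<lambda>v. Qf R (v, snd p)) (fst p)" for R p
  have qeq: "q R p = (\<Sum>b\<in>Basis. frechet_derivative (Qf R) (at p) (b, 0) \<bullet> b)" if "R > 0" for R p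
    unfolding q_def using tfield_slice(2)[OF Qf_tfield[OF that], of "snd p" "fst p"] by simp
  have qm: "q R \<in> borel_measurable borel" if "R > 0" for R
    using Qf_tfield[OF that] unfolding qeq[OF that, abs_def] tfield_def c1_on_def
    by (intro borel_measurable_continuous_onI continuous_intros) auto
  have qb: "\<exists>B. \<forall>p. \<bar>q R p\<bar> \<le> B" if "R > 0" for R
  proof -
    note tf = Qf_tfield[OF that]
    obtain B where B: "B > 0" "\<And>p v. norm (frechet_derivative (Qf R) (at p) v) \<le> B * norm v"
      using tfield_frechet_bounded[OF tf] by blast
    have "\<bar>q R p\<bar> \<le> (\<Sum>b\<in>(Basis :: vel set). B)" for p
      unfolding qeq[OF that]
    proof (intro order_trans[OF sum_abs] sum_mono)
      fix b :: vel assume b: "b \<in> Basis"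
      have "\<bar>frechet_derivative (Qf R) (at p) (b, 0) \<bullet> b\<bar> \<le> norm (frechet_derivative (Qf R) (at p) (b, 0)) * norm b"
        by (rule Cauchy_Schwarz_ineq2)
      also have "\<dots> \<le> B" using B(2)[of p "(b, 0)"] b by (simp add: norm_Pair)
      finally show "\<bar>frechet_derivative (Qf R) (at p) (b, 0) \<bullet> b\<bar> \<le> B" .
    qed
    then show ?thesis by blast
  qed
  have Qc: "continuous_on UNIV (\<lambda>p. (norm (Qf R p))\<^sup>2)" if "R > 0" for R
    by (intro continuous_intros tfield_continuous Qf_tfield that)
  have Qm: "(\<lambda>p. (norm (Qf R p))\<^sup>2) \<in> borel_measurable borel" if "R > 0" for R
    using Qc[OF that] by (rule borel_measurable_continuous_onI)
  have Qb: "\<exists>B. \<forall>p. \<bar>(norm (Qf R p))\<^sup>2\<bar> \<le> B" if "R > 0" for R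
  proof -
    note tf = Qf_tfield[OF that]
    obtain B where "B > 0" "\<And>p. norm (Qf R p) \<le> B" using tfield_bounded[OF tf] by blast
    then show ?thesis by (intro exI[of _ "B\<^sup>2"]) (auto intro: power_mono)
  qed
  \<comment> \<open>Fubini with v innermost: the dual bound of f is used in v with w frozen.\<close>
  have iter: "(\<integral>p. h p * F p \<partial>lborel) = (\<integral>w. (\<integral>v. h (v, w) * f v \<partial>lborel) * f w \<partial>lborel)"
    "integrable lborel (\<lambda>w. (\<integral>v. h (v, w) * f v \<partial>lborel) * f w)"
    if h: "h \<in> borel_measurable borel" "\<exists>B. \<forall>p. \<bar>h p\<bar> \<le> B" for h
  proof -
    have i: "integrable (lborel \<Otimes>\<^sub>M lborel) (\<lambda>(v, w). h (v, w) * F (v, w))"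
      using bi[OF h(1)] h(2) by (auto simp: lborel_prod case_prod_unfold)
    have e: "(\<integral>v. h (v, w) * F (v, w) \<partial>lborel) = (\<integral>v. h (v, w) * f v \<partial>lborel) * f w" for w
      by (simp add: F_def mult.assoc[symmetric])
    show "(\<integral>p. h p * F p \<partial>lborel) = (\<integral>w. (\<integral>v. h (v, w) * f v \<partial>lborel) * f w \<partial>lborel)"
      using lborel_pair.integral_snd[OF i] by (simp add: lborel_prod case_prod_unfold e)
    show "integrable lborel (\<lambda>w. (\<integral>v. h (v, w) * f v \<partial>lborel) * f w)"
      using lborel_pair.integrable_snd[OF i] by (simp add: e)
  qed
  define P where "P = (\<integral>p. Kop N p * F p \<partial>lborel)"
  have step: "(\<integral>p. (q R p + q R (snd p, fst p)) * F p \<partial>lborel) \<le> l * C + P / l" if R: "R > 0" for R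
  proof -
    note [measurable] = qm[OF R] Qm[OF R]
    obtain B where B: "\<And>p. \<bar>q R p\<bar> \<le> B" using qb[OF R] by blast
    have s: "(\<integral>p. q R (snd p, fst p) * F p \<partial>lborel) = (\<integral>p. q R p * F p \<partial>lborel)" by (rule swap) measurable
    have "(\<integral>p. (q R p + q R (snd p, fst p)) * F p \<partial>lborel) = 2 * (\<integral>p. q R p * F p \<partial>lborel)"
      unfolding distrib_right
      by (subst Bochner_Integration.integral_add) (auto intro!: bi B simp: s)
    also have "\<dots> = (\<integral>w. 2 * (\<integral>v. q R (v, w) * f v \<partial>lborel) * f w \<partial>lborel)"
      unfolding iter(1)[OF qm[OF R] qb[OF R]] by (simp add: mult.assoc)
    also have "\<dots> \<le> (\<integral>w. l * C * f w + (\<integral>v. (norm (Qf R (v, w)))\<^sup>2 * f v \<partial>lborel) * f w / l \<partial>lborel)"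
    proof (rule integral_mono)
      show "integrable lborel (\<lambda>w. 2 * (\<integral>v. q R (v, w) * f v \<partial>lborel) * f w)"
        using iter(2)[OF qm[OF R] qb[OF R]] by (simp add: mult.assoc)
      show "integrable lborel (\<lambda>w. l * C * f w + (\<integral>v. (norm (Qf R (v, w)))\<^sup>2 * f v \<partial>lborel) * f w / l)"
        using iter(2)[OF Qm[OF R] Qb[OF R]] fi(1) by simp
      fix w
      have "2 * (\<integral>v. q R (v, w) * f v \<partial>lborel) \<le> l * C + (\<integral>v. (norm (Qf R (v, w)))\<^sup>2 * f v \<partial>lborel) / l"
        using fisher_leD[OF C tfield_slice(1)[OF Qf_tfield[OF R]] l(1)] by (simp add: q_def)
      from mult_right_mono[OF this f0[of w]]
      show "2 * (\<integral>v. q R (v, w) * f v \<partial>lborel) * f w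
         \<le> l * C * f w + (\<integral>v. (norm (Qf R (v, w)))\<^sup>2 * f v \<partial>lborel) * f w / l"
        by (simp add: distrib_right)
    qed
    also have "\<dots> = l * C + (\<integral>p. (norm (Qf R p))\<^sup>2 * F p \<partial>lborel) / l"
      using iter[OF Qm[OF R] Qb[OF R]] fi by simp
    also have "(\<integral>p. (norm (Qf R p))\<^sup>2 * F p \<partial>lborel) \<le> P"
    proof -
      obtain B where B: "\<And>p. \<bar>(norm (Qf R p))\<^sup>2\<bar> \<le> B" using Qb[OF R] by blast
      have i1: "integrable lborel (\<lambda>p. (norm (Qf R p))\<^sup>2 * F p)" "integrable lborel (\<lambda>p. (norm (Qf R (snd p, fst p)))\<^sup>2 * F p)"
        by (auto intro!: bi B)
      have i2: "integrable lborel (\<lambda>p. Kop N p * F p)" "integrable lborel (\<lambda>p. Kop N (snd p, fst p) * F p)"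
        by (auto intro!: bi Kop_bounded[OF Nc NK])
      have "2 * (\<integral>p. (norm (Qf R p))\<^sup>2 * F p \<partial>lborel)
          = (\<integral>p. (norm (Qf R p))\<^sup>2 * F p \<partial>lborel) + (\<integral>p. (norm (Qf R (snd p, fst p)))\<^sup>2 * F p \<partial>lborel)"
        using swap[OF Qm[OF R]] by simp
      also have "\<dots> = (\<integral>p. ((norm (Qf R p))\<^sup>2 + (norm (Qf R (snd p, fst p)))\<^sup>2) * F p \<partial>lborel)"
        unfolding distrib_right by (rule Bochner_Integration.integral_add[symmetric, OF i1])
      also have "\<dots> \<le> (\<integral>p. (Kop N p + Kop N (snd p, fst p)) * F p \<partial>lborel)"
        using Qf_norm_sq_sum[of R] F0 Bochner_Integration.integrable_add[OF i1] Bochner_Integration.integrable_add[OF i2]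
        by (intro integral_mono mult_right_mono) (auto simp: distrib_right N_def[abs_def])
      also have "\<dots> = P + P"
        unfolding distrib_right P_def using swap[OF Km(2)] by (simp add: Bochner_Integration.integral_add[OF i2])
      finally show ?thesis by simp
    qed
    finally show ?thesis using l(1) by (simp add: divide_right_mono)
  qed
  let ?A = "\<lambda>p. (1 + e) * ((1/2) * (Kop (dvg \<psi>) p + Kop (dvg \<psi>) (snd p, fst p)))"
  have Ab: "\<bar>?A p\<bar> \<le> 2 * D" for p
  proof -
    have "\<bar>?A p\<bar> = (1 + e) * ((1/2) * \<bar>Kop (dvg \<psi>) p + Kop (dvg \<psi>) (snd p, fst p)\<bar>)" using e by (simp add: abs_mult)
    also have "\<dots> \<le> 2 * ((1/2) * (D + D))"
      using e by (intro mult_mono order_trans[OF abs_triangle_ineq] add_mono Kop_bounded[OF dc D(2)]) auto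
    finally show ?thesis by simp
  qed
  have close: "\<bar>q R p + q R (snd p, fst p) - Th R p * ?A p\<bar>
     \<le> 64 * K / R + (if R\<^sup>2 * ((fst p - snd p) \<bullet> (fst p - snd p)) < 2 then 32 * L else 0)"
    if "R > 0" "fst p \<noteq> snd p" for R p
  proof -
    have "avg even_dvg (cmrel (fst p, snd p)) = (1/2) * (Kop (dvg \<psi>) (fst p, snd p) + Kop (dvg \<psi>) (snd p, fst p))"
      unfolding even_dvg_def[abs_def] by (rule Kop_swap_sum[OF dc that(2)])
    from dvg_Qf_sym[OF that(2,1) KL(3,2,4), unfolded this]
    show ?thesis by (simp only: q_def fst_conv snd_conv prod.collapse)
  qed
  have "(\<lambda>n. \<integral>p. (q (real (Suc n)) p + q (real (Suc n)) (snd p, fst p)) * F p \<partial>lborel)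
      \<longlonglongrightarrow> (\<integral>p. ?A p * F p \<partial>lborel)"
  proof (rule integral_dominated_convergence[where w="\<lambda>p. (2 * D + 64 * K + 32 * L) * F p"])
    show "(\<lambda>p. ?A p * F p) \<in> borel_measurable lborel" by measurable
    show "(\<lambda>p. (q (real (Suc n)) p + q (real (Suc n)) (snd p, fst p)) * F p) \<in> borel_measurable lborel" for n
      using qm[of "real (Suc n)"] by simp
    show "integrable lborel (\<lambda>p. (2 * D + 64 * K + 32 * L) * F p)" using Fi by simp
    show "AE p in lborel. norm ((q (real (Suc n)) p + q (real (Suc n)) (snd p, fst p)) * F p) \<le> (2 * D + 64 * K + 32 * L) * F p" for n
    proof (rule AE_mp[OF AE_lborel_off_diagonal], rule AE_I2, rule impI)
      fix p :: "vel \<times> vel" assume p: "fst p \<noteq> snd p"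
      have "\<bar>Th (real (Suc n)) p * ?A p\<bar> \<le> 1 * (2 * D)"
        unfolding abs_mult[of "Th _ _"] using Th_bounds Ab by (intro mult_mono) auto
      moreover have "64 * K / real (Suc n) \<le> 64 * K / 1" using KL(1) by (intro divide_left_mono) auto
      ultimately have "\<bar>q (real (Suc n)) p + q (real (Suc n)) (snd p, fst p)\<bar> \<le> 2 * D + 64 * K + 32 * L"
        using close[of "real (Suc n)" p] p KL(2) by (simp split: if_splits)
      then show "norm ((q (real (Suc n)) p + q (real (Suc n)) (snd p, fst p)) * F p) \<le> (2 * D + 64 * K + 32 * L) * F p"
        using F0 by (simp add: abs_mult mult_right_mono)
    qed
    show "AE p in lborel. (\<lambda>n. (q (real (Suc n)) p + q (real (Suc n)) (snd p, fst p)) * F p) \<longlonglongrightarrow> ?A p * F p"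
    proof (rule AE_mp[OF AE_lborel_off_diagonal], rule AE_I2, rule impI)
      fix p :: "vel \<times> vel" assume p: "fst p \<noteq> snd p"
      define d where "d = (fst p - snd p) \<bullet> (fst p - snd p)"
      have d: "d > 0" using p by (simp add: d_def)
      \<comment> \<open>From n0 on R exceeds |v|, |w| and 2 / |v - w|^2, so at this pair every
        cutoff has reached its final value and the diagonal error is gone.\<close>
      obtain n0 where n0: "real n0 > norm (fst p) + norm (snd p) + 2 / d" using reals_Archimedean2 by blast
      have big: "2 \<le> (real (Suc n))\<^sup>2 * d \<and> Th (real (Suc n)) p = 1" if "n \<ge> n0" for n
      proof -
        have n: "real (Suc n) \<ge> norm (fst p)" "real (Suc n) \<ge> norm (snd p)" "real (Suc n) \<ge> 2 / d" "real (Suc n) \<ge> 1"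
          using n0 that d norm_ge_zero[of "fst p"] norm_ge_zero[of "snd p"] divide_pos_pos[of 2 d] by linarith+
        have "2 \<le> real (Suc n) * d" using n(3) d by (simp add: field_simps)
        also have "\<dots> \<le> (real (Suc n))\<^sup>2 * d" using n(4) d by (intro mult_right_mono) (auto simp: power2_eq_square)
        finally have a: "2 \<le> (real (Suc n))\<^sup>2 * d" .
        have b: "(x \<bullet> x) / (real (Suc n))\<^sup>2 \<le> 1" if "norm x \<le> real (Suc n)" for x :: vel
          using power_mono[OF that norm_ge_zero, of 2] by (simp add: dot_square_norm divide_le_eq)
        show ?thesis using a b[OF n(1)] b[OF n(2)] by (simp add: Th_def d_def del: of_nat_Suc)
      qed
      have lim0: "(\<lambda>n. 64 * K / real (Suc n)) \<longlonglongrightarrow> 0"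
        using tendsto_mult_right_zero[OF LIMSEQ_inverse_real_of_nat, of "64 * K"] by (simp add: divide_inverse)
      have "(\<lambda>n. (q (real (Suc n)) p + q (real (Suc n)) (snd p, fst p)) - ?A p) \<longlonglongrightarrow> 0"
      proof (rule Lim_null_comparison[OF _ lim0])
        show "\<forall>\<^sub>F n in sequentially. norm ((q (real (Suc n)) p + q (real (Suc n)) (snd p, fst p)) - ?A p) \<le> 64 * K / real (Suc n)"
          using eventually_ge_at_top[of n0]
        proof eventually_elim
          case (elim n)
          then show ?case using close[of "real (Suc n)" p] p big[OF elim] by (simp add: d_def del: of_nat_Suc)
        qed
      qed
      then show "(\<lambda>n. (q (real (Suc n)) p + q (real (Suc n)) (snd p, fst p)) * F p) \<longlonglongrightarrow> ?A p * F p"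
        by (intro tendsto_mult_right) (rule LIM_zero_cancel)
    qed
  qed
  then have "(\<integral>p. ?A p * F p \<partial>lborel) \<le> l * C + P / l"
    by (rule LIMSEQ_le_const2) (auto intro!: step simp del: of_nat_Suc)
  moreover have "(\<integral>p. ?A p * F p \<partial>lborel) = (1 + e) * (\<integral>p. Kop (dvg \<psi>) p * F p \<partial>lborel)"
  proof -
    have i: "integrable lborel (\<lambda>p. Kop (dvg \<psi>) p * F p)" "integrable lborel (\<lambda>p. Kop (dvg \<psi>) (snd p, fst p) * F p)"
      by (auto intro!: bi Kop_bounded[OF dc D(2)])
    have "(\<integral>p. ?A p * F p \<partial>lborel) = (\<integral>p. (1 + e) * (1/2) * (Kop (dvg \<psi>) p * F p + Kop (dvg \<psi>) (snd p, fst p) * F p) \<partial>lborel)"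
      by (simp add: algebra_simps)
    also have "\<dots> = (1 + e) * (1/2) * ((\<integral>p. Kop (dvg \<psi>) p * F p \<partial>lborel) + (\<integral>p. Kop (dvg \<psi>) (snd p, fst p) * F p \<partial>lborel))"
      by (simp only: integral_mult_right_zero Bochner_Integration.integral_add[OF i])
    finally show ?thesis using swap[OF Km(1)] by simp
  qed
  ultimately have "(1 + e) * (\<integral>p. Kop (dvg \<psi>) p * F p \<partial>lborel) \<le> l * C + P / l"
    by (simp only:)
  from mult_left_mono[OF this, of l] l(1)
  have "l * (1 + e) * (\<integral>p. Kop (dvg \<psi>) p * F p \<partial>lborel) \<le> l\<^sup>2 * C + P"
    by (simp add: distrib_left[of l "l * C"] power2_eq_square mult.assoc)
  then show ?thesis
    unfolding l(2) by (simp add: P_def N_def[abs_def] F_def l_def)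
qed

end

section \<open>The kernel on the sphere and the gain term\<close>

text \<open>Lebesgue measure is determined by boxes, and the preimage of a box under R is its image
  under the orthogonal inverse, which preserves volume.\<close>

lemma lborel_distr_orthogonal:
  fixes R :: "vel \<Rightarrow> vel"
  assumes R: "orthogonal_transformation R"
  shows "distr lborel borel R = lborel"
proof (rule lborel_eqI[symmetric])
  have Rm: "R \<in> borel_measurable borel"
    using R by (intro borel_measurable_continuous_onI linear_continuous_on)
      (simp add: orthogonal_transformation_linear linear_linear)
  have bij: "bij R" using R by (rule orthogonal_transformation_bij)
  have inv: "orthogonal_transformation (inv R)" using R by (rule orthogonal_transformation_inv)
  fix l u :: vel assume lu: "\<And>b. b \<in> Basis \<Longrightarrow> l \<bullet> b \<le> u \<bullet> b"
  have im: "R -` box l u = inv R ` box l u" using bij by (rule bij_vimage_eq_inv_image)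
  have bd: "bounded (R -` box l u)"
    unfolding im using inv by (intro bounded_linear_image bounded_box)
      (simp add: orthogonal_transformation_linear linear_linear)
  have s: "R -` box l u \<in> sets borel" using measurable_sets[OF Rm, of "box l u"] by simp
  have "emeasure lborel (R -` box l u) = ennreal (measure lborel (R -` box l u))"
    using emeasure_bounded_finite[OF bd] by (intro emeasure_eq_ennreal_measure) auto
  also have "measure lborel (R -` box l u) = measure lebesgue (inv R ` box l u)"
    using s unfolding im by (simp add: measure_completion)
  also have "\<dots> = measure lebesgue (box l u)"
    by (rule measure_orthogonal_image[OF inv]) simp
  also have "ennreal \<dots> = (\<Prod>b\<in>Basis. (u - l) \<bullet> b)"
    using lu by (simp add: measure_completion measure_lborel_box_eq inner_diff_left)
  finally show "emeasure (distr lborel borel R) (box l u) = (\<Prod>b\<in>Basis. (u - l) \<bullet> b)"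
    using Rm by (simp add: emeasure_distr)
qed simp

lemma nn_integral_lborel_shift:
  fixes h :: "vel \<Rightarrow> ennreal"
  assumes [measurable]: "h \<in> borel_measurable borel"
  shows "(\<integral>\<^sup>+x. h (x - c) \<partial>lborel) = (\<integral>\<^sup>+x. h x \<partial>lborel)" "(\<integral>\<^sup>+x. h (c - x) \<partial>lborel) = (\<integral>\<^sup>+x. h x \<partial>lborel)"
proof -
  have s: "(\<integral>\<^sup>+x. h (d + x) \<partial>lborel) = (\<integral>\<^sup>+x. h x \<partial>lborel)" if [measurable]: "h \<in> borel_measurable borel" for d and h :: "vel \<Rightarrow> ennreal"
    by (subst (2) lborel_distr_plus[of d, symmetric], subst nn_integral_distr) auto
  show "(\<integral>\<^sup>+x. h (x - c) \<partial>lborel) = (\<integral>\<^sup>+x. h x \<partial>lborel)" using s[of h "- c"] by simp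
  have o: "orthogonal_transformation (uminus :: vel \<Rightarrow> vel)"
    by (simp add: orthogonal_transformation_def linear_uminus)
  have "(\<integral>\<^sup>+x. h (c + x) \<partial>distr lborel borel uminus) = (\<integral>\<^sup>+x. h (c - x) \<partial>lborel)"
    by (subst nn_integral_distr) auto
  then show "(\<integral>\<^sup>+x. h (c - x) \<partial>lborel) = (\<integral>\<^sup>+x. h x \<partial>lborel)"
    unfolding lborel_distr_orthogonal[OF o] using s[of h c] by simp
qed

section \<open>The uniform measure on the sphere\<close>

lemma sets_sphere_measure [simp, measurable_cong]: "sets sphere_measure = sets borel"
  by (simp add: sphere_measure_def)

lemma space_sphere_measure [simp]: "space sphere_measure = UNIV"
  by (simp add: sphere_measure_def space_scale_measure)

lemma nn_integral_sphere_measure: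
  assumes [measurable]: "g \<in> borel_measurable borel"
  shows "(\<integral>\<^sup>+n. g n \<partial>sphere_measure) = 3 * (\<integral>\<^sup>+x. g (x /\<^sub>R norm x) * indicator (cball 0 1) x \<partial>lborel)"
proof -
  have m: "(\<lambda>x :: vel. x /\<^sub>R norm x) \<in> borel_measurable (restrict_space lborel (cball 0 1))"
    by (rule measurable_restrict_space1) simp
  show ?thesis unfolding sphere_measure_def
    by (subst nn_integral_scale_measure, simp, subst nn_integral_distr[OF m], simp)
       (simp add: nn_integral_restrict_space)
qed

text \<open>The unit ball and the radial projection are compatible with R, so the invariance
  descends from Lebesgue measure.\<close>

lemma nn_integral_sphere_rotate:
  assumes [measurable]: "g \<in> borel_measurable borel" and R: "orthogonal_transformation R"
  shows "(\<integral>\<^sup>+n. g (R n) \<partial>sphere_measure) = (\<integral>\<^sup>+n. g n \<partial>sphere_measure)"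
proof -
  have lin: "linear R" using R by (rule orthogonal_transformation_linear)
  have [measurable]: "R \<in> borel_measurable borel"
    using lin by (intro borel_measurable_continuous_onI linear_continuous_on) (simp add: linear_linear)
  have [measurable]: "cball (0 :: vel) 1 \<in> sets borel" by simp
  have nR: "norm (R x) = norm x" for x using R by (rule orthogonal_transformation_norm)
  have "(\<integral>\<^sup>+x. g (R (x /\<^sub>R norm x)) * indicator (cball 0 1) x \<partial>lborel)
      = (\<integral>\<^sup>+x. (\<lambda>x. g (x /\<^sub>R norm x) * indicator (cball 0 1) x) (R x) \<partial>lborel)"
    by (simp add: linear_cmul[OF lin] nR indicator_def)
  also have "\<dots> = (\<integral>\<^sup>+x. g (x /\<^sub>R norm x) * indicator (cball 0 1) x \<partial>distr lborel borel R)"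
    by (rule nn_integral_distr[symmetric]) measurable
  finally show ?thesis
    unfolding lborel_distr_orthogonal[OF R] by (simp add: nn_integral_sphere_measure)
qed

text \<open>\<open>sphere_measure\<close> is a measure on the whole space. Only the centre of the
  ball is not projected to a unit vector, since there the division by the norm gives 0, and a point
  is negligible.\<close>

lemma AE_sphere_measure: "AE n in sphere_measure. norm n = 1"
proof -
  have 0: "{0} \<in> null_sets (lborel :: vel measure)" by (intro null_setsI) auto
  have "(\<integral>\<^sup>+n. indicator {n :: vel. norm n \<noteq> 1} n \<partial>sphere_measure)
     = 3 * (\<integral>\<^sup>+x. indicator {n :: vel. norm n \<noteq> 1} (x /\<^sub>R norm x) * indicator (cball 0 1) x \<partial>lborel)"
    by (rule nn_integral_sphere_measure) measurable
  also have "(\<integral>\<^sup>+x. indicator {n :: vel. norm n \<noteq> 1} (x /\<^sub>R norm x) * indicator (cball 0 1) x \<partial>lborel) = (\<integral>\<^sup>+x. 0 \<partial>(lborel :: vel measure))"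
    by (rule nn_integral_cong_AE, rule AE_mp[OF AE_not_in[OF 0]]) (auto intro!: AE_I2 simp: indicator_def)
  finally have "emeasure sphere_measure {n :: vel. norm n \<noteq> 1} = 0"
    by (subst (asm) nn_integral_indicator) (auto intro: borel_open)
  then show ?thesis by (intro AE_I[of _ _ "{n. norm n \<noteq> 1}"]) auto
qed

text \<open>Reading the last two coordinates as a complex number turns the slices of the ball
  orthogonal to the first axis into discs.\<close>

definition join_coord :: "real \<times> complex \<Rightarrow> vel" where
  "join_coord p = vector [fst p, Re (snd p), Im (snd p)]"

lemma join_coord_borel [measurable]: "join_coord \<in> borel_measurable borel"
proof -
  have "join_coord = (\<lambda>p. fst p *\<^sub>R axis 1 1 + Re (snd p) *\<^sub>R axis 2 1 + Im (snd p) *\<^sub>R axis 3 1)"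
    by (auto simp: join_coord_def vec_eq_iff forall_3 axis_def)
  moreover have "continuous_on UNIV (\<lambda>p :: real \<times> complex. fst p *\<^sub>R axis 1 1 + Re (snd p) *\<^sub>R axis 2 1 + Im (snd p) *\<^sub>R axis 3 1 :: vel)"
    by (intro continuous_intros)
  ultimately have "continuous_on UNIV join_coord" by (simp only:)
  then show ?thesis by (rule borel_measurable_continuous_onI)
qed

lemma lborel_join_coord: "distr lborel borel join_coord = lborel"
proof (rule lborel_eqI[symmetric])
  fix l u :: vel assume lu: "\<And>b. b \<in> Basis \<Longrightarrow> l \<bullet> b \<le> u \<bullet> b"
  have lu': "l $ i \<le> u $ i" for i using lu[of "axis i 1"] by (simp add: inner_axis)
  let ?l = "(l $ 1, Complex (l $ 2) (l $ 3))" and ?u = "(u $ 1, Complex (u $ 2) (u $ 3))"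
  have "join_coord p \<in> box l u \<longleftrightarrow> p \<in> box ?l ?u" for p
  proof -
    have "join_coord p \<in> box l u \<longleftrightarrow> (l $ 1 < fst p \<and> fst p < u $ 1) \<and>
       (l $ 2 < Re (snd p) \<and> Re (snd p) < u $ 2) \<and> (l $ 3 < Im (snd p) \<and> Im (snd p) < u $ 3)"
      by (simp add: mem_box_cart forall_3 join_coord_def)
    also have "\<dots> \<longleftrightarrow> p \<in> box ?l ?u"
      by (cases p) (auto simp: mem_box Basis_prod_def Basis_complex_def inner_complex_def)
    finally show ?thesis .
  qed
  then have "join_coord -` box l u = box ?l ?u" by auto
  then have "emeasure (distr lborel borel join_coord) (box l u) = emeasure lborel (box ?l ?u)"
    by (simp add: emeasure_distr)
  also have "\<dots> = (\<Prod>b\<in>Basis. (?u - ?l) \<bullet> b)"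
    by (rule emeasure_lborel_box) (auto simp: Basis_prod_def Basis_complex_def inner_complex_def lu')
  also have "(\<Prod>b\<in>Basis. (?u - ?l) \<bullet> b) = (u $ 1 - l $ 1) * ((u $ 2 - l $ 2) * (u $ 3 - l $ 3))"
  proof -
    have B: "(Basis :: (real \<times> complex) set) = {(1, 0), (0, 1), (0, \<i>)}" by (auto simp: Basis_prod_def Basis_complex_def)
    show ?thesis unfolding B by (simp add: inner_complex_def)
  qed
  also have "\<dots> = (\<Prod>b\<in>Basis. (u - l) \<bullet> b)"
  proof -
    have B: "(Basis :: vel set) = {axis 1 1, axis 2 1, axis 3 1}"
      by (auto simp: Basis_vec_def axis_inverse UNIV_3)
    show ?thesis unfolding B by (simp add: axis_eq_axis inner_axis)
  qed
  finally show "emeasure (distr lborel borel join_coord) (box l u) = (\<Prod>b\<in>Basis. (u - l) \<bullet> b)" .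
qed simp

text \<open>A disc of radius sqrt q has area pi q, so |zeta|^2 pushes planar measure to pi times
  Lebesgue measure on the half line. The minus sign in the pushforward turns discs into preimages of
  upper half lines, on which the measures are compared and must be finite.\<close>

lemma nn_integral_complex_norm_sq:
  assumes [measurable]: "H \<in> borel_measurable borel"
  shows "(\<integral>\<^sup>+\<zeta>. H ((norm (\<zeta> :: complex))\<^sup>2) \<partial>lborel) = ennreal pi * (\<integral>\<^sup>+q. H q * indicator {0..} q \<partial>lborel)"
proof -
  have "distr lborel borel (\<lambda>\<zeta> :: complex. - (norm \<zeta>)\<^sup>2) = density lborel (\<lambda>t. ennreal pi * indicator {..0} t)"
  proof (rule measure_eqI_lessThan)
    fix x :: real
    have v: "(\<lambda>\<zeta> :: complex. - (norm \<zeta>)\<^sup>2) -` {x<..} = (if x < 0 then ball 0 (sqrt (- x)) else {})"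
    proof -
      have "(norm \<zeta>)\<^sup>2 < - x \<longleftrightarrow> norm \<zeta> < sqrt (- x)" if "x < 0" for \<zeta> :: complex
        using that by (metis abs_norm_cancel neg_0_less_iff_less real_sqrt_abs real_sqrt_less_iff)
      then have "x < - (norm \<zeta>)\<^sup>2 \<longleftrightarrow> x < 0 \<and> norm \<zeta> < sqrt (- x)" for \<zeta> :: complex
        using order_le_less_trans[OF zero_le_power2, of "norm \<zeta>" "- x"] by (cases "x < 0") (auto simp: less_minus_iff)
      then show ?thesis by auto
    qed
    have "emeasure (distr lborel borel (\<lambda>\<zeta> :: complex. - (norm \<zeta>)\<^sup>2)) {x<..} = ennreal (pi * max 0 (- x))"
      by (simp add: emeasure_distr v emeasure_ball unit_ball_vol_2)
    moreover have "emeasure (density lborel (\<lambda>t. ennreal pi * indicator {..0} t)) {x<..} = ennreal (pi * max 0 (- x))"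
    proof -
      have "(\<lambda>t. ennreal pi * indicator {..0} t * indicator {x<..} t) = (\<lambda>t. ennreal pi * indicator {x<..0} t)"
        by (auto simp: indicator_def)
      then have "emeasure (density lborel (\<lambda>t. ennreal pi * indicator {..0} t)) {x<..} = ennreal pi * emeasure lborel {x<..0}"
        by (simp add: emeasure_density nn_integral_cmult)
      then show ?thesis by (cases "x \<le> 0") (auto simp: ennreal_mult[symmetric])
    qed
    ultimately show "emeasure (distr lborel borel (\<lambda>\<zeta> :: complex. - (norm \<zeta>)\<^sup>2)) {x<..}
       = emeasure (density lborel (\<lambda>t. ennreal pi * indicator {..0} t)) {x<..}"
      and "emeasure (distr lborel borel (\<lambda>\<zeta> :: complex. - (norm \<zeta>)\<^sup>2)) {x<..} < \<infinity>" by simp_all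
  qed simp_all
  then have "(\<integral>\<^sup>+t. H (- t) \<partial>distr lborel borel (\<lambda>\<zeta> :: complex. - (norm \<zeta>)\<^sup>2))
     = (\<integral>\<^sup>+t. H (- t) \<partial>density lborel (\<lambda>t. ennreal pi * indicator {..0} t))" by simp
  then have "(\<integral>\<^sup>+\<zeta>. H ((norm (\<zeta> :: complex))\<^sup>2) \<partial>lborel) = (\<integral>\<^sup>+t. ennreal pi * (indicator {..0} t * H (- t)) \<partial>lborel)"
    by (simp add: nn_integral_distr nn_integral_density mult.assoc)
  also have "\<dots> = ennreal pi * (\<integral>\<^sup>+t. indicator {..0} t * H (- t) \<partial>lborel)" by (rule nn_integral_cmult) measurable
  also have "(\<integral>\<^sup>+t. indicator {..0} t * H (- t) \<partial>lborel) = (\<integral>\<^sup>+t. indicator {..0} (- t) * H t \<partial>lborel)"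
    using nn_integral_real_affine[of "\<lambda>t. indicator {..0} t * H (- t)" "-1" 0] by simp
  finally show ?thesis by (simp add: indicator_def mult.commute)
qed

text \<open>Archimedes' hat-box theorem, up to a constant that is then read off from the volume of the ball.\<close>

lemma ball_direction:
  assumes [measurable]: "G \<in> borel_measurable borel"
  shows "(\<integral>\<^sup>+x. G ((x /\<^sub>R norm x) $ 1) * indicator (cball 0 1) x \<partial>(lborel :: vel measure))
    = ennreal pi * (\<integral>\<^sup>+q. ennreal (sqrt q) * indicator {0..1} q \<partial>lborel) * (\<integral>\<^sup>+s. G s * indicator {-1..1} s \<partial>lborel)"
proof -
  have nj: "norm (join_coord p) = sqrt ((fst p)\<^sup>2 + (norm (snd p))\<^sup>2)" for p
    by (simp add: join_coord_def norm_vec_def L2_set_def sum_3 cmod_def)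
  have j1: "join_coord p $ 1 = fst p" for p by (simp add: join_coord_def)
  have null0: "{0} \<in> null_sets (lborel :: real measure)" by (intro null_setsI) auto
  have ni: "sqrt x \<le> 1 \<longleftrightarrow> x \<le> 1" for x :: real by simp
  \<comment> \<open>q is the squared length: for a given first coordinate s it is s^2 + |zeta|^2.
    After exchanging the integrals, s is rescaled by sqrt q and becomes the cosine.\<close>
  let ?h = "\<lambda>s q. G (s / sqrt q) * indicator {..1} q"
  have "(\<integral>\<^sup>+x. G ((x /\<^sub>R norm x) $ 1) * indicator (cball 0 1) x \<partial>(lborel :: vel measure))
     = (\<integral>\<^sup>+p. ?h (fst p) ((fst p)\<^sup>2 + (norm (snd p))\<^sup>2) \<partial>(lborel :: (real \<times> complex) measure))"
    by (subst lborel_join_coord[symmetric], subst nn_integral_distr)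
       (auto simp: nj j1 divide_inverse mult.commute indicator_def intro!: nn_integral_cong)
  also have "\<dots> = (\<integral>\<^sup>+s. \<integral>\<^sup>+\<zeta>. ?h s (s\<^sup>2 + (norm (\<zeta> :: complex))\<^sup>2) \<partial>lborel \<partial>lborel)"
    by (subst lborel_prod[symmetric], subst lborel.nn_integral_fst[symmetric]) (auto simp: lborel_prod)
  also have "\<dots> = (\<integral>\<^sup>+s. ennreal pi * (\<integral>\<^sup>+q. ?h s (s\<^sup>2 + q) * indicator {0..} q \<partial>lborel) \<partial>lborel)"
    by (intro nn_integral_cong nn_integral_complex_norm_sq[of "\<lambda>q. ?h _ (_ + q)"]) measurable
  also have "\<dots> = (\<integral>\<^sup>+s. ennreal pi * (\<integral>\<^sup>+q. ?h s q * (if s\<^sup>2 \<le> q then 1 else 0) \<partial>lborel) \<partial>lborel)"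
  proof -
    have "(\<integral>\<^sup>+q. ?h s (s\<^sup>2 + q) * indicator {0..} q \<partial>lborel) = (\<integral>\<^sup>+q. ?h s q * (if s\<^sup>2 \<le> q then 1 else 0) \<partial>lborel)" for s :: real
    proof -
    have "(\<integral>\<^sup>+q. ?h s q * (if s\<^sup>2 \<le> q then 1 else 0) \<partial>lborel) = (\<integral>\<^sup>+q. ?h s (s\<^sup>2 + 1 * q) * (if s\<^sup>2 \<le> s\<^sup>2 + 1 * q then 1 else 0) \<partial>lborel)"
      by (subst nn_integral_real_affine[where c=1 and t="s\<^sup>2"]) auto
    then show ?thesis by (simp add: indicator_def of_bool_def)
    qed
    then show ?thesis by (simp only:)
  qed
  also have "\<dots> = ennreal pi * (\<integral>\<^sup>+s. \<integral>\<^sup>+q. ?h s q * (if s\<^sup>2 \<le> q then 1 else 0) \<partial>lborel \<partial>lborel)"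
    by (rule nn_integral_cmult) measurable
  also have "(\<integral>\<^sup>+s. \<integral>\<^sup>+q. ?h s q * (if s\<^sup>2 \<le> q then 1 else 0) \<partial>lborel \<partial>lborel)
     = (\<integral>\<^sup>+q. \<integral>\<^sup>+s. ?h s q * (if s\<^sup>2 \<le> q then 1 else 0) \<partial>lborel \<partial>lborel)"
    by (rule lborel_pair.Fubini'[symmetric]) measurable
  also have "\<dots> = (\<integral>\<^sup>+q. ennreal (sqrt q) * indicator {0..1} q * (\<integral>\<^sup>+s. G s * indicator {-1..1} s \<partial>lborel) \<partial>lborel)"
  proof (rule nn_integral_cong_AE, rule AE_mp[OF AE_not_in[OF null0]], rule AE_I2, rule impI)
    fix q :: real assume q0: "q \<notin> {0}"
    show "(\<integral>\<^sup>+s. ?h s q * (if s\<^sup>2 \<le> q then 1 else 0) \<partial>lborel)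
       = ennreal (sqrt q) * indicator {0..1} q * (\<integral>\<^sup>+s. G s * indicator {-1..1} s \<partial>lborel)"
    proof (cases "q < 0")
      case True
      then have "\<not> s\<^sup>2 \<le> q" for s using order_trans[OF zero_le_power2, of s q] by auto
      with True show ?thesis by simp
    next
      case False
      with q0 have q: "q > 0" by auto
      have "(\<integral>\<^sup>+s. ?h s q * (if s\<^sup>2 \<le> q then 1 else 0) \<partial>lborel)
        = \<bar>sqrt q\<bar> * (\<integral>\<^sup>+s. ?h (0 + sqrt q * s) q * (if (0 + sqrt q * s)\<^sup>2 \<le> q then 1 else 0) \<partial>lborel)"
        by (rule nn_integral_real_affine) (use q in \<open>auto\<close>)
      also have "(\<integral>\<^sup>+s. ?h (0 + sqrt q * s) q * (if (0 + sqrt q * s)\<^sup>2 \<le> q then 1 else 0) \<partial>lborel)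
        = (\<integral>\<^sup>+s. indicator {..1} q * (G s * indicator {-1..1} s) \<partial>lborel)"
        using q by (intro nn_integral_cong)
          (auto simp: indicator_def power_mult_distrib abs_square_le_1 abs_le_iff)
      also have "\<dots> = indicator {..1} q * (\<integral>\<^sup>+s. G s * indicator {-1..1} s \<partial>lborel)"
        by (rule nn_integral_cmult) measurable
      finally show ?thesis using q by (simp add: indicator_def)
    qed
  qed
  also have "\<dots> = (\<integral>\<^sup>+q. ennreal (sqrt q) * indicator {0..1} q \<partial>lborel) * (\<integral>\<^sup>+s. G s * indicator {-1..1} s \<partial>lborel)"
    by (rule nn_integral_multc) measurable
  finally show ?thesis by (simp add: mult.assoc)
qed

text \<open>A reflection carries an arbitrary axis to the first one. Taking G = 1 fixes the
  constant: 2 c = 4 pi / 3, hence 3 c = 2 pi.\<close>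

lemma nn_integral_sphere_direction:
  assumes [measurable]: "G \<in> borel_measurable borel" and k: "norm k = 1"
  shows "(\<integral>\<^sup>+n. G (n \<bullet> k) \<partial>sphere_measure) = ennreal (2 * pi) * (\<integral>\<^sup>+s. G s * indicator {-1..1} s \<partial>lborel)"
proof -
  define c where "c = ennreal pi * (\<integral>\<^sup>+q. ennreal (sqrt q) * indicator {0..1} q \<partial>lborel)"
  have "ennreal (4 / 3 * pi) = c * 2"
  proof -
    have "ennreal (4 / 3 * pi) = emeasure lborel (cball 0 1 :: vel set)"
      by (simp add: emeasure_cball unit_ball_vol_3)
    also have "\<dots> = c * 2" using ball_direction[of "\<lambda>_. 1"] by (simp add: c_def)
    finally show ?thesis .
  qed
  then have c: "3 * c = ennreal (2 * pi)"
  proof (cases c)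
    case (real r)
    then have "4 / 3 * pi = r * 2" using \<open>ennreal (4 / 3 * pi) = c * 2\<close>
      by (metis ennreal_inj ennreal_mult' ennreal_numeral mult_nonneg_nonneg zero_le_numeral pi_ge_zero divide_nonneg_nonneg)
    then have "3 * r = 2 * pi" by simp
    moreover have "3 * c = ennreal (3 * r)" using real by (simp add: ennreal_mult')
    ultimately show ?thesis by simp
  qed (auto simp: ennreal_mult_eq_top_iff)
  have ax: "(\<integral>\<^sup>+n. G (n \<bullet> axis 1 1) \<partial>sphere_measure) = ennreal (2 * pi) * (\<integral>\<^sup>+s. G s * indicator {-1..1} s \<partial>lborel)"
    using ball_direction[of G] unfolding c[symmetric] c_def
    by (subst nn_integral_sphere_measure) (simp_all add: inner_axis mult.assoc)
  show ?thesis
  proof (cases "k = axis 1 1")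
    case False
    define R where "R = refl_at (axis 1 1 - k)"
    have R: "orthogonal_transformation R" unfolding R_def using False by (intro orthogonal_refl_at) auto
    have "R (axis 1 1) = k" unfolding R_def using False k by (intro refl_at_swap) (auto simp: norm_eq_1 inner_axis_axis)
    then have "G (R n \<bullet> k) = G (n \<bullet> axis 1 1)" for n
      using R by (metis orthogonal_transformation_def)
    then show ?thesis
      using nn_integral_sphere_rotate[OF _ R, of "\<lambda>n. G (n \<bullet> k)"] ax by simp
  qed (use ax in simp)
qed

section \<open>The inelastic scattering law\<close>

locale inelastic_kernel =
  fixes e :: real and B :: "real \<Rightarrow> real"
  assumes e: "0 < e" "e \<le> 1" and B: "admissible_kernel B"
    and Bm [measurable]: "B \<in> borel_measurable borel"
begin

text \<open>\<^term>\<open>B\<close> is unconstrained outside \<open>{-1..1}\<close>; the cosines that occur lie in this interval.\<close>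

definition beta :: "real \<Rightarrow> real" where "beta s = indicator {-1..1} s * B s / (4 * pi)"

lemma beta_measurable [measurable]: "beta \<in> borel_measurable borel"
  unfolding beta_def[abs_def] by measurable

lemma beta_nonneg: "beta s \<ge> 0"
  using B by (auto simp: beta_def admissible_kernel_def indicator_def less_imp_le)

text \<open>2 pi from the hat-box formula times 2 / (4 pi) from the normalisation of B:
  \<open>beta\<close> is a probability density in n.\<close>

lemma nn_integral_beta: "norm k = 1 \<Longrightarrow> (\<integral>\<^sup>+n. ennreal (beta (n \<bullet> k)) \<partial>sphere_measure) = 1"
proof -
  assume k: "norm k = 1"
  have i: "integrable lborel (\<lambda>s. indicator {-1..1} s * B s)" "(\<integral>s. indicator {-1..1} s * B s \<partial>lborel) = 2"
    using B unfolding admissible_kernel_def set_integrable_def set_lebesgue_integral_def by auto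
  have "(\<integral>\<^sup>+s. ennreal (beta s) * indicator {-1..1} s \<partial>lborel) = (\<integral>\<^sup>+s. ennreal (beta s) \<partial>lborel)"
    by (intro nn_integral_cong) (auto simp: beta_def indicator_def)
  also have "\<dots> = ennreal (\<integral>s. beta s \<partial>lborel)"
    using i(1) beta_nonneg by (intro nn_integral_eq_integral) (auto simp: beta_def[abs_def])
  also have "(\<integral>s. beta s \<partial>lborel) = 2 / (4 * pi)" unfolding beta_def using i(2) by simp
  finally have "(\<integral>\<^sup>+n. ennreal (beta (n \<bullet> k)) \<partial>sphere_measure) = ennreal (2 * pi) * ennreal (2 / (4 * pi))"
    using nn_integral_sphere_direction[OF _ k, of "\<lambda>s. ennreal (beta s)"] by simp
  also have "\<dots> = 1" by (simp add: ennreal_mult[symmetric])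
  finally show ?thesis .
qed

lemma integrable_beta: "norm k = 1 \<Longrightarrow> integrable sphere_measure (\<lambda>n. beta (n \<bullet> k))"
  using nn_integral_beta[of k] by (intro integrableI_nonneg) (auto simp: beta_nonneg)

lemma integral_beta: "norm k = 1 \<Longrightarrow> (\<integral>n. beta (n \<bullet> k) \<partial>sphere_measure) = 1"
  using nn_integral_beta[of k] by (subst integral_eq_nn_integral) (auto simp: beta_nonneg)

text \<open>The partner moves to w + ((1 + e) / 2) (u . n) n, so the relative velocity becomes u -
  (1 + e) (u . n) n. Divided by |u| it depends on u only through k.\<close>

definition scatter :: "vel \<Rightarrow> vel measure" where
  "scatter k = distr (density sphere_measure (\<lambda>n. ennreal (beta (n \<bullet> k)))) borel
     (\<lambda>n. k - ((1 + e) * (n \<bullet> k)) *\<^sub>R n)"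

lemma nn_integral_scatter:
  assumes [measurable]: "g \<in> borel_measurable borel"
  shows "(\<integral>\<^sup>+m. g m \<partial>scatter k) = (\<integral>\<^sup>+n. ennreal (beta (n \<bullet> k)) * g (k - ((1 + e) * (n \<bullet> k)) *\<^sub>R n) \<partial>sphere_measure)"
  unfolding scatter_def
  by (simp add: nn_integral_distr nn_integral_density)

text \<open>The squared length is 1 - (1 - e^2) (n . k)^2, with n . k a cosine.\<close>

lemma scatter_annulus:
  assumes "norm n = 1" "norm k = 1"
  shows "k - ((1 + e) * (n \<bullet> k)) *\<^sub>R n \<in> annulus e"
proof -
  let ?m = "k - ((1 + e) * (n \<bullet> k)) *\<^sub>R n"
  have nn: "n \<bullet> n = 1" "k \<bullet> k = 1" using assms by (auto simp: norm_eq_1)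
  have "\<bar>n \<bullet> k\<bar> \<le> 1" using Cauchy_Schwarz_ineq2[of n k] assms by simp
  then have s: "(n \<bullet> k)\<^sup>2 \<le> 1" by (simp add: abs_square_le_1)
  have e2: "0 \<le> 1 - e\<^sup>2" using e by (simp add: abs_square_le_1)
  have m: "(norm ?m)\<^sup>2 = 1 - (1 - e\<^sup>2) * (n \<bullet> k)\<^sup>2"
    unfolding power2_norm_eq_inner
    by (simp add: inner_diff_left inner_diff_right nn inner_commute power2_eq_square) algebra
  have "(1 - e\<^sup>2) * (n \<bullet> k)\<^sup>2 \<le> 1 - e\<^sup>2" using mult_left_mono[OF s e2] by simp
  moreover have "0 \<le> (1 - e\<^sup>2) * (n \<bullet> k)\<^sup>2" using e2 by simp
  ultimately have "e\<^sup>2 \<le> (norm ?m)\<^sup>2" "(norm ?m)\<^sup>2 \<le> 1\<^sup>2" unfolding m by auto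
  then show ?thesis unfolding annulus_def using power2_le_imp_le[of e "norm ?m"] power2_le_imp_le[of "norm ?m" 1]
    by auto
qed

text \<open>Rotating n along with k changes neither the cosine n . k nor the sphere measure, and the
  outgoing vector rotates too.\<close>

lemma scatter_rotate:
  assumes R: "orthogonal_transformation R"
  shows "scatter (R k) = distr (scatter k) borel R"
proof (rule measure_eqI)
  have lin: "linear R" using R by (rule orthogonal_transformation_linear)
  have [measurable]: "R \<in> borel_measurable borel"
    using lin by (intro borel_measurable_continuous_onI linear_continuous_on) (simp add: linear_linear)
  have [measurable_cong]: "sets (scatter k) = sets borel" for k by (simp add: scatter_def)
  fix A assume "A \<in> sets (scatter (R k))"
  then have A [measurable]: "A \<in> sets borel" by (simp add: scatter_def)
  let ?g = "\<lambda>n. ennreal (beta (n \<bullet> R k)) * indicator A (R k - ((1 + e) * (n \<bullet> R k)) *\<^sub>R n)"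
  have "emeasure (scatter (R k)) A = (\<integral>\<^sup>+m. indicator A m \<partial>scatter (R k))"
    using A by (simp add: scatter_def)
  also have "\<dots> = (\<integral>\<^sup>+n. ?g n \<partial>sphere_measure)" by (rule nn_integral_scatter) measurable
  also have "\<dots> = (\<integral>\<^sup>+n. ?g (R n) \<partial>sphere_measure)" by (rule nn_integral_sphere_rotate[OF _ R, symmetric]) measurable
  also have "\<dots> = (\<integral>\<^sup>+n. ennreal (beta (n \<bullet> k)) * indicator A (R (k - ((1 + e) * (n \<bullet> k)) *\<^sub>R n)) \<partial>sphere_measure)"
  proof -
    have "R n \<bullet> R k = n \<bullet> k" for n using R by (simp add: orthogonal_transformation_def)
    then show ?thesis by (simp add: linear_diff[OF lin] linear_cmul[OF lin])
  qed
  also have "\<dots> = (\<integral>\<^sup>+m. indicator A (R m) \<partial>scatter k)" by (rule nn_integral_scatter[symmetric]) measurable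
  also have "\<dots> = emeasure (distr (scatter k) borel R) A"
    by (subst nn_integral_indicator[symmetric]) (simp_all add: nn_integral_distr del: nn_integral_indicator)
  finally show "emeasure (scatter (R k)) A = emeasure (distr (scatter k) borel R) A" .
qed (simp add: scatter_def)

sublocale scattering e scatter
proof (rule scattering.intro)
  fix k :: vel assume k: "norm k = 1"
  have [measurable_cong]: "sets (scatter k) = sets borel" by (simp add: scatter_def)
  have em: "emeasure (scatter k) (space (scatter k)) = 1"
    using nn_integral_scatter[of "\<lambda>_. 1" k] nn_integral_beta[OF k] by simp
  show "finite_measure (scatter k)" using em by (intro finite_measureI) simp
  show "measure (scatter k) (space (scatter k)) = 1" using em by (simp add: measure_def)
  show "AE m in scatter k. m \<in> annulus e"
  proof -
    have "{m :: vel. m \<in> annulus e} \<in> sets borel" using compact_annulus by (simp add: borel_compact)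
    then show ?thesis unfolding scatter_def
      by (subst AE_distr_iff, simp_all add: AE_density)
        (rule AE_mp[OF AE_sphere_measure], auto intro!: AE_I2 scatter_annulus k)
  qed
qed (use e scatter_rotate in \<open>auto simp: scatter_def\<close>)

text \<open>\<open>Kern\<close> averages over all collision directions; \<open>Kop\<close> is the same average for continuous
  observables, written through the law of the outgoing relative velocity.\<close>

definition dirv :: "vel \<Rightarrow> vel" where "dirv u = u /\<^sub>R norm u"

definition Kern :: "(vel \<Rightarrow> real) \<Rightarrow> vel \<Rightarrow> vel \<Rightarrow> real" where
  "Kern \<phi> v w = (\<integral>n. beta (n \<bullet> dirv (v - w)) * \<phi> (post_vel e v w n) \<partial>sphere_measure)"

lemma norm_dirv: "u \<noteq> 0 \<Longrightarrow> norm (dirv u) = 1" by (simp add: dirv_def)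

lemma dirv_measurable [measurable]: "dirv \<in> borel_measurable borel"
  unfolding dirv_def[abs_def] by measurable

lemma finite_sphere_measure: "finite_measure sphere_measure"
proof (rule finite_measureI)
  have "emeasure sphere_measure (space sphere_measure) = (\<integral>\<^sup>+n. 1 \<partial>sphere_measure)" by simp
  also have "\<dots> = 3 * emeasure lborel (cball 0 1 :: vel set)" by (subst nn_integral_sphere_measure) simp_all
  also have "\<dots> \<noteq> \<infinity>" by (simp add: emeasure_cball unit_ball_vol_3 ennreal_mult_eq_top_iff)
  finally show "emeasure sphere_measure (space sphere_measure) \<noteq> \<infinity>" .
qed

lemma integrable_Kern:
  assumes [measurable]: "\<phi> \<in> borel_measurable borel" and "\<And>x. \<bar>\<phi> x\<bar> \<le> M" and vw: "v \<noteq> w"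
  shows "integrable sphere_measure (\<lambda>n. beta (n \<bullet> dirv (v - w)) * \<phi> (post_vel e v w n))"
proof (rule Bochner_Integration.integrable_bound[where f="\<lambda>n. beta (n \<bullet> dirv (v - w)) * M"])
  show "integrable sphere_measure (\<lambda>n. beta (n \<bullet> dirv (v - w)) * M)"
    using integrable_beta[OF norm_dirv, of "v - w"] vw by simp
  show "(\<lambda>n. beta (n \<bullet> dirv (v - w)) * \<phi> (post_vel e v w n)) \<in> borel_measurable sphere_measure"
    unfolding post_vel_def by measurable
  show "AE n in sphere_measure. norm (beta (n \<bullet> dirv (v - w)) * \<phi> (post_vel e v w n)) \<le> norm (beta (n \<bullet> dirv (v - w)) * M)"
    using assms(2) by (intro AE_I2) (auto simp: abs_mult beta_nonneg intro!: mult_left_mono order_trans[OF assms(2) abs_ge_self])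
qed

lemma Kern_bounded:
  assumes "\<phi> \<in> borel_measurable borel" and b: "\<And>x. \<bar>\<phi> x\<bar> \<le> M" and vw: "v \<noteq> w"
  shows "\<bar>Kern \<phi> v w\<bar> \<le> M"
proof -
  have k: "norm (dirv (v - w)) = 1" using vw by (simp add: norm_dirv)
  have "\<bar>Kern \<phi> v w\<bar> \<le> (\<integral>n. \<bar>beta (n \<bullet> dirv (v - w)) * \<phi> (post_vel e v w n)\<bar> \<partial>sphere_measure)"
    unfolding Kern_def by (rule integral_abs_bound)
  also have "\<dots> \<le> (\<integral>n. beta (n \<bullet> dirv (v - w)) * M \<partial>sphere_measure)"
    using integrable_Kern[OF assms] integrable_beta[OF k] b
    by (intro integral_mono integrable_abs) (auto simp: abs_mult beta_nonneg intro!: mult_left_mono)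
  also have "\<dots> = M" using integral_beta[OF k] by simp
  finally show ?thesis .
qed

lemma Kern_measurable [measurable]:
  assumes [measurable]: "\<phi> \<in> borel_measurable borel"
  shows "(\<lambda>p. Kern \<phi> (fst p) (snd p)) \<in> borel_measurable borel"
proof -
  interpret finite_measure sphere_measure by (rule finite_sphere_measure)
  show ?thesis unfolding Kern_def post_vel_def
    by (rule borel_measurable_lebesgue_integral) measurable
qed

text \<open>Since \<open>beta\<close> has integral 1, the loss term is the plain integral of f phi,
  and the gain term is the kernel tested on the tensor product.\<close>

lemma coll_weak_eq:
  assumes fm [measurable]: "f \<in> borel_measurable borel" and f0: "\<And>x. f x \<ge> 0"
    and fi: "integrable lborel f" "(\<integral>x. f x \<partial>lborel) = 1"
    and [measurable]: "\<phi> \<in> borel_measurable borel" and b: "\<And>x. \<bar>\<phi> x\<bar> \<le> M"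
  shows "coll_weak e B f \<phi> = (\<integral>p. Kern \<phi> (fst p) (snd p) * (f (fst p) * f (snd p)) \<partial>lborel) - (\<integral>v. f v * \<phi> v \<partial>lborel)"
    and "integrable lborel (\<lambda>p. Kern \<phi> (fst p) (snd p) * (f (fst p) * f (snd p)))"
proof -
  have M0: "M \<ge> 0" using order_trans[OF abs_ge_zero b] .
  have Fi: "integrable lborel (\<lambda>p. f (fst p) * f (snd p))" using pair_density_integrable(1)[OF _ fi(1)] fm by simp
  show KF: "integrable lborel (\<lambda>p. Kern \<phi> (fst p) (snd p) * (f (fst p) * f (snd p)))"
  proof (rule Bochner_Integration.integrable_bound[where f="\<lambda>p. M * (f (fst p) * f (snd p))"])
    show "integrable lborel (\<lambda>p. M * (f (fst p) * f (snd p)))" using Fi by simp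
    show "AE p in lborel. norm (Kern \<phi> (fst p) (snd p) * (f (fst p) * f (snd p))) \<le> norm (M * (f (fst p) * f (snd p)))"
    proof (rule AE_mp[OF AE_lborel_off_diagonal], rule AE_I2, rule impI)
      fix p :: "vel \<times> vel" assume "fst p \<noteq> snd p"
      from mult_right_mono[OF Kern_bounded[OF assms(5) b this], of "\<bar>f (fst p) * f (snd p)\<bar>"]
      show "norm (Kern \<phi> (fst p) (snd p) * (f (fst p) * f (snd p))) \<le> norm (M * (f (fst p) * f (snd p)))"
        using M0 by (simp add: abs_mult)
    qed
  qed measurable
  have inner: "(\<integral>n. B (n \<bullet> ((v - w) /\<^sub>R norm (v - w))) * f v * f w * (\<phi> (post_vel e v w n) - \<phi> v) \<partial>sphere_measure)
      = 4 * pi * (Kern \<phi> v w * (f v * f w) - f v * f w * \<phi> v)" if vw: "v \<noteq> w" for v w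
  proof -
    let ?k = "dirv (v - w)"
    have k: "norm ?k = 1" using vw by (simp add: norm_dirv)
    have "(\<integral>n. B (n \<bullet> ((v - w) /\<^sub>R norm (v - w))) * f v * f w * (\<phi> (post_vel e v w n) - \<phi> v) \<partial>sphere_measure)
      = (\<integral>n. 4 * pi * (f v * f w) * (beta (n \<bullet> ?k) * \<phi> (post_vel e v w n) - beta (n \<bullet> ?k) * \<phi> v) \<partial>sphere_measure)"
    proof (rule integral_cong_AE)
      show "(\<lambda>n. B (n \<bullet> ((v - w) /\<^sub>R norm (v - w))) * f v * f w * (\<phi> (post_vel e v w n) - \<phi> v)) \<in> borel_measurable sphere_measure"
        "(\<lambda>n. 4 * pi * (f v * f w) * (beta (n \<bullet> ?k) * \<phi> (post_vel e v w n) - beta (n \<bullet> ?k) * \<phi> v)) \<in> borel_measurable sphere_measure"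
        unfolding post_vel_def by measurable
      show "AE n in sphere_measure. B (n \<bullet> ((v - w) /\<^sub>R norm (v - w))) * f v * f w * (\<phi> (post_vel e v w n) - \<phi> v)
        = 4 * pi * (f v * f w) * (beta (n \<bullet> ?k) * \<phi> (post_vel e v w n) - beta (n \<bullet> ?k) * \<phi> v)"
      proof (rule AE_mp[OF AE_sphere_measure], rule AE_I2, rule impI)
        fix n :: vel assume n: "norm n = 1"
        have "\<bar>n \<bullet> ?k\<bar> \<le> 1" using Cauchy_Schwarz_ineq2[of n ?k] n k by simp
        then have "B (n \<bullet> ?k) = 4 * pi * beta (n \<bullet> ?k)" by (simp add: beta_def abs_le_iff)
        then show "B (n \<bullet> ((v - w) /\<^sub>R norm (v - w))) * f v * f w * (\<phi> (post_vel e v w n) - \<phi> v)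
          = 4 * pi * (f v * f w) * (beta (n \<bullet> ?k) * \<phi> (post_vel e v w n) - beta (n \<bullet> ?k) * \<phi> v)"
          unfolding dirv_def by (simp add: algebra_simps)
      qed
    qed
    also have "\<dots> = 4 * pi * (f v * f w) * (Kern \<phi> v w - \<phi> v)"
      unfolding Kern_def
      using integrable_Kern[OF assms(5) b vw] integrable_beta[OF k] integral_beta[OF k] by simp
    finally show ?thesis by (simp add: algebra_simps)
  qed
  have iKF: "integrable (lborel \<Otimes>\<^sub>M lborel) (\<lambda>(v, w). Kern \<phi> v w * (f v * f w))"
    using KF by (simp add: lborel_prod case_prod_unfold)
  have outer: "(\<integral>w. (\<integral>n. B (n \<bullet> ((v - w) /\<^sub>R norm (v - w))) * f v * f w * (\<phi> (post_vel e v w n) - \<phi> v) \<partial>sphere_measure) \<partial>lborel)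
      = (\<integral>w. 4 * pi * (Kern \<phi> v w * (f v * f w) - f v * f w * \<phi> v) \<partial>lborel)" for v
  proof -
    have 0: "{v} \<in> null_sets (lborel :: vel measure)" by (intro null_setsI) auto
    show "(\<integral>w. (\<integral>n. B (n \<bullet> ((v - w) /\<^sub>R norm (v - w))) * f v * f w * (\<phi> (post_vel e v w n) - \<phi> v) \<partial>sphere_measure) \<partial>lborel)
      = (\<integral>w. 4 * pi * (Kern \<phi> v w * (f v * f w) - f v * f w * \<phi> v) \<partial>lborel)"
    proof (rule integral_cong_AE)
      interpret finite_measure sphere_measure by (rule finite_sphere_measure)
      show "(\<lambda>w. \<integral>n. B (n \<bullet> ((v - w) /\<^sub>R norm (v - w))) * f v * f w * (\<phi> (post_vel e v w n) - \<phi> v) \<partial>sphere_measure) \<in> borel_measurable lborel"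
        unfolding post_vel_def by (rule borel_measurable_lebesgue_integral) measurable
      have "(\<lambda>w. Kern \<phi> v w) \<in> borel_measurable borel"
        unfolding Kern_def post_vel_def by (rule borel_measurable_lebesgue_integral) measurable
      then show "(\<lambda>w. 4 * pi * (Kern \<phi> v w * (f v * f w) - f v * f w * \<phi> v)) \<in> borel_measurable lborel" by simp
      show "AE w in lborel. (\<integral>n. B (n \<bullet> ((v - w) /\<^sub>R norm (v - w))) * f v * f w * (\<phi> (post_vel e v w n) - \<phi> v) \<partial>sphere_measure)
        = 4 * pi * (Kern \<phi> v w * (f v * f w) - f v * f w * \<phi> v)"
        by (rule AE_mp[OF AE_not_in[OF 0]], rule AE_I2, rule impI, rule inner) simp
    qed
  qed
  have "coll_weak e B f \<phi> = 1 / (4 * pi) * (\<integral>v. (\<integral>w. 4 * pi * (Kern \<phi> v w * (f v * f w) - f v * f w * \<phi> v) \<partial>lborel) \<partial>lborel)"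
    unfolding coll_weak_def outer ..
  also have "\<dots> = (\<integral>v. (\<integral>w. Kern \<phi> v w * (f v * f w) - f v * f w * \<phi> v \<partial>lborel) \<partial>lborel)" by simp
  also have "\<dots> = (\<integral>v. (\<integral>w. Kern \<phi> v w * (f v * f w) \<partial>lborel) - f v * \<phi> v \<partial>lborel)"
  proof (rule integral_cong_AE)
    have KF' [measurable]: "(\<lambda>p. Kern \<phi> (fst p) (snd p)) \<in> borel_measurable (lborel \<Otimes>\<^sub>M lborel)"
      using Kern_measurable[of \<phi>] by (simp add: lborel_prod)
    have "(\<lambda>p. Kern \<phi> (fst p) (snd p) * (f (fst p) * f (snd p))) \<in> borel_measurable (lborel \<Otimes>\<^sub>M lborel)"
      "(\<lambda>p. Kern \<phi> (fst p) (snd p) * (f (fst p) * f (snd p)) - f (fst p) * f (snd p) * \<phi> (fst p)) \<in> borel_measurable (lborel \<Otimes>\<^sub>M lborel)"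
      by measurable
    then show "(\<lambda>v. \<integral>w. Kern \<phi> v w * (f v * f w) - f v * f w * \<phi> v \<partial>lborel) \<in> borel_measurable lborel"
      "(\<lambda>v. (\<integral>w. Kern \<phi> v w * (f v * f w) \<partial>lborel) - f v * \<phi> v) \<in> borel_measurable lborel"
      by (auto intro!: lborel.borel_measurable_lebesgue_integral borel_measurable_diff simp: case_prod_unfold)
    show "AE v in lborel. (\<integral>w. Kern \<phi> v w * (f v * f w) - f v * f w * \<phi> v \<partial>lborel)
       = (\<integral>w. Kern \<phi> v w * (f v * f w) \<partial>lborel) - f v * \<phi> v"
      using lborel_pair.AE_integrable_fst[OF iKF]
    proof eventually_elim
      case (elim v)
      then show ?case using fi by (subst Bochner_Integration.integral_diff) (auto simp: mult.assoc)
    qed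
  qed
  also have "\<dots> = (\<integral>v. (\<integral>w. Kern \<phi> v w * (f v * f w) \<partial>lborel) \<partial>lborel) - (\<integral>v. f v * \<phi> v \<partial>lborel)"
  proof (rule Bochner_Integration.integral_diff)
    show "integrable lborel (\<lambda>v. \<integral>w. Kern \<phi> v w * (f v * f w) \<partial>lborel)"
      using lborel_pair.integrable_fst[OF iKF] .
    show "integrable lborel (\<lambda>v. f v * \<phi> v)"
      by (rule Bochner_Integration.integrable_bound[where f="\<lambda>v. f v * M"])
         (use fi(1) f0 M0 b in \<open>auto simp: abs_mult intro!: mult_left_mono\<close>)
  qed
  also have "(\<integral>v. (\<integral>w. Kern \<phi> v w * (f v * f w) \<partial>lborel) \<partial>lborel)
      = (\<integral>p. Kern \<phi> (fst p) (snd p) * (f (fst p) * f (snd p)) \<partial>lborel)"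
    using lborel_pair.integral_fst[OF iKF] by (simp add: lborel_prod case_prod_unfold)
  finally show "coll_weak e B f \<phi> = (\<integral>p. Kern \<phi> (fst p) (snd p) * (f (fst p) * f (snd p)) \<partial>lborel) - (\<integral>v. f v * \<phi> v \<partial>lborel)" .
qed

text \<open>The point c + y / 2, with y = |u| m and m drawn from \<open>scatter\<close>, is the
  outgoing velocity v - ((1 + e) / 2) (u . n) n.\<close>

lemma Kop_eq_Kern:
  fixes \<psi> :: "vel \<Rightarrow> vel"
  assumes psi: "tfield \<psi>" and c: "continuous_on UNIV \<phi>" and vw: "v \<noteq> w"
  shows "lifted_field.Kop e scatter \<phi> (v, w) = Kern \<phi> v w"
proof -
  interpret lifted_field e scatter \<psi> by unfold_locales (rule psi)
  let ?u = "v - w" and ?c = "(1/2) *\<^sub>R (v + w)"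
  let ?k = "dirv ?u"
  have k: "norm ?k = 1" using vw by (simp add: norm_dirv)
  have [measurable]: "\<phi> \<in> borel_measurable borel" using c by (rule borel_measurable_continuous_onI)
  have [measurable]: "annulus e \<in> sets borel" using compact_annulus by (simp add: borel_compact)
  have post: "?c + (1/2) *\<^sub>R norm ?u *\<^sub>R (?k - ((1 + e) * (n \<bullet> ?k)) *\<^sub>R n) = post_vel e v w n" for n
  proof -
    have uk: "norm ?u *\<^sub>R ?k = ?u" using vw by (simp add: dirv_def)
    then have "norm ?u * (n \<bullet> ?k) = n \<bullet> ?u" by (metis inner_scaleR_right)
    then have nk: "norm ?u * ((1 + e) * (n \<bullet> ?k)) = (1 + e) * (n \<bullet> ?u)" by (simp add: mult.left_commute)
    have "?c + (1/2) *\<^sub>R norm ?u *\<^sub>R (?k - ((1 + e) * (n \<bullet> ?k)) *\<^sub>R n)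
       = ?c + (1/2) *\<^sub>R ?u - ((1/2) * ((1 + e) * (n \<bullet> ?u))) *\<^sub>R n"
      using uk nk by (simp add: scaleR_diff_right)
    also have "?c + (1/2) *\<^sub>R ?u = v"
      by (simp add: scaleR_add_right scaleR_diff_right flip: scaleR_add_left)
    finally show ?thesis by (simp add: post_vel_def inner_commute)
  qed
  have "Kop \<phi> (v, w) = (\<integral>m. indicat_real (annulus e) m *\<^sub>R \<phi> (?c + (1/2) *\<^sub>R norm ?u *\<^sub>R m) \<partial>scatter ?k)"
    using vw by (simp add: Kop_def avg_def cmrel_simps set_lebesgue_integral_def dirv_def)
  also have "\<dots> = (\<integral>n. indicat_real (annulus e) (?k - ((1 + e) * (n \<bullet> ?k)) *\<^sub>R n) *\<^sub>R
     \<phi> (?c + (1/2) *\<^sub>R norm ?u *\<^sub>R (?k - ((1 + e) * (n \<bullet> ?k)) *\<^sub>R n)) \<partial>density sphere_measure (\<lambda>n. ennreal (beta (n \<bullet> ?k))))"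
    unfolding scatter_def by (rule integral_distr) measurable
  also have "\<dots> = (\<integral>n. beta (n \<bullet> ?k) *\<^sub>R (indicat_real (annulus e) (?k - ((1 + e) * (n \<bullet> ?k)) *\<^sub>R n) *\<^sub>R
     \<phi> (?c + (1/2) *\<^sub>R norm ?u *\<^sub>R (?k - ((1 + e) * (n \<bullet> ?k)) *\<^sub>R n))) \<partial>sphere_measure)"
    by (rule integral_density) (auto simp: beta_nonneg)
  also have "\<dots> = Kern \<phi> v w" unfolding Kern_def post
  proof (rule integral_cong_AE)
    show "AE n in sphere_measure. beta (n \<bullet> ?k) *\<^sub>R (indicat_real (annulus e) (?k - ((1 + e) * (n \<bullet> ?k)) *\<^sub>R n) *\<^sub>R
       \<phi> (post_vel e v w n)) = beta (n \<bullet> ?k) * \<phi> (post_vel e v w n)"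
      by (rule AE_mp[OF AE_sphere_measure]) (auto intro!: AE_I2 simp: scatter_annulus[OF _ k])
  qed (unfold post_vel_def, measurable)
  finally show ?thesis .
qed

section \<open>The gain term as a density\<close>

definition gain_nn :: "(vel \<Rightarrow> real) \<Rightarrow> vel \<Rightarrow> ennreal" where
  "gain_nn f x = (\<integral>\<^sup>+u. \<integral>\<^sup>+n. ennreal (beta (n \<bullet> dirv u) * (f (x + ((1 + e) / 2 * (u \<bullet> n)) *\<^sub>R n)
     * f (x + ((1 + e) / 2 * (u \<bullet> n)) *\<^sub>R n - u))) \<partial>sphere_measure \<partial>lborel)"

text \<open>\<open>gain_nn\<close> may be infinite on a null set; \<open>enn2real\<close> puts 0
  there.\<close>

definition gain :: "(vel \<Rightarrow> real) \<Rightarrow> vel \<Rightarrow> real" where "gain f x = enn2real (gain_nn f x)"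

text \<open>For a fixed relative velocity u and direction n the outgoing velocity is v minus a
  constant. So passing to it as the variable is a translation, and neither an inverse collision map
  nor a Jacobian occurs. The rest is Tonelli and u = v - w.\<close>

lemma nn_integral_gain:
  assumes [measurable]: "f \<in> borel_measurable borel" and f0: "\<And>x. f x \<ge> 0"
    and [measurable]: "\<phi> \<in> borel_measurable borel" and b: "\<And>x. 0 \<le> \<phi> x" "\<And>x. \<phi> x \<le> M"
  shows "(\<integral>\<^sup>+x. ennreal (\<phi> x) * gain_nn f x \<partial>lborel)
     = (\<integral>\<^sup>+p. ennreal (Kern \<phi> (fst p) (snd p) * (f (fst p) * f (snd p))) \<partial>lborel)"
proof -
  interpret S: finite_measure sphere_measure by (rule finite_sphere_measure)
  interpret LS: pair_sigma_finite "lborel :: vel measure" sphere_measure ..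
  let ?s = "\<lambda>u n. ((1 + e) / 2 * (u \<bullet> n)) *\<^sub>R n"
  let ?G = "\<lambda>u n v. ennreal (beta (n \<bullet> dirv u) * \<phi> (v - ?s u n) * (f v * f (v - u)))"
  have "(\<integral>\<^sup>+x. ennreal (\<phi> x) * gain_nn f x \<partial>lborel)
     = (\<integral>\<^sup>+x. \<integral>\<^sup>+u. \<integral>\<^sup>+n. ?G u n (x + ?s u n) \<partial>sphere_measure \<partial>lborel \<partial>lborel)"
    unfolding gain_nn_def
    by (simp add: nn_integral_cmult[symmetric] ennreal_mult[symmetric] b f0 beta_nonneg mult_ac)
  also have "\<dots> = (\<integral>\<^sup>+u. \<integral>\<^sup>+x. \<integral>\<^sup>+n. ?G u n (x + ?s u n) \<partial>sphere_measure \<partial>lborel \<partial>lborel)"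
    by (rule lborel_pair.Fubini') measurable
  also have "\<dots> = (\<integral>\<^sup>+u. \<integral>\<^sup>+n. \<integral>\<^sup>+x. ?G u n (x + ?s u n) \<partial>lborel \<partial>sphere_measure \<partial>lborel)"
    by (rule nn_integral_cong, rule LS.Fubini'[symmetric]) measurable
  also have "\<dots> = (\<integral>\<^sup>+u. \<integral>\<^sup>+n. \<integral>\<^sup>+v. ?G u n v \<partial>lborel \<partial>sphere_measure \<partial>lborel)"
  proof (rule nn_integral_cong, rule nn_integral_cong)
    fix u n :: vel
    show "(\<integral>\<^sup>+x. ?G u n (x + ?s u n) \<partial>lborel) = (\<integral>\<^sup>+v. ?G u n v \<partial>lborel)"
      using nn_integral_lborel_shift(1)[of "?G u n" "- ?s u n"] by simp
  qed
  also have "\<dots> = (\<integral>\<^sup>+u. \<integral>\<^sup>+v. \<integral>\<^sup>+n. ?G u n v \<partial>sphere_measure \<partial>lborel \<partial>lborel)"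
    by (rule nn_integral_cong, rule LS.Fubini') measurable
  also have "\<dots> = (\<integral>\<^sup>+v. \<integral>\<^sup>+u. \<integral>\<^sup>+n. ?G u n v \<partial>sphere_measure \<partial>lborel \<partial>lborel)"
    by (rule lborel_pair.Fubini') measurable
  also have "\<dots> = (\<integral>\<^sup>+v. \<integral>\<^sup>+w. \<integral>\<^sup>+n. ?G (v - w) n v \<partial>sphere_measure \<partial>lborel \<partial>lborel)"
    by (rule nn_integral_cong, rule nn_integral_lborel_shift(2)[symmetric]) measurable
  also have "\<dots> = (\<integral>\<^sup>+v. \<integral>\<^sup>+w. ennreal (Kern \<phi> v w * (f v * f w)) \<partial>lborel \<partial>lborel)"
  proof (rule nn_integral_cong, rule nn_integral_cong_AE)
    fix v :: vel
    have 0: "{v} \<in> null_sets (lborel :: vel measure)" by (intro null_setsI) auto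
    show "AE w in lborel. (\<integral>\<^sup>+n. ?G (v - w) n v \<partial>sphere_measure) = ennreal (Kern \<phi> v w * (f v * f w))"
    proof (rule AE_mp[OF AE_not_in[OF 0]], rule AE_I2, rule impI)
      fix w assume "w \<notin> {v}"
      then have vw: "v \<noteq> w" by auto
      have i: "integrable sphere_measure (\<lambda>n. beta (n \<bullet> dirv (v - w)) * \<phi> (post_vel e v w n))"
        using b by (intro integrable_Kern[OF _ _ vw, of _ M]) auto
      have "(\<integral>\<^sup>+n. ?G (v - w) n v \<partial>sphere_measure)
        = (\<integral>\<^sup>+n. ennreal (beta (n \<bullet> dirv (v - w)) * \<phi> (post_vel e v w n) * (f v * f w)) \<partial>sphere_measure)"
        by (simp add: post_vel_def)
      also have "\<dots> = ennreal (\<integral>n. beta (n \<bullet> dirv (v - w)) * \<phi> (post_vel e v w n) * (f v * f w) \<partial>sphere_measure)"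
        using i b f0 by (intro nn_integral_eq_integral integrable_mult_left) (auto intro!: AE_I2 mult_nonneg_nonneg beta_nonneg)
      finally show "(\<integral>\<^sup>+n. ?G (v - w) n v \<partial>sphere_measure) = ennreal (Kern \<phi> v w * (f v * f w))"
        by (simp add: Kern_def)
    qed
  qed
  also have "\<dots> = (\<integral>\<^sup>+p. ennreal (Kern \<phi> (fst p) (snd p) * (f (fst p) * f (snd p))) \<partial>lborel)"
    by (subst lborel_prod[symmetric], subst lborel.nn_integral_fst[symmetric])
       (simp_all add: lborel_prod)
  finally show ?thesis .
qed

lemma gain_nn_measurable [measurable]:
  "f \<in> borel_measurable borel \<Longrightarrow> gain_nn f \<in> borel_measurable borel"
proof -
  assume [measurable]: "f \<in> borel_measurable borel"
  interpret S: finite_measure sphere_measure by (rule finite_sphere_measure)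
  show ?thesis unfolding gain_nn_def[abs_def] by measurable
qed

lemma gain_measurable [measurable]: "f \<in> borel_measurable borel \<Longrightarrow> gain f \<in> borel_measurable borel"
  unfolding gain_def[abs_def] by measurable

lemma gain_props:
  assumes fm [measurable]: "f \<in> borel_measurable borel" and f0: "\<And>x. f x \<ge> 0"
    and fi: "integrable lborel f" "(\<integral>x. f x \<partial>lborel) = 1"
  shows gain_nonneg: "gain f x \<ge> 0" and gain_integrable: "integrable lborel (gain f)"
    and gain_integral: "(\<integral>x. gain f x \<partial>lborel) = 1"
    and gain_weak: "\<phi> \<in> borel_measurable borel \<Longrightarrow> (\<And>x. \<bar>\<phi> x\<bar> \<le> M) \<Longrightarrow>
      (\<integral>x. gain f x * \<phi> x \<partial>lborel) = (\<integral>p. Kern \<phi> (fst p) (snd p) * (f (fst p) * f (snd p)) \<partial>lborel)"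
proof -
  show "gain f x \<ge> 0" for x by (simp add: gain_def)
  have F: "integrable lborel (\<lambda>p. f (fst p) * f (snd p))" "(\<integral>p. f (fst p) * f (snd p) \<partial>lborel) = 1"
    using pair_density_integrable[OF _ fi(1)] fi(2) fm by simp_all
  have K1: "Kern (\<lambda>_. 1) v w = 1" if "v \<noteq> w" for v w
    using that by (simp add: Kern_def integral_beta norm_dirv)
  have "(\<integral>\<^sup>+x. gain_nn f x \<partial>lborel) = (\<integral>\<^sup>+p. ennreal (Kern (\<lambda>_. 1) (fst p) (snd p) * (f (fst p) * f (snd p))) \<partial>lborel)"
    using nn_integral_gain[OF fm f0, of "\<lambda>_. 1" 1] by simp
  also have "\<dots> = (\<integral>\<^sup>+p. ennreal (f (fst p) * f (snd p)) \<partial>lborel)"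
    by (rule nn_integral_cong_AE, rule AE_mp[OF AE_lborel_off_diagonal]) (auto intro!: AE_I2 simp: K1)
  also have "\<dots> = 1" using F f0 by (subst nn_integral_eq_integral) auto
  finally have tot: "(\<integral>\<^sup>+x. gain_nn f x \<partial>lborel) = 1" .
  then have "AE x in lborel. gain_nn f x \<noteq> \<infinity>" by (intro nn_integral_PInf_AE) auto
  then have fin: "AE x in lborel. ennreal (gain f x) = gain_nn f x"
    by eventually_elim (simp add: gain_def less_top)
  have nn1: "(\<integral>\<^sup>+x. ennreal (gain f x) \<partial>lborel) = 1" using tot nn_integral_cong_AE[OF fin] by simp
  show gi: "integrable lborel (gain f)"
    using nn1 by (intro integrableI_nonneg) (auto simp: gain_def)
  show gI: "(\<integral>x. gain f x \<partial>lborel) = 1"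
    using nn1 by (subst integral_eq_nn_integral) (auto simp: gain_def)
  have pos: "(\<integral>x. gain f x * \<phi> x \<partial>lborel) = (\<integral>p. Kern \<phi> (fst p) (snd p) * (f (fst p) * f (snd p)) \<partial>lborel)"
    if [measurable]: "\<phi> \<in> borel_measurable borel" and b: "\<And>x. 0 \<le> \<phi> x" "\<And>x. \<phi> x \<le> M" for \<phi> M
  proof -
    have K0: "Kern \<phi> v w \<ge> 0" for v w unfolding Kern_def
      using b beta_nonneg by (intro Bochner_Integration.integral_nonneg) auto
    have "(\<integral>\<^sup>+x. ennreal (gain f x * \<phi> x) \<partial>lborel) = (\<integral>\<^sup>+x. ennreal (\<phi> x) * gain_nn f x \<partial>lborel)"
      by (rule nn_integral_cong_AE, rule AE_mp[OF fin])
         (auto intro!: AE_I2 simp: ennreal_mult gain_def b mult.commute)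
    also have "\<dots> = (\<integral>\<^sup>+p. ennreal (Kern \<phi> (fst p) (snd p) * (f (fst p) * f (snd p))) \<partial>lborel)"
      by (rule nn_integral_gain[OF fm f0 that])
    finally show ?thesis
      using b K0 f0 by (subst (1 2) integral_eq_nn_integral) (auto simp: gain_def)
  qed
  show "(\<integral>x. gain f x * \<phi> x \<partial>lborel) = (\<integral>p. Kern \<phi> (fst p) (snd p) * (f (fst p) * f (snd p)) \<partial>lborel)"
    if m [measurable]: "\<phi> \<in> borel_measurable borel" and b: "\<And>x. \<bar>\<phi> x\<bar> \<le> M"
  proof -
    \<comment> \<open>A bounded phi becomes nonnegative after adding M. This changes both sides by
      M, since both integrate probability densities.\<close>
    have b': "0 \<le> \<phi> x + M" "\<phi> x + M \<le> 2 * M" for x using b[of x] by auto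
    have i: "integrable lborel (\<lambda>x. gain f x * \<phi> x)"
      by (rule Bochner_Integration.integrable_bound[where f="\<lambda>x. gain f x * M"])
         (use gi b order_trans[OF abs_ge_zero b] in \<open>auto simp: abs_mult intro!: mult_left_mono\<close>)
    have "(\<integral>x. gain f x * \<phi> x \<partial>lborel) + M = (\<integral>x. gain f x * (\<phi> x + M) \<partial>lborel)"
      using i gi gI by (simp add: distrib_left)
    also have "\<dots> = (\<integral>p. Kern (\<lambda>x. \<phi> x + M) (fst p) (snd p) * (f (fst p) * f (snd p)) \<partial>lborel)"
      using b' by (intro pos[of _ "2 * M"]) auto
    also have "\<dots> = (\<integral>p. Kern \<phi> (fst p) (snd p) * (f (fst p) * f (snd p)) + M * (f (fst p) * f (snd p)) \<partial>lborel)"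
    proof (rule integral_cong_AE)
      show "AE p in lborel. Kern (\<lambda>x. \<phi> x + M) (fst p) (snd p) * (f (fst p) * f (snd p))
        = Kern \<phi> (fst p) (snd p) * (f (fst p) * f (snd p)) + M * (f (fst p) * f (snd p))"
      proof (rule AE_mp[OF AE_lborel_off_diagonal], rule AE_I2, rule impI)
        fix p :: "vel \<times> vel" assume p: "fst p \<noteq> snd p"
        then have k: "norm (dirv (fst p - snd p)) = 1" by (simp add: norm_dirv)
        have "Kern (\<lambda>x. \<phi> x + M) (fst p) (snd p) = Kern \<phi> (fst p) (snd p) + M"
          unfolding Kern_def distrib_left
          using integrable_Kern[OF m b p] integrable_beta[OF k] integral_beta[OF k] by simp
        then show "Kern (\<lambda>x. \<phi> x + M) (fst p) (snd p) * (f (fst p) * f (snd p))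
          = Kern \<phi> (fst p) (snd p) * (f (fst p) * f (snd p)) + M * (f (fst p) * f (snd p))" by (simp add: distrib_right)
      qed
    qed measurable
    also have "\<dots> = (\<integral>p. Kern \<phi> (fst p) (snd p) * (f (fst p) * f (snd p)) \<partial>lborel) + M"
      using coll_weak_eq(2)[OF fm f0 fi m b] F by simp
    finally show ?thesis by simp
  qed
qed

theorem fisher_le_gain:
  assumes fm [measurable]: "f \<in> borel_measurable borel" and f0: "\<And>x. f x \<ge> 0"
    and fi: "integrable lborel f" "(\<integral>x. f x \<partial>lborel) = 1" and C: "fisher_le C f"
  shows "fisher_le ((2 / (1 + e))\<^sup>2 * C) (gain f)"
  unfolding fisher_le_def
proof (intro allI impI)
  fix \<psi> :: "vel \<Rightarrow> vel" assume psi: "tfield \<psi>"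
  interpret lifted_field e scatter \<psi> by unfold_locales (rule psi)
  have K: "(\<integral>p. Kop \<phi> p * (f (fst p) * f (snd p)) \<partial>lborel) = (\<integral>x. \<phi> x * gain f x \<partial>lborel)"
    if c: "continuous_on UNIV \<phi>" and b: "\<And>x. \<bar>\<phi> x\<bar> \<le> M" for \<phi> M
  proof -
    have [measurable]: "\<phi> \<in> borel_measurable borel" "Kop \<phi> \<in> borel_measurable borel"
      using c by (auto intro: borel_measurable_continuous_onI Kop_measurable)
    have "(\<integral>p. Kop \<phi> p * (f (fst p) * f (snd p)) \<partial>lborel) = (\<integral>p. Kern \<phi> (fst p) (snd p) * (f (fst p) * f (snd p)) \<partial>lborel)"
    proof (rule integral_cong_AE)
      show "AE p in lborel. Kop \<phi> p * (f (fst p) * f (snd p)) = Kern \<phi> (fst p) (snd p) * (f (fst p) * f (snd p))"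
        by (rule AE_mp[OF AE_lborel_off_diagonal], rule AE_I2)
           (metis Kop_eq_Kern[OF psi c] prod.collapse)
    qed measurable
    then show ?thesis using gain_weak[OF fm f0 fi _ b] by (simp add: mult.commute)
  qed
  obtain D where D: "\<And>x. \<bar>dvg \<psi> x\<bar> \<le> D" using tfield_dvg_bounded[OF psi] by blast
  obtain N where N: "\<And>x. norm (\<psi> x) \<le> N" using tfield_bounded[OF psi] by blast
  have N2: "\<bar>(norm (\<psi> x))\<^sup>2\<bar> \<le> N\<^sup>2" for x using N by (simp add: power_mono)
  have "continuous_on UNIV (\<lambda>x. (norm (\<psi> x))\<^sup>2)" by (intro continuous_intros psi_cont)
  from Kop_fisher_estimate[OF fm f0 fi C] K[OF continuous_on_dvg[OF psi_c1] D] K[OF this N2]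
  show "2 * (\<integral>x. dvg \<psi> x * gain f x \<partial>lborel) \<le> (2 / (1 + e))\<^sup>2 * C + (\<integral>x. (norm (\<psi> x))\<^sup>2 * gain f x \<partial>lborel)"
    by simp
qed

end

section \<open>The Euler scheme\<close>

text \<open>A measurable function is almost everywhere a limit of continuous ones; clamping them to
  [-M, M] keeps the bound and does not disturb the limit.\<close>

lemma continuous_approximation:
  fixes \<phi> :: "'a::euclidean_space \<Rightarrow> real"
  assumes [measurable]: "\<phi> \<in> borel_measurable borel" and b: "\<And>x. \<bar>\<phi> x\<bar> \<le> M"
  obtains g where "\<And>n. continuous_on UNIV (g n)" "\<And>n x. \<bar>g n x\<bar> \<le> M"
    "AE x in lborel. (\<lambda>n. g n x) \<longlonglongrightarrow> \<phi> x"
proof -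
  have M: "M \<ge> 0" using order_trans[OF abs_ge_zero b] .
  have "\<phi> \<in> borel_measurable lebesgue" by (rule measurable_completion) simp
  then have "\<phi> measurable_on UNIV" by (simp add: measurable_on_iff_borel_measurable)
  then obtain N g where N: "negligible N" and g: "\<And>n. continuous_on UNIV (g n)"
    and lim: "\<And>x. x \<notin> N \<Longrightarrow> (\<lambda>n. g n x) \<longlonglongrightarrow> \<phi> x"
    unfolding measurable_on_def by auto
  let ?c = "\<lambda>y. max (- M) (min M y)"
  have "continuous_on UNIV (\<lambda>x. ?c (g n x))" for n by (intro continuous_intros g)
  moreover have "\<bar>?c y\<bar> \<le> M" for y using M by auto
  moreover have "AE x in lborel. (\<lambda>n. ?c (g n x)) \<longlonglongrightarrow> \<phi> x"
  proof -
    have "AE x in lebesgue. x \<notin> N" using N by (simp add: negligible_iff_null_sets AE_not_in)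
    then have "AE x in lborel. x \<notin> N" by (simp add: AE_completion_iff)
    then show ?thesis
    proof (rule AE_mp, intro AE_I2 impI)
      fix x assume "x \<notin> N"
      from tendsto_max[OF tendsto_const tendsto_min[OF tendsto_const lim[OF this]], of "- M" M]
      moreover have "?c (\<phi> x) = \<phi> x" using b[of x] by (auto simp: abs_le_iff)
      ultimately show "(\<lambda>n. ?c (g n x)) \<longlonglongrightarrow> \<phi> x" by (simp only:)
    qed
  qed
  ultimately show thesis by (rule that)
qed

text \<open>The equation is tested with continuous functions only; approximating the sign of g by
  such functions still recovers the L^1 norm.\<close>

lemma L1_norm_le_by_duality:
  fixes g :: "'a::euclidean_space \<Rightarrow> real"
  assumes gm [measurable]: "g \<in> borel_measurable borel" and g: "integrable lborel g"
    and c: "\<And>\<phi>. continuous_on UNIV \<phi> \<Longrightarrow> (\<And>x. \<bar>\<phi> x\<bar> \<le> 1) \<Longrightarrow> (\<integral>x. g x * \<phi> x \<partial>lborel) \<le> c"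
  shows "(\<integral>x. \<bar>g x\<bar> \<partial>lborel) \<le> c"
proof -
  have [measurable]: "(\<lambda>x. sgn (g x)) \<in> borel_measurable borel" by measurable
  obtain h where h: "\<And>n. continuous_on UNIV (h n)" "\<And>n x. \<bar>h n x\<bar> \<le> 1"
    "AE x in lborel. (\<lambda>n. h n x) \<longlonglongrightarrow> sgn (g x)"
    by (rule continuous_approximation[of "\<lambda>x. sgn (g x)" 1]) (auto simp: sgn_real_def)
  have [measurable]: "h n \<in> borel_measurable borel" for n using h(1) by (rule borel_measurable_continuous_onI)
  have "(\<lambda>n. \<integral>x. g x * h n x \<partial>lborel) \<longlonglongrightarrow> (\<integral>x. g x * sgn (g x) \<partial>lborel)"
  proof (rule integral_dominated_convergence[where w="\<lambda>x. \<bar>g x\<bar>"])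
    show "AE x in lborel. (\<lambda>n. g x * h n x) \<longlonglongrightarrow> g x * sgn (g x)"
      using h(3) by eventually_elim (intro tendsto_mult_left)
    show "AE x in lborel. norm (g x * h n x) \<le> \<bar>g x\<bar>" for n
      using h(2) by (auto simp: abs_mult mult_left_le)
  qed (use g in auto)
  moreover have "(\<integral>x. g x * h n x \<partial>lborel) \<le> c" for n by (intro c h)
  ultimately have "(\<integral>x. g x * sgn (g x) \<partial>lborel) \<le> c" by (intro LIMSEQ_le_const2) auto
  then show ?thesis by (simp add: mult_sgn_abs[symmetric] abs_sgn)
qed

lemma integrable_mult_bounded:
  fixes g h :: "'a \<Rightarrow> real"
  assumes "integrable M g" "h \<in> borel_measurable M" "\<And>x. \<bar>h x\<bar> \<le> K"
  shows "integrable M (\<lambda>x. g x * h x)"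
proof (rule Bochner_Integration.integrable_bound[where f="\<lambda>x. g x * K"])
  show "AE x in M. norm (g x * h x) \<le> norm (g x * K)"
    using assms(3) by (intro AE_I2) (auto simp: abs_mult intro!: mult_left_mono order_trans[OF assms(3) abs_ge_self])
qed (use assms in auto)

lemma integral_mult_bounded_le:
  fixes g h :: "'a \<Rightarrow> real"
  assumes "integrable M g" "h \<in> borel_measurable M" "\<And>x. \<bar>h x\<bar> \<le> K"
  shows "\<bar>\<integral>x. g x * h x \<partial>M\<bar> \<le> K * (\<integral>x. \<bar>g x\<bar> \<partial>M)"
proof -
  have "\<bar>\<integral>x. g x * h x \<partial>M\<bar> \<le> (\<integral>x. \<bar>g x * h x\<bar> \<partial>M)" by (rule integral_abs_bound)
  also have "\<dots> \<le> (\<integral>x. \<bar>g x\<bar> * K \<partial>M)"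
    using assms integrable_mult_bounded[OF assms]
    by (intro integral_mono integrable_abs) (auto simp: abs_mult intro!: mult_left_mono)
  finally show ?thesis by (simp add: mult.commute)
qed

lemma pair_product_integral:
  fixes f h :: "'a::euclidean_space \<Rightarrow> real"
  assumes [measurable]: "f \<in> borel_measurable borel" "h \<in> borel_measurable borel"
    and f: "integrable lborel f" and h: "integrable lborel h"
  shows "integrable lborel (\<lambda>p. f (fst p) * h (snd p))"
    and "(\<integral>p. f (fst p) * h (snd p) \<partial>lborel) = (\<integral>x. f x \<partial>lborel) * (\<integral>x. h x \<partial>lborel)"
proof -
  have i: "integrable (lborel \<Otimes>\<^sub>M lborel) (\<lambda>(x,y). f x * h y)"
    by (rule lborel_pair.Fubini_integrable) (use f h in \<open>auto simp: abs_mult intro!: integrable_abs integrable_mult_left\<close>)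
  then show "integrable lborel (\<lambda>p. f (fst p) * h (snd p))" by (simp add: lborel_prod case_prod_unfold)
  have "(\<integral>p. f (fst p) * h (snd p) \<partial>lborel) = (\<integral>x. (\<integral>y. f x * h y \<partial>lborel) \<partial>lborel)"
    using lborel_pair.integral_fst[OF i] by (simp add: lborel_prod case_prod_unfold)
  then show "(\<integral>p. f (fst p) * h (snd p) \<partial>lborel) = (\<integral>x. f x \<partial>lborel) * (\<integral>x. h x \<partial>lborel)" by simp
qed

definition prob_density :: "(vel \<Rightarrow> real) \<Rightarrow> bool" where
  "prob_density f \<longleftrightarrow> f \<in> borel_measurable borel \<and> (\<forall>x. f x \<ge> 0) \<and> integrable lborel f \<and> (\<integral>x. f x \<partial>lborel) = 1"

definition L1dist :: "(vel \<Rightarrow> real) \<Rightarrow> (vel \<Rightarrow> real) \<Rightarrow> real" where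
  "L1dist f h = (\<integral>x. \<bar>f x - h x\<bar> \<partial>lborel)"

lemma prob_densityD:
  assumes "prob_density f"
  shows "f \<in> borel_measurable borel" "\<And>x. f x \<ge> 0" "integrable lborel f" "(\<integral>x. f x \<partial>lborel) = 1"
  using assms by (auto simp: prob_density_def)

text \<open>The zero field is a test field.\<close>

lemma fisher_le_nonneg: "fisher_le C f \<Longrightarrow> C \<ge> 0"
proof -
  assume "fisher_le C f"
  moreover have "tfield (\<lambda>_ :: vel. 0 :: vel)" by (simp add: tfield_def c1_on_const)
  ultimately show ?thesis unfolding fisher_le_def
    using frechet_derivative_const[of "0 :: vel"] by (fastforce simp: dvg_def)
qed

lemma tfield_dvg_measurable: "tfield \<psi> \<Longrightarrow> dvg \<psi> \<in> borel_measurable borel"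
  by (intro borel_measurable_continuous_onI continuous_on_dvg) (simp add: tfield_def)

lemma tfield_norm_sq_measurable: "tfield \<psi> \<Longrightarrow> (\<lambda>x. (norm (\<psi> x))\<^sup>2) \<in> borel_measurable borel"
  by (intro borel_measurable_continuous_onI continuous_intros tfield_continuous)

lemma tfield_integrable:
  fixes \<psi> :: "vel \<Rightarrow> vel"
  assumes "tfield \<psi>" "integrable lborel f"
  shows "integrable lborel (\<lambda>x. dvg \<psi> x * f x)" "integrable lborel (\<lambda>x. (norm (\<psi> x))\<^sup>2 * f x)"
proof -
  obtain D where D: "\<And>x. \<bar>dvg \<psi> x\<bar> \<le> D" using tfield_dvg_bounded[OF assms(1)] by blast
  obtain N where N: "\<And>x. norm (\<psi> x) \<le> N" using tfield_bounded[OF assms(1)] by blast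
  have "\<bar>(norm (\<psi> x))\<^sup>2\<bar> \<le> N\<^sup>2" for x using N by (simp add: power_mono)
  with integrable_mult_bounded[OF assms(2) _ D] integrable_mult_bounded[OF assms(2), where h="\<lambda>x. (norm (\<psi> x))\<^sup>2" and K="N\<^sup>2"]
    tfield_dvg_measurable[OF assms(1)] tfield_norm_sq_measurable[OF assms(1)]
  show "integrable lborel (\<lambda>x. dvg \<psi> x * f x)" "integrable lborel (\<lambda>x. (norm (\<psi> x))\<^sup>2 * f x)"
    by (simp_all add: mult.commute)
qed

lemma fisher_le_combination:
  assumes "fisher_le C f" "fisher_le D h" "integrable lborel f" "integrable lborel h" "a \<ge> 0" "b \<ge> 0"
  shows "fisher_le (a * C + b * D) (\<lambda>x. a * f x + b * h x)"
  unfolding fisher_le_def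
proof (intro allI impI)
  fix \<psi> :: "vel \<Rightarrow> vel" assume t: "tfield \<psi>"
  note i = tfield_integrable[OF t assms(3)] tfield_integrable[OF t assms(4)]
  have "2 * (\<integral>x. dvg \<psi> x * (a * f x + b * h x) \<partial>lborel)
      = a * (2 * (\<integral>x. dvg \<psi> x * f x \<partial>lborel)) + b * (2 * (\<integral>x. dvg \<psi> x * h x \<partial>lborel))"
    using i by (simp add: distrib_left mult.left_commute)
  also have "\<dots> \<le> a * (C + (\<integral>x. (norm (\<psi> x))\<^sup>2 * f x \<partial>lborel)) + b * (D + (\<integral>x. (norm (\<psi> x))\<^sup>2 * h x \<partial>lborel))"
    using assms t by (intro add_mono mult_left_mono) (auto simp: fisher_le_def)
  also have "\<dots> = a * C + b * D + (\<integral>x. (norm (\<psi> x))\<^sup>2 * (a * f x + b * h x) \<partial>lborel)"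
    using i by (simp add: distrib_left mult.left_commute)
  finally show "2 * (\<integral>x. dvg \<psi> x * (a * f x + b * h x) \<partial>lborel)
     \<le> a * C + b * D + (\<integral>x. (norm (\<psi> x))\<^sup>2 * (a * f x + b * h x) \<partial>lborel)" .
qed

lemma fisher_le_limit:
  assumes f: "integrable lborel f" "f \<in> borel_measurable borel" and h: "\<And>n. integrable lborel (h n)" "\<And>n. h n \<in> borel_measurable borel"
    and C: "\<And>n. fisher_le C (h n)" and lim: "(\<lambda>n. L1dist f (h n)) \<longlonglongrightarrow> 0"
  shows "fisher_le C f"
  unfolding fisher_le_def
proof (intro allI impI)
  fix \<psi> :: "vel \<Rightarrow> vel" assume t: "tfield \<psi>"
  obtain D where D: "\<And>x. \<bar>dvg \<psi> x\<bar> \<le> D" using tfield_dvg_bounded[OF t] by blast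
  obtain N where N: "\<And>x. norm (\<psi> x) \<le> N" using tfield_bounded[OF t] by blast
  have N2: "\<bar>(norm (\<psi> x))\<^sup>2\<bar> \<le> N\<^sup>2" for x using N by (simp add: power_mono)
  have conv: "(\<lambda>n. \<integral>x. \<phi> x * h n x \<partial>lborel) \<longlonglongrightarrow> (\<integral>x. \<phi> x * f x \<partial>lborel)"
    if \<phi>: "\<phi> \<in> borel_measurable borel" "\<And>x. \<bar>\<phi> x\<bar> \<le> K" for \<phi> K
  proof (rule LIM_zero_cancel, rule Lim_null_comparison)
    have i: "integrable lborel (\<lambda>x. \<phi> x * f x)" "integrable lborel (\<lambda>x. \<phi> x * h n x)" for n
      using integrable_mult_bounded[OF f(1), where h=\<phi> and K=K] integrable_mult_bounded[OF h(1), where h=\<phi> and K=K] \<phi>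
      by (simp_all add: mult.commute)
    show "\<forall>\<^sub>F n in sequentially. norm ((\<integral>x. \<phi> x * h n x \<partial>lborel) - (\<integral>x. \<phi> x * f x \<partial>lborel)) \<le> K * L1dist f (h n)"
    proof (rule always_eventually, rule allI)
      fix n
      have "(\<integral>x. \<phi> x * h n x \<partial>lborel) - (\<integral>x. \<phi> x * f x \<partial>lborel) = - (\<integral>x. (f x - h n x) * \<phi> x \<partial>lborel)"
        using i(1) i(2)[of n] by (simp add: right_diff_distrib mult.commute[of _ "\<phi> _"])
      then show "norm ((\<integral>x. \<phi> x * h n x \<partial>lborel) - (\<integral>x. \<phi> x * f x \<partial>lborel)) \<le> K * L1dist f (h n)"
        using integral_mult_bounded_le[where M=lborel and g="\<lambda>x. f x - h n x" and h=\<phi> and K=K] f(1) h(1) \<phi> by (simp add: L1dist_def)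
    qed
    show "(\<lambda>n. K * L1dist f (h n)) \<longlonglongrightarrow> 0" using tendsto_mult_right_zero[OF lim] .
  qed
  have "(\<lambda>n. 2 * (\<integral>x. dvg \<psi> x * h n x \<partial>lborel)) \<longlonglongrightarrow> 2 * (\<integral>x. dvg \<psi> x * f x \<partial>lborel)"
    by (intro tendsto_mult_left conv[OF tfield_dvg_measurable[OF t] D])
  moreover have "(\<lambda>n. C + (\<integral>x. (norm (\<psi> x))\<^sup>2 * h n x \<partial>lborel)) \<longlonglongrightarrow> C + (\<integral>x. (norm (\<psi> x))\<^sup>2 * f x \<partial>lborel)"
    by (intro tendsto_add tendsto_const conv[OF tfield_norm_sq_measurable[OF t] N2])
  ultimately show "2 * (\<integral>x. dvg \<psi> x * f x \<partial>lborel) \<le> C + (\<integral>x. (norm (\<psi> x))\<^sup>2 * f x \<partial>lborel)"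
  proof (rule LIMSEQ_le)
    show "\<exists>N. \<forall>n\<ge>N. 2 * (\<integral>x. dvg \<psi> x * h n x \<partial>lborel) \<le> C + (\<integral>x. (norm (\<psi> x))\<^sup>2 * h n x \<partial>lborel)"
      using C t by (auto simp: fisher_le_def)
  qed
qed

section \<open>Lipschitz continuity of the gain term and one Euler step\<close>

context inelastic_kernel begin

lemma gain_prob_density: "prob_density f \<Longrightarrow> prob_density (gain f)"
  using gain_props[of f] gain_measurable[of f] by (auto simp: prob_density_def)

text \<open>f(v) f(w) - h(v) h(w) telescopes into two products, each with one factor f - h and a
  probability density as the other; the kernel is bounded by 1. Hence the constant 2.\<close>

lemma gain_lipschitz:
  assumes f: "prob_density f" and h: "prob_density h"
  shows "L1dist (gain f) (gain h) \<le> 2 * L1dist f h"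
  unfolding L1dist_def
proof (rule L1_norm_le_by_duality)
  note fD = prob_densityD[OF f] and hD = prob_densityD[OF h]
  note gf = prob_densityD[OF gain_prob_density[OF f]] and gh = prob_densityD[OF gain_prob_density[OF h]]
  note [measurable] = fD(1) hD(1) gf(1) gh(1)
  show "(\<lambda>x. gain f x - gain h x) \<in> borel_measurable borel" by measurable
  show "integrable lborel (\<lambda>x. gain f x - gain h x)" using gf gh by auto
  fix \<phi> :: "vel \<Rightarrow> real" assume c: "continuous_on UNIV \<phi>" and b: "\<And>x. \<bar>\<phi> x\<bar> \<le> 1"
  have m [measurable]: "\<phi> \<in> borel_measurable borel" using c by (rule borel_measurable_continuous_onI)
  let ?K = "\<lambda>p. Kern \<phi> (fst p) (snd p)"
  let ?F = "\<lambda>p. f (fst p) * f (snd p)" and ?H = "\<lambda>p. h (fst p) * h (snd p)"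
  let ?d = "\<lambda>x. \<bar>f x - h x\<bar>"
  have di: "integrable lborel ?d" using fD hD by auto
  have i1: "integrable lborel (\<lambda>p. ?d (fst p) * f (snd p))" and e1: "(\<integral>p. ?d (fst p) * f (snd p) \<partial>lborel) = (\<integral>x. ?d x \<partial>lborel)"
    and i2: "integrable lborel (\<lambda>p. h (fst p) * ?d (snd p))" and e2: "(\<integral>p. h (fst p) * ?d (snd p) \<partial>lborel) = (\<integral>x. ?d x \<partial>lborel)"
    using pair_product_integral[OF _ _ di fD(3)] pair_product_integral[OF _ _ hD(3) di] fD(4) hD(4) by simp_all
  note iF = coll_weak_eq(2)[OF fD m b] and iH = coll_weak_eq(2)[OF hD m b]
  have "(\<integral>x. (gain f x - gain h x) * \<phi> x \<partial>lborel) = (\<integral>x. gain f x * \<phi> x \<partial>lborel) - (\<integral>x. gain h x * \<phi> x \<partial>lborel)"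
    unfolding left_diff_distrib
    by (intro Bochner_Integration.integral_diff integrable_mult_bounded[OF _ _ b] gf gh) measurable
  also have "\<dots> = (\<integral>p. ?K p * ?F p - ?K p * ?H p \<partial>lborel)"
    using iF iH by (simp add: gain_weak[OF fD m b] gain_weak[OF hD m b])
  also have "\<dots> \<le> (\<integral>p. ?d (fst p) * f (snd p) + h (fst p) * ?d (snd p) \<partial>lborel)"
  proof (rule integral_mono_AE)
    show "AE p in lborel. ?K p * ?F p - ?K p * ?H p \<le> ?d (fst p) * f (snd p) + h (fst p) * ?d (snd p)"
    proof (rule AE_mp[OF AE_lborel_off_diagonal], rule AE_I2, rule impI)
      fix p :: "vel \<times> vel" assume "fst p \<noteq> snd p"
      then have K: "\<bar>?K p\<bar> \<le> 1" by (rule Kern_bounded[OF m b])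
      have "?K p * ?F p - ?K p * ?H p = ?K p * (?F p - ?H p)" by (simp add: right_diff_distrib)
      also have "\<dots> \<le> \<bar>?K p\<bar> * \<bar>?F p - ?H p\<bar>" by (metis abs_ge_self abs_mult)
      also have "\<dots> \<le> 1 * \<bar>?F p - ?H p\<bar>" using K by (intro mult_right_mono) auto
      also have "?F p - ?H p = (f (fst p) - h (fst p)) * f (snd p) + h (fst p) * (f (snd p) - h (snd p))"
        by (simp add: algebra_simps)
      also have "1 * \<bar>\<dots>\<bar> \<le> ?d (fst p) * f (snd p) + h (fst p) * ?d (snd p)"
        using abs_triangle_ineq[of "(f (fst p) - h (fst p)) * f (snd p)" "h (fst p) * (f (snd p) - h (snd p))"] fD(2) hD(2)
        by (simp add: abs_mult)
      finally show "?K p * ?F p - ?K p * ?H p \<le> ?d (fst p) * f (snd p) + h (fst p) * ?d (snd p)" .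
    qed
  qed (use iF iH i1 i2 in auto)
  also have "\<dots> = 2 * (\<integral>x. ?d x \<partial>lborel)" using i1 i2 e1 e2 by simp
  finally show "(\<integral>x. (gain f x - gain h x) * \<phi> x \<partial>lborel) \<le> 2 * (\<integral>x. \<bar>f x - h x\<bar> \<partial>lborel)" .
qed

lemma L1dist_integrable:
  assumes "prob_density f" "prob_density h"
  shows "integrable lborel (\<lambda>x. f x - h x)"
  using assms by (auto simp: prob_density_def)

lemma pairing_diff_le:
  assumes f: "prob_density f" and h: "prob_density h" and m: "\<phi> \<in> borel_measurable borel" and b: "\<And>x. \<bar>\<phi> x\<bar> \<le> 1"
  shows "\<bar>(\<integral>x. f x * \<phi> x \<partial>lborel) - (\<integral>x. h x * \<phi> x \<partial>lborel)\<bar> \<le> L1dist f h"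
proof -
  have i: "integrable lborel (\<lambda>x. f x * \<phi> x)" "integrable lborel (\<lambda>x. h x * \<phi> x)"
    using integrable_mult_bounded[OF prob_densityD(3)[OF f], where h=\<phi> and K=1] integrable_mult_bounded[OF prob_densityD(3)[OF h], where h=\<phi> and K=1] m b
    by auto
  show ?thesis
    using integral_mult_bounded_le[OF L1dist_integrable[OF f h], where h=\<phi> and K=1] m b i
    by (simp add: L1dist_def left_diff_distrib)
qed

text \<open>For a step at most 1 this is a convex combination of probability densities; it preserves
  mass and sign, and \<open>fisher_le_combination\<close> applies to it.\<close>

definition euler :: "real \<Rightarrow> (vel \<Rightarrow> real) \<Rightarrow> nat \<Rightarrow> vel \<Rightarrow> real" where
  "euler \<tau> f0 n = ((\<lambda>f x. (1 - \<tau>) * f x + \<tau> * gain f x) ^^ n) f0"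

lemma euler_simps: "euler \<tau> f0 0 = f0"
  "euler \<tau> f0 (Suc n) = (\<lambda>x. (1 - \<tau>) * euler \<tau> f0 n x + \<tau> * gain (euler \<tau> f0 n) x)"
  by (simp_all add: euler_def)

lemma euler_prob_density: "prob_density f0 \<Longrightarrow> 0 \<le> \<tau> \<Longrightarrow> \<tau> \<le> 1 \<Longrightarrow> prob_density (euler \<tau> f0 n)"
proof (induction n)
  case (Suc n)
  then have "prob_density (euler \<tau> f0 n)" "prob_density (gain (euler \<tau> f0 n))" by (auto intro: gain_prob_density)
  with Suc.prems show ?case by (auto simp: euler_simps prob_density_def)
qed (simp add: euler_simps)

lemma euler_fisher_le:
  assumes f0: "prob_density f0" "fisher_le C f0" and \<tau>: "0 \<le> \<tau>" "\<tau> \<le> 1"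
  shows "fisher_le ((1 + \<tau> * ((2 / (1 + e))\<^sup>2 - 1)) ^ n * C) (euler \<tau> f0 n)"
proof (induction n)
  case (Suc n)
  have d: "prob_density (euler \<tau> f0 n)" by (rule euler_prob_density[OF f0(1) \<tau>])
  note D = prob_densityD[OF d] and G = prob_densityD[OF gain_prob_density[OF d]]
  let ?C = "(1 + \<tau> * ((2 / (1 + e))\<^sup>2 - 1)) ^ n * C"
  have "fisher_le ((1 - \<tau>) * ?C + \<tau> * ((2 / (1 + e))\<^sup>2 * ?C)) (euler \<tau> f0 (Suc n))"
    unfolding euler_simps using \<tau> D G Suc
    by (intro fisher_le_combination fisher_le_gain) auto
  also have "(1 - \<tau>) * ?C + \<tau> * ((2 / (1 + e))\<^sup>2 * ?C) = (1 + \<tau> * ((2 / (1 + e))\<^sup>2 - 1)) ^ Suc n * C"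
    by (simp add: algebra_simps)
  finally show ?case .
qed (simp add: euler_simps f0)

end

section \<open>Convergence of the scheme to the solution\<close>

locale weak_solution = inelastic_kernel +
  fixes f :: "real \<Rightarrow> vel \<Rightarrow> real"
  assumes sol: "solves_E1 e B f" and f0: "(\<integral>x. f 0 x \<partial>lborel) = 1"
begin

lemma sol_deriv:
  assumes "continuous_on UNIV \<phi>" "\<And>x. \<bar>\<phi> x\<bar> \<le> M" "t \<ge> 0"
  shows "((\<lambda>s. \<integral>v. f s v * \<phi> v \<partial>lborel) has_real_derivative coll_weak e B (f t) \<phi>) (at t within {0..})"
proof -
  have "bounded (range \<phi>)" using assms(2) by (auto simp: bounded_iff)
  then show ?thesis using sol assms unfolding solves_E1_def by blast
qed

text \<open>Testing with the constant 1, on which the collision term vanishes, conserves the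
  mass.\<close>

lemma sol_prob_density: "t \<ge> 0 \<Longrightarrow> prob_density (f t)"
proof -
  assume t: "t \<ge> 0"
  have "((\<lambda>s. \<integral>v. f s v * 1 \<partial>lborel) has_field_derivative 0) (at s within {0..})" if "s \<in> {0..}" for s
    using sol_deriv[of "\<lambda>_. 1" 1 s] that by (simp add: coll_weak_def)
  from has_field_derivative_zero_constant[OF convex_real_interval(1) this]
  obtain c where "\<And>s. s \<ge> 0 \<Longrightarrow> (\<integral>v. f s v * 1 \<partial>lborel) = c" by auto
  from this[of 0] this[of t] f0 t have "(\<integral>v. f t v \<partial>lborel) = 1" by simp
  then show ?thesis using sol t by (auto simp: solves_E1_def prob_density_def)
qed

lemma sol_deriv_gain:
  assumes c: "continuous_on UNIV \<phi>" and b: "\<And>x. \<bar>\<phi> x\<bar> \<le> 1" and t: "t \<ge> 0"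
  shows "((\<lambda>s. \<integral>v. f s v * \<phi> v \<partial>lborel) has_real_derivative
     (\<integral>v. gain (f t) v * \<phi> v \<partial>lborel) - (\<integral>v. f t v * \<phi> v \<partial>lborel)) (at t within {0..})"
proof -
  have m: "\<phi> \<in> borel_measurable borel" using c by (rule borel_measurable_continuous_onI)
  note D = prob_densityD[OF sol_prob_density[OF t]]
  show ?thesis using sol_deriv[OF c b t] unfolding coll_weak_eq(1)[OF D m b] gain_weak[OF D m b] .
qed

text \<open>The solution is differentiable only after pairing with a test function, so the mean
  value theorem is applied to the scalar pairing. The intermediate time r depends on phi, which
  duality tolerates because all later bounds are uniform in r.\<close>

lemma sol_mvt:
  assumes c: "continuous_on UNIV \<phi>" and b: "\<And>x. \<bar>\<phi> x\<bar> \<le> 1" and s: "0 \<le> s" "s < t"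
  obtains r where "s < r" "r < t" "(\<integral>v. f t v * \<phi> v \<partial>lborel) - (\<integral>v. f s v * \<phi> v \<partial>lborel)
     = ((\<integral>v. gain (f r) v * \<phi> v \<partial>lborel) - (\<integral>v. f r v * \<phi> v \<partial>lborel)) * (t - s)"
proof -
  have "\<exists>r\<in>{s<..<t}. (\<integral>v. f t v * \<phi> v \<partial>lborel) - (\<integral>v. f s v * \<phi> v \<partial>lborel)
     = (\<lambda>h. ((\<integral>v. gain (f r) v * \<phi> v \<partial>lborel) - (\<integral>v. f r v * \<phi> v \<partial>lborel)) * h) (t - s)"
  proof (rule mvt_simple[OF s(2)])
    fix r assume r: "s \<le> r" "r \<le> t"
    have "((\<lambda>s. \<integral>v. f s v * \<phi> v \<partial>lborel) has_real_derivative
     (\<integral>v. gain (f r) v * \<phi> v \<partial>lborel) - (\<integral>v. f r v * \<phi> v \<partial>lborel)) (at r within {s..t})"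
      using r s by (intro has_field_derivative_subset[OF sol_deriv_gain[OF c b]]) auto
    then show "((\<lambda>s. \<integral>v. f s v * \<phi> v \<partial>lborel) has_derivative
     (\<lambda>h. ((\<integral>v. gain (f r) v * \<phi> v \<partial>lborel) - (\<integral>v. f r v * \<phi> v \<partial>lborel)) * h)) (at r within {s..t})"
      by (rule has_field_derivative_imp_has_derivative)
  qed
  then show thesis using that by auto
qed

lemma pairing_le_1:
  assumes f: "prob_density h" and m: "\<phi> \<in> borel_measurable borel" and b: "\<And>x. \<bar>\<phi> x\<bar> \<le> 1"
  shows "\<bar>\<integral>x. h x * \<phi> x \<partial>lborel\<bar> \<le> 1"
  using integral_mult_bounded_le[OF prob_densityD(3)[OF f], where h=\<phi> and K=1] m b prob_densityD[OF f] by simp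

text \<open>Gain and loss both have mass 1, so each pairing with |phi| \<le> 1 moves with speed at
  most 2.\<close>

lemma sol_lipschitz: "0 \<le> s \<Longrightarrow> s \<le> t \<Longrightarrow> L1dist (f t) (f s) \<le> 2 * (t - s)"
proof (cases "s = t")
  case False
  assume st: "0 \<le> s" "s \<le> t"
  note fs = sol_prob_density[OF st(1)] and ft = sol_prob_density[OF order_trans[OF st]]
  show ?thesis unfolding L1dist_def
  proof (rule L1_norm_le_by_duality)
    show "(\<lambda>x. f t x - f s x) \<in> borel_measurable borel" "integrable lborel (\<lambda>x. f t x - f s x)"
      using prob_densityD[OF fs] prob_densityD[OF ft] by auto
    fix \<phi> :: "vel \<Rightarrow> real" assume c: "continuous_on UNIV \<phi>" and b: "\<And>x. \<bar>\<phi> x\<bar> \<le> 1"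
    have m: "\<phi> \<in> borel_measurable borel" using c by (rule borel_measurable_continuous_onI)
    have "s < t" using st False by simp
    from sol_mvt[OF c b st(1) this] obtain r where r: "s < r" and eq: "(\<integral>v. f t v * \<phi> v \<partial>lborel) - (\<integral>v. f s v * \<phi> v \<partial>lborel)
     = ((\<integral>v. gain (f r) v * \<phi> v \<partial>lborel) - (\<integral>v. f r v * \<phi> v \<partial>lborel)) * (t - s)"
      by blast
    have fr: "prob_density (f r)" using r st by (intro sol_prob_density) auto
    have "(\<integral>x. (f t x - f s x) * \<phi> x \<partial>lborel) = (\<integral>v. f t v * \<phi> v \<partial>lborel) - (\<integral>v. f s v * \<phi> v \<partial>lborel)"
      using integrable_mult_bounded[OF prob_densityD(3)[OF fs], where h=\<phi> and K=1] integrable_mult_bounded[OF prob_densityD(3)[OF ft], where h=\<phi> and K=1] m b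
      by (simp add: left_diff_distrib)
    also have "\<dots> \<le> 2 * (t - s)" unfolding eq
      using pairing_le_1[OF fr m b] pairing_le_1[OF gain_prob_density[OF fr] m b] st
      by (intro mult_right_mono) auto
    finally show "(\<integral>x. (f t x - f s x) * \<phi> x \<partial>lborel) \<le> 2 * (t - s)" .
  qed
qed (simp add: L1dist_def)

text \<open>Within one step the right side is evaluated at r instead of t. The densities differ by
  at most 2 \<tau>, and the gain term doubles this while the loss term does not: 4 + 2 = 6.\<close>

lemma euler_consistency:
  assumes t: "0 \<le> t" and \<tau>: "0 < \<tau>"
  shows "(\<integral>x. \<bar>f (t + \<tau>) x - ((1 - \<tau>) * f t x + \<tau> * gain (f t) x)\<bar> \<partial>lborel) \<le> 6 * \<tau>\<^sup>2"
proof (rule L1_norm_le_by_duality)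
  note ft = sol_prob_density[OF t] 
  have fu: "prob_density (f (t + \<tau>))" using t \<tau> by (intro sol_prob_density) auto
  note D = prob_densityD[OF ft] prob_densityD[OF fu] prob_densityD[OF gain_prob_density[OF ft]]
  note [measurable] = D(1) D(5) D(9)
  show "(\<lambda>x. f (t + \<tau>) x - ((1 - \<tau>) * f t x + \<tau> * gain (f t) x)) \<in> borel_measurable borel" by measurable
  show "integrable lborel (\<lambda>x. f (t + \<tau>) x - ((1 - \<tau>) * f t x + \<tau> * gain (f t) x))" using D by auto
  fix \<phi> :: "vel \<Rightarrow> real" assume c: "continuous_on UNIV \<phi>" and b: "\<And>x. \<bar>\<phi> x\<bar> \<le> 1"
  have m [measurable]: "\<phi> \<in> borel_measurable borel" using c by (rule borel_measurable_continuous_onI)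
  have i: "integrable lborel (\<lambda>x. f t x * \<phi> x)" "integrable lborel (\<lambda>x. f (t + \<tau>) x * \<phi> x)" "integrable lborel (\<lambda>x. gain (f t) x * \<phi> x)"
    using integrable_mult_bounded[OF D(3), where h=\<phi> and K=1] integrable_mult_bounded[OF D(7), where h=\<phi> and K=1]
      integrable_mult_bounded[OF D(11), where h=\<phi> and K=1] b by auto
  let ?p = "\<lambda>h. (\<integral>v. h v * \<phi> v \<partial>lborel)"
  have "t < t + \<tau>" using \<tau> by simp
  from sol_mvt[OF c b t this] obtain r where r: "t < r" "r < t + \<tau>" and eq: "?p (f (t + \<tau>)) - ?p (f t) = (?p (gain (f r)) - ?p (f r)) * (t + \<tau> - t)"
    by blast
  have fr: "prob_density (f r)" using r t by (intro sol_prob_density) auto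
  have l: "L1dist (f r) (f t) \<le> 2 * \<tau>" using sol_lipschitz[of t r] t r by simp
  have "(\<integral>x. (f (t + \<tau>) x - ((1 - \<tau>) * f t x + \<tau> * gain (f t) x)) * \<phi> x \<partial>lborel)
      = ?p (f (t + \<tau>)) - ((1 - \<tau>) * ?p (f t) + \<tau> * ?p (gain (f t)))"
    using i by (simp add: left_diff_distrib distrib_right mult.assoc)
  also have "\<dots> = \<tau> * ((?p (gain (f r)) - ?p (gain (f t))) - (?p (f r) - ?p (f t)))"
    using eq by (simp add: algebra_simps)
  also have "\<dots> \<le> \<tau> * (4 * \<tau> + 2 * \<tau>)"
  proof (rule mult_left_mono)
    have "\<bar>?p (gain (f r)) - ?p (gain (f t))\<bar> \<le> 4 * \<tau>"
      using pairing_diff_le[OF gain_prob_density[OF fr] gain_prob_density[OF ft] m b] gain_lipschitz[OF fr ft] l by linarith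
    moreover have "\<bar>?p (f r) - ?p (f t)\<bar> \<le> 2 * \<tau>" using pairing_diff_le[OF fr ft m b] l by linarith
    ultimately show "(?p (gain (f r)) - ?p (gain (f t))) - (?p (f r) - ?p (f t)) \<le> 4 * \<tau> + 2 * \<tau>" by linarith
  qed (use \<tau> in simp)
  finally show "(\<integral>x. (f (t + \<tau>) x - ((1 - \<tau>) * f t x + \<tau> * gain (f t) x)) * \<phi> x \<partial>lborel) \<le> 6 * \<tau>\<^sup>2"
    by (simp add: power2_eq_square algebra_simps)
qed

text \<open>The step map has Lipschitz constant (1 - \<tau>) + 2 \<tau> = 1 + \<tau>. The bound is
  the exact solution of the recursion a(n+1) = (1 + \<tau>) a(n) + 6 \<tau>^2 with a(0) = 0.\<close>

lemma euler_error:
  assumes \<tau>: "0 < \<tau>" "\<tau> \<le> 1"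
  shows "L1dist (f (real n * \<tau>)) (euler \<tau> (f 0) n) \<le> 6 * \<tau> * ((1 + \<tau>) ^ n - 1)"
proof (induction n)
  case 0
  show ?case by (simp add: euler_simps L1dist_def)
next
  case (Suc n)
  let ?t = "real n * \<tau>"
  have t: "?t \<ge> 0" using \<tau> by simp
  have s: "real (Suc n) * \<tau> = ?t + \<tau>" by (simp add: algebra_simps)
  let ?E = "euler \<tau> (f 0) n"
  have E: "prob_density ?E" using \<tau> by (intro euler_prob_density sol_prob_density) auto
  have ft: "prob_density (f ?t)" and fu: "prob_density (f (?t + \<tau>))"
    using t \<tau> by (auto intro: sol_prob_density)
  note gE = gain_prob_density[OF E] and gf = gain_prob_density[OF ft]
  note D = prob_densityD(3)[OF E] prob_densityD(3)[OF ft] prob_densityD(3)[OF fu] prob_densityD(3)[OF gE] prob_densityD(3)[OF gf]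
  have "L1dist (f (?t + \<tau>)) (euler \<tau> (f 0) (Suc n))
    \<le> (\<integral>x. \<bar>f (?t + \<tau>) x - ((1 - \<tau>) * f ?t x + \<tau> * gain (f ?t) x)\<bar>
        + ((1 - \<tau>) * \<bar>f ?t x - ?E x\<bar> + \<tau> * \<bar>gain (f ?t) x - gain ?E x\<bar>) \<partial>lborel)"
    unfolding L1dist_def euler_simps
  proof (rule integral_mono)
    fix x
    define A p q where "A = f (?t + \<tau>) x - ((1 - \<tau>) * f ?t x + \<tau> * gain (f ?t) x)"
      and "p = f ?t x - ?E x" and "q = gain (f ?t) x - gain ?E x"
    have "f (?t + \<tau>) x - ((1 - \<tau>) * ?E x + \<tau> * gain ?E x) = A + ((1 - \<tau>) * p + \<tau> * q)"
      by (simp add: A_def p_def q_def algebra_simps)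
    moreover have "\<bar>A + ((1 - \<tau>) * p + \<tau> * q)\<bar> \<le> \<bar>A\<bar> + (\<bar>(1 - \<tau>) * p\<bar> + \<bar>\<tau> * q\<bar>)" by arith
    moreover have "\<bar>(1 - \<tau>) * p\<bar> = (1 - \<tau>) * \<bar>p\<bar>" "\<bar>\<tau> * q\<bar> = \<tau> * \<bar>q\<bar>" using \<tau> by (simp_all add: abs_mult)
    ultimately have "\<bar>f (?t + \<tau>) x - ((1 - \<tau>) * ?E x + \<tau> * gain ?E x)\<bar> \<le> \<bar>A\<bar> + ((1 - \<tau>) * \<bar>p\<bar> + \<tau> * \<bar>q\<bar>)"
      by (simp only:)
    then show "\<bar>f (?t + \<tau>) x - ((1 - \<tau>) * ?E x + \<tau> * gain ?E x)\<bar>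
      \<le> \<bar>f (?t + \<tau>) x - ((1 - \<tau>) * f ?t x + \<tau> * gain (f ?t) x)\<bar>
        + ((1 - \<tau>) * \<bar>f ?t x - ?E x\<bar> + \<tau> * \<bar>gain (f ?t) x - gain ?E x\<bar>)"
      unfolding A_def p_def q_def .
  qed (use D in auto)
  also have "\<dots> = (\<integral>x. \<bar>f (?t + \<tau>) x - ((1 - \<tau>) * f ?t x + \<tau> * gain (f ?t) x)\<bar> \<partial>lborel)
        + ((1 - \<tau>) * L1dist (f ?t) ?E + \<tau> * L1dist (gain (f ?t)) (gain ?E))"
    unfolding L1dist_def using D by simp
  also have "\<dots> \<le> 6 * \<tau>\<^sup>2 + ((1 - \<tau>) * L1dist (f ?t) ?E + \<tau> * (2 * L1dist (f ?t) ?E))"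
    using euler_consistency[OF t \<tau>(1)] gain_lipschitz[OF ft E] \<tau> by (intro add_mono mult_left_mono) auto
  also have "\<dots> = 6 * \<tau>\<^sup>2 + (1 + \<tau>) * L1dist (f ?t) ?E" by (simp add: algebra_simps)
  also have "\<dots> \<le> 6 * \<tau>\<^sup>2 + (1 + \<tau>) * (6 * \<tau> * ((1 + \<tau>) ^ n - 1))"
    using Suc \<tau> by (intro add_left_mono mult_left_mono) auto
  also have "\<dots> = 6 * \<tau> * ((1 + \<tau>) ^ Suc n - 1)" by (simp add: algebra_simps power2_eq_square)
  finally show ?case by (simp only: s)
qed

lemma one_plus_div_power_le_exp: "0 \<le> x \<Longrightarrow> (1 + x / real (Suc n)) ^ Suc n \<le> exp x"
proof -
  assume x: "0 \<le> x"
  have "(1 + x / real (Suc n)) ^ Suc n \<le> exp (x / real (Suc n)) ^ Suc n"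
    using x by (intro power_mono exp_ge_add_one_self) auto
  also have "\<dots> = exp x" by (simp add: exp_of_nat_mult[symmetric] del: of_nat_Suc power_Suc)
  finally show ?thesis .
qed

theorem fisher_le_solution:
  assumes C: "fisher_le C (f 0)" and t: "t \<ge> 0"
  shows "fisher_le (exp (((2 / (1 + e))\<^sup>2 - 1) * t) * C) (f t)"
proof (cases "t = 0")
  case False
  define h where "h n = euler (t / real (Suc n)) (f 0) (Suc n)" for n
  \<comment> \<open>Shifting the index by n0 makes the step t / (n + n0 + 1) at most 1 for every
    n.\<close>
  obtain n0 where n0: "real n0 \<ge> t" using real_arch_simple by blast
  define m where "m n = n + n0" for n
  have \<tau>: "0 < t / real (Suc (m n))" "t / real (Suc (m n)) \<le> 1" for n
    using t False n0 by (auto simp: m_def)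
  have f0d: "prob_density (f 0)" by (rule sol_prob_density) simp
  have hd: "prob_density (h (m n))" for n
    unfolding h_def using \<tau>[of n] by (intro euler_prob_density f0d) auto
  have k: "(2 / (1 + e))\<^sup>2 - 1 \<ge> 0"
    using one_le_power[of "2 / (1 + e)" 2] e by (simp add: divide_simps)
  show ?thesis
  proof (rule fisher_le_limit[where h="\<lambda>n. h (m n)"])
    fix n
    have "fisher_le ((1 + t / real (Suc (m n)) * ((2 / (1 + e))\<^sup>2 - 1)) ^ Suc (m n) * C) (h (m n))"
      unfolding h_def using \<tau>[of n] by (intro euler_fisher_le f0d C) auto
    moreover have "(1 + t / real (Suc (m n)) * ((2 / (1 + e))\<^sup>2 - 1)) ^ Suc (m n) * C \<le> exp (((2 / (1 + e))\<^sup>2 - 1) * t) * C"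
      using one_plus_div_power_le_exp[of "((2 / (1 + e))\<^sup>2 - 1) * t" "m n"] k t fisher_le_nonneg[OF C]
      by (intro mult_right_mono) (auto simp: mult.commute)
    ultimately show "fisher_le (exp (((2 / (1 + e))\<^sup>2 - 1) * t) * C) (h (m n))"
      unfolding fisher_le_def by (meson add_right_mono order_trans)
  next
    show "(\<lambda>n. L1dist (f t) (h (m n))) \<longlonglongrightarrow> 0"
    proof (rule Lim_null_comparison)
      show "\<forall>\<^sub>F n in sequentially. norm (L1dist (f t) (h (m n))) \<le> 6 * t * exp t * inverse (real (Suc n))"
      proof (rule always_eventually, rule allI)
        fix n
        have "L1dist (f t) (h (m n)) \<le> 6 * (t / real (Suc (m n))) * ((1 + t / real (Suc (m n))) ^ Suc (m n) - 1)"
          using euler_error[OF \<tau>(1)[of n] \<tau>(2)[of n], of "Suc (m n)"] by (simp add: h_def del: of_nat_Suc power_Suc)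
        also have "\<dots> \<le> 6 * (t / real (Suc n)) * exp t"
        proof (rule mult_mono)
          show "6 * (t / real (Suc (m n))) \<le> 6 * (t / real (Suc n))"
            using t by (intro mult_left_mono divide_left_mono) (auto simp: m_def)
          show "(1 + t / real (Suc (m n))) ^ Suc (m n) - 1 \<le> exp t"
            using one_plus_div_power_le_exp[OF t, of "m n"] by linarith
          show "0 \<le> (1 + t / real (Suc (m n))) ^ Suc (m n) - 1"
            using one_le_power[of "1 + t / real (Suc (m n))" "Suc (m n)"] t by (simp del: of_nat_Suc power_Suc)
        qed (use t in simp)
        finally show "norm (L1dist (f t) (h (m n))) \<le> 6 * t * exp t * inverse (real (Suc n))"
          by (simp add: L1dist_def divide_inverse mult_ac)
      qed
      show "(\<lambda>n. 6 * t * exp t * inverse (real (Suc n))) \<longlonglongrightarrow> 0"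
        using tendsto_mult_right_zero[OF LIMSEQ_inverse_real_of_nat] .
    qed
  qed (use prob_densityD[OF hd] prob_densityD[OF sol_prob_density[OF t]] in auto)
qed (use C in simp)

end

section \<open>Translations and mollification\<close>

lemma integrable_nonneg_bound:
  fixes f g :: "'a \<Rightarrow> real"
  assumes "integrable M g" "f \<in> borel_measurable M" "\<And>x. 0 \<le> f x" "\<And>x. f x \<le> g x"
  shows "integrable M f"
  using assms(1,2)
proof (rule Bochner_Integration.integrable_bound)
  show "AE x in M. norm (f x) \<le> norm (g x)"
    using assms(3,4) by (intro AE_I2) (metis abs_ge_self abs_of_nonneg order_trans real_norm_def)
qed

lemma tfield_real_integrable:
  fixes \<phi> :: "vel \<Rightarrow> 'b::euclidean_space"
  assumes c: "continuous_on UNIV \<phi>" and z: "\<And>x. norm x > R \<Longrightarrow> \<phi> x = 0"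
  shows "integrable lborel \<phi>"
proof -
  have "set_integrable lborel (cball 0 R) \<phi>"
    unfolding set_integrable_def
    by (rule borel_integrable_compact[OF compact_cball continuous_on_subset[OF c subset_UNIV]])
  moreover have "(\<lambda>x. indicat_real (cball 0 R) x *\<^sub>R \<phi> x) = \<phi>" using z by (force simp: indicator_def)
  ultimately show ?thesis by (simp add: set_integrable_def)
qed

lemma integral_lborel_shift:
  fixes h :: "vel \<Rightarrow> 'b::euclidean_space"
  assumes "h \<in> borel_measurable borel"
  shows "(\<integral>x. h (x + c) \<partial>lborel) = (\<integral>x. h x \<partial>lborel)" "(\<integral>x. h (c - x) \<partial>lborel) = (\<integral>x. h x \<partial>lborel)"
    "integrable lborel h \<Longrightarrow> integrable lborel (\<lambda>x. h (x + c))" "integrable lborel h \<Longrightarrow> integrable lborel (\<lambda>x. h (c - x))"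
proof -
  note [measurable] = assms
  have p: "distr lborel borel (\<lambda>x. x + c) = (lborel :: vel measure)"
  proof -
    have "(\<lambda>x. x + c) = (+) c" by (auto simp: add.commute)
    then show ?thesis using lborel_distr_plus[of c] by simp
  qed
  have o: "orthogonal_transformation (uminus :: vel \<Rightarrow> vel)"
    by (simp add: orthogonal_transformation_def linear_uminus)
  have m: "distr lborel borel (\<lambda>x. c - x) = (lborel :: vel measure)"
  proof -
    have "distr lborel borel (\<lambda>x. c - x) = distr (distr lborel borel uminus) borel (\<lambda>x :: vel. c + x)"
      by (subst distr_distr) (auto simp: comp_def)
    also have "\<dots> = lborel" using lborel_distr_plus[of c] by (simp add: lborel_distr_orthogonal[OF o])
    finally show ?thesis .
  qed
  show "(\<integral>x. h (x + c) \<partial>lborel) = (\<integral>x. h x \<partial>lborel)" by (subst (2) p[symmetric], subst integral_distr) auto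
  show "(\<integral>x. h (c - x) \<partial>lborel) = (\<integral>x. h x \<partial>lborel)" by (subst (2) m[symmetric], subst integral_distr) auto
  show "integrable lborel (\<lambda>x. h (x + c))" if "integrable lborel h"
    using that by (subst (asm) p[symmetric], subst (asm) integrable_distr_eq) auto
  show "integrable lborel (\<lambda>x. h (c - x))" if "integrable lborel h"
    using that by (subst (asm) m[symmetric], subst (asm) integrable_distr_eq) auto
qed

text \<open>The difference quotients have integral 0 by translation invariance, and the Lipschitz
  bound on a fixed ball dominates them in the limit.\<close>

lemma integral_frechet_derivative_zero:
  fixes \<phi> :: "vel \<Rightarrow> real"
  assumes t: "tfield \<phi>"
  shows "(\<integral>x. frechet_derivative \<phi> (at x) b \<partial>lborel) = 0"
    "integrable lborel (\<lambda>x. frechet_derivative \<phi> (at x) b)"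
proof -
  obtain R where R: "R > 0" "\<And>x. norm x > R \<Longrightarrow> \<phi> x = 0" "\<And>x. norm x > R \<Longrightarrow> frechet_derivative \<phi> (at x) = (\<lambda>_. 0)"
    using tfield_vanish[OF t] by metis
  obtain L where L: "L > 0" "\<And>x y. norm (\<phi> x - \<phi> y) \<le> L * norm (x - y)" using tfield_lipschitz[OF t] by metis
  have c1: "c1_on UNIV \<phi>" using t by (simp add: tfield_def)
  note pc = tfield_continuous[OF t]
  have pm [measurable]: "\<phi> \<in> borel_measurable borel" using pc by (rule borel_measurable_continuous_onI)
  have pi: "integrable lborel \<phi>" using pc R(2) by (rule tfield_real_integrable)
  have dc: "continuous_on UNIV (\<lambda>x. frechet_derivative \<phi> (at x) b)" using c1 by (simp add: c1_on_def)
  show "integrable lborel (\<lambda>x. frechet_derivative \<phi> (at x) b)"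
    by (rule tfield_real_integrable[OF dc, of R]) (simp add: R(3))
  let ?h = "\<lambda>n. inverse (real (Suc n))"
  let ?q = "\<lambda>n x. (\<phi> (x + ?h n *\<^sub>R b) - \<phi> x) / ?h n"
  have "(\<lambda>n. \<integral>x. ?q n x \<partial>lborel) \<longlonglongrightarrow> (\<integral>x. frechet_derivative \<phi> (at x) b \<partial>lborel)"
  proof (rule integral_dominated_convergence[where w="\<lambda>x. L * norm b * indicator (cball 0 (R + norm b)) x"])
    show "(\<lambda>x. frechet_derivative \<phi> (at x) b) \<in> borel_measurable lborel"
      using borel_measurable_continuous_onI[OF dc] by simp
    show "integrable lborel (\<lambda>x :: vel. L * norm b * indicator (cball 0 (R + norm b)) x)"
      using emeasure_compact_finite[of "cball (0 :: vel) (R + norm b)"] by simp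
    show "AE x in lborel. (\<lambda>n. ?q n x) \<longlonglongrightarrow> frechet_derivative \<phi> (at x) b"
    proof (rule AE_I2)
      fix x
      have l: "linear (frechet_derivative \<phi> (at x))" using c1_on_has_derivative[OF c1] has_derivative_linear by blast
      have a: "((\<lambda>s. x + s *\<^sub>R b) has_derivative (\<lambda>s. s *\<^sub>R b)) (at (0::real))" by (auto intro!: derivative_eq_intros)
      have "(\<phi> has_derivative frechet_derivative \<phi> (at x)) (at (x + 0 *\<^sub>R b))" using c1_on_has_derivative[OF c1] by simp
      from has_derivative_compose[OF a this]
      have "((\<lambda>s. \<phi> (x + s *\<^sub>R b)) has_field_derivative frechet_derivative \<phi> (at x) b) (at 0)"
        by (simp add: has_field_derivative_def linear_cmul[OF l] mult_commute_abs)
      then have "(\<lambda>s. (\<phi> (x + s *\<^sub>R b) - \<phi> x) / s) \<midarrow>0\<rightarrow> frechet_derivative \<phi> (at x) b" by (simp add: DERIV_def)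
      moreover have "filterlim ?h (at 0) sequentially"
        using LIMSEQ_inverse_real_of_nat by (auto simp: filterlim_at intro!: always_eventually)
      ultimately show "(\<lambda>n. ?q n x) \<longlonglongrightarrow> frechet_derivative \<phi> (at x) b" by (rule filterlim_compose)
    qed
    show "AE x in lborel. norm (?q n x) \<le> L * norm b * indicator (cball 0 (R + norm b)) x" for n
    proof (rule AE_I2)
      fix x
      have h: "0 < ?h n" "?h n \<le> 1" by (auto simp: divide_simps)
      show "norm (?q n x) \<le> L * norm b * indicator (cball 0 (R + norm b)) x"
      proof (cases "norm x \<le> R + norm b")
        case True
        have "\<bar>\<phi> (x + ?h n *\<^sub>R b) - \<phi> x\<bar> \<le> L * (?h n * norm b)" using L(2)[of "x + ?h n *\<^sub>R b" x] h by simp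
        then have "norm (?q n x) \<le> L * norm b" using h(1) unfolding real_norm_def abs_divide abs_of_pos[OF h(1)]
          by (simp only: pos_divide_le_eq mult_ac)
        with True show ?thesis by simp
      next
        case False
        have "norm x \<le> norm (x + ?h n *\<^sub>R b) + norm (?h n *\<^sub>R b)" by (metis add_diff_cancel norm_triangle_ineq4)
        moreover have "norm (?h n *\<^sub>R b) \<le> norm b" using h by (simp add: mult_left_le_one_le)
        ultimately have "norm (x + ?h n *\<^sub>R b) > R" using False by linarith
        then have "\<phi> (x + ?h n *\<^sub>R b) = 0" by (rule R(2))
        moreover have "\<phi> x = 0" using False norm_ge_zero[of b] by (intro R(2)) linarith
        ultimately show ?thesis using False by simp
      qed
    qed
  qed simp
  moreover have "(\<integral>x. ?q n x \<partial>lborel) = 0" for n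
    using integral_lborel_shift(1,3)[OF pm, of "?h n *\<^sub>R b"] pi by simp
  ultimately show "(\<integral>x. frechet_derivative \<phi> (at x) b \<partial>lborel) = 0" using LIMSEQ_unique tendsto_const by (metis (no_types, lifting) ext)
qed

lemma tfield_inner: "tfield \<psi> \<Longrightarrow> tfield (\<lambda>x. \<psi> x \<bullet> b)"
  unfolding tfield_def by (auto intro!: c1_on_inner elim: bounded_subset)

lemma frechet_inner:
  assumes "\<psi> differentiable (at x)"
  shows "frechet_derivative (\<lambda>x. \<psi> x \<bullet> b) (at x) = (\<lambda>v. frechet_derivative \<psi> (at x) v \<bullet> b)"
  using assms by (intro frechet_eqI has_derivative_inner_left) (simp add: frechet_derivative_works)

lemma integral_dvg_zero:
  fixes \<psi> :: "vel \<Rightarrow> vel"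
  assumes t: "tfield \<psi>"
  shows "(\<integral>x. dvg \<psi> x \<partial>lborel) = 0"
proof -
  have "dvg \<psi> = (\<lambda>x. \<Sum>b\<in>Basis. frechet_derivative (\<lambda>x. \<psi> x \<bullet> b) (at x) b)"
    using t by (intro ext) (simp add: dvg_def frechet_inner tfield_def c1_on_def)
  then show ?thesis
    using integral_frechet_derivative_zero[OF tfield_inner[OF t]] by simp
qed

section \<open>Approximation and continuity of translations in L^p\<close>

lemma power_sum3_le:
  fixes a b c :: real
  shows "\<bar>a + b + c\<bar> ^ p \<le> 3 ^ p * (\<bar>a\<bar> ^ p + \<bar>b\<bar> ^ p + \<bar>c\<bar> ^ p)"
proof -
  let ?m = "max \<bar>a\<bar> (max \<bar>b\<bar> \<bar>c\<bar>)"
  have "\<bar>a + b + c\<bar> ^ p \<le> (3 * ?m) ^ p" by (intro power_mono) auto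
  also have "\<dots> = 3 ^ p * ?m ^ p" by (rule power_mult_distrib)
  also have "?m ^ p \<le> \<bar>a\<bar> ^ p + \<bar>b\<bar> ^ p + \<bar>c\<bar> ^ p"
    using zero_le_power[of "\<bar>a\<bar>" p] zero_le_power[of "\<bar>b\<bar>" p] zero_le_power[of "\<bar>c\<bar>" p]
    by (auto simp: max_def)
  finally show ?thesis by simp
qed

text \<open>Truncating in space and in value makes u bounded with bounded support; a continuous
  approximation of this is multiplied by a radial cutoff. Both steps are dominated convergence, each
  with error below eta / (2 * 3^p), which the crude constant of \<open>power_sum3_le\<close> turns
  into eta.\<close>

lemma Lp_compact_approximation:
  fixes u :: "vel \<Rightarrow> real"
  assumes um [measurable]: "u \<in> borel_measurable borel" and ui: "integrable lborel (\<lambda>x. \<bar>u x\<bar> ^ p)" and p: "p > 0" and \<eta>: "\<eta> > 0"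
  obtains g R where "continuous_on UNIV g" "R > 0" "\<And>x. norm x > R \<Longrightarrow> g x = 0" "(\<integral>x. \<bar>u x - g x\<bar> ^ p \<partial>lborel) < \<eta>"
    "integrable lborel (\<lambda>x. \<bar>u x - g x\<bar> ^ p)"
proof -
  define cut where "cut n x = (if norm x \<le> real n \<and> \<bar>u x\<bar> \<le> real n then u x else 0)" for n x
  have cm [measurable]: "cut n \<in> borel_measurable borel" for n unfolding cut_def[abs_def] by measurable
  have "(\<lambda>n. \<integral>x. \<bar>u x - cut n x\<bar> ^ p \<partial>lborel) \<longlonglongrightarrow> (\<integral>x. 0 \<partial>(lborel :: vel measure))"
  proof (rule integral_dominated_convergence[OF _ _ ui])
    show "AE x in lborel. (\<lambda>n. \<bar>u x - cut n x\<bar> ^ p) \<longlonglongrightarrow> 0"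
    proof (rule AE_I2)
      fix x
      obtain n0 where "real n0 \<ge> max (norm x) \<bar>u x\<bar>" using real_arch_simple by blast
      then have "\<forall>\<^sub>F n in sequentially. \<bar>u x - cut n x\<bar> ^ p = 0"
        using p by (intro eventually_sequentiallyI[of n0]) (auto simp: cut_def)
      then show "(\<lambda>n. \<bar>u x - cut n x\<bar> ^ p) \<longlonglongrightarrow> 0" by (rule tendsto_eventually)
    qed
    show "AE x in lborel. norm (\<bar>u x - cut n x\<bar> ^ p) \<le> \<bar>u x\<bar> ^ p" for n
      by (intro AE_I2) (auto simp: cut_def power_mono p)
  qed measurable
  then have "\<forall>\<^sub>F n in sequentially. (\<integral>x. \<bar>u x - cut n x\<bar> ^ p \<partial>lborel) < \<eta> / (2 * 3 ^ p)"
    using \<eta> by (intro order_tendstoD) auto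
  then obtain n where n: "(\<integral>x. \<bar>u x - cut n x\<bar> ^ p \<partial>lborel) < \<eta> / (2 * 3 ^ p)"
    by (auto simp: eventually_sequentially)
  have ci: "integrable lborel (\<lambda>x. \<bar>u x - cut n x\<bar> ^ p)"
    by (rule Bochner_Integration.integrable_bound[OF ui]) (auto simp: cut_def power_mono p)
  obtain g where g: "\<And>k. continuous_on UNIV (g k)" "\<And>k x. \<bar>g k x\<bar> \<le> real n" "AE x in lborel. (\<lambda>k. g k x) \<longlonglongrightarrow> cut n x"
    by (rule continuous_approximation[OF cm, of n "real n"]) (auto simp: cut_def)
  \<comment> \<open>The cutoff vanishes once |x|^2 \<ge> 2 (n + 1)^2, in particular beyond 2 (n +
    1), and it equals 1 where the truncated function lives.\<close>
  define R where "R = 2 * real (Suc n)"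
  define th where "th x = cutoff ((x \<bullet> x) / (real (Suc n))\<^sup>2)" for x :: vel
  have thc: "continuous_on UNIV th" unfolding th_def[abs_def]
    by (intro continuous_on_compose2[OF c1_on_imp_continuous_on[OF c1_on_cutoff[of UNIV]]] continuous_intros) auto
  have th0: "th x = 0" if "norm x > R" for x
  proof -
    have "(2 * real (Suc n))\<^sup>2 \<le> (norm x)\<^sup>2" using that unfolding R_def by (intro power_mono) auto
    then have "2 \<le> (x \<bullet> x) / (real (Suc n))\<^sup>2"
      by (simp add: dot_square_norm power_mult_distrib le_divide_eq del: of_nat_Suc)
         (use zero_le_power2[of "real (Suc n)"] in linarith)
    then show ?thesis by (simp add: th_def)
  qed
  have th1: "th x = 1" if "norm x \<le> real n" for x
  proof -
    have "(norm x)\<^sup>2 \<le> (real (Suc n))\<^sup>2" using that by (intro power_mono) auto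
    then show ?thesis by (simp add: th_def dot_square_norm divide_le_eq del: of_nat_Suc)
  qed
  have thb: "0 \<le> th x" "th x \<le> 1" for x by (auto simp: th_def cutoff_bounds)
  have gm [measurable]: "(\<lambda>x. th x * g k x) \<in> borel_measurable borel" for k
    by (intro borel_measurable_continuous_onI continuous_intros thc g)
  have cut_th: "cut n x = th x * cut n x" for x by (auto simp: cut_def th1)
  have b: "\<bar>cut n x - th x * g k x\<bar> \<le> 2 * real n * indicator (cball 0 R) x" for k x
  proof (cases "norm x \<le> R")
    case True
    have "\<bar>th x * g k x\<bar> \<le> 1 * real n" unfolding abs_mult using thb g(2) by (intro mult_mono) auto
    moreover have "\<bar>cut n x\<bar> \<le> real n" by (auto simp: cut_def)
    ultimately show ?thesis using True by simp
  next
    case False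
    then have "th x = 0" using th0 by simp
    then show ?thesis using cut_th[of x] by simp
  qed
  have wi: "integrable lborel (\<lambda>x :: vel. (2 * real n) ^ p * indicator (cball 0 R) x)"
    using emeasure_compact_finite[of "cball (0 :: vel) R"] by simp
  have b': "\<bar>cut n x - th x * g k x\<bar> ^ p \<le> (2 * real n) ^ p * indicator (cball 0 R) x" for k x
  proof -
    have "\<bar>cut n x - th x * g k x\<bar> ^ p \<le> (2 * real n * indicator (cball 0 R) x) ^ p" by (rule power_mono[OF b abs_ge_zero])
    also have "\<dots> = (2 * real n) ^ p * indicator (cball 0 R) x" using p by (cases "x \<in> cball 0 R") (simp_all add: power_0_left)
    finally show ?thesis .
  qed
  have "(\<lambda>k. \<integral>x. \<bar>cut n x - th x * g k x\<bar> ^ p \<partial>lborel) \<longlonglongrightarrow> (\<integral>x. 0 \<partial>(lborel :: vel measure))"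
  proof (rule integral_dominated_convergence[OF _ _ wi])
    show "AE x in lborel. (\<lambda>k. \<bar>cut n x - th x * g k x\<bar> ^ p) \<longlonglongrightarrow> 0"
      using g(3)
    proof eventually_elim
      case (elim x)
      have "(\<lambda>k. \<bar>cut n x - th x * g k x\<bar> ^ p) \<longlonglongrightarrow> \<bar>cut n x - th x * cut n x\<bar> ^ p"
        by (intro tendsto_intros elim)
      then show ?case using cut_th[of x] p by (simp add: power_0_left)
    qed
    show "AE x in lborel. norm (\<bar>cut n x - th x * g k x\<bar> ^ p) \<le> (2 * real n) ^ p * indicator (cball 0 R) x" for k
      using b' by auto
  qed measurable
  then have "\<forall>\<^sub>F k in sequentially. (\<integral>x. \<bar>cut n x - th x * g k x\<bar> ^ p \<partial>lborel) < \<eta> / (2 * 3 ^ p)"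
    using \<eta> by (intro order_tendstoD) auto
  then obtain k where k: "(\<integral>x. \<bar>cut n x - th x * g k x\<bar> ^ p \<partial>lborel) < \<eta> / (2 * 3 ^ p)"
    by (auto simp: eventually_sequentially)
  have ki: "integrable lborel (\<lambda>x. \<bar>cut n x - th x * g k x\<bar> ^ p)"
    by (rule integrable_nonneg_bound[OF wi _ _ b']) auto
  have pw: "\<bar>u x - th x * g k x\<bar> ^ p \<le> 3 ^ p * (\<bar>u x - cut n x\<bar> ^ p + \<bar>cut n x - th x * g k x\<bar> ^ p)" for x
    using power_sum3_le[of "u x - cut n x" "cut n x - th x * g k x" 0 p] p by (simp add: power_0_left)
  have Wi: "integrable lborel (\<lambda>x. 3 ^ p * (\<bar>u x - cut n x\<bar> ^ p + \<bar>cut n x - th x * g k x\<bar> ^ p))" using ci ki by simp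
  have fi: "integrable lborel (\<lambda>x. \<bar>u x - th x * g k x\<bar> ^ p)"
    by (rule integrable_nonneg_bound[OF Wi _ _ pw]) auto
  have "(\<integral>x. \<bar>u x - th x * g k x\<bar> ^ p \<partial>lborel) \<le> (\<integral>x. 3 ^ p * (\<bar>u x - cut n x\<bar> ^ p + \<bar>cut n x - th x * g k x\<bar> ^ p) \<partial>lborel)"
    by (rule integral_mono[OF fi Wi pw])
  also have "\<dots> = 3 ^ p * ((\<integral>x. \<bar>u x - cut n x\<bar> ^ p \<partial>lborel) + (\<integral>x. \<bar>cut n x - th x * g k x\<bar> ^ p \<partial>lborel))"
    using ci ki by simp
  also have "\<dots> < 3 ^ p * (\<eta> / (2 * 3 ^ p) + \<eta> / (2 * 3 ^ p))" using n k by (intro mult_strict_left_mono add_strict_mono) auto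
  also have "\<dots> = \<eta>" by simp
  finally show thesis using fi thc g(1) th0 
    by (intro that[of "\<lambda>x. th x * g k x" R]) (auto intro!: continuous_intros simp: R_def)
qed

text \<open>u is replaced by a continuous g of compact support. The two replacement errors are equal
  by translation invariance, and the middle term is controlled by uniform continuity of g on a fixed
  ball.\<close>

lemma Lp_translation_continuous:
  fixes u :: "vel \<Rightarrow> real"
  assumes um [measurable]: "u \<in> borel_measurable borel" and ui: "integrable lborel (\<lambda>x. \<bar>u x\<bar> ^ p)" and p: "p > 0" and \<eta>: "\<eta> > 0"
  shows "\<exists>\<delta>>0. \<forall>z. norm z < \<delta> \<longrightarrow> (\<integral>x. \<bar>u (x - z) - u x\<bar> ^ p \<partial>lborel) \<le> \<eta>"
proof -
  define \<eta>' where "\<eta>' = \<eta> / 3 ^ p / 3"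
  have \<eta>': "\<eta>' > 0" using \<eta> by (simp add: \<eta>'_def)
  obtain g R where g: "continuous_on UNIV g" "R > 0" "\<And>x. norm x > R \<Longrightarrow> g x = 0" "(\<integral>x. \<bar>u x - g x\<bar> ^ p \<partial>lborel) < \<eta>'"
    "integrable lborel (\<lambda>x. \<bar>u x - g x\<bar> ^ p)"
    using Lp_compact_approximation[OF um ui p \<eta>'] by blast
  have gm [measurable]: "g \<in> borel_measurable borel" using g(1) by (rule borel_measurable_continuous_onI)
  define V where "V = measure lborel (cball (0 :: vel) (R + 1))"
  obtain s where s: "s > 0" "s ^ p * V \<le> \<eta>'"
  proof -
    have "(\<lambda>n. inverse (real (Suc n)) ^ p * V) \<longlonglongrightarrow> 0 ^ p * V" by (intro tendsto_intros LIMSEQ_inverse_real_of_nat)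
    then have "\<forall>\<^sub>F n in sequentially. inverse (real (Suc n)) ^ p * V < \<eta>'" using \<eta>' p by (intro order_tendstoD) (auto simp: power_0_left)
    then obtain n where "inverse (real (Suc n)) ^ p * V < \<eta>'" by (auto simp: eventually_sequentially)
    then show thesis by (intro that[of "inverse (real (Suc n))"]) auto
  qed
  have "uniformly_continuous_on (cball 0 (R + 2)) g"
    by (intro compact_uniformly_continuous continuous_on_subset[OF g(1)]) auto
  from this[unfolded uniformly_continuous_on_def, rule_format, OF s(1)]
  obtain d where d: "d > 0" "\<And>x x'. x \<in> cball 0 (R + 2) \<Longrightarrow> x' \<in> cball 0 (R + 2) \<Longrightarrow> dist x' x < d \<Longrightarrow> dist (g x') (g x) < s"
    by blast
  have "(\<integral>x. \<bar>u (x - z) - u x\<bar> ^ p \<partial>lborel) \<le> \<eta>" if z: "norm z < min d 1" for z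
  proof -
    have gz: "\<bar>g (x - z) - g x\<bar> \<le> s * indicator (cball 0 (R + 1)) x" for x
    proof (cases "norm x \<le> R + 1")
      case True
      have "norm (x - z) \<le> R + 2" using True z norm_triangle_ineq4[of x z] by simp
      then show ?thesis using d(2)[of x "x - z"] True z by (simp add: dist_norm norm_minus_commute)
    next
      case False
      have "norm x \<le> norm (x - z) + norm z" by (metis diff_add_cancel norm_triangle_ineq)
      then have "norm (x - z) > R" using False z by simp
      then show ?thesis using g(3) False by simp
    qed
    have gz': "\<bar>g (x - z) - g x\<bar> ^ p \<le> s ^ p * indicator (cball 0 (R + 1)) x" for x
    proof -
      have "\<bar>g (x - z) - g x\<bar> ^ p \<le> (s * indicator (cball 0 (R + 1)) x) ^ p" by (rule power_mono[OF gz abs_ge_zero])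
      also have "\<dots> = s ^ p * indicator (cball 0 (R + 1)) x" using p by (cases "x \<in> cball 0 (R + 1)") (simp_all add: power_0_left)
      finally show ?thesis .
    qed
    have Si: "integrable lborel (\<lambda>x :: vel. s ^ p * indicator (cball 0 (R + 1)) x)"
      using emeasure_compact_finite[of "cball (0 :: vel) (R + 1)"] by simp
    have i1: "integrable lborel (\<lambda>x. \<bar>u (x - z) - g (x - z)\<bar> ^ p)" "(\<integral>x. \<bar>u (x - z) - g (x - z)\<bar> ^ p \<partial>lborel) = (\<integral>x. \<bar>u x - g x\<bar> ^ p \<partial>lborel)"
      using integral_lborel_shift(1,3)[of "\<lambda>x. \<bar>u x - g x\<bar> ^ p" "- z"] g(5) by auto
    have pw: "\<bar>u (x - z) - u x\<bar> ^ p \<le> 3 ^ p * (\<bar>u (x - z) - g (x - z)\<bar> ^ p + s ^ p * indicator (cball 0 (R + 1)) x + \<bar>u x - g x\<bar> ^ p)" for x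
    proof -
      have "\<bar>u (x - z) - u x\<bar> ^ p \<le> 3 ^ p * (\<bar>u (x - z) - g (x - z)\<bar> ^ p + \<bar>g (x - z) - g x\<bar> ^ p + \<bar>g x - u x\<bar> ^ p)"
        using power_sum3_le[of "u (x - z) - g (x - z)" "g (x - z) - g x" "g x - u x" p] by simp
      also have "\<dots> \<le> 3 ^ p * (\<bar>u (x - z) - g (x - z)\<bar> ^ p + s ^ p * indicator (cball 0 (R + 1)) x + \<bar>u x - g x\<bar> ^ p)"
        using gz'[of x] by (intro mult_left_mono add_mono) (auto simp: abs_minus_commute)
      finally show ?thesis .
    qed
    have Wi: "integrable lborel (\<lambda>x. 3 ^ p * (\<bar>u (x - z) - g (x - z)\<bar> ^ p + s ^ p * indicator (cball 0 (R + 1)) x + \<bar>u x - g x\<bar> ^ p))"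
      using i1 Si g(5) by simp
    have "(\<integral>x. \<bar>u (x - z) - u x\<bar> ^ p \<partial>lborel) \<le> (\<integral>x. 3 ^ p * (\<bar>u (x - z) - g (x - z)\<bar> ^ p + s ^ p * indicator (cball 0 (R + 1)) x + \<bar>u x - g x\<bar> ^ p) \<partial>lborel)"
      by (intro integral_mono Wi pw integrable_nonneg_bound[OF Wi _ _ pw]) auto
    also have "\<dots> = 3 ^ p * ((\<integral>x. \<bar>u x - g x\<bar> ^ p \<partial>lborel) + s ^ p * V + (\<integral>x. \<bar>u x - g x\<bar> ^ p \<partial>lborel))"
      using i1 Si g(5) by (simp add: V_def)
    also have "\<dots> \<le> 3 ^ p * (\<eta>' + \<eta>' + \<eta>')" using g(4) s(2) by (intro mult_left_mono add_mono) auto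
    also have "\<dots> = \<eta>" by (simp add: \<eta>'_def)
    finally show ?thesis .
  qed
  with d(1) show ?thesis by (intro exI[of _ "min d 1"]) auto
qed

section \<open>Mollification\<close>

definition bump :: "real \<Rightarrow> vel \<Rightarrow> real" where "bump \<epsilon> z = sqpos (1 - (z \<bullet> z) / \<epsilon>\<^sup>2)"
definition kr :: "real \<Rightarrow> vel \<Rightarrow> real" where "kr \<epsilon> z = bump \<epsilon> z / (\<integral>z. bump \<epsilon> z \<partial>lborel)"

lemma bump_zero: "\<epsilon> > 0 \<Longrightarrow> norm z \<ge> \<epsilon> \<Longrightarrow> bump \<epsilon> z = 0"
proof -
  assume "\<epsilon> > 0" "norm z \<ge> \<epsilon>"
  then have "\<epsilon>\<^sup>2 \<le> (norm z)\<^sup>2" by (intro power_mono) auto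
  then show ?thesis using \<open>\<epsilon> > 0\<close> by (simp add: bump_def sqpos_def dot_square_norm le_divide_eq)
qed

lemma bump_nonneg: "bump \<epsilon> z \<ge> 0" by (simp add: bump_def sqpos_def)

text \<open>The squared positive part of 1 - |z|^2 / \<epsilon>^2 is C^1, the regularity asked of
  test fields.\<close>

lemma bump_tfield: "\<epsilon> > 0 \<Longrightarrow> tfield (bump \<epsilon>)"
  unfolding tfield_def
proof
  assume e: "\<epsilon> > 0"
  show "c1_on UNIV (bump \<epsilon>)" unfolding bump_def[abs_def] divide_inverse
    by (intro c1_on_compose[OF c1_on_sqpos[of UNIV]] c1_on_diff c1_on_mult c1_on_inner c1_on_const c1_on_id) simp
  have "norm z \<le> \<epsilon>" if "bump \<epsilon> z \<noteq> 0" for z using bump_zero[OF e, of z] that by (cases "norm z \<ge> \<epsilon>") auto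
  then show "bounded {x. bump \<epsilon> x \<noteq> 0}" unfolding bounded_iff by blast
qed

lemma bump_integrable: "\<epsilon> > 0 \<Longrightarrow> integrable lborel (bump \<epsilon>)"
  by (rule tfield_real_integrable[OF tfield_continuous[OF bump_tfield], of _ \<epsilon>]) (auto intro: bump_zero)

text \<open>On the ball of radius \<epsilon> / 2 the bump is at least 1/4, which bounds its integral
  below by a multiple of the volume.\<close>

lemma bump_integral_pos: "\<epsilon> > 0 \<Longrightarrow> (\<integral>z. bump \<epsilon> z \<partial>lborel) > 0"
proof -
  assume e: "\<epsilon> > 0"
  have b: "(1/4) * indicator (cball 0 (\<epsilon> / 2)) z \<le> bump \<epsilon> z" for z
  proof (cases "norm z \<le> \<epsilon> / 2")
    case True
    then have "(norm z)\<^sup>2 \<le> (\<epsilon> / 2)\<^sup>2" by (intro power_mono) auto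
    then have "(z \<bullet> z) / \<epsilon>\<^sup>2 \<le> 1 / 4" using e by (simp add: dot_square_norm divide_le_eq power_divide)
    then have "1/2 \<le> 1 - (z \<bullet> z) / \<epsilon>\<^sup>2" by linarith
    then have "(1/2)\<^sup>2 \<le> (1 - (z \<bullet> z) / \<epsilon>\<^sup>2)\<^sup>2" by (rule power_mono) simp
    moreover have "bump \<epsilon> z = (1 - (z \<bullet> z) / \<epsilon>\<^sup>2)\<^sup>2" 
    proof -
      have "max 0 (1 - (z \<bullet> z) / \<epsilon>\<^sup>2) = 1 - (z \<bullet> z) / \<epsilon>\<^sup>2" using \<open>(z \<bullet> z) / \<epsilon>\<^sup>2 \<le> 1 / 4\<close> by linarith
      then show ?thesis by (simp only: bump_def sqpos_def)
    qed
    ultimately show ?thesis using True by (simp add: power2_eq_square)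
  qed (simp add: bump_nonneg)
  have "0 < (1/4) * measure lborel (cball (0 :: vel) (\<epsilon> / 2))" using e content_cball_pos[of "\<epsilon>/2" "0 :: vel"] by simp
  also have "\<dots> = (\<integral>z. (1/4) * indicator (cball (0 :: vel) (\<epsilon> / 2)) z \<partial>lborel)" by simp
  also have "\<dots> \<le> (\<integral>z. bump \<epsilon> z \<partial>lborel)"
    using emeasure_compact_finite[of "cball (0 :: vel) (\<epsilon> / 2)"]
    by (intro integral_mono bump_integrable e b) simp
  finally show ?thesis .
qed

context
  fixes \<epsilon> :: real
  assumes eps: "\<epsilon> > 0"
begin

lemma kr_nonneg: "kr \<epsilon> z \<ge> 0"
  using bump_nonneg bump_integral_pos[OF eps] by (simp add: kr_def)

lemma kr_zero: "norm z \<ge> \<epsilon> \<Longrightarrow> kr \<epsilon> z = 0" using bump_zero[OF eps] by (simp add: kr_def)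

lemma kr_even: "kr \<epsilon> (- z) = kr \<epsilon> z" by (simp add: kr_def bump_def)

lemma kr_minus_commute: "kr \<epsilon> (x - z) = kr \<epsilon> (z - x)" using kr_even[of "z - x"] by simp

lemma kr_tfield: "tfield (kr \<epsilon>)"
proof -
  have "kr \<epsilon> = (\<lambda>z. inverse (\<integral>z. bump \<epsilon> z \<partial>lborel) *\<^sub>R bump \<epsilon> z)" by (auto simp: kr_def divide_inverse mult.commute)
  then show ?thesis using tfield_scaleR[OF bump_tfield[OF eps]] by simp
qed

lemma kr_continuous: "continuous_on UNIV (kr \<epsilon>)" using tfield_continuous[OF kr_tfield] .

lemma kr_measurable [measurable]: "kr \<epsilon> \<in> borel_measurable borel"
  using kr_continuous by (rule borel_measurable_continuous_onI)

lemma kr_integrable: "integrable lborel (kr \<epsilon>)"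
  using bump_integrable[OF eps] by (simp add: kr_def[abs_def])

lemma kr_integral: "(\<integral>z. kr \<epsilon> z \<partial>lborel) = 1"
  using bump_integral_pos[OF eps] by (simp add: kr_def)

lemma kr_nn_integral: "(\<integral>\<^sup>+z. ennreal (kr \<epsilon> z) \<partial>lborel) = 1"
  using kr_integrable kr_nonneg kr_integral by (subst nn_integral_eq_integral) auto

lemma kr_bounded: obtains K where "K > 0" "\<And>z. \<bar>kr \<epsilon> z\<bar> \<le> K"
  using tfield_bounded[OF kr_tfield] by (metis real_norm_def)

text \<open>Jensen's inequality from the variance: the kernel is a probability density, and (g -
  a)^2 with a the mean has a nonnegative integral against it.\<close>

lemma kr_jensen:
  assumes "integrable lborel (\<lambda>z. kr \<epsilon> z * g z)" "integrable lborel (\<lambda>z. kr \<epsilon> z * (g z)\<^sup>2)"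
  shows "(\<integral>z. kr \<epsilon> z * g z \<partial>lborel)\<^sup>2 \<le> (\<integral>z. kr \<epsilon> z * (g z)\<^sup>2 \<partial>lborel)"
proof -
  define a where "a = (\<integral>z. kr \<epsilon> z * g z \<partial>lborel)"
  have "0 \<le> (\<integral>z. kr \<epsilon> z * (g z - a)\<^sup>2 \<partial>lborel)" by (intro Bochner_Integration.integral_nonneg) (simp add: kr_nonneg)
  also have "\<dots> = (\<integral>z. kr \<epsilon> z * (g z)\<^sup>2 - 2 * a * (kr \<epsilon> z * g z) + a\<^sup>2 * kr \<epsilon> z \<partial>lborel)"
    by (simp add: power2_diff algebra_simps)
  also have "\<dots> = (\<integral>z. kr \<epsilon> z * (g z)\<^sup>2 \<partial>lborel) - 2 * a * a + a\<^sup>2"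
    using assms kr_integrable kr_integral by (simp add: a_def)
  finally show ?thesis by (simp add: a_def power2_eq_square)
qed

definition moll :: "(vel \<Rightarrow> real) \<Rightarrow> vel \<Rightarrow> real" where
  "moll u x = (\<integral>z. kr \<epsilon> z * u (x - z) \<partial>lborel)"

lemma moll_alt: "u \<in> borel_measurable borel \<Longrightarrow> moll u x = (\<integral>z. kr \<epsilon> (x - z) * u z \<partial>lborel)"
  unfolding moll_def using integral_lborel_shift(2)[of "\<lambda>z. kr \<epsilon> (x - z) * u z" x] by simp

text \<open>|a| \<le> 1 + |a|^p reduces the first power to the p-th one and the kernel itself. The
  exponent is 1 for densities and 2 for their square roots.\<close>

lemma moll_integrand:
  assumes um [measurable]: "u \<in> borel_measurable borel" and ui: "integrable lborel (\<lambda>x. \<bar>u x\<bar> ^ p)" and p: "p = 1 \<or> p = 2"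
  shows "integrable lborel (\<lambda>z. kr \<epsilon> z * u (x - z))" "integrable lborel (\<lambda>z. kr \<epsilon> z * \<bar>u (x - z)\<bar> ^ p)"
proof -
  obtain K where K: "K > 0" "\<And>z. \<bar>kr \<epsilon> z\<bar> \<le> K" using kr_bounded by blast
  have si: "integrable lborel (\<lambda>z. \<bar>u (x - z)\<bar> ^ p)" using integral_lborel_shift(4)[OF _ ui, of x] by simp
  show i: "integrable lborel (\<lambda>z. kr \<epsilon> z * \<bar>u (x - z)\<bar> ^ p)"
    using integrable_mult_bounded[OF si, where h="kr \<epsilon>" and K=K] K by (simp add: mult.commute)
  have "integrable lborel (\<lambda>z. kr \<epsilon> z + kr \<epsilon> z * \<bar>u (x - z)\<bar> ^ p)" using i kr_integrable by simp
  then show "integrable lborel (\<lambda>z. kr \<epsilon> z * u (x - z))"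
  proof (rule Bochner_Integration.integrable_bound)
    have "\<bar>a\<bar> \<le> 1 + \<bar>a\<bar> ^ p" for a :: real
      using p zero_le_power2[of "\<bar>a\<bar> - 1"] by (auto simp: power2_eq_square algebra_simps abs_mult_self_eq intro: add_increasing)
    then have "norm (kr \<epsilon> z * u (x - z)) \<le> kr \<epsilon> z * (1 + \<bar>u (x - z)\<bar> ^ p)" for z
      by (simp add: abs_mult kr_nonneg mult_left_mono)
    then show "AE z in lborel. norm (kr \<epsilon> z * u (x - z)) \<le> norm (kr \<epsilon> z + kr \<epsilon> z * \<bar>u (x - z)\<bar> ^ p)"
      by (intro AE_I2) (auto simp: distrib_left intro: order_trans[OF _ abs_ge_self])
  qed measurable
qed

lemma moll_measurable [measurable]: "u \<in> borel_measurable borel \<Longrightarrow> moll u \<in> borel_measurable borel"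
proof -
  assume [measurable]: "u \<in> borel_measurable borel"
  show ?thesis unfolding moll_def[abs_def] by (rule lborel.borel_measurable_lebesgue_integral) measurable
qed

lemma moll_nonneg: "(\<And>x. u x \<ge> 0) \<Longrightarrow> moll u x \<ge> 0"
  unfolding moll_def by (intro Bochner_Integration.integral_nonneg) (simp add: kr_nonneg)

lemma kr_power_jensen:
  assumes "p = 1 \<or> p = 2" "integrable lborel (\<lambda>z. kr \<epsilon> z * g z)" "integrable lborel (\<lambda>z. kr \<epsilon> z * \<bar>g z\<bar> ^ p)"
  shows "\<bar>\<integral>z. kr \<epsilon> z * g z \<partial>lborel\<bar> ^ p \<le> (\<integral>z. kr \<epsilon> z * \<bar>g z\<bar> ^ p \<partial>lborel)"
  using assms(1)
proof
  assume p: "p = 1"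
  have "\<bar>\<integral>z. kr \<epsilon> z * g z \<partial>lborel\<bar> \<le> (\<integral>z. \<bar>kr \<epsilon> z * g z\<bar> \<partial>lborel)" by (rule integral_abs_bound)
  then show ?thesis using p by (simp add: abs_mult kr_nonneg)
next
  assume "p = 2"
  then show ?thesis using kr_jensen assms by simp
qed

text \<open>Jensen in z followed by Tonelli: an average of translates has at most the L^p size of u,
  and is as close to u as the translates by less than \<epsilon> are.\<close>

lemma moll_Lp:
  assumes um [measurable]: "u \<in> borel_measurable borel" and ui: "integrable lborel (\<lambda>x. \<bar>u x\<bar> ^ p)" and p: "p = 1 \<or> p = 2"
  shows "(\<integral>\<^sup>+x. ennreal (\<bar>moll u x\<bar> ^ p) \<partial>lborel) \<le> ennreal (\<integral>x. \<bar>u x\<bar> ^ p \<partial>lborel)"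
    and "(\<And>z. norm z < \<epsilon> \<Longrightarrow> (\<integral>x. \<bar>u (x - z) - u x\<bar> ^ p \<partial>lborel) \<le> \<eta>) \<Longrightarrow>
      (\<integral>\<^sup>+x. ennreal (\<bar>moll u x - u x\<bar> ^ p) \<partial>lborel) \<le> ennreal \<eta>"
proof -
  note mi = moll_integrand[OF um ui p]
  have "(\<integral>\<^sup>+x. ennreal (\<bar>moll u x\<bar> ^ p) \<partial>lborel) \<le> (\<integral>\<^sup>+x. \<integral>\<^sup>+z. ennreal (kr \<epsilon> z * \<bar>u (x - z)\<bar> ^ p) \<partial>lborel \<partial>lborel)"
  proof (rule nn_integral_mono)
    fix x
    have "\<bar>moll u x\<bar> ^ p \<le> (\<integral>z. kr \<epsilon> z * \<bar>u (x - z)\<bar> ^ p \<partial>lborel)" unfolding moll_def by (rule kr_power_jensen[OF p mi])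
    then show "ennreal (\<bar>moll u x\<bar> ^ p) \<le> (\<integral>\<^sup>+z. ennreal (kr \<epsilon> z * \<bar>u (x - z)\<bar> ^ p) \<partial>lborel)"
      using mi(2) kr_nonneg by (subst nn_integral_eq_integral) (auto intro!: ennreal_leI)
  qed
  also have "\<dots> = (\<integral>\<^sup>+z. \<integral>\<^sup>+x. ennreal (kr \<epsilon> z * \<bar>u (x - z)\<bar> ^ p) \<partial>lborel \<partial>lborel)"
    by (rule lborel_pair.Fubini') measurable
  also have "\<dots> = (\<integral>\<^sup>+z. ennreal (kr \<epsilon> z) * ennreal (\<integral>x. \<bar>u x\<bar> ^ p \<partial>lborel) \<partial>lborel)"
  proof (rule nn_integral_cong)
    fix z
    have "(\<integral>\<^sup>+x. ennreal (kr \<epsilon> z * \<bar>u (x - z)\<bar> ^ p) \<partial>lborel) = ennreal (kr \<epsilon> z) * (\<integral>\<^sup>+x. ennreal (\<bar>u (x - z)\<bar> ^ p) \<partial>lborel)"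
      by (simp add: nn_integral_cmult ennreal_mult kr_nonneg)
    also have "(\<integral>\<^sup>+x. ennreal (\<bar>u (x - z)\<bar> ^ p) \<partial>lborel) = (\<integral>\<^sup>+x. ennreal (\<bar>u x\<bar> ^ p) \<partial>lborel)"
      using nn_integral_lborel_shift(1)[of "\<lambda>x. ennreal (\<bar>u x\<bar> ^ p)" z] by simp
    also have "\<dots> = ennreal (\<integral>x. \<bar>u x\<bar> ^ p \<partial>lborel)" by (rule nn_integral_eq_integral[OF ui]) auto
    finally show "(\<integral>\<^sup>+x. ennreal (kr \<epsilon> z * \<bar>u (x - z)\<bar> ^ p) \<partial>lborel) = ennreal (kr \<epsilon> z) * ennreal (\<integral>x. \<bar>u x\<bar> ^ p \<partial>lborel)" .
  qed
  also have "\<dots> = ennreal (\<integral>x. \<bar>u x\<bar> ^ p \<partial>lborel)"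
    by (subst nn_integral_multc) (auto simp: kr_nn_integral)
  finally show "(\<integral>\<^sup>+x. ennreal (\<bar>moll u x\<bar> ^ p) \<partial>lborel) \<le> ennreal (\<integral>x. \<bar>u x\<bar> ^ p \<partial>lborel)" .
  assume \<eta>: "\<And>z. norm z < \<epsilon> \<Longrightarrow> (\<integral>x. \<bar>u (x - z) - u x\<bar> ^ p \<partial>lborel) \<le> \<eta>"
  have p0: "p > 0" using p by auto
  have di: "integrable lborel (\<lambda>x. \<bar>u (x - z) - u x\<bar> ^ p)" for z
  proof (rule integrable_nonneg_bound)
    show "integrable lborel (\<lambda>x. 3 ^ p * (\<bar>u (x - z)\<bar> ^ p + \<bar>u x\<bar> ^ p))"
      using integral_lborel_shift(3)[OF _ ui, of "- z"] ui by simp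
    show "\<bar>u (x - z) - u x\<bar> ^ p \<le> 3 ^ p * (\<bar>u (x - z)\<bar> ^ p + \<bar>u x\<bar> ^ p)" for x
      using power_sum3_le[of "u (x - z)" "- u x" 0 p] p0 by (simp add: power_0_left)
  qed auto
  obtain K where K: "K > 0" "\<And>z. \<bar>kr \<epsilon> z\<bar> \<le> K" using kr_bounded by blast
  have m1: "integrable lborel (\<lambda>z. kr \<epsilon> z * (u (x - z) - u x))" for x
    using mi(1)[of x] kr_integrable by (simp add: right_diff_distrib)
  have m2: "integrable lborel (\<lambda>z. kr \<epsilon> z * \<bar>u (x - z) - u x\<bar> ^ p)" for x
  proof (rule integrable_nonneg_bound)
    show "integrable lborel (\<lambda>z. 3 ^ p * (kr \<epsilon> z * \<bar>u (x - z)\<bar> ^ p + kr \<epsilon> z * \<bar>u x\<bar> ^ p))"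
      using mi(2)[of x] kr_integrable by simp
    show "kr \<epsilon> z * \<bar>u (x - z) - u x\<bar> ^ p \<le> 3 ^ p * (kr \<epsilon> z * \<bar>u (x - z)\<bar> ^ p + kr \<epsilon> z * \<bar>u x\<bar> ^ p)" for z
      using mult_left_mono[OF power_sum3_le[of "u (x - z)" "- u x" 0 p] kr_nonneg[of z]] p0 by (simp add: power_0_left algebra_simps)
  qed (auto simp: kr_nonneg)
  have "(\<integral>\<^sup>+x. ennreal (\<bar>moll u x - u x\<bar> ^ p) \<partial>lborel) \<le> (\<integral>\<^sup>+x. \<integral>\<^sup>+z. ennreal (kr \<epsilon> z * \<bar>u (x - z) - u x\<bar> ^ p) \<partial>lborel \<partial>lborel)"
  proof (rule nn_integral_mono)
    fix x
    have "moll u x - u x = (\<integral>z. kr \<epsilon> z * (u (x - z) - u x) \<partial>lborel)"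
      unfolding moll_def using mi(1)[of x] kr_integrable kr_integral by (simp add: right_diff_distrib)
    then have "\<bar>moll u x - u x\<bar> ^ p \<le> (\<integral>z. kr \<epsilon> z * \<bar>u (x - z) - u x\<bar> ^ p \<partial>lborel)"
      using kr_power_jensen[OF p m1 m2] by simp
    then show "ennreal (\<bar>moll u x - u x\<bar> ^ p) \<le> (\<integral>\<^sup>+z. ennreal (kr \<epsilon> z * \<bar>u (x - z) - u x\<bar> ^ p) \<partial>lborel)"
      using m2 kr_nonneg by (subst nn_integral_eq_integral) (auto intro!: ennreal_leI)
  qed
  also have "\<dots> = (\<integral>\<^sup>+z. \<integral>\<^sup>+x. ennreal (kr \<epsilon> z * \<bar>u (x - z) - u x\<bar> ^ p) \<partial>lborel \<partial>lborel)"
    by (rule lborel_pair.Fubini') measurable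
  also have "\<dots> \<le> (\<integral>\<^sup>+z. ennreal (kr \<epsilon> z) * ennreal \<eta> \<partial>lborel)"
  proof (rule nn_integral_mono)
    fix z
    show "(\<integral>\<^sup>+x. ennreal (kr \<epsilon> z * \<bar>u (x - z) - u x\<bar> ^ p) \<partial>lborel) \<le> ennreal (kr \<epsilon> z) * ennreal \<eta>"
    proof (cases "norm z < \<epsilon>")
      case True
      have "(\<integral>\<^sup>+x. ennreal (kr \<epsilon> z * \<bar>u (x - z) - u x\<bar> ^ p) \<partial>lborel) = ennreal (kr \<epsilon> z) * (\<integral>\<^sup>+x. ennreal (\<bar>u (x - z) - u x\<bar> ^ p) \<partial>lborel)"
        by (simp add: nn_integral_cmult ennreal_mult kr_nonneg)
      also have "(\<integral>\<^sup>+x. ennreal (\<bar>u (x - z) - u x\<bar> ^ p) \<partial>lborel) = ennreal (\<integral>x. \<bar>u (x - z) - u x\<bar> ^ p \<partial>lborel)"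
        by (rule nn_integral_eq_integral[OF di]) auto
      finally show ?thesis using \<eta>[OF True] by (simp add: mult_left_mono ennreal_leI)
    qed (simp add: kr_zero)
  qed
  also have "\<dots> = ennreal \<eta>" by (subst nn_integral_multc) (auto simp: kr_nn_integral)
  finally show "(\<integral>\<^sup>+x. ennreal (\<bar>moll u x - u x\<bar> ^ p) \<partial>lborel) \<le> ennreal \<eta>" .
qed

text \<open>On a ball of radius r only the values of u within radius r + \<epsilon> matter. As u is
  nonnegative, its restriction there is the density of a finite measure, and
  \<open>c1_on_integral_compact\<close> applies with the kernel as integrand.\<close>

lemma moll_c1:
  assumes um [measurable]: "u \<in> borel_measurable borel" and u0: "\<And>x. u x \<ge> 0"
    and ui: "integrable lborel (\<lambda>x. \<bar>u x\<bar> ^ p)" and p: "p = 1 \<or> p = 2"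
  shows "c1_on UNIV (moll u)"
    and "frechet_derivative (moll u) (at x) v = (\<integral>z. frechet_derivative (kr \<epsilon>) (at (x - z)) v * u z \<partial>lborel)"
proof -
  have kc1: "c1_on UNIV (kr \<epsilon>)" using kr_tfield by (simp add: tfield_def)
  have "c1_on (ball 0 r) (moll u) \<and> (\<forall>x\<in>ball 0 r. \<forall>v. frechet_derivative (moll u) (at x) v
     = (\<integral>z. frechet_derivative (kr \<epsilon>) (at (x - z)) v * u z \<partial>lborel))" for r
  proof -
    define A where "A = cball (0 :: vel) (r + \<epsilon>)"
    have A: "compact A" "A \<in> sets borel" by (auto simp: A_def)
    define N where "N = density lborel (\<lambda>z. ennreal (indicator A z * u z))"
    have Nw: "indicat_real A z * u z \<ge> 0" for z using u0 by simp
    have Ai: "integrable lborel (indicat_real A)" using emeasure_compact_finite[OF A(1)] A by simp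
    have "integrable lborel (\<lambda>z. indicat_real A z * u z)"
    proof (rule integrable_nonneg_bound)
      show "integrable lborel (\<lambda>x. indicat_real A x + \<bar>u x\<bar> ^ p)" using ui Ai by simp
      show "indicat_real A z * u z \<le> indicat_real A z + \<bar>u z\<bar> ^ p" for z
        using p zero_le_power2[of "u z - 1"] u0[of z] by (auto simp: indicator_def power2_eq_square algebra_simps)
    qed (use A Nw in auto)
    then have fin: "(\<integral>\<^sup>+z. ennreal (indicator A z * u z) \<partial>lborel) < \<infinity>"
      using Nw by (subst nn_integral_eq_integral) auto
    have N: "finite_measure N" "sets N = sets borel"
      unfolding N_def using fin A by (auto intro!: finite_measureI simp: emeasure_density)
    have intN: "(LINT z:A|N. h z) = (\<integral>z. h z * u z \<partial>lborel)"
      if [measurable]: "h \<in> borel_measurable borel" and "\<And>z. z \<notin> A \<Longrightarrow> h z = 0" for h :: "vel \<Rightarrow> real"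
    proof -
      have "(LINT z:A|N. h z) = (\<integral>z. (indicat_real A z * u z) *\<^sub>R (indicat_real A z *\<^sub>R h z) \<partial>lborel)"
        unfolding set_lebesgue_integral_def N_def using A Nw by (intro integral_density) auto
      also have "\<dots> = (\<integral>z. h z * u z \<partial>lborel)"
        using that(2) by (intro Bochner_Integration.integral_cong) (auto simp: indicator_def)
      finally show ?thesis .
    qed
    have off: "norm (x - z) > \<epsilon>" if "x \<in> ball 0 r" "z \<notin> A" for x z
      using that norm_triangle_ineq2[of z x] by (auto simp: A_def norm_minus_commute)
    let ?g = "\<lambda>q :: vel \<times> vel. kr \<epsilon> (fst q - snd q)"
    have gc1: "c1_on UNIV ?g" by (intro c1_on_compose[OF kc1] c1_on_diff c1_on_fst c1_on_snd) simp
    have kD: "(kr \<epsilon> has_derivative frechet_derivative (kr \<epsilon>) (at y)) (at y)" for y using c1_on_has_derivative[OF kc1] by simp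
    have gD: "frechet_derivative ?g (at (x, z)) (v, 0) = frechet_derivative (kr \<epsilon>) (at (x - z)) v" for x z v
    proof -
      have "((\<lambda>q :: vel \<times> vel. fst q - snd q) has_derivative (\<lambda>q. fst q - snd q)) (at (x, z))" by (auto intro!: derivative_eq_intros)
      from frechet_eqI[OF has_derivative_compose[OF this, of "kr \<epsilon>" "frechet_derivative (kr \<epsilon>) (at (x - z))"]] kD[of "x - z"]
      show ?thesis by simp
    qed
    have kz: "frechet_derivative (kr \<epsilon>) (at y) = (\<lambda>_. 0)" if "norm y > \<epsilon>" for y
    proof -
      have "(kr \<epsilon> has_derivative (\<lambda>_. 0)) (at y)"
      proof (rule has_derivative_transform_within_open)
        show "((\<lambda>_. 0) has_derivative (\<lambda>_. 0)) (at y)" by (rule has_derivative_const)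
        show "y \<in> - cball 0 \<epsilon>" using that by simp
        show "0 = kr \<epsilon> w" if "w \<in> - cball 0 \<epsilon>" for w using that kr_zero[of w] by simp
      qed auto
      then show ?thesis by (rule frechet_eqI)
    qed
    have eq: "(LINT z:A|N. ?g (x, z)) = moll u x" if "x \<in> ball 0 r" for x
      unfolding moll_alt[OF um] using off[OF that]
      by (subst intN) (auto simp: less_imp_le intro: kr_zero)
    note c = c1_on_integral_compact[OF N A(1) open_ball[of 0 r] gc1 subset_UNIV]
    have "c1_on (ball 0 r) (moll u)" by (rule c1_on_cong[OF c(1) open_ball eq])
    moreover have "frechet_derivative (moll u) (at x) v = (\<integral>z. frechet_derivative (kr \<epsilon>) (at (x - z)) v * u z \<partial>lborel)"
      if x: "x \<in> ball 0 r" for x v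
    proof -
      have "(moll u has_derivative (\<lambda>v. LINT z:A|N. frechet_derivative ?g (at (x, z)) (v, 0))) (at x)"
        by (rule has_derivative_transform_within_open[OF c(2)[OF x] open_ball x eq])
      then have "frechet_derivative (moll u) (at x) v = (LINT z:A|N. frechet_derivative (kr \<epsilon>) (at (x - z)) v)"
        unfolding gD by (simp add: frechet_eqI)
      also have "\<dots> = (\<integral>z. frechet_derivative (kr \<epsilon>) (at (x - z)) v * u z \<partial>lborel)"
      proof (rule intN)
        have "continuous_on UNIV (\<lambda>z. frechet_derivative (kr \<epsilon>) (at (x - z)) v)"
          by (intro continuous_on_frechet_derivative[OF kc1] continuous_intros) simp
        then show "(\<lambda>z. frechet_derivative (kr \<epsilon>) (at (x - z)) v) \<in> borel_measurable borel" by (rule borel_measurable_continuous_onI)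
        show "frechet_derivative (kr \<epsilon>) (at (x - z)) v = 0" if "z \<notin> A" for z using kz[OF off[OF x that]] by simp
      qed
      finally show ?thesis .
    qed
    ultimately show ?thesis by blast
  qed
  note * = this
  show "c1_on UNIV (moll u)"
  proof (rule c1_on_local)
    fix x :: vel
    show "\<exists>T. open T \<and> x \<in> T \<and> c1_on T (moll u)"
      using *[of "norm x + 1"] by (intro exI[of _ "ball 0 (norm x + 1)"]) auto
  qed
  show "frechet_derivative (moll u) (at x) v = (\<integral>z. frechet_derivative (kr \<epsilon>) (at (x - z)) v * u z \<partial>lborel)"
    using *[of "norm x + 1"] by auto
qed

end

section \<open>Weak gradients and the dual bound\<close>

lemma grad_tfield:
  assumes "\<And>x. \<phi> differentiable (at x)"
  shows "frechet_derivative \<phi> (at x) v = grad \<phi> x \<bullet> v"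
proof -
  have l: "linear (frechet_derivative \<phi> (at x))" using assms by (intro linear_frechet_derivative)
  have "v = (\<Sum>i\<in>UNIV. v $ i *\<^sub>R axis i 1)" by (simp add: vec_eq_iff axis_def if_distrib cong: if_cong)
  then have "frechet_derivative \<phi> (at x) v = frechet_derivative \<phi> (at x) (\<Sum>i\<in>UNIV. v $ i *\<^sub>R axis i 1)" by simp
  also have "\<dots> = (\<Sum>i\<in>UNIV. v $ i * frechet_derivative \<phi> (at x) (axis i 1))"
    by (simp add: linear_sum[OF l] linear_cmul[OF l])
  finally show ?thesis by (simp add: grad_def inner_vec_def mult.commute)
qed

lemma test_fun_iff_tfield: "test_fun \<phi> \<longleftrightarrow> tfield \<phi>"
proof
  assume t: "test_fun \<phi>"
  then have d: "\<And>x. \<phi> differentiable (at x)" by (simp add: test_fun_def)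
  have "continuous_on UNIV (\<lambda>x. frechet_derivative \<phi> (at x) v)" for v
    unfolding grad_tfield[OF d] using t by (intro continuous_intros) (simp add: test_fun_def)
  then show "tfield \<phi>" using t by (simp add: tfield_def test_fun_def c1_on_def)
next
  assume t: "tfield \<phi>"
  then have c: "continuous_on UNIV (\<lambda>x. frechet_derivative \<phi> (at x) v)" for v by (simp add: tfield_def c1_on_def)
  have "continuous_on UNIV (grad \<phi>)" unfolding grad_def[abs_def] by (intro continuous_on_vec_lambda c)
  then show "test_fun \<phi>" using t by (simp add: tfield_def test_fun_def c1_on_def)
qed

lemma dvg_product:
  assumes g: "g differentiable (at x)" and \<phi>: "\<phi> differentiable (at x)"
  shows "dvg (\<lambda>x. g x *\<^sub>R \<phi> x) x = g x * dvg \<phi> x + frechet_derivative g (at x) (\<phi> x)"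
proof -
  have "((\<lambda>x. g x *\<^sub>R \<phi> x) has_derivative (\<lambda>v. g x *\<^sub>R frechet_derivative \<phi> (at x) v + frechet_derivative g (at x) v *\<^sub>R \<phi> x)) (at x)"
    using assms by (intro has_derivative_scaleR) (simp_all add: frechet_derivative_works)
  from frechet_eqI[OF this]
  have "dvg (\<lambda>x. g x *\<^sub>R \<phi> x) x = g x * dvg \<phi> x + (\<Sum>b\<in>Basis. (\<phi> x \<bullet> b) * frechet_derivative g (at x) b)"
    by (simp add: dvg_def inner_add_left sum.distrib sum_distrib_left mult_ac)
  also have "(\<Sum>b\<in>Basis. (\<phi> x \<bullet> b) * frechet_derivative g (at x) b) = frechet_derivative g (at x) (\<Sum>b\<in>Basis. (\<phi> x \<bullet> b) *\<^sub>R b)"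
    using linear_frechet_derivative[OF g] by (simp add: linear_sum linear_cmul)
  finally show ?thesis by (simp add: euclidean_representation)
qed

lemma tfield_mult: "c1_on UNIV g \<Longrightarrow> tfield \<phi> \<Longrightarrow> tfield (\<lambda>x. g x *\<^sub>R \<phi> x)"
  unfolding tfield_def by (auto intro!: c1_on_scaleR elim: bounded_subset)

text \<open>The divergence of g phi has integral 0. The compact support of phi suffices, so g may be
  any C^1 function; later it is the square or the root of a mollified function.\<close>

lemma integral_product_rule:
  fixes \<phi> :: "vel \<Rightarrow> vel"
  assumes g: "c1_on UNIV g" and \<phi>: "tfield \<phi>"
  shows "(\<integral>x. g x * dvg \<phi> x \<partial>lborel) = - (\<integral>x. frechet_derivative g (at x) (\<phi> x) \<partial>lborel)"
    and "integrable lborel (\<lambda>x. g x * dvg \<phi> x)" "integrable lborel (\<lambda>x. frechet_derivative g (at x) (\<phi> x))"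
proof -
  obtain R where R: "R > 0" "\<And>x. norm x > R \<Longrightarrow> \<phi> x = 0" "\<And>x. norm x > R \<Longrightarrow> frechet_derivative \<phi> (at x) = (\<lambda>_. 0)"
    using tfield_vanish[OF \<phi>] by metis
  have pc: "c1_on UNIV \<phi>" using \<phi> by (simp add: tfield_def)
  show i1: "integrable lborel (\<lambda>x. g x * dvg \<phi> x)"
  proof (rule tfield_real_integrable[of _ R])
    show "continuous_on UNIV (\<lambda>x. g x * dvg \<phi> x)"
      by (intro continuous_on_mult c1_on_imp_continuous_on[OF g] continuous_on_dvg[OF pc])
  qed (simp add: dvg_def R(3))
  show i2: "integrable lborel (\<lambda>x. frechet_derivative g (at x) (\<phi> x))"
  proof (rule tfield_real_integrable[of _ R])
    show "continuous_on UNIV (\<lambda>x. frechet_derivative g (at x) (\<phi> x))"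
      by (intro continuous_on_frechet_derivative[OF g] continuous_on_id tfield_continuous[OF \<phi>]) simp
    show "frechet_derivative g (at x) (\<phi> x) = 0" if "R < norm x" for x
      using R(2)[OF that] linear_0[OF linear_frechet_derivative[of g "at x"]] g by (simp add: c1_on_def)
  qed
  have "0 = (\<integral>x. dvg (\<lambda>x. g x *\<^sub>R \<phi> x) x \<partial>lborel)" by (rule integral_dvg_zero[OF tfield_mult[OF g \<phi>], symmetric])
  also have "\<dots> = (\<integral>x. g x * dvg \<phi> x + frechet_derivative g (at x) (\<phi> x) \<partial>lborel)"
    using g pc by (subst dvg_product) (auto simp: c1_on_def)
  also have "\<dots> = (\<integral>x. g x * dvg \<phi> x \<partial>lborel) + (\<integral>x. frechet_derivative g (at x) (\<phi> x) \<partial>lborel)" using i1 i2 by simp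
  finally show "(\<integral>x. g x * dvg \<phi> x \<partial>lborel) = - (\<integral>x. frechet_derivative g (at x) (\<phi> x) \<partial>lborel)" by simp
qed

section \<open>From a weak gradient to the dual bound\<close>

lemma moll_L1_limit:
  assumes fm [measurable]: "f \<in> borel_measurable borel" and fi: "integrable lborel (\<lambda>x. \<bar>f x\<bar> ^ p)" and p: "p = 1 \<or> p = 2" and \<eta>: "\<eta> > 0"
  obtains \<epsilon> where "\<epsilon> > 0" "(\<integral>x. \<bar>moll \<epsilon> f x - f x\<bar> ^ p \<partial>lborel) \<le> \<eta>" "integrable lborel (\<lambda>x. \<bar>moll \<epsilon> f x - f x\<bar> ^ p)"
proof -
  have p0: "p > 0" using p by auto
  obtain \<delta> where \<delta>: "\<delta> > 0" "\<And>z. norm z < \<delta> \<Longrightarrow> (\<integral>x. \<bar>f (x - z) - f x\<bar> ^ p \<partial>lborel) \<le> \<eta>"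
    using Lp_translation_continuous[OF fm fi p0 \<eta>] by blast
  note [measurable] = moll_measurable[OF \<delta>(1) fm]
  have nn: "(\<integral>\<^sup>+x. ennreal (\<bar>moll \<delta> f x - f x\<bar> ^ p) \<partial>lborel) \<le> ennreal \<eta>" by (rule moll_Lp(2)[OF \<delta>(1) fm fi p \<delta>(2)])
  have i: "integrable lborel (\<lambda>x. \<bar>moll \<delta> f x - f x\<bar> ^ p)"
  proof (rule integrableI_nonneg)
    show "(\<integral>\<^sup>+x. ennreal (\<bar>moll \<delta> f x - f x\<bar> ^ p) \<partial>lborel) < \<infinity>"
      using nn by (rule order.strict_trans1) simp
  qed auto
  have "ennreal (\<integral>x. \<bar>moll \<delta> f x - f x\<bar> ^ p \<partial>lborel) \<le> ennreal \<eta>" using nn i by (subst (asm) nn_integral_eq_integral) auto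
  then have "(\<integral>x. \<bar>moll \<delta> f x - f x\<bar> ^ p \<partial>lborel) \<le> \<eta>" using \<eta> by (simp add: ennreal_le_iff)
  with \<delta>(1) i show thesis by (intro that)
qed

text \<open>The mollified square root can be squared and differentiated classically.\<close>

lemma weak_grad_mollified:
  assumes um [measurable]: "u \<in> borel_measurable borel" and u0: "\<And>x. u x \<ge> 0"
    and ui: "integrable lborel (\<lambda>x. (u x)\<^sup>2)" and G: "weak_grad u G" and \<epsilon>: "\<epsilon> > 0"
  shows "frechet_derivative (moll \<epsilon> u) (at x) (axis i 1) = (\<integral>z. kr \<epsilon> (x - z) * G z $ i \<partial>lborel)"
proof -
  have ui': "integrable lborel (\<lambda>x. \<bar>u x\<bar> ^ 2)" using ui by simp
  have kc1: "c1_on UNIV (kr \<epsilon>)" using kr_tfield[OF \<epsilon>] by (simp add: tfield_def)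
  let ?\<phi> = "\<lambda>z. kr \<epsilon> (x - z)"
  have D: "(?\<phi> has_derivative (\<lambda>v. frechet_derivative (kr \<epsilon>) (at (x - z)) (- v))) (at z)" for z
  proof -
    have "((\<lambda>z. x - z) has_derivative (\<lambda>v. - v)) (at z)" by (auto intro!: derivative_eq_intros)
    from has_derivative_compose[OF this, of "kr \<epsilon>"] c1_on_has_derivative[OF kc1] show ?thesis by simp
  qed
  have t: "tfield ?\<phi>"
  proof -
    have "c1_on UNIV ?\<phi>" by (intro c1_on_compose[OF kc1] c1_on_diff c1_on_const c1_on_id) simp
    moreover have "norm z \<le> norm x + \<epsilon>" if "?\<phi> z \<noteq> 0" for z
      using that kr_zero[OF \<epsilon>, of "x - z"] norm_triangle_ineq2[of z x] by (force simp: norm_minus_commute)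
    then have "bounded {z. ?\<phi> z \<noteq> 0}" unfolding bounded_iff by blast
    ultimately show ?thesis by (simp add: tfield_def)
  qed
  have "(\<integral>z. u z * grad ?\<phi> z $ i \<partial>lborel) = - (\<integral>z. G z $ i * ?\<phi> z \<partial>lborel)"
    using G t unfolding weak_grad_def test_fun_iff_tfield by blast
  moreover have "grad ?\<phi> z $ i = - frechet_derivative (kr \<epsilon>) (at (x - z)) (axis i 1)" for z
    using frechet_eqI[OF D[of z]] linear_neg[OF linear_frechet_derivative[of "kr \<epsilon>" "at (x - z)"]] kc1
    by (simp add: grad_def c1_on_def)
  ultimately have "(\<integral>z. u z * frechet_derivative (kr \<epsilon>) (at (x - z)) (axis i 1) \<partial>lborel) = (\<integral>z. G z $ i * ?\<phi> z \<partial>lborel)"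
    by simp
  then show ?thesis using moll_c1(2)[OF \<epsilon> um u0 ui'] by (simp add: mult.commute)
qed

text \<open>The root u = sqrt f is mollified rather than f: the gradient of the mollified root U is
  the mollified G, so by Jensen its energy is at most that of G. For U^2 the dual bound is the
  integral of |2 grad U + U psi|^2 \<ge> 0 after integration by parts, and U^2 tends to f in
  L^1.\<close>

theorem fisher_le_of_weak_grad:
  assumes fm [measurable]: "f \<in> borel_measurable borel" and f0: "\<And>x. f x \<ge> 0" and fi: "integrable lborel f"
    and G: "weak_grad (\<lambda>x. sqrt (f x)) G" and Gi: "integrable lborel (\<lambda>x. (norm (G x))\<^sup>2)"
  shows "fisher_le (4 * (\<integral>x. (norm (G x))\<^sup>2 \<partial>lborel)) f"
proof -
  define u where "u x = sqrt (f x)" for x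
  have um [measurable]: "u \<in> borel_measurable borel" unfolding u_def[abs_def] by measurable
  have u0: "u x \<ge> 0" and uf: "(u x)\<^sup>2 = f x" for x using f0 by (auto simp: u_def)
  have ui: "integrable lborel (\<lambda>x. (u x)\<^sup>2)" using fi by (simp add: uf)
  then have ui2: "integrable lborel (\<lambda>x. \<bar>u x\<bar> ^ 2)" by simp
  have G': "weak_grad u G" using G by (simp add: u_def[abs_def])
  have Gm [measurable]: "G \<in> borel_measurable borel" using G by (simp add: weak_grad_def)
  define I where "I = (\<integral>x. (norm (G x))\<^sup>2 \<partial>lborel)"
  have U: "fisher_le (4 * I) (\<lambda>x. (moll \<epsilon> u x)\<^sup>2) \<and> integrable lborel (\<lambda>x. (moll \<epsilon> u x)\<^sup>2)" if \<epsilon>: "\<epsilon> > 0" for \<epsilon>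
  proof
    let ?U = "moll \<epsilon> u"
    note [measurable] = moll_measurable[OF \<epsilon> um] kr_measurable[OF \<epsilon>]
    have Uc1: "c1_on UNIV ?U" by (rule moll_c1(1)[OF \<epsilon> um u0 ui2]) simp
    have Ud: "?U differentiable (at x)" for x using Uc1 by (simp add: c1_on_def)
    show Ui: "integrable lborel (\<lambda>x. (?U x)\<^sup>2)"
    proof (rule integrableI_nonneg)
      have "(\<integral>\<^sup>+x. ennreal (\<bar>?U x\<bar> ^ 2) \<partial>lborel) \<le> ennreal (\<integral>x. \<bar>u x\<bar> ^ 2 \<partial>lborel)"
        by (rule moll_Lp(1)[OF \<epsilon> um ui2]) simp
      then show "(\<integral>\<^sup>+x. ennreal ((?U x)\<^sup>2) \<partial>lborel) < \<infinity>" by (simp add: order.strict_trans1)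
    qed auto
    define V where "V = grad ?U"
    have DV: "frechet_derivative ?U (at x) v = V x \<bullet> v" for x v unfolding V_def by (rule grad_tfield[OF Ud])
    have Vi: "V x $ i = (\<integral>z. kr \<epsilon> (x - z) * G z $ i \<partial>lborel)" for x i
      using weak_grad_mollified[OF um u0 ui G' \<epsilon>, of x i] by (simp add: V_def grad_def)
    have Vc: "continuous_on UNIV V"
      unfolding V_def grad_def[abs_def] using Uc1 by (intro continuous_on_vec_lambda) (simp add: c1_on_def)
    have Vm [measurable]: "V \<in> borel_measurable borel" using Vc by (rule borel_measurable_continuous_onI)
    obtain K where K: "K > 0" "\<And>z. \<bar>kr \<epsilon> z\<bar> \<le> K" using kr_bounded[OF \<epsilon>] by blast
    have kG: "integrable lborel (\<lambda>z. kr \<epsilon> (x - z) * (norm (G z))\<^sup>2)" for x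
      using integrable_mult_bounded[OF Gi, where h="\<lambda>z. kr \<epsilon> (x - z)" and K=K] K by (simp add: mult.commute)
    have Gim [measurable]: "(\<lambda>z. G z $ i) \<in> borel_measurable borel" for i
      using borel_measurable_inner[OF Gm borel_measurable_const[of "axis i 1"]] by (simp add: inner_axis)
    have Vle: "(norm (V x))\<^sup>2 \<le> (\<integral>z. kr \<epsilon> (x - z) * (norm (G z))\<^sup>2 \<partial>lborel)" for x
    proof -
      have comp: "(G z $ i)\<^sup>2 \<le> (norm (G z))\<^sup>2" for z i
        using component_le_norm_cart[of "G z" i] by (metis abs_le_square_iff abs_norm_cancel)
      have nrm: "(norm y)\<^sup>2 = (\<Sum>i\<in>UNIV. (y $ i)\<^sup>2)" for y :: vel
        unfolding power2_norm_eq_inner by (simp add: inner_vec_def power2_eq_square)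
      have i2: "integrable lborel (\<lambda>z. kr \<epsilon> (x - z) * (G z $ i)\<^sup>2)" for i
        by (rule integrable_nonneg_bound[OF kG[of x]]) (auto simp: kr_nonneg[OF \<epsilon>] comp mult_left_mono)
      have i1: "integrable lborel (\<lambda>z. kr \<epsilon> (x - z) * G z $ i)" for i
      proof (rule Bochner_Integration.integrable_bound)
        show "integrable lborel (\<lambda>z. kr \<epsilon> (x - z) + kr \<epsilon> (x - z) * (G z $ i)\<^sup>2)"
          using i2 integral_lborel_shift(4)[OF kr_measurable[OF \<epsilon>] kr_integrable[OF \<epsilon>], of x] by simp
        have "\<bar>a\<bar> \<le> 1 + a\<^sup>2" for a :: real using zero_le_power2[of "\<bar>a\<bar> - 1"] by (simp add: power2_eq_square algebra_simps abs_mult_self_eq)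
        then have "norm (kr \<epsilon> (x - z) * G z $ i) \<le> kr \<epsilon> (x - z) * (1 + (G z $ i)\<^sup>2)" for z
          by (simp add: abs_mult kr_nonneg[OF \<epsilon>] mult_left_mono)
        then show "AE z in lborel. norm (kr \<epsilon> (x - z) * G z $ i) \<le> norm (kr \<epsilon> (x - z) + kr \<epsilon> (x - z) * (G z $ i)\<^sup>2)"
          by (intro AE_I2) (auto simp: distrib_left intro: order_trans[OF _ abs_ge_self])
      qed measurable
      have sh: "(\<integral>z. kr \<epsilon> (x - z) * h z \<partial>lborel) = (\<integral>z. kr \<epsilon> z * h (x - z) \<partial>lborel)"
        and shi: "integrable lborel (\<lambda>z. kr \<epsilon> (x - z) * h z) \<Longrightarrow> integrable lborel (\<lambda>z. kr \<epsilon> z * h (x - z))"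
        if [measurable]: "h \<in> borel_measurable borel" for h :: "vel \<Rightarrow> real"
        using integral_lborel_shift(2,4)[of "\<lambda>z. kr \<epsilon> (x - z) * h z" x] by simp_all
      have "(V x $ i)\<^sup>2 \<le> (\<integral>z. kr \<epsilon> (x - z) * (G z $ i)\<^sup>2 \<partial>lborel)" for i
        using kr_jensen[OF \<epsilon> shi[OF Gim i1[of i]]] shi[OF _ i2[of i]] unfolding Vi by (simp add: sh)
      then have "(\<Sum>i\<in>UNIV. (V x $ i)\<^sup>2) \<le> (\<Sum>i\<in>UNIV. (\<integral>z. kr \<epsilon> (x - z) * (G z $ i)\<^sup>2 \<partial>lborel))" by (intro sum_mono)
      also have "\<dots> = (\<integral>z. (\<Sum>i\<in>UNIV. kr \<epsilon> (x - z) * (G z $ i)\<^sup>2) \<partial>lborel)" using i2 by simp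
      also have "\<dots> = (\<integral>z. kr \<epsilon> (x - z) * (norm (G z))\<^sup>2 \<partial>lborel)"
        by (simp add: sum_distrib_left[symmetric] nrm)
      finally show ?thesis by (simp add: nrm)
    qed
    have "(\<integral>\<^sup>+x. ennreal ((norm (V x))\<^sup>2) \<partial>lborel) \<le> (\<integral>\<^sup>+x. \<integral>\<^sup>+z. ennreal (kr \<epsilon> (x - z) * (norm (G z))\<^sup>2) \<partial>lborel \<partial>lborel)"
    proof (rule nn_integral_mono)
      fix x
      show "ennreal ((norm (V x))\<^sup>2) \<le> (\<integral>\<^sup>+z. ennreal (kr \<epsilon> (x - z) * (norm (G z))\<^sup>2) \<partial>lborel)"
        using kG Vle kr_nonneg[OF \<epsilon>] by (subst nn_integral_eq_integral) (auto intro!: ennreal_leI)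
    qed
    also have "\<dots> = (\<integral>\<^sup>+z. \<integral>\<^sup>+x. ennreal (kr \<epsilon> (x - z) * (norm (G z))\<^sup>2) \<partial>lborel \<partial>lborel)"
      by (rule lborel_pair.Fubini') measurable
    also have "\<dots> = (\<integral>\<^sup>+z. ennreal ((norm (G z))\<^sup>2) \<partial>lborel)"
    proof (rule nn_integral_cong)
      fix z
      have "(\<integral>\<^sup>+x. ennreal (kr \<epsilon> (x - z) * (norm (G z))\<^sup>2) \<partial>lborel) = (\<integral>\<^sup>+x. ennreal (kr \<epsilon> (x - z)) \<partial>lborel) * ennreal ((norm (G z))\<^sup>2)"
        by (simp add: nn_integral_multc ennreal_mult kr_nonneg[OF \<epsilon>])
      also have "(\<integral>\<^sup>+x. ennreal (kr \<epsilon> (x - z)) \<partial>lborel) = 1"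
        using nn_integral_lborel_shift(1)[of "\<lambda>x. ennreal (kr \<epsilon> x)" z] kr_nn_integral[OF \<epsilon>] by simp
      finally show "(\<integral>\<^sup>+x. ennreal (kr \<epsilon> (x - z) * (norm (G z))\<^sup>2) \<partial>lborel) = ennreal ((norm (G z))\<^sup>2)" by simp
    qed
    also have "\<dots> = ennreal I" unfolding I_def using Gi by (intro nn_integral_eq_integral) auto
    finally have Vnn: "(\<integral>\<^sup>+x. ennreal ((norm (V x))\<^sup>2) \<partial>lborel) \<le> ennreal I" .
    have I0: "I \<ge> 0" by (simp add: I_def)
    have Vint: "integrable lborel (\<lambda>x. (norm (V x))\<^sup>2)"
      using Vnn by (intro integrableI_nonneg) (auto intro: order.strict_trans1)
    have VI: "(\<integral>x. (norm (V x))\<^sup>2 \<partial>lborel) \<le> I"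
      using Vnn Vint I0 by (subst (asm) nn_integral_eq_integral) (auto simp: ennreal_le_iff)
    show "fisher_le (4 * I) (\<lambda>x. (?U x)\<^sup>2)"
      unfolding fisher_le_def
    proof (intro allI impI)
      fix \<psi> :: "vel \<Rightarrow> vel" assume t: "tfield \<psi>"
      have sc1: "c1_on UNIV (\<lambda>x. (?U x)\<^sup>2)" unfolding power2_eq_square by (intro c1_on_mult Uc1)
      have sD: "frechet_derivative (\<lambda>x. (?U x)\<^sup>2) (at x) v = 2 * ?U x * (V x \<bullet> v)" for x v
      proof -
        have "(?U has_derivative (\<lambda>v. V x \<bullet> v)) (at x)" using Ud[of x] unfolding frechet_derivative_works DV[abs_def] .
        then have "((\<lambda>x. (?U x)\<^sup>2) has_derivative (\<lambda>v. 2 * ?U x * (V x \<bullet> v))) (at x)"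
          by (auto intro!: derivative_eq_intros)
        then show ?thesis by (simp add: frechet_eqI)
      qed
      note pr = integral_product_rule[OF sc1 t]
      have Ni: "integrable lborel (\<lambda>x. (norm (\<psi> x))\<^sup>2 * (?U x)\<^sup>2)" by (rule tfield_integrable(2)[OF t Ui])
      have "2 * (\<integral>x. dvg \<psi> x * (?U x)\<^sup>2 \<partial>lborel) = (\<integral>x. - (2 * (2 * ?U x * (V x \<bullet> \<psi> x))) \<partial>lborel)"
        using pr(1) by (simp add: sD mult.assoc mult.commute[of "dvg _ _"])
      also have "\<dots> \<le> (\<integral>x. 4 * (norm (V x))\<^sup>2 + (norm (\<psi> x))\<^sup>2 * (?U x)\<^sup>2 \<partial>lborel)"
      proof (rule integral_mono)
        show "integrable lborel (\<lambda>x. - (2 * (2 * ?U x * (V x \<bullet> \<psi> x))))" using pr(3) by (simp add: sD mult.assoc)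
        show "integrable lborel (\<lambda>x. 4 * (norm (V x))\<^sup>2 + (norm (\<psi> x))\<^sup>2 * (?U x)\<^sup>2)" using Vint Ni by simp
        fix x
        have "0 \<le> (norm (2 *\<^sub>R V x + ?U x *\<^sub>R \<psi> x))\<^sup>2" by simp
        also have "\<dots> = (norm (2 *\<^sub>R V x))\<^sup>2 + (norm (?U x *\<^sub>R \<psi> x))\<^sup>2 + 2 * ((2 *\<^sub>R V x) \<bullet> (?U x *\<^sub>R \<psi> x))"
          using dot_norm[of "2 *\<^sub>R V x" "?U x *\<^sub>R \<psi> x"] by simp
        also have "\<dots> = 4 * (norm (V x))\<^sup>2 + (norm (\<psi> x))\<^sup>2 * (?U x)\<^sup>2 + 2 * (2 * ?U x * (V x \<bullet> \<psi> x))"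
          by (simp add: power_mult_distrib)
        finally show "- (2 * (2 * ?U x * (V x \<bullet> \<psi> x))) \<le> 4 * (norm (V x))\<^sup>2 + (norm (\<psi> x))\<^sup>2 * (?U x)\<^sup>2" by simp
      qed
      also have "\<dots> = 4 * (\<integral>x. (norm (V x))\<^sup>2 \<partial>lborel) + (\<integral>x. (norm (\<psi> x))\<^sup>2 * (?U x)\<^sup>2 \<partial>lborel)" using Vint Ni by simp
      finally show "2 * (\<integral>x. dvg \<psi> x * (?U x)\<^sup>2 \<partial>lborel) \<le> 4 * I + (\<integral>x. (norm (\<psi> x))\<^sup>2 * (?U x)\<^sup>2 \<partial>lborel)" using VI by linarith
    qed
  qed
  have "\<exists>h. h \<in> borel_measurable borel \<and> integrable lborel h \<and> fisher_le (4 * I) h \<and> L1dist f h \<le> \<eta>" if \<eta>: "\<eta> > 0" for \<eta>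
  proof -
    \<comment> \<open>The estimate will be |u^2 - U^2| \<le> (1 + 1 / s) |U - u|^2 + s f. First s is
      taken so small that s F \<le> eta / 2; then the mollification error absorbs the factor 1 + 1 /
      s.\<close>
    define F where "F = (\<integral>x. f x \<partial>lborel)"
    have F: "F \<ge> 0" unfolding F_def using f0 by simp
    define s where "s = \<eta> / (2 * (F + 1))"
    have s: "s > 0" using \<eta> F by (simp add: s_def)
    have sF: "s * F \<le> \<eta> / 2"
    proof -
      have "s * F \<le> s * (F + 1)" using s by simp
      also have "\<dots> = \<eta> / 2" using F unfolding s_def by (simp add: field_simps)
      finally show ?thesis .
    qed
    define \<eta>' where "\<eta>' = \<eta> / 2 / (1 + 1 / s)"
    have \<eta>': "\<eta>' > 0" using \<eta> s by (simp add: \<eta>'_def add_pos_pos)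
    obtain \<epsilon> where \<epsilon>: "\<epsilon> > 0" "(\<integral>x. \<bar>moll \<epsilon> u x - u x\<bar> ^ 2 \<partial>lborel) \<le> \<eta>'" "integrable lborel (\<lambda>x. \<bar>moll \<epsilon> u x - u x\<bar> ^ 2)"
      using moll_L1_limit[OF um ui2 _ \<eta>'] by auto
    let ?U = "moll \<epsilon> u"
    note [measurable] = moll_measurable[OF \<epsilon>(1) um]
    have pw: "\<bar>f x - (?U x)\<^sup>2\<bar> \<le> (1 + 1 / s) * \<bar>?U x - u x\<bar> ^ 2 + s * f x" for x
    proof -
      define a b where "a = ?U x - u x" and "b = u x"
      have "\<bar>b\<^sup>2 - (a + b)\<^sup>2\<bar> \<le> a\<^sup>2 + 2 * \<bar>a\<bar> * \<bar>b\<bar>"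
      proof -
        have "b\<^sup>2 - (a + b)\<^sup>2 = - (a\<^sup>2 + 2 * (a * b))" by (simp add: power2_eq_square algebra_simps)
        then show ?thesis using abs_triangle_ineq[of "a\<^sup>2" "2 * (a * b)"] by (simp add: abs_mult)
      qed
      also have "2 * \<bar>a\<bar> * \<bar>b\<bar> \<le> a\<^sup>2 / s + s * b\<^sup>2"
      proof -
        have "0 \<le> (\<bar>a\<bar> - s * \<bar>b\<bar>)\<^sup>2 / s" using s by simp
        also have "\<dots> = a\<^sup>2 / s + s * b\<^sup>2 - 2 * \<bar>a\<bar> * \<bar>b\<bar>"
          using s by (simp add: power2_eq_square field_simps abs_mult_self_eq)
        finally show ?thesis by simp
      qed
      finally show ?thesis using uf[of x] by (simp add: a_def b_def distrib_right)
    qed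
    have "L1dist f (\<lambda>x. (?U x)\<^sup>2) \<le> (\<integral>x. (1 + 1 / s) * \<bar>?U x - u x\<bar> ^ 2 + s * f x \<partial>lborel)"
      unfolding L1dist_def using fi \<epsilon>(3) U[OF \<epsilon>(1)] pw by (intro integral_mono) auto
    also have "\<dots> = (1 + 1 / s) * (\<integral>x. \<bar>?U x - u x\<bar> ^ 2 \<partial>lborel) + s * F" using \<epsilon>(3) fi by (simp add: F_def)
    also have "\<dots> \<le> (1 + 1 / s) * \<eta>' + \<eta> / 2" using \<epsilon>(2) sF s by (intro add_mono mult_left_mono) auto
    also have "(1 + 1 / s) * \<eta>' = \<eta> / 2"
    proof -
      have "c * (\<eta> / 2 / c) = \<eta> / 2" if "c > 0" for c :: real using that by simp
      moreover have "1 + 1 / s > 0" using s by (simp add: add_pos_pos)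
      ultimately show ?thesis unfolding \<eta>'_def by blast
    qed
    finally show ?thesis using U[OF \<epsilon>(1)] by (intro exI[of _ "\<lambda>x. (?U x)\<^sup>2"]) auto
  qed
  then have "\<exists>h. \<forall>n. h n \<in> borel_measurable borel \<and> integrable lborel (h n) \<and> fisher_le (4 * I) (h n) \<and> L1dist f (h n) \<le> inverse (real (Suc n))"
    by (intro choice allI) simp
  then obtain h where h: "\<And>n. h n \<in> borel_measurable borel" "\<And>n. integrable lborel (h n)" "\<And>n. fisher_le (4 * I) (h n)"
    "\<And>n. L1dist f (h n) \<le> inverse (real (Suc n))" by blast
  have "(\<lambda>n. L1dist f (h n)) \<longlonglongrightarrow> 0"
    by (rule Lim_null_comparison[OF _ LIMSEQ_inverse_real_of_nat]) (use h(4) in \<open>auto intro!: always_eventually simp: L1dist_def\<close>)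
  from fisher_le_limit[OF fi fm h(2,1,3) this] show ?thesis by (simp add: I_def)
qed

section \<open>From the dual bound to a weak gradient\<close>

lemma
  assumes t: "tfield \<psi>"
  shows tfield_translate: "tfield (\<lambda>x. \<psi> (x + z))"
    and dvg_translate: "dvg (\<lambda>x. \<psi> (x + z)) x = dvg \<psi> (x + z)"
proof -
  have c: "c1_on UNIV \<psi>" using t by (simp add: tfield_def)
  obtain R where R: "R > 0" "\<And>x. norm x > R \<Longrightarrow> \<psi> x = 0" using tfield_vanish[OF t] by metis
  have "norm x \<le> R + norm z" if "\<psi> (x + z) \<noteq> 0" for x
    using that R(2)[of "x + z"] norm_triangle_ineq4[of "x + z" z] by (force simp: not_less[symmetric])
  then have "bounded {x. \<psi> (x + z) \<noteq> 0}" unfolding bounded_iff by blast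
  moreover have "c1_on UNIV (\<lambda>x. \<psi> (x + z))" by (intro c1_on_compose[OF c] c1_on_add c1_on_const c1_on_id) simp
  ultimately show "tfield (\<lambda>x. \<psi> (x + z))" by (simp add: tfield_def)
  have "((\<lambda>x. x + z) has_derivative (\<lambda>v. v)) (at x)" by (auto intro!: derivative_eq_intros)
  from has_derivative_compose[OF this, of \<psi>] c1_on_has_derivative[OF c]
  have "((\<lambda>x. \<psi> (x + z)) has_derivative (\<lambda>v. frechet_derivative \<psi> (at (x + z)) v)) (at x)" by simp
  from frechet_eqI[OF this] show "dvg (\<lambda>x. \<psi> (x + z)) x = dvg \<psi> (x + z)" by (simp add: dvg_def)
qed

lemma fisher_le_translate:
  assumes C: "fisher_le C f" and fm [measurable]: "f \<in> borel_measurable borel"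
  shows "fisher_le C (\<lambda>x. f (x - z))"
  unfolding fisher_le_def
proof (intro allI impI)
  fix \<psi> :: "vel \<Rightarrow> vel" assume t: "tfield \<psi>"
  note [measurable] = tfield_dvg_measurable[OF t] tfield_norm_sq_measurable[OF t]
  show "2 * (\<integral>x. dvg \<psi> x * f (x - z) \<partial>lborel) \<le> C + (\<integral>x. (norm (\<psi> x))\<^sup>2 * f (x - z) \<partial>lborel)"
    using C[unfolded fisher_le_def, rule_format, OF tfield_translate[OF t, of z]]
      integral_lborel_shift(1)[of "\<lambda>x. dvg \<psi> x * f (x - z)" z] integral_lborel_shift(1)[of "\<lambda>x. (norm (\<psi> x))\<^sup>2 * f (x - z)" z]
    by (simp add: dvg_translate[OF t])
qed

lemma integral_mult_moll:
  assumes fm [measurable]: "f \<in> borel_measurable borel" and fi: "integrable lborel f" and \<epsilon>: "\<epsilon> > 0"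
    and hm [measurable]: "h \<in> borel_measurable borel" and K: "\<And>x. \<bar>h x\<bar> \<le> (K :: real)"
  shows "(\<integral>x. h x * moll \<epsilon> f x \<partial>lborel) = (\<integral>z. kr \<epsilon> z * (\<integral>x. h x * f (x - z) \<partial>lborel) \<partial>lborel)"
    and "integrable lborel (\<lambda>z. kr \<epsilon> z * (\<integral>x. h x * f (x - z) \<partial>lborel))"
proof -
  note [measurable] = kr_measurable[OF \<epsilon>]
  let ?A = "\<integral>x. \<bar>f x\<bar> \<partial>lborel"
  have sh: "integrable lborel (\<lambda>x. f (x - z))" for z using integral_lborel_shift(3)[OF fm fi, of "- z"] by simp
  have ash: "(\<integral>x. \<bar>f (x - z)\<bar> \<partial>lborel) = ?A" for z using integral_lborel_shift(1)[of "\<lambda>x. \<bar>f x\<bar>" "- z"] by simp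
  have hi: "integrable lborel (\<lambda>x. h x * f (x - z))" for z
    using integrable_mult_bounded[OF sh, of h K z] K by (simp add: mult.commute)
  have bd: "(\<integral>x. \<bar>h x * f (x - z)\<bar> \<partial>lborel) \<le> K * ?A" for z
  proof -
    have "(\<integral>x. \<bar>h x * f (x - z)\<bar> \<partial>lborel) \<le> (\<integral>x. K * \<bar>f (x - z)\<bar> \<partial>lborel)"
      using K by (intro integral_mono integrable_abs hi integrable_mult_right sh) (auto simp: abs_mult intro!: mult_right_mono)
    then show ?thesis by (simp add: ash)
  qed
  let ?F = "\<lambda>(z, x). kr \<epsilon> z * (h x * f (x - z))"
  have i: "integrable (lborel \<Otimes>\<^sub>M lborel) ?F"
  proof (rule lborel_pair.Fubini_integrable)
    show "?F \<in> borel_measurable (lborel \<Otimes>\<^sub>M lborel)" by measurable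
    show "integrable lborel (\<lambda>z. \<integral>x. norm (?F (z, x)) \<partial>lborel)"
    proof (rule integrable_nonneg_bound)
      show "integrable lborel (\<lambda>z. kr \<epsilon> z * (K * ?A))" using kr_integrable[OF \<epsilon>] by simp
      show "0 \<le> (\<integral>x. norm (?F (z, x)) \<partial>lborel)" for z by simp
      show "(\<integral>x. norm (?F (z, x)) \<partial>lborel) \<le> kr \<epsilon> z * (K * ?A)" for z
      proof -
        have "(\<integral>x. norm (?F (z, x)) \<partial>lborel) = kr \<epsilon> z * (\<integral>x. \<bar>h x * f (x - z)\<bar> \<partial>lborel)"
          by (simp add: abs_mult kr_nonneg[OF \<epsilon>])
        also have "\<dots> \<le> kr \<epsilon> z * (K * ?A)" by (intro mult_left_mono bd kr_nonneg[OF \<epsilon>])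
        finally show ?thesis .
      qed
    qed measurable
    show "AE z in lborel. integrable lborel (\<lambda>x. ?F (z, x))" using hi by simp
  qed
  have e: "(\<integral>z. \<integral>x. kr \<epsilon> z * (h x * f (x - z)) \<partial>lborel \<partial>lborel) = (\<integral>x. \<integral>z. kr \<epsilon> z * (h x * f (x - z)) \<partial>lborel \<partial>lborel)"
    using lborel_pair.Fubini_integral[OF i] by simp
  have "h x * moll \<epsilon> f x = (\<integral>z. kr \<epsilon> z * (h x * f (x - z)) \<partial>lborel)" for x
    unfolding moll_def[OF \<epsilon>] by (subst integral_mult_right_zero[symmetric]) (simp add: mult_ac)
  then show "(\<integral>x. h x * moll \<epsilon> f x \<partial>lborel) = (\<integral>z. kr \<epsilon> z * (\<integral>x. h x * f (x - z) \<partial>lborel) \<partial>lborel)"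
    using e by simp
  show "integrable lborel (\<lambda>z. kr \<epsilon> z * (\<integral>x. h x * f (x - z) \<partial>lborel))"
    using lborel_pair.integrable_fst'[OF i] by simp
qed

text \<open>A mollification is an average of translates, each of which satisfies the same bound, and
  the dual bound is linear in f.\<close>

lemma fisher_le_moll:
  assumes C: "fisher_le C f" and fm [measurable]: "f \<in> borel_measurable borel" and fi: "integrable lborel f" and \<epsilon>: "\<epsilon> > 0"
  shows "fisher_le C (moll \<epsilon> f)"
  unfolding fisher_le_def
proof (intro allI impI)
  fix \<psi> :: "vel \<Rightarrow> vel" assume t: "tfield \<psi>"
  obtain D where D: "\<And>x. \<bar>dvg \<psi> x\<bar> \<le> D" using tfield_dvg_bounded[OF t] by blast
  obtain N where N: "\<And>x. norm (\<psi> x) \<le> N" using tfield_bounded[OF t] by blast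
  have N': "\<bar>(norm (\<psi> x))\<^sup>2\<bar> \<le> N\<^sup>2" for x using N by (simp add: power_mono)
  note a = integral_mult_moll[OF fm fi \<epsilon> tfield_dvg_measurable[OF t] D]
  note b = integral_mult_moll[OF fm fi \<epsilon> tfield_norm_sq_measurable[OF t] N']
  have "2 * (\<integral>x. dvg \<psi> x * moll \<epsilon> f x \<partial>lborel) = (\<integral>z. 2 * (kr \<epsilon> z * (\<integral>x. dvg \<psi> x * f (x - z) \<partial>lborel)) \<partial>lborel)"
    using a(1) by simp
  also have "\<dots> \<le> (\<integral>z. kr \<epsilon> z * C + kr \<epsilon> z * (\<integral>x. (norm (\<psi> x))\<^sup>2 * f (x - z) \<partial>lborel) \<partial>lborel)"
  proof (rule integral_mono)
    show "integrable lborel (\<lambda>z. 2 * (kr \<epsilon> z * (\<integral>x. dvg \<psi> x * f (x - z) \<partial>lborel)))" using a(2) by simp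
    show "integrable lborel (\<lambda>z. kr \<epsilon> z * C + kr \<epsilon> z * (\<integral>x. (norm (\<psi> x))\<^sup>2 * f (x - z) \<partial>lborel))"
      using b(2) kr_integrable[OF \<epsilon>] by simp
    fix z
    have "kr \<epsilon> z * (2 * (\<integral>x. dvg \<psi> x * f (x - z) \<partial>lborel)) \<le> kr \<epsilon> z * (C + (\<integral>x. (norm (\<psi> x))\<^sup>2 * f (x - z) \<partial>lborel))"
      using fisher_le_translate[OF C fm, of z] t unfolding fisher_le_def by (intro mult_left_mono kr_nonneg[OF \<epsilon>]) blast
    then show "2 * (kr \<epsilon> z * (\<integral>x. dvg \<psi> x * f (x - z) \<partial>lborel)) \<le> kr \<epsilon> z * C + kr \<epsilon> z * (\<integral>x. (norm (\<psi> x))\<^sup>2 * f (x - z) \<partial>lborel)"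
      by (simp add: distrib_left)
  qed
  also have "\<dots> = C + (\<integral>x. (norm (\<psi> x))\<^sup>2 * moll \<epsilon> f x \<partial>lborel)"
    using b kr_integrable[OF \<epsilon>] kr_integral[OF \<epsilon>] by simp
  finally show "2 * (\<integral>x. dvg \<psi> x * moll \<epsilon> f x \<partial>lborel) \<le> C + (\<integral>x. (norm (\<psi> x))\<^sup>2 * moll \<epsilon> f x \<partial>lborel)" .
qed

lemma dvg_integrable: "tfield \<psi> \<Longrightarrow> integrable lborel (dvg \<psi>)" for \<psi> :: "vel \<Rightarrow> vel"
proof -
  assume t: "tfield \<psi>"
  obtain R where "\<And>x. norm x > R \<Longrightarrow> frechet_derivative \<psi> (at x) = (\<lambda>_. 0)" using tfield_vanish[OF t] by metis
  then show ?thesis using t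
    by (intro tfield_real_integrable[of _ R] continuous_on_dvg) (simp_all add: dvg_def tfield_def)
qed

text \<open>Testing the dual bound for \<open>F\<close> with \<open>\<phi> / sqrt (F + \<delta>)\<close> linearises it in \<open>sqrt (F + \<delta>)\<close>.\<close>

lemma sqrt_dual_bound_regular:
  assumes C: "fisher_le C F" and Fc: "c1_on UNIV F" and F0: "\<And>x. F x \<ge> 0" and Fi: "integrable lborel F" and \<delta>: "\<delta> > 0"
    and t: "tfield \<phi>"
  shows "2 * (\<integral>x. sqrt (F x + \<delta>) * dvg \<phi> x \<partial>lborel) \<le> C / 4 + (\<integral>x. (norm (\<phi> x))\<^sup>2 \<partial>lborel)"
proof -
  define r where "r x = sqrt (F x + \<delta>)" for x
  have pos: "F x + \<delta> > 0" for x using F0[of x] \<delta> by simp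
  have r0: "r x > 0" and rr: "r x * r x = F x + \<delta>" for x using pos[of x] by (auto simp: r_def)
  have ac: "c1_on UNIV (\<lambda>x. F x + \<delta>)" by (intro c1_on_add Fc c1_on_const)
  have rc: "c1_on UNIV r" unfolding r_def[abs_def] by (rule c1_on_sqrt[OF ac pos])
  have rd: "r differentiable (at x)" for x using rc by (simp add: c1_on_def)
  define \<psi> where "\<psi> x = inverse (r x) *\<^sub>R \<phi> x" for x
  have ric: "c1_on UNIV (\<lambda>x. inverse (r x))" using rc r0 by (intro c1_on_inverse) (auto simp: less_imp_neq[symmetric])
  have t\<psi>: "tfield \<psi>" unfolding \<psi>_def[abs_def] by (rule tfield_mult[OF ric t])
  have r\<psi>: "r x *\<^sub>R \<psi> x = \<phi> x" for x using r0[of x] by (simp add: \<psi>_def)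
  have Da: "frechet_derivative (\<lambda>x. F x + \<delta>) (at x) (\<psi> x) = 2 * frechet_derivative r (at x) (\<phi> x)" for x
  proof -
    have "(r has_derivative frechet_derivative r (at x)) (at x)" using rd by (simp add: frechet_derivative_works)
    from has_derivative_mult[OF this this]
    have "((\<lambda>x. F x + \<delta>) has_derivative (\<lambda>v. r x * frechet_derivative r (at x) v + frechet_derivative r (at x) v * r x)) (at x)"
      by (simp add: rr)
    from frechet_eqI[OF this] have "frechet_derivative (\<lambda>x. F x + \<delta>) (at x) (\<psi> x) = 2 * (r x * frechet_derivative r (at x) (\<psi> x))"
      by simp
    also have "r x * frechet_derivative r (at x) (\<psi> x) = frechet_derivative r (at x) (r x *\<^sub>R \<psi> x)"
      using linear_cmul[OF linear_frechet_derivative[OF rd]] by simp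
    finally show ?thesis by (simp add: r\<psi>)
  qed
  have "2 * (\<integral>x. r x * dvg \<phi> x \<partial>lborel) = - (\<integral>x. 2 * frechet_derivative r (at x) (\<phi> x) \<partial>lborel)"
    using integral_product_rule(1)[OF rc t] by simp
  also have "\<dots> = (\<integral>x. (F x + \<delta>) * dvg \<psi> x \<partial>lborel)"
    using integral_product_rule(1)[OF ac t\<psi>] by (simp add: Da)
  also have "\<dots> = (\<integral>x. dvg \<psi> x * F x + \<delta> * dvg \<psi> x \<partial>lborel)" by (simp add: algebra_simps)
  \<comment> \<open>The constant \<delta> multiplies the integral of a divergence, which is
    0.\<close>
  also have "\<dots> = (\<integral>x. dvg \<psi> x * F x \<partial>lborel)"
    using dvg_integrable[OF t\<psi>] tfield_integrable(1)[OF t\<psi> Fi] integral_dvg_zero[OF t\<psi>] by simp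
  finally have e: "2 * (\<integral>x. r x * dvg \<phi> x \<partial>lborel) = (\<integral>x. dvg \<psi> x * F x \<partial>lborel)" .
  have "(\<integral>x. (norm (\<psi> x))\<^sup>2 * F x \<partial>lborel) \<le> (\<integral>x. (norm (\<phi> x))\<^sup>2 \<partial>lborel)"
  proof (rule integral_mono)
    show "integrable lborel (\<lambda>x. (norm (\<psi> x))\<^sup>2 * F x)" by (rule tfield_integrable(2)[OF t\<psi> Fi])
    obtain R where "\<And>x. norm x > R \<Longrightarrow> \<phi> x = 0" using tfield_vanish[OF t] by metis
    then show "integrable lborel (\<lambda>x. (norm (\<phi> x))\<^sup>2)"
      by (intro tfield_real_integrable[of _ R] continuous_intros tfield_continuous[OF t]) simp
    fix x
    have "(norm (\<psi> x))\<^sup>2 * F x \<le> (norm (\<psi> x))\<^sup>2 * (r x)\<^sup>2" using rr[of x] \<delta> by (intro mult_left_mono) (simp_all add: power2_eq_square)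
    also have "\<dots> = (norm (\<phi> x))\<^sup>2" using r0[of x] by (simp add: r\<psi>[symmetric] power_mult_distrib mult.commute del: r\<psi>)
    finally show "(norm (\<psi> x))\<^sup>2 * F x \<le> (norm (\<phi> x))\<^sup>2" .
  qed
  \<comment> \<open>By \<open>e\<close> the left side of the dual bound is four times the integral
    of r div phi; l = 1/2 leaves C / 4, matching the factor 4 in the Fisher information.\<close>
  with fisher_leD[OF C t\<psi>, of "1/2"] e show ?thesis by (simp add: r_def)
qed

text \<open>Multiplying by the sum of the roots, which is at least s, leaves the difference of the
  radicands. The regularisation s^2 costs s, and an error in b is amplified by 1 / s.\<close>

lemma sqrt_diff_le:
  assumes "a \<ge> 0" "b \<ge> 0" "s > 0"
  shows "\<bar>sqrt a - sqrt (b + s\<^sup>2)\<bar> \<le> s + \<bar>b - a\<bar> / s"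
proof -
  have s1: "s \<le> sqrt (b + s\<^sup>2)" using assms by (intro real_le_rsqrt) simp
  have "\<bar>sqrt a - sqrt (b + s\<^sup>2)\<bar> * s \<le> \<bar>sqrt a - sqrt (b + s\<^sup>2)\<bar> * \<bar>sqrt a + sqrt (b + s\<^sup>2)\<bar>"
    using s1 assms by (intro mult_left_mono) (auto intro: order_trans[OF _ abs_ge_self] simp: add_increasing)
  also have "\<dots> = \<bar>a - (b + s\<^sup>2)\<bar>"
    unfolding abs_mult[symmetric] using assms by (simp add: algebra_simps)
  also have "\<dots> \<le> s\<^sup>2 + \<bar>b - a\<bar>" using abs_triangle_ineq[of "a - b" "- s\<^sup>2"] by (simp add: abs_minus_commute)
  also have "\<dots> = (s + \<bar>b - a\<bar> / s) * s" using assms by (simp add: power2_eq_square field_simps)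
  finally show ?thesis using assms(3) by simp
qed

lemma sqrt_dvg_integrable:
  fixes f :: "vel \<Rightarrow> real"
  assumes fm [measurable]: "f \<in> borel_measurable borel" and f0: "\<And>x. f x \<ge> 0" and fi: "integrable lborel f" and t: "tfield \<psi>"
  shows "integrable lborel (\<lambda>x. sqrt (f x) * dvg \<psi> x)"
proof (rule Bochner_Integration.integrable_bound)
  show "integrable lborel (\<lambda>x. \<bar>dvg \<psi> x\<bar> + \<bar>dvg \<psi> x * f x\<bar>)" using dvg_integrable[OF t] tfield_integrable(1)[OF t fi] by simp
  have "sqrt (f x) \<le> 1 + f x" for x
    using f0[of x] by (intro real_le_lsqrt) (auto simp: power2_eq_square algebra_simps)
  then have "sqrt (f x) * \<bar>dvg \<psi> x\<bar> \<le> (1 + f x) * \<bar>dvg \<psi> x\<bar>" for x by (intro mult_right_mono) auto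
  then show "AE x in lborel. norm (sqrt (f x) * dvg \<psi> x) \<le> norm (\<bar>dvg \<psi> x\<bar> + \<bar>dvg \<psi> x * f x\<bar>)"
    using f0 by (intro AE_I2) (simp add: abs_mult algebra_simps)
qed (use tfield_dvg_measurable[OF t] in measurable)

text \<open>Mollification with L^1 error at most s^2 and regularisation \<delta> = s^2 together
  perturb the left side by O(s), and s is arbitrary.\<close>

lemma sqrt_dual_bound:
  assumes C: "fisher_le C f" and fm [measurable]: "f \<in> borel_measurable borel" and f0: "\<And>x. f x \<ge> 0" and fi: "integrable lborel f"
    and t: "tfield \<phi>"
  shows "2 * (\<integral>x. sqrt (f x) * dvg \<phi> x \<partial>lborel) \<le> C / 4 + (\<integral>x. (norm (\<phi> x))\<^sup>2 \<partial>lborel)"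
proof -
  obtain D where D: "D > 0" "\<And>x. \<bar>dvg \<phi> x\<bar> \<le> D" using tfield_dvg_bounded[OF t] by blast
  define A where "A = (\<integral>x. \<bar>dvg \<phi> x\<bar> \<partial>lborel)"
  let ?N = "\<integral>x. (norm (\<phi> x))\<^sup>2 \<partial>lborel"
  note dm [measurable] = tfield_dvg_measurable[OF t]
  have fi1: "integrable lborel (\<lambda>x. \<bar>f x\<bar> ^ 1)" using fi by simp
  have main: "2 * (\<integral>x. sqrt (f x) * dvg \<phi> x \<partial>lborel) \<le> C / 4 + ?N + s * (2 * A + 2 * D)" if s: "s > 0" for s
  proof -
    have "s\<^sup>2 > 0" using s by simp
    from moll_L1_limit[OF fm fi1 _ this] obtain \<epsilon> where \<epsilon>: "\<epsilon> > 0" "(\<integral>x. \<bar>moll \<epsilon> f x - f x\<bar> \<partial>lborel) \<le> s\<^sup>2" "integrable lborel (\<lambda>x. \<bar>moll \<epsilon> f x - f x\<bar>)"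
      by auto
    let ?F = "moll \<epsilon> f"
    note [measurable] = moll_measurable[OF \<epsilon>(1) fm]
    have F0: "?F x \<ge> 0" for x by (rule moll_nonneg[OF \<epsilon>(1) f0])
    have Fc: "c1_on UNIV ?F" by (rule moll_c1(1)[OF \<epsilon>(1) fm f0 fi1]) simp
    have Fi: "integrable lborel ?F"
    proof -
      have "integrable lborel (\<lambda>x. ?F x - f x)" using \<epsilon>(3) by (subst (asm) integrable_abs_iff) auto
      from Bochner_Integration.integrable_add[OF this fi] show ?thesis by simp
    qed
    note reg = sqrt_dual_bound_regular[OF fisher_le_moll[OF C fm fi \<epsilon>(1)] Fc F0 Fi \<open>s\<^sup>2 > 0\<close> t]
    have Ri: "integrable lborel (\<lambda>x. sqrt (?F x + s\<^sup>2) * dvg \<phi> x)"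
    proof -
      have "c1_on UNIV (\<lambda>x. sqrt (?F x + s\<^sup>2))" using F0 s by (intro c1_on_sqrt c1_on_add Fc c1_on_const) (simp add: add_nonneg_pos)
      from integral_product_rule(2)[OF this t] show ?thesis .
    qed
    have "(\<integral>x. sqrt (f x) * dvg \<phi> x \<partial>lborel)
        \<le> (\<integral>x. sqrt (?F x + s\<^sup>2) * dvg \<phi> x + (s * \<bar>dvg \<phi> x\<bar> + (D / s) * \<bar>?F x - f x\<bar>) \<partial>lborel)"
    proof (rule integral_mono)
      show "integrable lborel (\<lambda>x. sqrt (f x) * dvg \<phi> x)" by (rule sqrt_dvg_integrable[OF fm f0 fi t])
      show "integrable lborel (\<lambda>x. sqrt (?F x + s\<^sup>2) * dvg \<phi> x + (s * \<bar>dvg \<phi> x\<bar> + (D / s) * \<bar>?F x - f x\<bar>))"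
        using Ri \<epsilon>(3) dvg_integrable[OF t] by simp
      fix x
      have "(sqrt (f x) - sqrt (?F x + s\<^sup>2)) * dvg \<phi> x \<le> \<bar>sqrt (f x) - sqrt (?F x + s\<^sup>2)\<bar> * \<bar>dvg \<phi> x\<bar>"
        unfolding abs_mult[symmetric] by simp
      also have "\<dots> \<le> (s + \<bar>?F x - f x\<bar> / s) * \<bar>dvg \<phi> x\<bar>" by (intro mult_right_mono sqrt_diff_le f0 F0 s) simp
      also have "\<dots> \<le> s * \<bar>dvg \<phi> x\<bar> + (\<bar>?F x - f x\<bar> / s) * D"
        using D(2)[of x] s unfolding distrib_right by (intro add_left_mono mult_left_mono) auto
      finally show "sqrt (f x) * dvg \<phi> x \<le> sqrt (?F x + s\<^sup>2) * dvg \<phi> x + (s * \<bar>dvg \<phi> x\<bar> + (D / s) * \<bar>?F x - f x\<bar>)"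
        by (simp add: algebra_simps)
    qed
    also have "\<dots> = (\<integral>x. sqrt (?F x + s\<^sup>2) * dvg \<phi> x \<partial>lborel) + (s * A + (D / s) * (\<integral>x. \<bar>?F x - f x\<bar> \<partial>lborel))"
      using Ri \<epsilon>(3) dvg_integrable[OF t] by (simp add: A_def)
    also have "(D / s) * (\<integral>x. \<bar>?F x - f x\<bar> \<partial>lborel) \<le> (D / s) * s\<^sup>2" using \<epsilon>(2) D(1) s by (intro mult_left_mono) auto
    also have "(D / s) * s\<^sup>2 = D * s" using s by (simp add: power2_eq_square)
    finally show ?thesis using reg by (simp add: algebra_simps)
  qed
  show ?thesis
  proof (rule field_le_epsilon)
    fix \<eta> :: real assume \<eta>: "\<eta> > 0"
    have A0: "A \<ge> 0" by (simp add: A_def)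
    define c where "c = 2 * A + 2 * D"
    have c: "c > 0" using A0 D(1) by (simp add: c_def)
    have "2 * (\<integral>x. sqrt (f x) * dvg \<phi> x \<partial>lborel) \<le> C / 4 + ?N + (\<eta> / c) * c" using main[of "\<eta> / c"] \<eta> c by (simp add: c_def)
    then show "2 * (\<integral>x. sqrt (f x) * dvg \<phi> x \<partial>lborel) \<le> C / 4 + ?N + \<eta>" using c by simp
  qed
qed

section \<open>Square-integrable fields and representation of functionals\<close>

lemma tfield_square_integrable:
  fixes \<phi> :: "vel \<Rightarrow> vel"
  assumes "tfield \<phi>"
  shows "integrable lborel (\<lambda>x. (norm (\<phi> x))\<^sup>2)"
proof -
  obtain R where "\<And>x. norm x > R \<Longrightarrow> \<phi> x = 0" using tfield_vanish[OF assms] by metis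
  then show ?thesis by (intro tfield_real_integrable[of _ R] continuous_intros tfield_continuous[OF assms]) simp
qed

text \<open>Young's inequality with a free weight c in place of Cauchy-Schwarz, so that no square
  roots of integrals occur.\<close>

lemma integrable_inner_square:
  fixes u v :: "'a \<Rightarrow> vel"
  assumes [measurable]: "u \<in> borel_measurable M" "v \<in> borel_measurable M"
    and i: "integrable M (\<lambda>x. (norm (u x))\<^sup>2)" "integrable M (\<lambda>x. (norm (v x))\<^sup>2)"
  shows "integrable M (\<lambda>x. u x \<bullet> v x)"
    and "c > 0 \<Longrightarrow> 2 * \<bar>\<integral>x. u x \<bullet> v x \<partial>M\<bar> \<le> c * (\<integral>x. (norm (u x))\<^sup>2 \<partial>M) + (\<integral>x. (norm (v x))\<^sup>2 \<partial>M) / c"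
proof -
  have p: "2 * \<bar>u x \<bullet> v x\<bar> \<le> c * (norm (u x))\<^sup>2 + (norm (v x))\<^sup>2 / c" if c: "c > 0" for c x
  proof -
    have "0 \<le> (c * norm (u x) - norm (v x))\<^sup>2 / c" using c by simp
    also have "\<dots> = c * (norm (u x))\<^sup>2 + (norm (v x))\<^sup>2 / c - 2 * (norm (u x) * norm (v x))"
      using c by (simp add: power2_eq_square field_simps)
    finally show ?thesis using Cauchy_Schwarz_ineq2[of "u x" "v x"] by linarith
  qed
  show ii: "integrable M (\<lambda>x. u x \<bullet> v x)"
  proof (rule Bochner_Integration.integrable_bound)
    show "integrable M (\<lambda>x. (norm (u x))\<^sup>2 + (norm (v x))\<^sup>2)" using i by simp
    show "AE x in M. norm (u x \<bullet> v x) \<le> norm ((norm (u x))\<^sup>2 + (norm (v x))\<^sup>2)"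
    proof (rule AE_I2)
      fix x show "norm (u x \<bullet> v x) \<le> norm ((norm (u x))\<^sup>2 + (norm (v x))\<^sup>2)"
        using p[of 1 x] by simp
    qed
  qed measurable
  assume c: "c > 0"
  have "2 * \<bar>\<integral>x. u x \<bullet> v x \<partial>M\<bar> \<le> (\<integral>x. 2 * \<bar>u x \<bullet> v x\<bar> \<partial>M)"
    using integral_abs_bound[of M "\<lambda>x. u x \<bullet> v x"] by simp
  also have "\<dots> \<le> (\<integral>x. c * (norm (u x))\<^sup>2 + (norm (v x))\<^sup>2 / c \<partial>M)"
    using i ii p[OF c] by (intro integral_mono) auto
  also have "\<dots> = c * (\<integral>x. (norm (u x))\<^sup>2 \<partial>M) + (\<integral>x. (norm (v x))\<^sup>2 \<partial>M) / c" using i by simp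
  finally show "2 * \<bar>\<integral>x. u x \<bullet> v x \<partial>M\<bar> \<le> c * (\<integral>x. (norm (u x))\<^sup>2 \<partial>M) + (\<integral>x. (norm (v x))\<^sup>2 \<partial>M) / c" .
qed

lemma integral_norm_add_square:
  fixes u v :: "'a \<Rightarrow> vel"
  assumes [measurable]: "u \<in> borel_measurable M" "v \<in> borel_measurable M"
    and i: "integrable M (\<lambda>x. (norm (u x))\<^sup>2)" "integrable M (\<lambda>x. (norm (v x))\<^sup>2)"
  shows "(\<integral>x. (norm (u x + c *\<^sub>R v x))\<^sup>2 \<partial>M)
      = (\<integral>x. (norm (u x))\<^sup>2 \<partial>M) + 2 * c * (\<integral>x. u x \<bullet> v x \<partial>M) + c\<^sup>2 * (\<integral>x. (norm (v x))\<^sup>2 \<partial>M)"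
    and "integrable M (\<lambda>x. (norm (u x + c *\<^sub>R v x))\<^sup>2)"
proof -
  have e: "(norm (u x + c *\<^sub>R v x))\<^sup>2 = (norm (u x))\<^sup>2 + 2 * c * (u x \<bullet> v x) + c\<^sup>2 * (norm (v x))\<^sup>2" for x
    using dot_norm[of "u x" "c *\<^sub>R v x"] by (simp add: power_mult_distrib)
  note ii = integrable_inner_square(1)[OF assms]
  show "(\<integral>x. (norm (u x + c *\<^sub>R v x))\<^sup>2 \<partial>M)
      = (\<integral>x. (norm (u x))\<^sup>2 \<partial>M) + 2 * c * (\<integral>x. u x \<bullet> v x \<partial>M) + c\<^sup>2 * (\<integral>x. (norm (v x))\<^sup>2 \<partial>M)"
    unfolding e using i ii by simp
  show "integrable M (\<lambda>x. (norm (u x + c *\<^sub>R v x))\<^sup>2)"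
    unfolding e using i ii by simp
qed

text \<open>Fast convergence makes the sum of 2^n |phi(n+1) - phi(n)|^2 integrable. By 2 a \<le>
  2^(-n) + 2^n a^2 the increments are then summable almost everywhere, which yields the pointwise
  limit; Fatou's lemma carries the estimate over to it.\<close>

lemma L2_fast_Cauchy_limit:
  fixes \<phi> :: "nat \<Rightarrow> 'a \<Rightarrow> vel"
  assumes m [measurable]: "\<And>n. \<phi> n \<in> borel_measurable M"
    and c: "\<And>n m. n \<le> m \<Longrightarrow> (\<integral>\<^sup>+x. ennreal ((norm (\<phi> m x - \<phi> n x))\<^sup>2) \<partial>M) \<le> ennreal (4 * (1/8) ^ n)"
  obtains G where "G \<in> borel_measurable M" "\<And>n. (\<integral>\<^sup>+x. ennreal ((norm (G x - \<phi> n x))\<^sup>2) \<partial>M) \<le> ennreal (4 * (1/8) ^ n)"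
proof -
  define G where "G x = lim (\<lambda>n. \<phi> n x)" for x
  have Gm [measurable]: "G \<in> borel_measurable M" unfolding G_def[abs_def] by (rule borel_measurable_lim_metric) measurable
  define d where "d n x = (norm (\<phi> (Suc n) x - \<phi> n x))\<^sup>2" for n x
  have [measurable]: "d n \<in> borel_measurable M" for n unfolding d_def[abs_def] by measurable
  have "(\<integral>\<^sup>+x. (\<Sum>n. ennreal (2 ^ n * d n x)) \<partial>M) = (\<Sum>n. \<integral>\<^sup>+x. ennreal (2 ^ n * d n x) \<partial>M)"
    by (rule nn_integral_suminf) measurable
  also have "\<dots> \<le> (\<Sum>n. ennreal (4 * (1/4) ^ n))"
  proof (intro suminf_le allI summableI)
    fix n
    have "(\<integral>\<^sup>+x. ennreal (2 ^ n * d n x) \<partial>M) = ennreal (2 ^ n) * (\<integral>\<^sup>+x. ennreal (d n x) \<partial>M)"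
      by (simp add: ennreal_mult d_def nn_integral_cmult)
    also have "\<dots> \<le> ennreal (2 ^ n) * ennreal (4 * (1/8) ^ n)" unfolding d_def by (intro mult_left_mono c) auto
    also have "\<dots> = ennreal (2 ^ n * (4 * (1/8) ^ n))" by (rule ennreal_mult[symmetric]) auto
    also have "2 ^ n * (4 * (1/8) ^ n) = 4 * (1/4 :: real) ^ n" by (simp add: power_mult_distrib[symmetric])
    finally show "(\<integral>\<^sup>+x. ennreal (2 ^ n * d n x) \<partial>M) \<le> ennreal (4 * (1/4) ^ n)" .
  qed
  also have "\<dots> < \<infinity>"
  proof -
    have "summable (\<lambda>n. 4 * (1/4 :: real) ^ n)" by (intro summable_mult summable_geometric) simp
    then show ?thesis by (subst suminf_ennreal2) auto
  qed
  finally have "AE x in M. (\<Sum>n. ennreal (2 ^ n * d n x)) \<noteq> \<infinity>" by (intro nn_integral_noteq_infinite) auto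
  then have lim: "AE x in M. (\<lambda>n. \<phi> n x) \<longlonglongrightarrow> G x"
  proof eventually_elim
    case (elim x)
    then have s: "summable (\<lambda>n. 2 ^ n * d n x)" by (intro summable_suminf_not_top) (auto simp: d_def)
    have "summable (\<lambda>n. norm (\<phi> (Suc n) x - \<phi> n x))"
    proof (rule summable_comparison_test')
      show "summable (\<lambda>n. (1/2) ^ n + 2 ^ n * d n x)" using s by (intro summable_add summable_geometric) auto
      show "norm (norm (\<phi> (Suc n) x - \<phi> n x)) \<le> (1/2) ^ n + 2 ^ n * d n x" if "n \<ge> 0" for n
      proof -
        let ?a = "norm (\<phi> (Suc n) x - \<phi> n x)"
        have "2 * ?a \<le> (1/2) ^ n + 2 ^ n * ?a\<^sup>2"
        proof -
          have "0 \<le> (1/2 :: real) ^ n * (1 - 2 ^ n * ?a)\<^sup>2" by simp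
          also have "\<dots> = (1/2) ^ n - 2 * ?a * ((1/2) ^ n * 2 ^ n) + 2 ^ n * ?a\<^sup>2 * ((1/2) ^ n * 2 ^ n)"
            by (simp only: power2_eq_square) (simp add: algebra_simps del: power_mult_distrib)
          also have "(1/2 :: real) ^ n * 2 ^ n = 1" by (simp add: power_mult_distrib[symmetric])
          finally show ?thesis by simp
        qed
        then show ?thesis by (simp add: d_def) (use norm_ge_zero[of "\<phi> (Suc n) x - \<phi> n x"] in linarith)
      qed
    qed
    then have "summable (\<lambda>n. \<phi> (Suc n) x - \<phi> n x)" by (rule summable_norm_cancel)
    then have "convergent (\<lambda>n. \<Sum>i<n. \<phi> (Suc i) x - \<phi> i x)" by (simp add: summable_iff_convergent)
    then have "convergent (\<lambda>n. \<phi> n x - \<phi> 0 x)" by (simp add: sum_lessThan_telescope[of "\<lambda>i. \<phi> i x"])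
    then have "convergent (\<lambda>n. (\<phi> n x - \<phi> 0 x) + \<phi> 0 x)" by (rule convergent_add[OF _ convergent_const])
    then show ?case by (simp add: G_def convergent_LIMSEQ_iff)
  qed
  have "(\<integral>\<^sup>+x. ennreal ((norm (G x - \<phi> n x))\<^sup>2) \<partial>M) \<le> ennreal (4 * (1/8) ^ n)" for n
  proof -
    have "(\<integral>\<^sup>+x. ennreal ((norm (G x - \<phi> n x))\<^sup>2) \<partial>M) = (\<integral>\<^sup>+x. liminf (\<lambda>m. ennreal ((norm (\<phi> m x - \<phi> n x))\<^sup>2)) \<partial>M)"
    proof (rule nn_integral_cong_AE, use lim in eventually_elim)
      case (elim x)
      then have "(\<lambda>m. ennreal ((norm (\<phi> m x - \<phi> n x))\<^sup>2)) \<longlonglongrightarrow> ennreal ((norm (G x - \<phi> n x))\<^sup>2)"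
        by (intro tendsto_intros)
      then show ?case by (rule lim_imp_Liminf[OF trivial_limit_sequentially, symmetric])
    qed
    also have "\<dots> \<le> liminf (\<lambda>m. \<integral>\<^sup>+x. ennreal ((norm (\<phi> m x - \<phi> n x))\<^sup>2) \<partial>M)" by (rule nn_integral_liminf) measurable
    also have "\<dots> \<le> ennreal (4 * (1/8) ^ n)"
      by (rule Liminf_le[OF trivial_limit_sequentially eventually_sequentiallyI[of n]]) (rule c)
    finally show ?thesis .
  qed
  with Gm show thesis by (rule that)
qed

text \<open>A fast maximising sequence of \<open>2 \<Lambda>(\<phi>) - \<parallel>\<phi>\<parallel>\<^sup>2\<close> is Cauchy by the parallelogram law.\<close>

theorem tfield_riesz:
  fixes \<Lambda> :: "(vel \<Rightarrow> vel) \<Rightarrow> real"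
  assumes lin: "\<And>\<phi> \<psi> c. tfield \<phi> \<Longrightarrow> tfield \<psi> \<Longrightarrow> \<Lambda> (\<lambda>x. \<phi> x + c *\<^sub>R \<psi> x) = \<Lambda> \<phi> + c * \<Lambda> \<psi>"
    and bd: "\<And>\<phi>. tfield \<phi> \<Longrightarrow> 2 * \<Lambda> \<phi> \<le> C + (\<integral>x. (norm (\<phi> x))\<^sup>2 \<partial>lborel)"
  obtains G where "G \<in> borel_measurable borel" "integrable lborel (\<lambda>x. (norm (G x))\<^sup>2)" "(\<integral>x. (norm (G x))\<^sup>2 \<partial>lborel) \<le> C"
    "\<And>\<psi>. tfield \<psi> \<Longrightarrow> \<Lambda> \<psi> = (\<integral>x. G x \<bullet> \<psi> x \<partial>lborel)"
proof -
  define N where "N \<phi> = (\<integral>x. (norm (\<phi> x))\<^sup>2 \<partial>lborel)" for \<phi> :: "vel \<Rightarrow> vel"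
  define J where "J \<phi> = 2 * \<Lambda> \<phi> - N \<phi>" for \<phi>
  define T where "T = {\<phi> :: vel \<Rightarrow> vel. tfield \<phi>}"
  have tm: "\<phi> \<in> borel_measurable borel" if "tfield \<phi>" for \<phi> :: "vel \<Rightarrow> vel"
    by (intro borel_measurable_continuous_onI tfield_continuous that)
  have ta: "tfield (\<lambda>x. \<phi> x + c *\<^sub>R \<psi> x)" if "tfield \<phi>" "tfield \<psi>" for \<phi> \<psi> :: "vel \<Rightarrow> vel" and c
  proof -
    have "bounded ({x. \<phi> x \<noteq> 0} \<union> {x. \<psi> x \<noteq> 0})" using that by (simp add: tfield_def)
    then have "bounded {x. \<phi> x + c *\<^sub>R \<psi> x \<noteq> 0}" by (rule bounded_subset) auto
    then show ?thesis using that by (simp add: tfield_def c1_on_add c1_on_scaleR c1_on_const)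
  qed
  have t0: "tfield (\<lambda>_ :: vel. 0 :: vel)" by (simp add: tfield_def c1_on_const)
  have Nadd: "N (\<lambda>x. \<phi> x + c *\<^sub>R \<psi> x) = N \<phi> + 2 * c * (\<integral>x. \<phi> x \<bullet> \<psi> x \<partial>lborel) + c\<^sup>2 * N \<psi>"
    if "tfield \<phi>" "tfield \<psi>" for \<phi> \<psi> c
    unfolding N_def using that by (intro integral_norm_add_square) (simp_all add: tm tfield_square_integrable)
  have JC: "J \<phi> \<le> C" if "tfield \<phi>" for \<phi> using bd[OF that] by (simp add: J_def N_def)
  then have bT: "bdd_above (J ` T)" unfolding bdd_above_def by (intro exI[of _ C]) (auto simp: T_def)
  define S where "S = Sup (J ` T)"
  have JS: "J \<phi> \<le> S" if "tfield \<phi>" for \<phi> unfolding S_def using that bT by (intro cSup_upper) (auto simp: T_def)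
  have SC: "S \<le> C" unfolding S_def using t0 JC by (intro cSup_least) (auto simp: T_def)
  have "\<exists>\<phi>. tfield \<phi> \<and> S - (1/8) ^ n < J \<phi>" for n :: nat
  proof -
    have "S - (1/8) ^ n < S" by simp
    from less_cSupD[OF _ this[unfolded S_def]] t0 show ?thesis by (auto simp: T_def S_def)
  qed
  then obtain \<phi> where \<phi>: "\<And>n. tfield (\<phi> n)" "\<And>n. S - (1/8) ^ n < J (\<phi> n)" by metis
  note [measurable] = tm[OF \<phi>(1)]
  \<comment> \<open>N (a - b) = 4 J ((a + b) / 2) - 2 J a - 2 J b, because the linear parts cancel.
    The first term is at most 4 S, and J a, J b are within (1/8)^m and (1/8)^n of S.\<close>
  have diff: "N (\<lambda>x. \<phi> m x - \<phi> n x) \<le> 4 * (1/8) ^ n" if "n \<le> m" for n m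
  proof -
    define a b where "a = \<phi> m" and "b = \<phi> n"
    have t: "tfield a" "tfield b" using \<phi>(1) by (auto simp: a_def b_def)
    define ip where "ip = (\<integral>x. a x \<bullet> b x \<partial>lborel)"
    have l0: "\<Lambda> (\<lambda>_. 0) = 0" using lin[OF t0 t0, of 1] by simp
    have tb: "tfield (\<lambda>x. (1/2) *\<^sub>R b x)" by (rule tfield_scaleR[OF t(2)])
    have "J (\<lambda>x. (1/2) *\<^sub>R b x + (1/2) *\<^sub>R a x) \<le> S" by (rule JS[OF ta[OF tb t(1)]])
    moreover have "\<Lambda> (\<lambda>x. (1/2) *\<^sub>R b x + (1/2) *\<^sub>R a x) = \<Lambda> b / 2 + \<Lambda> a / 2"
      using lin[OF tb t(1), of "1/2"] lin[OF t0 t(2), of "1/2"] l0 by simp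
    moreover have "N (\<lambda>x. (1/2) *\<^sub>R b x + (1/2) *\<^sub>R a x) = N b / 4 + ip / 2 + N a / 4"
      using Nadd[OF tb t(1), of "1/2"] Nadd[OF t0 t(2), of "1/2"]
      by (simp add: N_def ip_def power2_eq_square inner_commute)
    moreover have "N (\<lambda>x. a x + (-1) *\<^sub>R b x) = N a - 2 * ip + N b" using Nadd[OF t, of "-1"] by (simp add: ip_def)
    moreover have "(1/8 :: real) ^ m \<le> (1/8) ^ n" using that by (intro power_decreasing) auto
    ultimately have "N (\<lambda>x. a x + (-1) *\<^sub>R b x) \<le> 4 * (1/8) ^ n"
      using \<phi>(2)[of m, folded a_def] \<phi>(2)[of n, folded b_def] unfolding J_def by linarith
    then show ?thesis by (simp add: a_def b_def)
  qed
  have c: "(\<integral>\<^sup>+x. ennreal ((norm (\<phi> m x - \<phi> n x))\<^sup>2) \<partial>lborel) \<le> ennreal (4 * (1/8) ^ n)" if "n \<le> m" for n m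
  proof -
    have "tfield (\<lambda>x. \<phi> m x - \<phi> n x)" using ta[OF \<phi>(1) \<phi>(1), of m "-1" n] by simp
    from tfield_square_integrable[OF this] show ?thesis
      using diff[OF that] by (subst nn_integral_eq_integral) (auto simp: N_def intro!: ennreal_leI)
  qed
  from L2_fast_Cauchy_limit[of \<phi> lborel, OF _ c] obtain G where G [measurable]: "G \<in> borel_measurable borel"
    and GN: "\<And>n. (\<integral>\<^sup>+x. ennreal ((norm (G x - \<phi> n x))\<^sup>2) \<partial>lborel) \<le> ennreal (4 * (1/8) ^ n)" by auto
  have Di: "integrable lborel (\<lambda>x. (norm (G x - \<phi> n x))\<^sup>2)" for n
  proof (rule integrableI_nonneg)
    show "(\<integral>\<^sup>+x. ennreal ((norm (G x - \<phi> n x))\<^sup>2) \<partial>lborel) < \<infinity>" using GN[of n] by (rule order.strict_trans1) simp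
  qed auto
  have DN: "N (\<lambda>x. G x - \<phi> n x) \<le> 4 * (1/8) ^ n" for n
    using GN[of n] Di[of n] unfolding N_def by (subst (asm) nn_integral_eq_integral) (auto simp: ennreal_le_iff)
  have Gi: "integrable lborel (\<lambda>x. (norm (G x))\<^sup>2)"
    using integral_norm_add_square(2)[OF _ _ Di[of 0] tfield_square_integrable[OF \<phi>(1)], of 0 1] by simp
  have pairing: "\<Lambda> \<psi> = (\<integral>x. G x \<bullet> \<psi> x \<partial>lborel)" if t: "tfield \<psi>" for \<psi>
  proof -
    note [measurable] = tm[OF t]
    note ti = tfield_square_integrable[OF t]
    define L where "L = \<Lambda> \<psi> - (\<integral>x. G x \<bullet> \<psi> x \<partial>lborel)"
    \<comment> \<open>First-order condition at a near-maximiser: perturbing phi(n) by c psi raises J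
      by less than (1/8)^n, so the linear term in c is bounded by the quadratic one up to errors
      that vanish with n.\<close>
    have ineq: "2 * c * L \<le> c\<^sup>2 * N \<psi> + (1 + \<bar>c\<bar> * (4 + N \<psi>)) * (1/2) ^ n" for c and n :: nat
    proof -
      have Gp: "(\<integral>x. G x \<bullet> \<psi> x \<partial>lborel) = (\<integral>x. (G x - \<phi> n x) \<bullet> \<psi> x \<partial>lborel) + (\<integral>x. \<phi> n x \<bullet> \<psi> x \<partial>lborel)"
        using integrable_inner_square(1)[OF _ _ Gi ti] integrable_inner_square(1)[OF _ _ tfield_square_integrable[OF \<phi>(1)] ti, of n]
        by (simp add: inner_diff_left)
      have "J (\<lambda>x. \<phi> n x + c *\<^sub>R \<psi> x) \<le> J (\<phi> n) + (1/8) ^ n" using JS[OF ta[OF \<phi>(1) t], of n c] \<phi>(2)[of n] by linarith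
      then have 1: "2 * c * (\<Lambda> \<psi> - (\<integral>x. \<phi> n x \<bullet> \<psi> x \<partial>lborel)) \<le> c\<^sup>2 * N \<psi> + (1/8) ^ n"
        unfolding J_def lin[OF \<phi>(1) t] Nadd[OF \<phi>(1) t] by (simp add: algebra_simps)
      have 2: "2 * \<bar>\<integral>x. (G x - \<phi> n x) \<bullet> \<psi> x \<partial>lborel\<bar> \<le> (4 + N \<psi>) * (1/2) ^ n"
      proof -
        have "2 * \<bar>\<integral>x. (G x - \<phi> n x) \<bullet> \<psi> x \<partial>lborel\<bar> \<le> 2 ^ n * N (\<lambda>x. G x - \<phi> n x) + N \<psi> / 2 ^ n"
          unfolding N_def using Di ti by (intro integrable_inner_square(2)) auto
        also have "2 ^ n * N (\<lambda>x. G x - \<phi> n x) \<le> 2 ^ n * (4 * (1/8) ^ n)" using DN by (intro mult_left_mono) auto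
        also have "2 ^ n * (4 * (1/8) ^ n) = 4 * (1/4 :: real) ^ n" by (simp add: power_mult_distrib[symmetric])
        also have "\<dots> \<le> 4 * (1/2) ^ n" by (intro mult_left_mono power_mono) auto
        finally show ?thesis by (simp add: algebra_simps power_divide add_divide_distrib)
      qed
      have alg': "- (c * (2 * a)) \<le> \<bar>c\<bar> * (2 * \<bar>a\<bar>)" for a
        using abs_ge_minus_self[of "c * (2 * a)"] by (simp add: abs_mult)
      have alg: "2 * c * (l - (a + b)) = 2 * c * (l - b) - c * (2 * a)" for l a b by (simp add: algebra_simps)
      have "2 * c * L = 2 * c * (\<Lambda> \<psi> - (\<integral>x. \<phi> n x \<bullet> \<psi> x \<partial>lborel)) - c * (2 * (\<integral>x. (G x - \<phi> n x) \<bullet> \<psi> x \<partial>lborel))"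
        unfolding L_def Gp by (rule alg)
      also have "\<dots> \<le> (c\<^sup>2 * N \<psi> + (1/8) ^ n) + \<bar>c\<bar> * ((4 + N \<psi>) * (1/2) ^ n)"
      proof -
        have "- (c * (2 * (\<integral>x. (G x - \<phi> n x) \<bullet> \<psi> x \<partial>lborel))) \<le> \<bar>c\<bar> * (2 * \<bar>\<integral>x. (G x - \<phi> n x) \<bullet> \<psi> x \<partial>lborel\<bar>)"
          by (rule alg')
        also have "\<dots> \<le> \<bar>c\<bar> * ((4 + N \<psi>) * (1/2) ^ n)" using 2 by (intro mult_left_mono) auto
        finally show ?thesis using 1 by linarith
      qed
      also have "(1/8 :: real) ^ n \<le> (1/2) ^ n" by (intro power_mono) auto
      finally show ?thesis by (simp add: algebra_simps)
    qed
    have N0: "N \<psi> \<ge> 0" by (simp add: N_def)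
    have lim: "2 * c * L \<le> c\<^sup>2 * N \<psi>" for c
    proof (rule LIMSEQ_le_const)
      have "(\<lambda>n. c\<^sup>2 * N \<psi> + (1 + \<bar>c\<bar> * (4 + N \<psi>)) * (1/2) ^ n) \<longlonglongrightarrow> c\<^sup>2 * N \<psi> + (1 + \<bar>c\<bar> * (4 + N \<psi>)) * 0"
        by (intro tendsto_intros LIMSEQ_realpow_zero) auto
      then show "(\<lambda>n. c\<^sup>2 * N \<psi> + (1 + \<bar>c\<bar> * (4 + N \<psi>)) * (1/2) ^ n) \<longlonglongrightarrow> c\<^sup>2 * N \<psi>" by simp
    qed (use ineq in blast)
    \<comment> \<open>This c turns the inequality into L^2 / (N + 1) \<le> 0; the + 1 admits N =
      0.\<close>
    have "2 * (L / (N \<psi> + 1)) * L \<le> (L / (N \<psi> + 1))\<^sup>2 * N \<psi>" by (rule lim)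
    also have "\<dots> \<le> (L / (N \<psi> + 1))\<^sup>2 * (N \<psi> + 1)" by (intro mult_left_mono) auto
    also have "\<dots> = L\<^sup>2 / (N \<psi> + 1)" using N0 by (simp add: power2_eq_square)
    finally have "L\<^sup>2 / (N \<psi> + 1) \<le> 0" by (simp add: power2_eq_square)
    then have "L = 0" using N0 by (simp add: divide_le_0_iff)
    then show ?thesis by (simp add: L_def)
  qed
  \<comment> \<open>Once \<Lambda> is represented by G, N (G - phi(n)) = N G - J (phi(n)), so N G
    exceeds a value of J, which is at most C, by no more than 4 (1/8)^n.\<close>
  have GC: "N G \<le> C + 4 * (1/8) ^ n" for n
  proof -
    have t: "tfield (\<phi> n)" by (rule \<phi>)
    note ti = tfield_square_integrable[OF t]
    have "N (\<lambda>x. G x - \<phi> n x) = N G - 2 * \<Lambda> (\<phi> n) + N (\<phi> n)"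
      using integral_norm_add_square(1)[OF _ _ Gi ti, of "-1"] pairing[OF t] by (simp add: N_def)
    then show ?thesis using JS[OF t] SC DN[of n] unfolding J_def by linarith
  qed
  have "N G \<le> C"
  proof (rule LIMSEQ_le_const)
    have "(\<lambda>n. C + 4 * (1/8 :: real) ^ n) \<longlonglongrightarrow> C + 4 * 0" by (intro tendsto_intros LIMSEQ_realpow_zero) auto
    then show "(\<lambda>n. C + 4 * (1/8 :: real) ^ n) \<longlonglongrightarrow> C" by simp
  qed (use GC in blast)
  with G Gi pairing show thesis by (intro that) (auto simp: N_def)
qed

text \<open>Pairing sqrt f with divergences is a linear functional bounded by
  \<open>sqrt_dual_bound\<close>, so it is represented by a field G with integral of |G|^2 at most C
  / 4. The fields phi times a basis vector show that -G is the weak gradient, the sign coming from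
  integration by parts.\<close>

theorem fisher_le_imp_fisher:
  assumes C: "fisher_le C f" and fm [measurable]: "f \<in> borel_measurable borel" and f0: "\<And>x. f x \<ge> 0" and fi: "integrable lborel f"
  shows "fisher f \<le> ennreal C"
proof -
  define \<Lambda> where "\<Lambda> \<phi> = (\<integral>x. sqrt (f x) * dvg \<phi> x \<partial>lborel)" for \<phi>
  have lin: "\<Lambda> (\<lambda>x. \<phi> x + c *\<^sub>R \<psi> x) = \<Lambda> \<phi> + c * \<Lambda> \<psi>" if t: "tfield \<phi>" "tfield \<psi>" for \<phi> \<psi> c
  proof -
    have d: "\<phi> differentiable (at x)" "\<psi> differentiable (at x)" for x using t by (auto simp: tfield_def c1_on_def)
    have "dvg (\<lambda>x. \<phi> x + c *\<^sub>R \<psi> x) x = dvg \<phi> x + c * dvg \<psi> x" for x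
    proof -
      have "((\<lambda>x. \<phi> x + c *\<^sub>R \<psi> x) has_derivative (\<lambda>v. frechet_derivative \<phi> (at x) v + c *\<^sub>R frechet_derivative \<psi> (at x) v)) (at x)"
        using d by (intro derivative_intros) (simp_all add: frechet_derivative_works)
      from frechet_eqI[OF this] show ?thesis by (simp add: dvg_def inner_add_left sum.distrib sum_distrib_left)
    qed
    then show ?thesis
      using sqrt_dvg_integrable[OF fm f0 fi t(1)] sqrt_dvg_integrable[OF fm f0 fi t(2)]
      by (simp add: \<Lambda>_def distrib_left mult.left_commute)
  qed
  from tfield_riesz[of \<Lambda>, OF lin sqrt_dual_bound[OF C fm f0 fi, folded \<Lambda>_def]]
  obtain G where G [measurable]: "G \<in> borel_measurable borel" and Gi: "integrable lborel (\<lambda>x. (norm (G x))\<^sup>2)"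
    and GC: "(\<integral>x. (norm (G x))\<^sup>2 \<partial>lborel) \<le> C / 4"
    and Gl: "\<And>\<psi>. tfield \<psi> \<Longrightarrow> \<Lambda> \<psi> = (\<integral>x. G x \<bullet> \<psi> x \<partial>lborel)" by blast
  have "weak_grad (\<lambda>x. sqrt (f x)) (\<lambda>x. - G x)"
    unfolding weak_grad_def
  proof (intro conjI allI impI)
    show "(\<lambda>x. sqrt (f x)) \<in> borel_measurable lborel" "(\<lambda>x. - G x) \<in> borel_measurable lborel" by measurable
    fix K :: "vel set" assume K: "compact K"
    then have [measurable]: "K \<in> sets borel" by (rule borel_compact)
    have Ki: "integrable lborel (indicator K :: vel \<Rightarrow> real)"
      using emeasure_bounded_finite[OF compact_imp_bounded[OF K]] by (simp add: integrable_indicator_iff)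
    show "set_integrable lborel K (\<lambda>x. sqrt (f x))"
      unfolding set_integrable_def
    proof (rule Bochner_Integration.integrable_bound)
      show "integrable lborel (\<lambda>x. indicator K x + f x)" using Ki fi by simp
      have "sqrt (f x) \<le> 1 + f x" for x using f0[of x] by (intro real_le_lsqrt) (auto simp: power2_eq_square algebra_simps)
      then show "AE x in lborel. norm (indicator K x *\<^sub>R sqrt (f x)) \<le> norm (indicator K x + f x)"
        using f0 by (intro AE_I2) (auto simp: indicator_def)
    qed measurable
    show "set_integrable lborel K (\<lambda>x. - G x)"
      unfolding set_integrable_def
    proof (rule Bochner_Integration.integrable_bound)
      show "integrable lborel (\<lambda>x. indicator K x + (norm (G x))\<^sup>2)" using Ki Gi by simp
      have "norm (G x) \<le> 1 + (norm (G x))\<^sup>2" for x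
      proof -
        have "2 * norm (G x) \<le> 1 + (norm (G x))\<^sup>2" using zero_le_power2[of "norm (G x) - 1"] by (simp add: power2_diff)
        then show ?thesis using norm_ge_zero[of "G x"] by linarith
      qed
      then show "AE x in lborel. norm (indicator K x *\<^sub>R - G x) \<le> norm (indicator K x + (norm (G x))\<^sup>2)"
        by (intro AE_I2) (auto simp: indicator_def)
    qed measurable
  next
    fix \<phi> :: "vel \<Rightarrow> real" and i assume "test_fun \<phi>"
    then have t: "tfield \<phi>" by (simp add: test_fun_iff_tfield)
    then have d: "\<phi> differentiable (at x)" and c: "c1_on UNIV \<phi>" for x by (auto simp: tfield_def c1_on_def)
    have "bounded {x. \<phi> x *\<^sub>R (axis i 1 :: vel) \<noteq> 0}" using t unfolding tfield_def by (auto elim: bounded_subset)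
    then have t': "tfield (\<lambda>x. \<phi> x *\<^sub>R (axis i 1 :: vel))" by (simp add: tfield_def c1_on_scaleR c c1_on_const)
    have "dvg (\<lambda>x. \<phi> x *\<^sub>R (axis i 1 :: vel)) x = grad \<phi> x $ i" for x
      by (subst dvg_product[OF d]) (simp_all add: grad_def dvg_def)
    then have "(\<integral>x. sqrt (f x) * grad \<phi> x $ i \<partial>lborel) = (\<integral>x. G x \<bullet> (\<phi> x *\<^sub>R axis i 1) \<partial>lborel)"
      using Gl[OF t'] by (simp add: \<Lambda>_def)
    then show "(\<integral>x. sqrt (f x) * grad \<phi> x $ i \<partial>lborel) = - (\<integral>x. (- G x) $ i * \<phi> x \<partial>lborel)"
      by (simp add: inner_axis mult.commute)
  qed
  then have "fisher f \<le> ennreal 4 * (\<integral>\<^sup>+x. ennreal ((norm (- G x))\<^sup>2) \<partial>lborel)"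
    unfolding fisher_def by (intro Inf_lower CollectI exI[of _ "\<lambda>x. - G x"] conjI refl)
  also have "\<dots> = ennreal (4 * (\<integral>x. (norm (G x))\<^sup>2 \<partial>lborel))"
    using Gi by (simp add: nn_integral_eq_integral ennreal_mult)
  also have "\<dots> \<le> ennreal C" using GC by (intro ennreal_leI) simp
  finally show ?thesis .
qed

section \<open>Kernels that are not Borel measurable\<close>

text \<open>Borel measurability of \<open>B\<close> on the whole line is not assumed. If it fails, then the integrand
  over the sphere in \<^const>\<open>coll_weak\<close> is non-measurable (restrict it to \<open>n = s *\<^sub>R k\<close>) whenever
  the test function is strictly radial, so that the integral has the junk value \<open>0\<close>.\<close>

lemma coll_weak_nonmeasurable:
  assumes B: "B \<notin> borel_measurable borel" and e: "e > 0" and P: "inj_on P {0..}"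
    and \<phi>: "\<And>x. \<phi> x = P ((x - y) \<bullet> (x - y))" and \<phi>m [measurable]: "\<phi> \<in> borel_measurable borel"
  shows "coll_weak e B f \<phi> = 0"
proof -
  have "(\<integral>n. B (n \<bullet> ((v - w) /\<^sub>R norm (v - w))) * f v * f w * (\<phi> (post_vel e v w n) - \<phi> v) \<partial>sphere_measure) = 0" for v w
  proof (cases "v = w \<or> f v * f w = 0")
    case True
    then show ?thesis by (auto simp: post_vel_def)
  next
    case False
    define u k c where "u = v - w" and "k = (v - w) /\<^sub>R norm (v - w)" and "c = f v * f w"
    have u: "u \<noteq> 0" and c: "c \<noteq> 0" using False by (auto simp: u_def c_def)
    have k: "k \<bullet> k = 1" and uk: "u \<bullet> k = norm u"
      using u by (simp_all add: k_def u_def[symmetric] dot_square_norm power2_eq_square)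
    define a where "a = (1 + e) / 2 * norm u"
    have a: "a > 0" using u e by (simp add: a_def)
    have "\<not> integrable sphere_measure (\<lambda>n. B (n \<bullet> k) * f v * f w * (\<phi> (post_vel e v w n) - \<phi> v))"
    proof
      assume "integrable sphere_measure (\<lambda>n. B (n \<bullet> k) * f v * f w * (\<phi> (post_vel e v w n) - \<phi> v))"
      then have m [measurable]: "(\<lambda>n. B (n \<bullet> k) * f v * f w * (\<phi> (post_vel e v w n) - \<phi> v)) \<in> borel_measurable borel"
        using borel_measurable_integrable by (simp add: measurable_cong_sets[OF sets_sphere_measure refl])
      \<comment> \<open>The measurable sets of \<open>sphere_measure\<close> are the Borel sets of
        the whole space, so an integrable integrand may be restricted to the line through k. There
        the argument of B is s itself, and dividing by the other factor recovers B.\<close>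
      have r: "(\<lambda>s. s *\<^sub>R k) \<in> borel \<rightarrow>\<^sub>M borel" by measurable
      have pv: "post_vel e v w (s *\<^sub>R k) = v - (a * s\<^sup>2) *\<^sub>R k" for s
        using uk by (simp add: post_vel_def u_def[symmetric] a_def power2_eq_square)
      define h where "h s = \<phi> (v - (a * s\<^sup>2) *\<^sub>R k) - \<phi> v" for s
      have [measurable]: "h \<in> borel_measurable borel" unfolding h_def[abs_def] by measurable
      have "(\<lambda>s. B s * c * h s) \<in> borel_measurable borel"
        using measurable_compose[OF r m] by (simp add: k pv c_def h_def mult.assoc)
      then have q: "(\<lambda>s. (B s * c * h s) / (c * h s)) \<in> borel_measurable borel" by measurable
      have gen: "(d - r *\<^sub>R k) \<bullet> (d - r *\<^sub>R k) = d \<bullet> d - r * (2 * (d \<bullet> k)) + r * r" for d r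
        using k by (simp add: inner_diff_left inner_diff_right inner_commute)
      \<comment> \<open>P is injective, so the divisor vanishes only for s = 0 or when s^2 takes one
        other value. This set is finite, and off it B agrees with a Borel function.\<close>
      define X where "X = {s. h s = 0}"
      have "X \<subseteq> {s. s\<^sup>2 = 0} \<union> {s. s\<^sup>2 = 2 * ((v - y) \<bullet> k) / a}"
      proof
        fix s assume "s \<in> X"
        then have "P ((v - (a * s\<^sup>2) *\<^sub>R k - y) \<bullet> (v - (a * s\<^sup>2) *\<^sub>R k - y)) = P ((v - y) \<bullet> (v - y))"
          by (simp add: X_def h_def \<phi>)
        then have "(v - (a * s\<^sup>2) *\<^sub>R k - y) \<bullet> (v - (a * s\<^sup>2) *\<^sub>R k - y) = (v - y) \<bullet> (v - y)"
          using inj_onD[OF P] by simp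
        moreover have "v - (a * s\<^sup>2) *\<^sub>R k - y = (v - y) - (a * s\<^sup>2) *\<^sub>R k" by simp
        ultimately have "(a * s\<^sup>2) * ((a * s\<^sup>2) - 2 * ((v - y) \<bullet> k)) = 0"
          using gen[of "v - y" "a * s\<^sup>2"] by (simp only: right_diff_distrib)
        then have "a * s\<^sup>2 = 0 \<or> a * s\<^sup>2 = 2 * ((v - y) \<bullet> k)" by simp
        then show "s \<in> {s. s\<^sup>2 = 0} \<union> {s. s\<^sup>2 = 2 * ((v - y) \<bullet> k) / a}" using a by (auto simp: field_simps)
      qed
      moreover have "finite {s :: real. s\<^sup>2 = b}" for b
      proof (rule finite_subset)
        show "{s. s\<^sup>2 = b} \<subseteq> {sqrt b, - sqrt b}" by (auto simp: real_sqrt_unique)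
      qed simp
      ultimately have "countable X" by (meson countable_finite finite_Un finite_subset)
      then have "B \<in> borel_measurable borel"
        by (rule measurable_discrete_difference[OF q]) (use c in \<open>auto simp: X_def\<close>)
      then show False using B by simp
    qed
    then show ?thesis by (simp add: k_def not_integrable_integral_eq)
  qed
  then show ?thesis by (simp add: coll_weak_def)
qed

lemma solution_constant_pairing:
  assumes sol: "solves_E1 e B f" and B: "B \<notin> borel_measurable borel" and e: "e > 0" and P: "inj_on P {0..}"
    and \<phi>: "\<And>x. \<phi> x = P ((x - y) \<bullet> (x - y))" and c: "continuous_on UNIV \<phi>" and b: "bounded (range \<phi>)" and t: "t \<ge> 0"
  shows "(\<integral>x. f t x * \<phi> x \<partial>lborel) = (\<integral>x. f 0 x * \<phi> x \<partial>lborel)"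
proof -
  have z: "coll_weak e B (f s) \<phi> = 0" for s
    by (rule coll_weak_nonmeasurable[OF B e P \<phi> borel_measurable_continuous_onI[OF c]])
  have "\<And>s. s \<in> {0..} \<Longrightarrow> ((\<lambda>s. \<integral>x. f s x * \<phi> x \<partial>lborel) has_real_derivative 0) (at s within {0..})"
  proof -
    fix s :: real assume "s \<in> {0..}"
    then have "((\<lambda>s. \<integral>x. f s x * \<phi> x \<partial>lborel) has_real_derivative coll_weak e B (f s) \<phi>) (at s within {0..})"
      using sol c b by (simp add: solves_E1_def)
    then show "((\<lambda>s. \<integral>x. f s x * \<phi> x \<partial>lborel) has_real_derivative 0) (at s within {0..})" using z by simp
  qed
  then obtain C where "\<And>s. s \<in> {0..} \<Longrightarrow> (\<integral>x. f s x * \<phi> x \<partial>lborel) = C"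
    using has_field_derivative_zero_constant[OF convex_real_interval(1)[of "0 :: real"], of "\<lambda>s. \<integral>x. f s x * \<phi> x \<partial>lborel"] by blast
  then show ?thesis using t by simp
qed

text \<open>All pairings with strictly radial functions are conserved, which forces every
  mollification of \<open>f t\<close> to coincide with that of \<open>f 0\<close>. The dual bound
  passes from \<open>f 0\<close> to its mollifications and, in the L^1 limit, to
  \<open>f t\<close>.\<close>

lemma fisher_le_solution_nonmeasurable:
  assumes sol: "solves_E1 e B f" and B: "B \<notin> borel_measurable borel" and e: "e > 0"
    and C: "fisher_le C (f 0)" and t: "t \<ge> 0"
  shows "fisher_le C (f t)"
proof -
  have m [measurable]: "f s \<in> borel_measurable borel" and i: "integrable lborel (f s)" if "s \<ge> 0" for s
    using sol that by (auto simp: solves_E1_def)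
  note [measurable] = m[OF t] m[OF order_refl]
  have eq: "moll \<epsilon> (f t) y = moll \<epsilon> (f 0) y" if \<epsilon>: "\<epsilon> > 0" for \<epsilon> y
  proof -
    define c where "c = (\<integral>z. bump \<epsilon> z \<partial>lborel)"
    have c0: "c > 0" unfolding c_def by (rule bump_integral_pos[OF \<epsilon>])
    \<comment> \<open>The mollifier is radial but constantly 0 outside its support, hence not
      injective in the squared distance. It is the difference Q - P of two strictly decreasing
      profiles, and the pairing with each of them is conserved.\<close>
    define P Q where "P q = inverse (1 + q)" and "Q q = sqpos (1 - q / \<epsilon>\<^sup>2) / c + inverse (1 + q)" for q :: real
    have mono: "P q < P p" "Q q < Q p" if "0 \<le> p" "p < q" for p q
    proof -
      show *: "P q < P p" using that by (simp add: P_def less_imp_inverse_less)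
      have "p / \<epsilon>\<^sup>2 \<le> q / \<epsilon>\<^sup>2" using that by (simp add: divide_right_mono)
      then have "sqpos (1 - q / \<epsilon>\<^sup>2) / c \<le> sqpos (1 - p / \<epsilon>\<^sup>2) / c"
        unfolding sqpos_def using c0 by (intro divide_right_mono power_mono) auto
      with * show "Q q < Q p" by (simp add: P_def Q_def)
    qed
    have inj: "inj_on P {0..}" by (rule linorder_inj_onI') (use mono(1) in force)
    have inj': "inj_on Q {0..}" by (rule linorder_inj_onI') (use mono(2) in force)
    define p where "p x = P ((x - y) \<bullet> (x - y))" for x
    have kc: "continuous_on UNIV (\<lambda>x. kr \<epsilon> (x - y))"
      by (rule continuous_on_compose2[OF kr_continuous[OF \<epsilon>]]) (auto intro!: continuous_intros)
    have d0: "1 + (x - y) \<bullet> (x - y) > 0" for x by (simp add: add_pos_nonneg)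
    have pc: "continuous_on UNIV p" unfolding p_def[abs_def] P_def
      using d0 by (intro continuous_intros) (auto simp: less_imp_neq[symmetric])
    have pb: "\<bar>p x\<bar> \<le> 1" for x using d0[of x] by (simp add: p_def P_def inverse_le_1_iff)
    obtain K where K: "K > 0" "\<And>z. \<bar>kr \<epsilon> z\<bar> \<le> K" using kr_bounded[OF \<epsilon>] by blast
    have kpb: "\<bar>kr \<epsilon> (x - y) + p x\<bar> \<le> K + 1" for x using K(2)[of "x - y"] pb[of x] by linarith
    have Qe: "kr \<epsilon> (x - y) + p x = Q ((x - y) \<bullet> (x - y))" for x
      by (simp add: Q_def p_def P_def kr_def bump_def c_def)
    note [measurable] = borel_measurable_continuous_onI[OF pc] kr_measurable[OF \<epsilon>]
    have A: "(\<integral>x. f t x * p x \<partial>lborel) = (\<integral>x. f 0 x * p x \<partial>lborel)"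
      by (rule solution_constant_pairing[OF sol B e inj p_def pc _ t]) (auto simp: bounded_iff intro: pb)
    have A': "(\<integral>x. f t x * (kr \<epsilon> (x - y) + p x) \<partial>lborel) = (\<integral>x. f 0 x * (kr \<epsilon> (x - y) + p x) \<partial>lborel)"
      by (rule solution_constant_pairing[OF sol B e inj' Qe continuous_on_add[OF kc pc] _ t]) (auto simp: bounded_iff intro: kpb)
    have ki: "integrable lborel (\<lambda>x. f s x * kr \<epsilon> (x - y))" "integrable lborel (\<lambda>x. f s x * p x)" if "s \<ge> 0" for s
      using integrable_mult_bounded[OF i[OF that], where h="\<lambda>x. kr \<epsilon> (x - y)" and K=K] K
        integrable_mult_bounded[OF i[OF that], where h=p and K=1] pb by auto
    have "(\<integral>x. f t x * kr \<epsilon> (x - y) \<partial>lborel) = (\<integral>x. f 0 x * kr \<epsilon> (x - y) \<partial>lborel)"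
      using A A' ki[OF t] ki[OF order_refl] by (simp add: distrib_left)
    then show ?thesis
      by (simp add: moll_alt[OF \<epsilon>] kr_minus_commute[OF \<epsilon>, of y] mult.commute)
  qed
  have i1: "integrable lborel (\<lambda>x. \<bar>f t x\<bar> ^ 1)" using i[OF t] by simp
  have "\<exists>\<epsilon>>0. L1dist (f t) (moll \<epsilon> (f t)) \<le> inverse (real (Suc n)) \<and> integrable lborel (moll \<epsilon> (f t))" for n
  proof -
    have "inverse (real (Suc n)) > 0" by simp
    from moll_L1_limit[OF m[OF t] i1 _ this] obtain \<epsilon> where \<epsilon>: "\<epsilon> > 0" "(\<integral>x. \<bar>moll \<epsilon> (f t) x - f t x\<bar> \<partial>lborel) \<le> inverse (real (Suc n))"
      "integrable lborel (\<lambda>x. \<bar>moll \<epsilon> (f t) x - f t x\<bar>)" by auto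
    note [measurable] = moll_measurable[OF \<epsilon>(1) m[OF t]]
    have "integrable lborel (\<lambda>x. moll \<epsilon> (f t) x - f t x)" using \<epsilon>(3) by (subst (asm) integrable_abs_iff) auto
    from Bochner_Integration.integrable_add[OF this i[OF t]] have "integrable lborel (moll \<epsilon> (f t))" by simp
    then show ?thesis using \<epsilon> by (intro exI[of _ \<epsilon>]) (simp add: L1dist_def abs_minus_commute)
  qed
  then obtain \<epsilon> where \<epsilon>: "\<And>n. \<epsilon> n > 0" "\<And>n. L1dist (f t) (moll (\<epsilon> n) (f t)) \<le> inverse (real (Suc n))" "\<And>n. integrable lborel (moll (\<epsilon> n) (f t))"
    by metis
  show ?thesis
  proof (rule fisher_le_limit[OF i[OF t] m[OF t] \<epsilon>(3)])
    show "moll (\<epsilon> n) (f t) \<in> borel_measurable borel" for n by (rule moll_measurable[OF \<epsilon>(1) m[OF t]])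
    have "moll (\<epsilon> n) (f t) = moll (\<epsilon> n) (f 0)" for n by (intro ext eq \<epsilon>(1))
    then show "fisher_le C (moll (\<epsilon> n) (f t))" for n using fisher_le_moll[OF C m i \<epsilon>(1)] by simp
    show "(\<lambda>n. L1dist (f t) (moll (\<epsilon> n) (f t))) \<longlonglongrightarrow> 0"
      by (rule Lim_null_comparison[OF _ LIMSEQ_inverse_real_of_nat]) (use \<epsilon>(2) in \<open>auto intro!: always_eventually simp: L1dist_def\<close>)
  qed
qed

section \<open>Rescaling and conclusion\<close>

text \<open>Every weak gradient bounds the dual expression \<open>X\<close>, which does not refer to
  the gradient, so the infimum may be taken. A negative \<open>X\<close> does no harm, as
  \<open>ennreal\<close> sends it to 0.\<close>

lemma fisher_le_fisher:
  assumes fm: "f \<in> borel_measurable borel" and f0: "\<And>x. f x \<ge> 0" and fi: "integrable lborel f" and fin: "fisher f < \<infinity>"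
  shows "fisher_le (enn2real (fisher f)) f"
  unfolding fisher_le_def
proof (intro allI impI)
  fix \<psi> :: "vel \<Rightarrow> vel" assume t: "tfield \<psi>"
  define X where "X = 2 * (\<integral>x. dvg \<psi> x * f x \<partial>lborel) - (\<integral>x. (norm (\<psi> x))\<^sup>2 * f x \<partial>lborel)"
  have "ennreal X \<le> fisher f"
    unfolding fisher_def
  proof (rule Inf_greatest, clarify)
    fix G assume G: "weak_grad (\<lambda>x. sqrt (f x)) G"
    then have [measurable]: "G \<in> borel_measurable borel" by (simp add: weak_grad_def)
    show "ennreal X \<le> ennreal 4 * (\<integral>\<^sup>+x. ennreal ((norm (G x))\<^sup>2) \<partial>lborel)"
    proof (cases "(\<integral>\<^sup>+x. ennreal ((norm (G x))\<^sup>2) \<partial>lborel) < \<infinity>")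
      case True
      then have Gi: "integrable lborel (\<lambda>x. (norm (G x))\<^sup>2)" by (intro integrableI_nonneg) auto
      have "X \<le> 4 * (\<integral>x. (norm (G x))\<^sup>2 \<partial>lborel)"
        using fisher_le_of_weak_grad[OF fm f0 fi G Gi] t unfolding fisher_le_def X_def by (simp add: le_diff_eq diff_le_eq)
      then have "ennreal X \<le> ennreal (4 * (\<integral>x. (norm (G x))\<^sup>2 \<partial>lborel))" by (rule ennreal_leI)
      also have "\<dots> = ennreal 4 * (\<integral>\<^sup>+x. ennreal ((norm (G x))\<^sup>2) \<partial>lborel)"
        using Gi by (simp add: nn_integral_eq_integral ennreal_mult)
      finally show ?thesis .
    next
      case False
      then have "(\<integral>\<^sup>+x. ennreal ((norm (G x))\<^sup>2) \<partial>lborel) = top" by (simp add: less_top[symmetric])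
      then show ?thesis by (simp add: ennreal_mult_top)
    qed
  qed
  also have "fisher f = ennreal (enn2real (fisher f))" using fin by simp
  finally have "X \<le> enn2real (fisher f)" by simp
  then show "2 * (\<integral>x. dvg \<psi> x * f x \<partial>lborel) \<le> enn2real (fisher f) + (\<integral>x. (norm (\<psi> x))\<^sup>2 * f x \<partial>lborel)"
    by (simp add: X_def)
qed

lemma
  fixes h :: "vel \<Rightarrow> real"
  assumes [measurable]: "h \<in> borel_measurable borel" and l: "l > 0"
  shows integral_dilate: "(\<integral>x. h (l *\<^sub>R x) * l ^ 3 \<partial>lborel) = (\<integral>x. h x \<partial>lborel)"
    and integrable_dilate: "integrable lborel h \<Longrightarrow> integrable lborel (\<lambda>x. h (l *\<^sub>R x) * l ^ 3)"
proof -
  have d: "(lborel :: vel measure) = density (distr lborel borel (\<lambda>x. 0 + l *\<^sub>R x)) (\<lambda>_. ennreal (l ^ 3))"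
    using lborel_affine[of l "0 :: vel"] l by simp
  show "(\<integral>x. h (l *\<^sub>R x) * l ^ 3 \<partial>lborel) = (\<integral>x. h x \<partial>lborel)"
    using l by (subst (2) d) (simp add: integral_density integral_distr mult.commute)
  assume "integrable lborel h"
  then have "integrable (density (distr lborel borel (\<lambda>x. 0 + l *\<^sub>R x)) (\<lambda>_. ennreal (l ^ 3))) h" using d by simp
  then show "integrable lborel (\<lambda>x. h (l *\<^sub>R x) * l ^ 3)"
    using l by (simp add: integrable_density integrable_distr_eq mult.commute)
qed

text \<open>The field psi(x / l) has its divergence scaled by 1 / l while its square norm is not
  scaled; the parameter l of \<open>fisher_leD\<close> restores the ratio and leaves the factor
  l^2.\<close>

lemma fisher_le_dilate:
  assumes C: "fisher_le C f" and fm [measurable]: "f \<in> borel_measurable borel" and l: "l > 0"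
  shows "fisher_le (l\<^sup>2 * C) (\<lambda>x. l ^ 3 * f (l *\<^sub>R x))"
  unfolding fisher_le_def
proof (intro allI impI)
  fix \<psi> :: "vel \<Rightarrow> vel" assume t: "tfield \<psi>"
  note [measurable] = tfield_dvg_measurable[OF t] tfield_norm_sq_measurable[OF t]
  have c: "c1_on UNIV \<psi>" using t by (simp add: tfield_def)
  define \<chi>' where "\<chi>' y = \<psi> (inverse l *\<^sub>R y)" for y
  have D: "(\<chi>' has_derivative (\<lambda>v. frechet_derivative \<psi> (at (inverse l *\<^sub>R x)) (inverse l *\<^sub>R v))) (at x)" for x
  proof -
    have "((\<lambda>x. inverse l *\<^sub>R x) has_derivative (\<lambda>v. inverse l *\<^sub>R v)) (at x)" by (auto intro!: derivative_eq_intros)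
    from has_derivative_compose[OF this, of \<psi>] c1_on_has_derivative[OF c] show ?thesis unfolding \<chi>'_def[abs_def] by simp
  qed
  have lin: "linear (frechet_derivative \<psi> (at x))" for x using c by (intro linear_frechet_derivative) (simp add: c1_on_def)
  have dv: "dvg \<chi>' x = inverse l * dvg \<psi> (inverse l *\<^sub>R x)" for x
    unfolding dvg_def frechet_eqI[OF D] by (simp add: linear_cmul[OF lin] sum_distrib_left)
  have t': "tfield \<chi>'"
  proof -
    obtain R where R: "R > 0" "\<And>x. norm x > R \<Longrightarrow> \<psi> x = 0" using tfield_vanish[OF t] by metis
    have "norm x \<le> R * l" if "\<chi>' x \<noteq> 0" for x
    proof (rule ccontr)
      assume "\<not> norm x \<le> R * l"
      then have "norm (inverse l *\<^sub>R x) > R" using l by (simp add: field_simps)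
      then show False using R(2) that by (simp add: \<chi>'_def)
    qed
    then have "bounded {x. \<chi>' x \<noteq> 0}" unfolding bounded_iff by blast
    moreover have "c1_on UNIV \<chi>'" unfolding \<chi>'_def[abs_def]
      by (intro c1_on_compose[OF c] c1_on_scaleR c1_on_const c1_on_id) simp
    ultimately show ?thesis by (simp add: tfield_def)
  qed
  have 1: "(\<integral>x. dvg \<psi> x * (l ^ 3 * f (l *\<^sub>R x)) \<partial>lborel) = (\<integral>x. dvg \<psi> (inverse l *\<^sub>R x) * f x \<partial>lborel)"
    using integral_dilate[of "\<lambda>x. dvg \<psi> (inverse l *\<^sub>R x) * f x" l] l by (simp add: mult_ac)
  have 2: "(\<integral>x. (norm (\<psi> x))\<^sup>2 * (l ^ 3 * f (l *\<^sub>R x)) \<partial>lborel) = (\<integral>x. (norm (\<psi> (inverse l *\<^sub>R x)))\<^sup>2 * f x \<partial>lborel)"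
    using integral_dilate[of "\<lambda>x. (norm (\<psi> (inverse l *\<^sub>R x)))\<^sup>2 * f x" l] l by (simp add: mult_ac)
  have alg: "2 * a \<le> l\<^sup>2 * C + b" if "2 * (inverse l * a) \<le> l * C + b / l" for a b
  proof -
    have "l * (2 * (inverse l * a)) \<le> l * (l * C + b / l)" using that l by (intro mult_left_mono) auto
    also have "l * (2 * (inverse l * a)) = 2 * a" using l by (simp add: field_simps)
    also have "l * (l * C + b / l) = l\<^sup>2 * C + b" using l by (simp add: distrib_left power2_eq_square)
    finally show ?thesis .
  qed
  have "2 * (inverse l * (\<integral>x. dvg \<psi> (inverse l *\<^sub>R x) * f x \<partial>lborel))
      \<le> l * C + (\<integral>x. (norm (\<psi> (inverse l *\<^sub>R x)))\<^sup>2 * f x \<partial>lborel) / l"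
    using fisher_leD[OF C t' l] by (simp add: dv \<chi>'_def mult.assoc)
  then show "2 * (\<integral>x. dvg \<psi> x * (l ^ 3 * f (l *\<^sub>R x)) \<partial>lborel)
      \<le> l\<^sup>2 * C + (\<integral>x. (norm (\<psi> x))\<^sup>2 * (l ^ 3 * f (l *\<^sub>R x)) \<partial>lborel)"
    unfolding 1 2 by (rule alg)
qed

section \<open>The exponent\<close>

lemma rate_comparison:
  assumes e: "0 < e" "e \<le> (1 :: real)"
  shows "(2 / (1 + e))\<^sup>2 - 1 \<le> (1 - e) * (2 + e + 15 * e\<^sup>2) / (8 * e ^ 3)"
proof -
  have "(2 / (1 + e))\<^sup>2 - 1 = (1 - e) * ((3 + e) / (1 + e)\<^sup>2)"
  proof -
    have "(2 / (1 + e))\<^sup>2 - 1 = (4 - (1 + e)\<^sup>2) / (1 + e)\<^sup>2" using e by (simp add: power_divide diff_divide_distrib)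
    also have "4 - (1 + e)\<^sup>2 = (1 - e) * (3 + e)" by (simp add: power2_eq_square algebra_simps)
    finally show ?thesis by simp
  qed
  also have "\<dots> \<le> (1 - e) * ((2 + e + 15 * e\<^sup>2) / (8 * e ^ 3))"
  proof (rule mult_left_mono)
    \<comment> \<open>The right side is 2 + 5 e + 19 e^2 + 7 e^3 + 7 e^4, with positive coefficients
      only.\<close>
    have "(1 + e)\<^sup>2 * (2 + e + 15 * e\<^sup>2) - 8 * e ^ 3 * (3 + e) = (2 + 5 * e + 19 * e\<^sup>2 - 17 * e ^ 3) + 24 * e ^ 3 + 7 * e ^ 4 + 0 * e"
      by (simp add: power2_eq_square power3_eq_cube power4_eq_xxxx algebra_simps)
    moreover have "e ^ 3 \<le> e\<^sup>2" using e by (intro power_decreasing) auto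
    moreover have "0 \<le> e ^ 3" "0 \<le> e ^ 4" using e by auto
    ultimately have "8 * e ^ 3 * (3 + e) \<le> (1 + e)\<^sup>2 * (2 + e + 15 * e\<^sup>2)" using e by linarith
    then show "(3 + e) / (1 + e)\<^sup>2 \<le> (2 + e + 15 * e\<^sup>2) / (8 * e ^ 3)" using e by (simp add: divide_simps mult_ac)
  qed (use e in simp)
  finally show ?thesis by simp
qed

text \<open>s^2 \<le> 1 on the interval; this gives E \<le> (1 - e^2) / 4 for every admissible
  kernel.\<close>

lemma admissible_second_moment:
  assumes B: "admissible_kernel B"
  shows "(LINT s:{-1..1}|lborel. s\<^sup>2 * B s) \<le> 2"
proof -
  have Bi: "set_integrable lborel {-1..1} B" and B2: "(LINT s:{-1..1}|lborel. B s) = 2"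
    and B0: "\<And>s. s \<in> {-1..1} \<Longrightarrow> B s > 0" using B by (auto simp: admissible_kernel_def)
  have le: "s\<^sup>2 * B s \<le> B s" if "s \<in> {-1..1}" for s
    using that B0[OF that] by (intro mult_left_le_one_le) (auto simp: abs_square_le_1 abs_le_iff)
  have "integrable lborel (\<lambda>s. s\<^sup>2 * (indicator {-1..1} s * B s))"
  proof (rule Bochner_Integration.integrable_bound)
    show Bi': "integrable lborel (\<lambda>s. indicator {-1..1} s * B s)" using Bi by (simp add: set_integrable_def)
    show "(\<lambda>s. s\<^sup>2 * (indicator {-1..1} s * B s)) \<in> borel_measurable lborel"
      using borel_measurable_integrable[OF Bi'] by measurable
    show "AE s in lborel. norm (s\<^sup>2 * (indicator {-1..1} s * B s)) \<le> norm (indicator {-1..1} s * B s)"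
      using le B0 by (intro AE_I2) (auto simp: indicator_def abs_mult less_imp_le)
  qed
  then have "set_integrable lborel {-1..1} (\<lambda>s. s\<^sup>2 * B s)" by (simp add: set_integrable_def mult.left_commute)
  from set_integral_mono[OF this Bi le] show ?thesis using B2 by simp
qed

text \<open>With E \<le> (1 - e^2) / 4 and a factor 1 - e > 0 taken out, the claim becomes 4 e^3 (1
  + e) < 2 + e + 15 e^2, where the left side is at most 8 e^2.\<close>

lemma fisher_rate_pos:
  assumes B: "admissible_kernel B" and e: "0 < e" "e < 1"
  shows "fisher_rate e B > 0"
proof -
  have "2 * coeffE e B \<le> (1 - e\<^sup>2) / 4 * 2"
    unfolding coeffE_def using admissible_second_moment[OF B] e
      mult_left_mono[OF admissible_second_moment[OF B], of "(1 - e\<^sup>2) / 4"] by (simp add: power_le_one)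
  also have "\<dots> = (1 - e) * ((1 + e) / 2)" by (simp add: power2_eq_square field_simps)
  also have "\<dots> < (1 - e) * ((2 + e + 15 * e\<^sup>2) / (8 * e ^ 3))"
  proof (rule mult_strict_left_mono)
    have "e ^ 3 \<le> e\<^sup>2" "e ^ 4 \<le> e\<^sup>2" using e by (intro power_decreasing; simp)+
    moreover have "0 < e\<^sup>2" using e by simp
    ultimately have "8 * e ^ 3 + 8 * e ^ 4 < 2 * (2 + e + 15 * e\<^sup>2)" using e by argo
    also have "8 * e ^ 3 + 8 * e ^ 4 = 8 * e ^ 3 * (1 + e)" by (simp add: distrib_left power4_eq_xxxx power3_eq_cube)
    finally have "8 * e ^ 3 * (1 + e) < 2 * (2 + e + 15 * e\<^sup>2)" .
    then show "(1 + e) / 2 < (2 + e + 15 * e\<^sup>2) / (8 * e ^ 3)" using e by (simp add: divide_simps mult_ac)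
  qed (use e in simp)
  finally show ?thesis by (simp add: fisher_rate_def)
qed

lemma fisher_rate_tendsto: "((\<lambda>e. fisher_rate e B) \<longlongrightarrow> 0) (at_left 1)"
proof -
  have "isCont (\<lambda>e. fisher_rate e B) 1" unfolding fisher_rate_def coeffE_def by (intro continuous_intros) auto
  then have "((\<lambda>e. fisher_rate e B) \<longlongrightarrow> fisher_rate 1 B) (at 1)" by (simp add: isCont_def)
  then have "((\<lambda>e. fisher_rate e B) \<longlongrightarrow> fisher_rate 1 B) (at_left 1)" by (rule filterlim_at_split[THEN iffD1, THEN conjunct1])
  then show ?thesis by (simp add: fisher_rate_def coeffE_def)
qed

theorem theorem1p1:
  fixes e :: real and B :: "real \<Rightarrow> real" and f :: "real \<Rightarrow> vel \<Rightarrow> real"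
    and f0 :: "vel \<Rightarrow> real" and g :: "real \<Rightarrow> vel \<Rightarrow> real"
  assumes e: "0 < e" "e \<le> 1"
    and B: "admissible_kernel B"
    and sol: "solves_E1 e B f"
    and init: "f 0 = f0"
    and f0_meas: "f0 \<in> borel_measurable lborel"
    and f0_nonneg: "\<forall>v. f0 v \<ge> 0"
    and f0_int: "integrable lborel f0" "(\<integral>v. f0 v \<partial>lborel) = 1"
    and f0_mom: "integrable lborel (\<lambda>v. f0 v *\<^sub>R v)" "(\<integral>v. f0 v *\<^sub>R v \<partial>lborel) = 0"
    and g_def: "\<forall>t v. g t v = exp (- 3 * coeffE e B * t) * f t (exp (- coeffE e B * t) *\<^sub>R v)"
  shows "(\<forall>t\<ge>0. fisher (g t) \<le> ennreal (exp (fisher_rate e B * t)) * fisher (g 0)) \<and>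
         (\<forall>B'. admissible_kernel B' \<longrightarrow>
            (\<forall>e'. 0 < e' \<and> e' < 1 \<longrightarrow> fisher_rate e' B' > 0) \<and>
            ((\<lambda>e'. fisher_rate e' B') \<longlongrightarrow> 0) (at_left 1))"
proof (intro conjI allI impI)
  fix t :: real assume t: "t \<ge> 0"
  have g0: "g 0 = f 0" using g_def by (intro ext) simp
  show "fisher (g t) \<le> ennreal (exp (fisher_rate e B * t)) * fisher (g 0)"
  proof (cases "fisher f0 < \<infinity>")
    \<comment> \<open>Infinite initial information makes the right side infinite, because the
      exponential factor is positive.\<close>
    case False
    then have "fisher (g 0) = top" by (simp add: g0 init less_top[symmetric])
    then show ?thesis by (simp add: ennreal_mult_top)
  next
    case True
    define C \<kappa> l where "C = enn2real (fisher f0)" and "\<kappa> = (2 / (1 + e))\<^sup>2 - 1" and "l = exp (- coeffE e B * t)"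
    have C: "fisher_le C (f 0)" unfolding C_def init
      using f0_meas f0_nonneg f0_int(1) True by (intro fisher_le_fisher) auto
    have C0: "C \<ge> 0" by (simp add: C_def)
    have \<kappa>0: "\<kappa> \<ge> 0" using e by (simp add: \<kappa>_def)
    have Ct: "fisher_le (exp (\<kappa> * t) * C) (f t)"
    proof (cases "B \<in> borel_measurable borel")
      case True
      interpret weak_solution e B f
        using e B True sol f0_int(2) init by unfold_locales auto
      show ?thesis unfolding \<kappa>_def by (rule fisher_le_solution[OF C t])
    next
      \<comment> \<open>Here the bound does not grow at all; as \<kappa> and t are nonnegative it is
        weakened to the form of the other case.\<close>
      case False
      have "C \<le> exp (\<kappa> * t) * C" using mult_right_mono[of 1 "exp (\<kappa> * t)" C] C0 \<kappa>0 t by simp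
      with fisher_le_solution_nonmeasurable[OF sol False e(1) C t] show ?thesis
        unfolding fisher_le_def by fastforce
    qed
    have ft: "f t \<in> borel_measurable borel" "\<And>x. f t x \<ge> 0" "integrable lborel (f t)"
      using sol t by (auto simp: solves_E1_def)
    note [measurable] = ft(1)
    have l: "l > 0" by (simp add: l_def)
    have l3: "l ^ 3 = exp (- 3 * coeffE e B * t)" unfolding l_def exp_of_nat_mult[symmetric] by simp
    have l2: "l\<^sup>2 = exp (- 2 * coeffE e B * t)" unfolding l_def exp_of_nat_mult[symmetric] by simp
    have gt: "g t = (\<lambda>x. l ^ 3 * f t (l *\<^sub>R x))" unfolding l3 using g_def by (intro ext) (simp add: l_def)
    have "fisher (g t) \<le> ennreal (l\<^sup>2 * (exp (\<kappa> * t) * C))"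
      unfolding gt
    proof (rule fisher_le_imp_fisher[OF fisher_le_dilate[OF Ct ft(1) l]])
      show "(\<lambda>x. l ^ 3 * f t (l *\<^sub>R x)) \<in> borel_measurable borel" by measurable
      show "l ^ 3 * f t (l *\<^sub>R x) \<ge> 0" for x using ft(2) l by simp
      show "integrable lborel (\<lambda>x. l ^ 3 * f t (l *\<^sub>R x))"
        using integrable_dilate[OF ft(1) l ft(3)] by (simp add: mult.commute)
    qed
    also have "l\<^sup>2 * (exp (\<kappa> * t) * C) = exp ((\<kappa> - 2 * coeffE e B) * t) * C"
      unfolding l2 mult.assoc[symmetric] exp_add[symmetric] by (simp add: algebra_simps)
    also have "ennreal \<dots> \<le> ennreal (exp (fisher_rate e B * t) * C)"
    proof (intro ennreal_leI mult_right_mono C0)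
      have "\<kappa> - 2 * coeffE e B \<le> fisher_rate e B" using rate_comparison[OF e] by (simp add: \<kappa>_def fisher_rate_def)
      then show "exp ((\<kappa> - 2 * coeffE e B) * t) \<le> exp (fisher_rate e B * t)" using t by (simp add: mult_right_mono)
    qed
    also have "\<dots> = ennreal (exp (fisher_rate e B * t)) * fisher (g 0)"
      using True C0 by (simp add: ennreal_mult C_def g0 init)
    finally show ?thesis .
  qed
next
  fix B' e' assume "admissible_kernel B'" "0 < e' \<and> e' < (1 :: real)"
  then show "fisher_rate e' B' > 0" by (simp add: fisher_rate_pos)
qed (rule fisher_rate_tendsto)

end
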